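(* Let $P\subset\mathbf{R}^2$ be the moment polygon of a smooth polarised toric surface, and suppose $P$ is K-semistable, i.e. $\mathcal{L}(f)\ge0$ for all continuous convex functions $f$ on $P$. Then $P$ has a canonical decomposition into rational subpolygons $Q_i$, each of which is either K-polystable (with respect to the induced boundary measure $d\sigma_i$) or is a parallelogram in which two opposite edges lie on edges of $P$.
   Context: $P$ is defined by inequalities $h_k(x)\ge c_k$, with $h_k$ linear and inducing primitive maps $\mathbf{Z}^2\to\mathbf{Z}$. $d\mu$ is Lebesgue measure on $P$; $d\sigma$ is the measure on $\partial P$ which on the edge $h_r=c_r$ is the constant 1-form with $dh_r\wedge d\sigma=\pm d\mu$. Put $$\mathcal{L}(f)=\int_{\partial P}f\,d\sigma-a\int_Pf\,d\mu,\qquad a=\frac{\mathrm{Vol}(\partial P,d\sigma)}{\mathrm{Vol}(P,d\mu)}.$$ A subpolygon $Q_i$ of $P$ carries the measure $d\sigma_i$ on $\partial Q_i$ equal to $d\sigma$ on the edges of $Q_i$ that are contained in edges of $P$, and equal to zero on the edges of $Q_i$ lying in the interior of $P$. For a bounded function $A$ on $Q_i$ put $\mathcal{L}_A(f)=\int_{\partial Q_i}f\,d\sigma_i-\int_{Q_i}Af\,d\mu$; there is a unique affine linear $A$ with $\mathcal{L}_A(H)=0$ for all affine linear $H$. $(Q_i,d\sigma_i)$ is relatively K-polystable if, for this $A$, $\mathcal{L}_A(f)>0$ for all non-affine convex functions $f$; it is K-polystable if moreover $A$ is constant, i.e. if $\int_{\partial Q_i}f\,d\sigma_i-a_i\int_{Q_i}f\,d\mu\geq0$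 for all convex $f$ on $Q_i$ with equality only for affine linear $f$, where $a_i=\mathrm{Vol}(\partial Q_i,d\sigma_i)/\mathrm{Vol}(Q_i,d\mu)$. "Rational" means that the vertices have rational coordinates. "Canonical" means that the decomposition involves no choices and is determined by $P$ and $d\sigma$: the segments along which $P$ is cut are taken from the set of segments $l\subset P$, passing through the interior and joining boundary points, that are creases of simple piecewise linear functions $h(x)=\max(\lambda(x)+c,0)$ ($\lambda$ linear, crease $\{\lambda=-c\}$) with $\mathcal{L}(h)=0$.
   Formalization: K-polystability of the Q_i is tested on continuous convex functions only, as for K-semistability; for arbitrary convex functions no polygon is K-polystable (take the value 1 at one vertex and 0 elsewhere), so the claim would already fail for the standard triangle. *)

theory Defs
  imports "HOL-Analysis.Analysis"
begin

definition lform :: "int^2 \<Rightarrow> real^2 \<Rightarrow> real" where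
  "lform u x = of_int (u $ 1) * x $ 1 + of_int (u $ 2) * x $ 2"

text \<open>The pairs \<open>(u, c)\<close> such that \<open>lform u \<ge> c\<close> is one of the defining inequalities of \<open>P\<close>:
  \<open>lform u\<close> maps the integer lattice onto the integers (coprime coefficients) and
  \<open>lform u = c\<close> cuts out an edge.\<close>

definition facet_data :: "(real^2) set \<Rightarrow> ((int^2) \<times> real) set" where
  "facet_data P = {(u, c). coprime (u $ 1) (u $ 2) \<and> (\<forall>x\<in>P. c \<le> lform u x) \<and>
     {x \<in> P. lform u x = c} edge_of P}"

text \<open>The polygons of smooth polarised toric surfaces: lattice polygons such that at each vertex
  exactly two edges meet, and their primitive normals form a basis of the lattice.\<close>

definition moment_polygon :: "(real^2) set \<Rightarrow> bool" where
  "moment_polygon P \<longleftrightarrow> polytope P \<and> interior P \<noteq> {} \<and>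
     (\<forall>v. v extreme_point_of P \<longrightarrow>
        (\<forall>i. v $ i \<in> \<int>) \<and>
        (\<exists>u c u' c'. {(w, d) \<in> facet_data P. lform w v = d} = {(u, c), (u', c')} \<and>
           \<bar>u $ 1 * u' $ 2 - u $ 2 * u' $ 1\<bar> = 1))"

text \<open>The measure on the line \<open>lform u = c\<close> given by the constant 1-form \<open>\<theta>\<close> with
  \<open>d(lform u) \<and> \<theta> = \<plusminus> dx \<and> dy\<close>. The condition says that \<open>\<theta> = \<plusminus> 1\<close> on the
  tangent vector \<open>(-u2, u1)\<close>, so the measure is \<open>dt\<close> in the parametrisation
  \<open>t \<mapsto> p + t (-u2, u1)\<close>; \<open>p\<close> is the point of the line closest to the origin.\<close>

definition line_measure :: "int^2 \<Rightarrow> real \<Rightarrow> (real^2) measure" where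
  "line_measure u c = distr lborel borel (\<lambda>t.
     (c / (of_int (u $ 1) ^ 2 + of_int (u $ 2) ^ 2)) *\<^sub>R vector [of_int (u $ 1), of_int (u $ 2)]
     + t *\<^sub>R vector [- of_int (u $ 2), of_int (u $ 1)])"

definition dsigma :: "(real^2) set \<Rightarrow> (real^2) measure" where
  "dsigma P = measure_of UNIV (sets borel)
     (\<lambda>B. \<Sum>(u, c)\<in>facet_data P. emeasure (line_measure u c) (B \<inter> P))"

text \<open>The measure on the boundary of a subpolygon \<open>Q\<close> of \<open>P\<close>.\<close>

definition dsigma_sub :: "(real^2) set \<Rightarrow> (real^2) set \<Rightarrow> (real^2) measure" where
  "dsigma_sub P Q = density (dsigma P)
     (indicator (\<Union>{F. F edge_of Q \<and> (\<exists>E. E edge_of P \<and> F \<subseteq> E)}))"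

definition stab_functional :: "(real^2) measure \<Rightarrow> (real^2) set \<Rightarrow> (real^2 \<Rightarrow> real) \<Rightarrow> real" where
  "stab_functional \<sigma> Q f =
     (LINT x:frontier Q|\<sigma>. f x)
     - measure \<sigma> (frontier Q) / measure lborel Q * (LINT x:Q|lborel. f x)"

definition K_semistable :: "(real^2) measure \<Rightarrow> (real^2) set \<Rightarrow> bool" where
  "K_semistable \<sigma> Q \<longleftrightarrow>
     (\<forall>f. convex_on Q f \<and> continuous_on Q f \<longrightarrow> 0 \<le> stab_functional \<sigma> Q f)"

text \<open>Continuity up to the boundary cannot be dropped: a function that is 0 on \<open>Q\<close> except for the
  value 1 at a vertex is convex and not affine, but both integrals vanish.\<close>

definition K_polystable :: "(real^2) measure \<Rightarrow> (real^2) set \<Rightarrow> bool" where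
  "K_polystable \<sigma> Q \<longleftrightarrow>
     (\<forall>f. convex_on Q f \<and> continuous_on Q f \<longrightarrow>
        0 \<le> stab_functional \<sigma> Q f \<and>
        (stab_functional \<sigma> Q f = 0 \<longrightarrow> (\<exists>b c. \<forall>x\<in>Q. f x = b \<bullet> x + c)))"

definition creases :: "(real^2) set \<Rightarrow> (real^2) set set" where
  "creases P = {l. \<exists>b c. b \<noteq> 0 \<and> l = {x \<in> P. b \<bullet> x + c = 0} \<and> l \<inter> interior P \<noteq> {} \<and>
     stab_functional (dsigma P) P (\<lambda>x. max (b \<bullet> x + c) 0) = 0}"

definition rational_polygon :: "(real^2) set \<Rightarrow> bool" where
  "rational_polygon Q \<longleftrightarrow> polytope Q \<and> interior Q \<noteq> {} \<and>
     (\<forall>v. v extreme_point_of Q \<longrightarrow> (\<forall>i. v $ i \<in> \<rat>))"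

definition rational_decomposition :: "(real^2) set \<Rightarrow> (real^2) set set \<Rightarrow> bool" where
  "rational_decomposition P \<Q> \<longleftrightarrow> finite \<Q> \<and> \<Union>\<Q> = P \<and> (\<forall>Q\<in>\<Q>. rational_polygon Q) \<and>
     pairwise (\<lambda>Q R. interior Q \<inter> interior R = {}) \<Q>"

definition cut_along :: "(real^2) set \<Rightarrow> (real^2) set set \<Rightarrow> (real^2) set set \<Rightarrow> bool" where
  "cut_along P C \<Q> \<longleftrightarrow> (\<Union>Q\<in>\<Q>. frontier Q) = frontier P \<union> \<Union>C"

definition parallelogram_between_edges :: "(real^2) set \<Rightarrow> (real^2) set \<Rightarrow> bool" where
  "parallelogram_between_edges P Q \<longleftrightarrow>
     (\<exists>p v w. independent {v, w} \<and> v \<noteq> w \<and> Q = convex hull {p, p + v, p + w, p + v + w} \<and>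
        (\<exists>E. E edge_of P \<and> closed_segment p (p + v) \<subseteq> E) \<and>
        (\<exists>E. E edge_of P \<and> closed_segment (p + w) (p + v + w) \<subseteq> E))"

text \<open>A rule for decomposing semistable polygons makes no choices, and depends only on \<open>P\<close> and the
  measure on its boundary, if it commutes with all affine isomorphisms between such pairs. All
  integral affine isomorphisms are of this kind. In particular the decomposition of \<open>P\<close> is
  invariant under all symmetries of the pair.\<close>

definition choice_free :: "((real^2) set \<Rightarrow> (real^2) set set) \<Rightarrow> bool" where
  "choice_free D \<longleftrightarrow> (\<forall>P (A :: real^2^2) b. let \<phi> = (\<lambda>x. A *v x + b) in
     moment_polygon P \<and> K_semistable (dsigma P) P \<and> invertible A \<and>
     moment_polygon (\<phi> ` P) \<and> dsigma (\<phi> ` P) = distr (dsigma P) borel \<phi>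
     \<longrightarrow> D (\<phi> ` P) = (`) \<phi> ` D P)"

end

theory Submission
  imports Defs
begin

text \<open>Write \<open>L A f\<close> for the integral of \<open>f\<close> over \<open>A\<close> against \<open>d\<sigma> - a d\<mu>\<close>, and call \<open>A\<close> good if
  \<open>L A\<close> is nonnegative on convex functions. Cutting a good set along a zero crease (the crease of a
  simple piecewise linear function with \<open>L A = 0\<close>) gives two good sets. If \<open>L Q f = 0\<close> for a convex,
  non-affine \<open>f\<close>, then the contact set of \<open>f\<close> with a supporting affine function has no extreme point
  in the interior of \<open>Q\<close> (a bump there would make \<open>L\<close> negative), so a boundary point of it lies on a
  chord contained in it, and that chord is a zero crease of \<open>Q\<close>. Corners between touching creases
  are excluded in the same way. Hence the creases of \<open>P\<close> are disjoint, and a zero crease of a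
  piece extends to a crease of \<open>P\<close>.

  A formula for the change of \<open>L\<close> when an end of a chord moves along an edge shows that two disjoint
  creases joining the same two edges force these edges to be parallel at lattice distance \<open>2 / a\<close>, and then
  all translates of the crease are creases as well. All other creases are finite in number and have
  rational ends. The polygon is cut along these; a piece that still meets a crease is swept out by
  the translates of that crease and is a parallelogram, and the other pieces are K-polystable.\<close>

section \<open>Measures concentrated on the boundary\<close>

text \<open>Goodness survives a cut because, for convex \<open>g\<close> and a crease
  \<open>l\<close>, the functions \<open>max (l + g / n) 0\<close> stay convex, and their difference
  quotients at a zero crease tend to \<open>g\<close> on one half. Affine functions and their
  negatives are convex, so \<open>L\<close> kills them on every good set; hence each piece has the
  same ratio of boundary mass to area as \<open>P\<close>, and the constant \<open>a\<close> of
  \<open>P\<close> serves all pieces. The obstacle to cutting along all creases is a family of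
  parallel ones: it is infinite, and most of its members are not rational. Excluding these and
  taking the regions not separated by the others refers to translations, segments and closures only,
  so compatibility with affine maps is formal. Rationality of the remaining creases is the
  arithmetic core: the vanishing of \<open>L\<close> on affine functions gives polynomial equations
  for the ends, and irrational solutions are ruled out by an inequality. Cutting a thin triangle off
  at an end that is not a vertex shows that \<open>a\<close> times the lattice height of the chord
  is at most 3.\<close>

lemma convex_on_affine_fun: "convex_on UNIV (\<lambda>x. b \<bullet> x + c)" for b :: "'a::real_inner"
  by (rule convex_onI) (auto simp: inner_simps algebra_simps)

lemma convex_on_max:
  fixes f :: "'a::real_vector \<Rightarrow> real"
  assumes "convex_on A f" "convex_on A g"
  shows "convex_on A (\<lambda>x. max (f x) (g x))"
proof (rule convex_onI)
  show "convex A"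
    using assms by (simp add: convex_on_def)
next
  fix t :: real and x y
  assume t: "0 < t" "t < 1" and xy: "x \<in> A" "y \<in> A"
  have "(1 - t) * f x + t * f y \<le> (1 - t) * max (f x) (g x) + t * max (f y) (g y)"
       "(1 - t) * g x + t * g y \<le> (1 - t) * max (f x) (g x) + t * max (f y) (g y)"
    using t by (intro add_mono mult_left_mono; simp)+
  then show "max (f ((1 - t) *\<^sub>R x + t *\<^sub>R y)) (g ((1 - t) *\<^sub>R x + t *\<^sub>R y))
      \<le> (1 - t) * max (f x) (g x) + t * max (f y) (g y)"
    using convex_onD[OF assms(1), of t x y] convex_onD[OF assms(2), of t x y] t xy by auto
qed

lemma continuous_on_convex_UNIV:
  fixes f :: "'a::euclidean_space \<Rightarrow> real"
  assumes "convex_on UNIV f"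
  shows "continuous_on A f"
  using convex_on_continuous[OF open_UNIV assms] continuous_on_subset by blast

lemma AE_lborel_line: "b \<noteq> 0 \<Longrightarrow> AE x in lborel. b \<bullet> x + c \<noteq> (0::real)" for b :: "real^2"
proof -
  assume b: "b \<noteq> 0"
  have "negligible {x. b \<bullet> x = -c}"
    using negligible_hyperplane[of b "-c"] b by auto
  then have "AE x in lebesgue. x \<notin> {x. b \<bullet> x = -c}"
    using AE_not_in negligible_iff_null_sets by blast
  then have "AE x in lborel. x \<notin> {x. b \<bullet> x = -c}"
    by (simp add: AE_completion_iff)
  then show ?thesis by eventually_elim auto
qed

text \<open>The theory of creases rests on two facts about the boundary measure: its mass sits on
  the frontier, and a line through the interior is null for it, as it is for area. The edges of a
  cut can therefore be given to either side or dropped.\<close>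

locale boundary_pair =
  fixes P :: "(real^2) set" and \<sigma> :: "(real^2) measure" and a :: real
  assumes compact_P: "compact P" and convex_P: "convex P"
    and sets_\<sigma>: "sets \<sigma> = sets borel" and finite_\<sigma>: "emeasure \<sigma> UNIV \<noteq> \<infinity>"
    and AE_frontier: "AE x in \<sigma>. x \<in> frontier P"
    and AE_line: "\<And>b c x. b \<noteq> 0 \<Longrightarrow> x \<in> interior P \<Longrightarrow> b \<bullet> x + c = 0 \<Longrightarrow> AE y in \<sigma>. b \<bullet> y + c \<noteq> 0"
    and a_pos: "a > 0"
begin

text \<open>Integrating over \<open>A\<close> itself and not over its frontier builds in the
  convention for subpolygons: \<open>\<sigma>\<close> lives on \<open>frontier P\<close>, so edges
  of \<open>A\<close> inside \<open>P\<close> contribute nothing.\<close>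

definition L :: "(real^2) set \<Rightarrow> (real^2 \<Rightarrow> real) \<Rightarrow> real" where
  "L A f = (LINT x:A|\<sigma>. f x) - a * (LINT x:A|lborel. f x)"

text \<open>Both measures are finite on \<open>P\<close>, so these functions are integrable for
  both; this is the class on which \<open>L\<close> is additive.\<close>

definition tame :: "(real^2) set \<Rightarrow> (real^2 \<Rightarrow> real) \<Rightarrow> bool" where
  "tame A f \<longleftrightarrow> A \<in> sets borel \<and> A \<subseteq> P \<and> set_borel_measurable borel A f \<and> bounded (f ` A)"

section \<open>Additivity and convergence of the functional\<close>

lemma space_\<sigma>: "space \<sigma> = UNIV"
  using sets_eq_imp_space_eq[OF sets_\<sigma>] by simp

lemma finite_measure_\<sigma>: "finite_measure \<sigma>"
  using finite_\<sigma> by (intro finite_measureI) (simp add: space_\<sigma>)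

lemma borel_measurable_\<sigma>: "borel_measurable \<sigma> = borel_measurable borel"
  by (rule measurable_cong_sets) (simp_all add: sets_\<sigma>)

lemma tame_integrable:
  assumes "tame A f"
  shows "set_integrable \<sigma> A f" "set_integrable lborel A f"
proof -
  interpret finite_measure \<sigma> by (rule finite_measure_\<sigma>)
  obtain B where B: "\<And>x. x \<in> A \<Longrightarrow> norm (f x) \<le> B"
    using assms unfolding tame_def bounded_iff by blast
  have m: "(\<lambda>x. indicator A x *\<^sub>R f x) \<in> borel_measurable borel"
    using assms unfolding tame_def set_borel_measurable_def by blast
  have A: "A \<in> sets borel" "A \<subseteq> P" using assms unfolding tame_def by auto
  have le: "norm (indicator A x *\<^sub>R f x) \<le> norm (\<bar>B\<bar> * indicator A x)" for x
    using B[of x] by (auto simp: indicator_def)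
  show "set_integrable \<sigma> A f"
    unfolding set_integrable_def
  proof (rule Bochner_Integration.integrable_bound[where f="\<lambda>x. \<bar>B\<bar> * indicator A x"])
    show "integrable \<sigma> (\<lambda>x. \<bar>B\<bar> * indicator A x)"
      using A by (intro integrable_mult_right integrable_real_indicator)
        (auto simp: sets_\<sigma> emeasure_finite less_top[symmetric])
  qed (use m le in \<open>auto simp: borel_measurable_\<sigma>\<close>)
  have "emeasure lborel A \<le> emeasure lborel P"
    using A compact_P by (intro emeasure_mono) (auto simp: borel_compact)
  then have "emeasure lborel A < \<infinity>"
    using emeasure_lborel_cbox_finite emeasure_bounded_finite[OF compact_imp_bounded[OF compact_P]]
    by (meson le_less_trans)
  then have "integrable lborel (\<lambda>x. \<bar>B\<bar> * indicator A x)"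
    using A by (intro integrable_mult_right integrable_real_indicator) auto
  then show "set_integrable lborel A f"
    unfolding set_integrable_def
    by (rule Bochner_Integration.integrable_bound) (use m le in auto)
qed

lemma tame_continuous_compact:
  assumes "compact Q" "Q \<subseteq> P" "continuous_on Q f"
  shows "tame Q f"
  unfolding tame_def set_borel_measurable_def
  using assms borel_measurable_continuous_on_indicator[of Q f]
  by (auto simp: borel_compact compact_imp_bounded compact_continuous_image)

lemma tame_subset:
  assumes "tame Q f" "A \<subseteq> Q" "A \<in> sets borel"
  shows "tame A f"
proof -
  have "(\<lambda>x. indicator A x *\<^sub>R (indicator Q x *\<^sub>R f x)) \<in> borel_measurable borel"
    by (rule borel_measurable_scaleR) (use assms in \<open>simp_all only: tame_def set_borel_measurable_def borel_measurable_indicator\<close>)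
  moreover have "(\<lambda>x. indicator A x *\<^sub>R (indicator Q x *\<^sub>R f x)) = (\<lambda>x. indicat_real A x *\<^sub>R f x)"
    using assms(2) by (auto simp: indicator_def fun_eq_iff)
  ultimately have "(\<lambda>x. indicator A x *\<^sub>R f x) \<in> borel_measurable borel" by metis
  moreover have "bounded (f ` A)" "A \<subseteq> P"
    using assms bounded_subset[OF _ image_mono[OF assms(2)]] by (auto simp: tame_def)
  ultimately show ?thesis
    using assms(3) unfolding tame_def set_borel_measurable_def by blast
qed

lemma tame_continuous:
  assumes "A \<in> sets borel" "A \<subseteq> P" "continuous_on P f"
  shows "tame A f"
  using tame_subset[OF tame_continuous_compact[OF compact_P order_refl assms(3)] assms(2,1)] .

lemma L_add:
  assumes "tame A f" "tame A g"
  shows "L A (\<lambda>x. f x + g x) = L A f + L A g"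
  using set_integral_add(2)[OF tame_integrable(1)[OF assms(1)] tame_integrable(1)[OF assms(2)]]
    set_integral_add(2)[OF tame_integrable(2)[OF assms(1)] tame_integrable(2)[OF assms(2)]]
  unfolding L_def by (simp only: distrib_left)

lemma L_diff:
  assumes "tame A f" "tame A g"
  shows "L A (\<lambda>x. f x - g x) = L A f - L A g"
  using set_integral_diff(2)[OF tame_integrable(1)[OF assms(1)] tame_integrable(1)[OF assms(2)]]
    set_integral_diff(2)[OF tame_integrable(2)[OF assms(1)] tame_integrable(2)[OF assms(2)]]
  unfolding L_def by (simp only: right_diff_distrib)

lemma L_cmult: "L A (\<lambda>x. k * f x) = k * L A f"
  unfolding L_def by (simp add: algebra_simps)

lemma L_uminus: "L A (\<lambda>x. - f x) = - L A f"
  using L_cmult[of A "-1" f] by simp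

lemma L_cong:
  assumes "A \<in> sets borel" "\<And>x. x \<in> A \<Longrightarrow> f x = g x"
  shows "L A f = L A g"
  using set_lebesgue_integral_cong[of A \<sigma> f g] set_lebesgue_integral_cong[of A lborel f g] assms
  unfolding L_def by (simp add: sets_\<sigma>)

lemma L_restrict: "L A (\<lambda>x. indicator B x * f x) = L (A \<inter> B) f"
  unfolding L_def set_lebesgue_integral_def
  by (simp add: indicator_inter_arith mult.assoc)

lemma L_Un:
  assumes "tame A f" "tame B f" "AE x in \<sigma>. \<not> (x \<in> A \<and> x \<in> B)" "AE x in lborel. \<not> (x \<in> A \<and> x \<in> B)"
  shows "L (A \<union> B) f = L A f + L B f"
proof -
  have AB: "A \<in> sets borel" "B \<in> sets borel" using assms(1,2) by (auto simp: tame_def)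
  have "(LINT x:A \<union> B|\<sigma>. f x) = (LINT x:A|\<sigma>. f x) + (LINT x:B|\<sigma>. f x)"
    using tame_integrable[OF assms(1)] tame_integrable[OF assms(2)] assms(3) AB
    by (intro set_integral_Un_AE) (auto simp: sets_\<sigma>)
  moreover have "(LINT x:A \<union> B|lborel. f x) = (LINT x:A|lborel. f x) + (LINT x:B|lborel. f x)"
    using tame_integrable[OF assms(1)] tame_integrable[OF assms(2)] assms(4) AB
    by (intro set_integral_Un_AE) auto
  ultimately show ?thesis by (simp add: L_def algebra_simps)
qed

lemma L_null_cong:
  assumes f: "set_borel_measurable borel A f" "set_borel_measurable borel B f"
    and ae: "AE x in \<sigma>. x \<in> A \<longleftrightarrow> x \<in> B" "AE x in lborel. x \<in> A \<longleftrightarrow> x \<in> B"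
  shows "L A f = L B f"
proof -
  have "(LINT x:A|M. f x) = (LINT x:B|M. f x)"
    if M: "(borel_measurable M :: (real^2 \<Rightarrow> real) set) = borel_measurable borel" and ae: "AE x in M. x \<in> A \<longleftrightarrow> x \<in> B" for M
    unfolding set_lebesgue_integral_def
  proof (rule integral_cong_AE)
    show "AE x in M. indicator A x *\<^sub>R f x = indicator B x *\<^sub>R f x"
      using ae by eventually_elim (simp add: indicator_def)
  qed (use f in \<open>simp_all add: set_borel_measurable_def M del: real_scaleR_def\<close>)
  from this[OF borel_measurable_\<sigma> ae(1)] this[OF _ ae(2)] show ?thesis by (simp add: L_def)
qed

lemma L_tendsto:
  fixes k :: "nat \<Rightarrow> real^2 \<Rightarrow> real"
  assumes k: "\<And>n. tame A (k n)" and k': "tame A k'"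
    and B: "\<And>n x. x \<in> A \<Longrightarrow> \<bar>k n x\<bar> \<le> B"
    and lim: "AE x in \<sigma>. x \<in> A \<longrightarrow> (\<lambda>n. k n x) \<longlonglongrightarrow> k' x"
             "AE x in lborel. x \<in> A \<longrightarrow> (\<lambda>n. k n x) \<longlonglongrightarrow> k' x"
  shows "(\<lambda>n. L A (k n)) \<longlonglongrightarrow> L A k'"
proof -
  have A: "A \<in> sets borel" "A \<subseteq> P" using k' by (auto simp: tame_def)
  have const: "tame A (\<lambda>x. B)" using A by (intro tame_continuous) auto
  have "(\<lambda>n. LINT x:A|M. k n x) \<longlonglongrightarrow> (LINT x:A|M. k' x)"
    if M: "M = \<sigma> \<or> M = lborel" and lim: "AE x in M. x \<in> A \<longrightarrow> (\<lambda>n. k n x) \<longlonglongrightarrow> k' x" for M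
    unfolding set_lebesgue_integral_def
  proof (rule integral_dominated_convergence)
    show "integrable M (\<lambda>x. indicator A x *\<^sub>R B)"
      using tame_integrable[OF const] M by (auto simp: set_integrable_def)
    show "(\<lambda>x. indicator A x *\<^sub>R k' x) \<in> borel_measurable M"
      using k' M by (auto simp: tame_def set_borel_measurable_def borel_measurable_\<sigma>)
    show "(\<lambda>x. indicator A x *\<^sub>R k n x) \<in> borel_measurable M" for n
      using k[of n] M by (auto simp: tame_def set_borel_measurable_def borel_measurable_\<sigma>)
    show "AE x in M. (\<lambda>n. indicator A x *\<^sub>R k n x) \<longlonglongrightarrow> indicator A x *\<^sub>R k' x"
      using lim by eventually_elim (auto simp: indicator_def)
    show "AE x in M. norm (indicator A x *\<^sub>R k n x) \<le> indicator A x *\<^sub>R B" for n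
      using B by (auto simp: indicator_def)
  qed
  from this[of \<sigma>] this[of lborel] show ?thesis
    unfolding L_def using lim by (intro tendsto_intros) auto
qed

text \<open>Test functions are convex on the whole plane, so they are continuous and bounded on
  \<open>P\<close>, and the class of test functions does not change when \<open>A\<close> is
  cut.\<close>

definition good :: "(real^2) set \<Rightarrow> bool" where
  "good A \<longleftrightarrow> A \<in> sets borel \<and> A \<subseteq> P \<and> (\<forall>g. convex_on UNIV g \<longrightarrow> 0 \<le> L A g)"

lemma good_tame: "good A \<Longrightarrow> convex_on UNIV g \<Longrightarrow> tame A g"
  unfolding good_def by (intro tame_continuous continuous_on_convex_UNIV) auto

lemma good_tame': "good A \<Longrightarrow> continuous_on UNIV g \<Longrightarrow> tame A g"
  unfolding good_def by (intro tame_continuous) (auto elim: continuous_on_subset)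

lemma good_affine:
  assumes "good A"
  shows "L A (\<lambda>x. b \<bullet> x + c) = 0"
proof (rule antisym)
  have "0 \<le> L A (\<lambda>x. (- b) \<bullet> x + (- c))"
    using assms convex_on_affine_fun[of "-b" "-c"] unfolding good_def by blast
  also have "(\<lambda>x. (- b) \<bullet> x + (- c)) = (\<lambda>x. - (b \<bullet> x + c))" by auto
  also have "L A \<dots> = - L A (\<lambda>x. b \<bullet> x + c)" by (rule L_uminus)
  finally show "L A (\<lambda>x. b \<bullet> x + c) \<le> 0" by simp
  show "0 \<le> L A (\<lambda>x. b \<bullet> x + c)"
    using assms convex_on_affine_fun[of b c] unfolding good_def by blast
qed

definition crease_fun :: "real^2 \<Rightarrow> real \<Rightarrow> bool" where
  "crease_fun b c \<longleftrightarrow> b \<noteq> 0 \<and> (\<exists>x\<in>interior P. b \<bullet> x + c = 0)"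

lemma crease_fun_AE:
  assumes "crease_fun b c"
  shows "AE x in \<sigma>. b \<bullet> x + c \<noteq> 0" "AE x in lborel. b \<bullet> x + c \<noteq> 0"
  using assms AE_line AE_lborel_line unfolding crease_fun_def by blast+

lemma crease_fun_uminus: "crease_fun (-b) (-c) \<longleftrightarrow> crease_fun b c"
proof -
  have "(-b) \<bullet> x + (-c) = 0 \<longleftrightarrow> b \<bullet> x + c = 0" for x by auto
  then show ?thesis unfolding crease_fun_def by auto
qed

lemma sets_halfplane [measurable]: "{x. b \<bullet> x + c > 0} \<in> sets (borel :: (real^2) measure)"
  by measurable

lemma convex_crease: "convex_on UNIV (\<lambda>x. max (b \<bullet> x + c) 0)" for b :: "'a::real_inner"
  by (intro convex_on_max convex_on_affine_fun) (auto simp: convex_on_def)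

text \<open>Let \<open>l\<close> be the affine function of the crease and \<open>g\<close> convex.
  \<open>L A\<close> is nonnegative on the convex functions \<open>max (l + g / n) 0\<close> and
  vanishes on \<open>max l 0\<close>, so their difference quotients have nonnegative
  \<open>L A\<close>. These tend to \<open>g\<close> where \<open>l > 0\<close> and to 0 where
  \<open>l < 0\<close>, and the line \<open>l = 0\<close> is null.\<close>

lemma good_cut:
  assumes A: "good A" and cr: "crease_fun b c" and zero: "L A (\<lambda>x. max (b \<bullet> x + c) 0) = 0"
  shows "good (A \<inter> {x. b \<bullet> x + c > 0})"
  unfolding good_def
proof (intro conjI allI impI)
  show "A \<inter> {x. b \<bullet> x + c > 0} \<in> sets borel" "A \<inter> {x. b \<bullet> x + c > 0} \<subseteq> P"
    using A unfolding good_def by auto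
  fix g :: "real^2 \<Rightarrow> real" assume g: "convex_on UNIV g"
  let ?l = "\<lambda>x::real^2. b \<bullet> x + c"
  define h where "h n x = max (?l x + (1 / real (Suc n)) * g x) 0" for n x
  have h: "convex_on UNIV (h n)" for n
    unfolding h_def by (intro convex_on_max convex_on_add convex_on_affine_fun convex_on_cmul g)
      (auto simp: convex_on_def)
  define k where "k n x = real (Suc n) * (h n x - max (?l x) 0)" for n x
  have cont: "continuous_on UNIV g" "continuous_on UNIV (h n)" for n
    using g h continuous_on_convex_UNIV by blast+
  have lc: "tame A (\<lambda>x. max (?l x) 0)"
    by (intro good_tame' A continuous_intros)
  have pos: "0 \<le> L A (k n)" for n
  proof -
    have "L A (k n) = real (Suc n) * (L A (h n) - L A (\<lambda>x. max (?l x) 0))"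
      unfolding k_def by (subst L_cmult, subst L_diff) (auto intro: lc good_tame A h)
    moreover have "0 \<le> L A (h n)" using A h unfolding good_def by blast
    ultimately show ?thesis using zero by simp
  qed
  have kx: "(\<lambda>n. k n x) \<longlonglongrightarrow> indicator {x. ?l x > 0} x * g x" if "?l x \<noteq> 0" for x
  proof -
    have lim: "(\<lambda>n. ?l x + (1 / real (Suc n)) * g x) \<longlonglongrightarrow> ?l x + 0 * g x"
      by (intro tendsto_intros LIMSEQ_Suc[OF lim_1_over_n])
    show ?thesis
    proof (cases "?l x > 0")
      case True
      have "eventually (\<lambda>n. ?l x + (1 / real (Suc n)) * g x > 0) sequentially"
        using order_tendstoD(1)[OF lim, of 0] True by simp
      then have "eventually (\<lambda>n. k n x = g x) sequentially"
        by eventually_elim (use True in \<open>auto simp: k_def h_def field_simps simp del: of_nat_Suc\<close>)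
      then show ?thesis using True by (simp add: tendsto_eventually)
    next
      case False
      then have "eventually (\<lambda>n. ?l x + (1 / real (Suc n)) * g x < 0) sequentially"
        using order_tendstoD(2)[OF lim, of 0] that by simp
      then have "eventually (\<lambda>n. k n x = 0) sequentially"
        by eventually_elim (use False in \<open>auto simp: k_def h_def\<close>)
      then show ?thesis using False by (simp add: tendsto_eventually)
    qed
  qed
  obtain B where B: "\<And>x. x \<in> P \<Longrightarrow> \<bar>g x\<bar> \<le> B"
    using compact_imp_bounded[OF compact_continuous_image[OF continuous_on_convex_UNIV[OF g] compact_P]]
    unfolding bounded_iff by auto
  have "(\<lambda>n. L A (k n)) \<longlonglongrightarrow> L A (\<lambda>x. indicator {x. ?l x > 0} x * g x)"
  proof (rule L_tendsto[where B=B])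
    show "tame A (k n)" for n
      unfolding k_def by (intro good_tame' A continuous_intros cont)
    have t: "tame A g" by (rule good_tame[OF A g])
    have "(\<lambda>x. indicator {x. ?l x > 0} x *\<^sub>R (indicator A x *\<^sub>R g x)) \<in> borel_measurable borel"
      by (rule borel_measurable_scaleR)
        (use t in \<open>simp_all add: tame_def set_borel_measurable_def del: real_scaleR_def\<close>)
    then show "tame A (\<lambda>x. indicator {x. ?l x > 0} x * g x)"
      using t order_trans[OF abs_ge_zero B] B unfolding tame_def set_borel_measurable_def
      by (auto simp: bounded_iff indicator_def mult_ac intro!: exI[of _ B])
    show "\<bar>k n x\<bar> \<le> B" if "x \<in> A" for n x
    proof -
      \<comment> \<open>Truncation at 0 does not increase distances, so \<open>g\<close> dominates
        all the quotients and dominated convergence applies.\<close>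
      have "\<bar>h n x - max (?l x) 0\<bar> \<le> \<bar>(1 / real (Suc n)) * g x\<bar>" unfolding h_def by linarith
      then have "\<bar>k n x\<bar> \<le> real (Suc n) * \<bar>(1 / real (Suc n)) * g x\<bar>"
        unfolding k_def abs_mult by (intro mult_mono) auto
      also have "\<dots> = \<bar>g x\<bar>" by (simp add: abs_mult field_simps del: of_nat_Suc)
      also have "\<dots> \<le> B" using B that A unfolding good_def by blast
      finally show ?thesis .
    qed
  qed (use crease_fun_AE[OF cr] kx in \<open>auto elim!: eventually_mono\<close>)
  then have "0 \<le> L A (\<lambda>x. indicator {x. ?l x > 0} x * g x)"
    using pos by (intro LIMSEQ_le_const) auto
  then show "0 \<le> L (A \<inter> {x. b \<bullet> x + c > 0}) g"
    by (simp add: L_restrict)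
qed

lemma crease_reverse:
  assumes A: "good A" and zero: "L A (\<lambda>x. max (b \<bullet> x + c) 0) = 0"
  shows "L A (\<lambda>x. max ((-b) \<bullet> x + (-c)) 0) = 0"
proof -
  have "(\<lambda>x. max ((-b) \<bullet> x + (-c)) 0) = (\<lambda>x. max (b \<bullet> x + c) 0 - (b \<bullet> x + c))" by auto
  then show ?thesis
    using zero good_affine[OF A]
    by (simp only:) (subst L_diff, auto intro!: good_tame' A continuous_intros)
qed

lemma L_split:
  assumes A: "good A" and cr: "crease_fun b c" and f: "continuous_on UNIV f"
  shows "L A f = L (A \<inter> {x. b \<bullet> x + c > 0}) f + L (A \<inter> {x. (-b) \<bullet> x + (-c) > 0}) f"
proof -
  have sA: "A \<in> sets borel" "A \<subseteq> P" using A by (auto simp: good_def)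
  let ?B = "A \<inter> {x. b \<bullet> x + c > 0}" and ?C = "A \<inter> {x. (-b) \<bullet> x + (-c) > 0}"
  have t: "tame ?B f" "tame ?C f" "tame A f" "tame (?B \<union> ?C) f"
    using sA f by (auto intro!: tame_continuous sets.Int sets.Un sets_halfplane
        elim: continuous_on_subset simp del: inner_minus_left)
  have "L A f = L (?B \<union> ?C) f"
    using t crease_fun_AE[OF cr] unfolding tame_def
    by (intro L_null_cong) (auto elim!: eventually_mono)
  also have "\<dots> = L ?B f + L ?C f"
    by (rule L_Un[OF t(1,2)]) auto
  finally show ?thesis .
qed

end

section \<open>Affine approximation of convex functions\<close>

lemma continuous_on_affine: "continuous_on S (\<lambda>x. b \<bullet> x + c)" for b :: "'a::real_inner"
  by (intro continuous_intros)

text \<open>At a boundary point of \<open>Q\<close> a convex function may have infinite slope and no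
  supporting affine function, so a loss of \<open>e\<close> is allowed. The point lowered by
  \<open>e\<close> is strictly separated from the closed epigraph, and the hyperplane is not
  vertical because it separates two points over the same \<open>x\<close>.\<close>

lemma convex_affine_minorant:
  fixes f :: "'a::euclidean_space \<Rightarrow> real"
  assumes Q: "closed Q" and f: "convex_on Q f" "continuous_on Q f" and x: "x \<in> Q" and e: "0 < e"
  shows "\<exists>b c. (\<forall>y\<in>Q. b \<bullet> y + c \<le> f y) \<and> f x - e < b \<bullet> x + c"
proof -
  let ?E = "epigraph Q f"
  have "closed ((Q \<times> UNIV) \<inter> (\<lambda>z. snd z - f (fst z)) -` {0..})"
    by (rule continuous_closed_preimage)
      (auto intro!: continuous_intros continuous_on_compose2[OF f(2)] closed_Times Q)
  moreover have "(Q \<times> UNIV) \<inter> (\<lambda>z. snd z - f (fst z)) -` {0..} = ?E"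
    by (auto simp: epigraph_def)
  ultimately have clE: "closed ?E" by simp
  have cvE: "convex ?E" using f(1) by (simp add: convex_epigraph)
  have "(x, f x - e) \<notin> ?E" using e by (simp add: epigraph_def)
  then obtain n d where nd: "n \<bullet> (x, f x - e) < d" "\<And>z. z \<in> ?E \<Longrightarrow> d < n \<bullet> z"
    using separating_hyperplane_closed_point[OF cvE clE] by blast
  obtain \<alpha> \<beta> where n: "n = (\<alpha>, \<beta>)" by fastforce
  have "d < \<alpha> \<bullet> x + \<beta> * f x" using nd(2)[of "(x, f x)"] x by (simp add: epigraph_def n)
  moreover have "\<alpha> \<bullet> x + \<beta> * (f x - e) < d" using nd(1) by (simp add: n)
  ultimately have "0 < \<beta> * e" by (simp add: algebra_simps)
  then have \<beta>: "0 < \<beta>" using e by (simp add: zero_less_mult_iff)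
  have eq: "((-1/\<beta>) *\<^sub>R \<alpha>) \<bullet> y + d / \<beta> = (d - \<alpha> \<bullet> y) / \<beta>" for y
    using \<beta> by (simp add: field_simps)
  have "(d - \<alpha> \<bullet> y) / \<beta> \<le> f y" if "y \<in> Q" for y
    using nd(2)[of "(y, f y)"] that \<beta> by (simp add: epigraph_def n field_simps)
  moreover have "f x - e < (d - \<alpha> \<bullet> x) / \<beta>"
    using nd(1) \<beta> by (simp add: n field_simps)
  ultimately show ?thesis
    using eq by (intro exI[of _ "(-1/\<beta>) *\<^sub>R \<alpha>"] exI[of _ "d / \<beta>"]) simp
qed

text \<open>At an interior point no loss is necessary: \<open>(p, f p)\<close> is separated weakly
  from the strict epigraph, and a vertical hyperplane is impossible because \<open>Q\<close> extends
  from \<open>p\<close> to both sides of it.\<close>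

lemma convex_subgradient:
  fixes f :: "'a::euclidean_space \<Rightarrow> real"
  assumes f: "convex_on Q f" and p: "p \<in> interior Q"
  shows "\<exists>b c. (\<forall>y\<in>Q. b \<bullet> y + c \<le> f y) \<and> b \<bullet> p + c = f p"
proof -
  have pQ: "p \<in> Q" using p interior_subset by blast
  let ?T = "{z. fst z \<in> Q \<and> f (fst z) < snd z}"
  have "convex ?T"
  proof (rule convexI)
    fix z w and s t :: real
    assume z: "z \<in> ?T" and w: "w \<in> ?T" and st: "0 \<le> s" "0 \<le> t" "s + t = 1"
    have "convex Q" using f by (simp add: convex_on_def)
    then have "s *\<^sub>R fst z + t *\<^sub>R fst w \<in> Q" using z w st by (auto intro: convexD)
    moreover have "f (s *\<^sub>R fst z + t *\<^sub>R fst w) \<le> s * f (fst z) + t * f (fst w)"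
      using f z w st unfolding convex_on_def by auto
    moreover have "s * f (fst z) + t * f (fst w) < s * snd z + t * snd w"
    proof (cases "s = 0")
      case False
      then have "s * f (fst z) < s * snd z" using st z by simp
      moreover have "t * f (fst w) \<le> t * snd w" using st w by (simp add: mult_left_mono)
      ultimately show ?thesis by simp
    qed (use st w in simp)
    ultimately show "s *\<^sub>R z + t *\<^sub>R w \<in> ?T" by simp
  qed
  moreover have "(p, f p + 1) \<in> ?T" using pQ by simp
  moreover have "{(p, f p)} \<inter> ?T = {}" by auto
  ultimately obtain n d where n0: "n \<noteq> 0" and nd: "n \<bullet> (p, f p) \<le> d" "\<And>z. z \<in> ?T \<Longrightarrow> d \<le> n \<bullet> z"
    using separating_hyperplane_sets[of "{(p, f p)}" ?T] by (metis (no_types, lifting) convex_singleton empty_iff insertI1)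
  obtain \<alpha> \<beta> where n: "n = (\<alpha>, \<beta>)" by fastforce
  have T: "\<alpha> \<bullet> p + \<beta> * f p \<le> \<alpha> \<bullet> y + \<beta> * t" if "y \<in> Q" "f y < t" for y t
    using nd(1) nd(2)[of "(y, t)"] that by (simp add: n)
  have \<beta>0: "0 \<le> \<beta>" using T[OF pQ, of "f p + 1"] by (simp add: algebra_simps)
  have Tf: "\<alpha> \<bullet> p + \<beta> * f p \<le> \<alpha> \<bullet> y + \<beta> * f y" if "y \<in> Q" for y
  proof (rule field_le_epsilon)
    fix e :: real assume e: "0 < e"
    \<comment> \<open>The graph is approached from the strict epigraph; the denominator
      \<open>\<beta> + 1\<close> is safe while \<open>\<beta> = 0\<close> is not yet
      excluded.\<close>
    have "\<alpha> \<bullet> p + \<beta> * f p \<le> \<alpha> \<bullet> y + \<beta> * (f y + e / (\<beta> + 1))"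
      using T[OF that, of "f y + e / (\<beta> + 1)"] e \<beta>0 by simp
    also have "\<beta> * (e / (\<beta> + 1)) \<le> e" using e \<beta>0 by (simp add: field_simps)
    then have "\<alpha> \<bullet> y + \<beta> * (f y + e / (\<beta> + 1)) \<le> \<alpha> \<bullet> y + \<beta> * f y + e"
      by (simp add: algebra_simps)
    finally show "\<alpha> \<bullet> p + \<beta> * f p \<le> \<alpha> \<bullet> y + \<beta> * f y + e" .
  qed
  have "\<beta> \<noteq> 0"
  proof
    assume "\<beta> = 0"
    then have \<alpha>: "\<alpha> \<noteq> 0" using n0 n by (auto simp: zero_prod_def)
    obtain r where r: "0 < r" "cball p r \<subseteq> Q" using p mem_interior_cball by blast
    let ?y = "p - (r / norm \<alpha>) *\<^sub>R \<alpha>"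
    have "?y \<in> Q" using r \<alpha> by (intro subsetD[OF r(2)]) (simp add: dist_norm)
    then have "\<alpha> \<bullet> p \<le> \<alpha> \<bullet> ?y" using Tf[of ?y] \<open>\<beta> = 0\<close> by simp
    then have "r / norm \<alpha> * (\<alpha> \<bullet> \<alpha>) \<le> 0" by (simp add: inner_diff_right)
    moreover have "0 < r / norm \<alpha> * (\<alpha> \<bullet> \<alpha>)" using r \<alpha> by simp
    ultimately show False by simp
  qed
  then have \<beta>: "0 < \<beta>" using \<beta>0 by simp
  let ?d = "\<alpha> \<bullet> p + \<beta> * f p"
  have eq: "((-1/\<beta>) *\<^sub>R \<alpha>) \<bullet> y + ?d / \<beta> = (?d - \<alpha> \<bullet> y) / \<beta>" for y
    using \<beta> by (simp add: field_simps)
  have "(?d - \<alpha> \<bullet> y) / \<beta> \<le> f y" if "y \<in> Q" for y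
    using Tf[OF that] \<beta> by (simp add: field_simps)
  moreover have "(?d - \<alpha> \<bullet> p) / \<beta> = f p" using \<beta> by simp
  ultimately show ?thesis
    using eq by (intro exI[of _ "(-1/\<beta>) *\<^sub>R \<alpha>"] exI[of _ "?d / \<beta>"]) simp
qed

text \<open>This transfers goodness, tested by functions convex on the plane, to functions convex on
  \<open>Q\<close> only. By compactness the maximum of finitely many affine minorants comes within
  \<open>e\<close> of \<open>f\<close>.\<close>

lemma convex_approximation:
  fixes f :: "'a::euclidean_space \<Rightarrow> real"
  assumes Q: "compact Q" and f: "convex_on Q f" "continuous_on Q f" and e: "0 < e"
  shows "\<exists>g. convex_on UNIV g \<and> (\<forall>x\<in>Q. \<bar>f x - g x\<bar> \<le> e)"
proof (cases "Q = {}")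
  case True
  then show ?thesis by (intro exI[of _ "\<lambda>x. 0 \<bullet> x + 0"] conjI convex_on_affine_fun) (simp add: True)
next
  case False
  then obtain x0 where x0: "x0 \<in> Q" by blast
  have clQ: "closed Q" using Q compact_imp_closed by blast
  define M where "M = {(b, c). \<forall>y\<in>Q. b \<bullet> y + c \<le> f y}"
  let ?U = "\<lambda>(b, c). {y \<in> Q. f y - e < b \<bullet> y + c}"
  have op: "openin (top_of_set Q) (?U m)" for m
  proof -
    obtain b c where m: "m = (b, c)" by fastforce
    have "openin (top_of_set Q) (Q \<inter> (\<lambda>y. b \<bullet> y + c - f y + e) -` {0<..})"
      by (intro continuous_openin_preimage_gen continuous_intros f)
    moreover have "Q \<inter> (\<lambda>y. b \<bullet> y + c - f y + e) -` {0<..} = ?U m" by (auto simp: m)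
    ultimately show ?thesis by simp
  qed
  have cov: "Q \<subseteq> \<Union>(?U ` M)"
  proof
    fix x assume "x \<in> Q"
    moreover from this obtain b c where "\<forall>y\<in>Q. b \<bullet> y + c \<le> f y" "f x - e < b \<bullet> x + c"
      using convex_affine_minorant[OF clQ f _ e, of x] by blast
    ultimately have "(b, c) \<in> M" "x \<in> ?U (b, c)" by (auto simp: M_def)
    then show "x \<in> \<Union>(?U ` M)" by blast
  qed
  have "\<exists>\<D>\<subseteq>?U ` M. finite \<D> \<and> Q \<subseteq> \<Union>\<D>"
    using Q[unfolded compact_eq_openin_cover, rule_format, of "?U ` M"] op cov by blast
  then obtain \<D> where D: "\<D> \<subseteq> ?U ` M" "finite \<D>" "Q \<subseteq> \<Union>\<D>" by blast
  obtain K where K: "K \<subseteq> M" "finite K" "\<D> = ?U ` K"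
    using finite_subset_image[OF D(2,1)] by blast
  then have K: "finite K" "K \<subseteq> M" "Q \<subseteq> \<Union>(?U ` K)" using D(3) by simp_all
  have "\<exists>g. convex_on UNIV g \<and> (\<forall>y\<in>Q. g y \<le> f y) \<and> (\<forall>(b,c)\<in>K. \<forall>y. b \<bullet> y + c \<le> g y)"
    using K(1,2)
  proof induction
    case empty
    obtain b c where "\<forall>y\<in>Q. b \<bullet> y + c \<le> f y" using convex_affine_minorant[OF clQ f x0 e] by blast
    then show ?case by (intro exI[of _ "\<lambda>x. b \<bullet> x + c"] conjI convex_on_affine_fun) simp_all
  next
    case (insert m K)
    then obtain g where g: "convex_on UNIV g" "\<forall>y\<in>Q. g y \<le> f y" "\<forall>(b,c)\<in>K. \<forall>y. b \<bullet> y + c \<le> g y"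
      unfolding insert_subset by blast
    obtain b c where m: "m = (b, c)" by fastforce
    have "convex_on UNIV (\<lambda>y. max (b \<bullet> y + c) (g y))" by (intro convex_on_max convex_on_affine_fun g)
    moreover have "\<forall>y\<in>Q. max (b \<bullet> y + c) (g y) \<le> f y" using g(2) insert.prems by (auto simp: m M_def)
    moreover have "\<forall>(b',c')\<in>insert m K. \<forall>y. b' \<bullet> y + c' \<le> max (b \<bullet> y + c) (g y)"
      using g(3) by (auto simp: m le_max_iff_disj)
    ultimately show ?case by (intro exI[of _ "\<lambda>y. max (b \<bullet> y + c) (g y)"] conjI)
  qed
  then obtain g where g: "convex_on UNIV g" "\<forall>y\<in>Q. g y \<le> f y" "\<forall>(b,c)\<in>K. \<forall>y. b \<bullet> y + c \<le> g y" by blast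
  have "\<bar>f x - g x\<bar> \<le> e" if "x \<in> Q" for x
  proof -
    obtain m where m: "m \<in> K" "x \<in> ?U m" using K(3) \<open>x \<in> Q\<close> by blast
    obtain b c where "m = (b, c)" by fastforce
    then have "f x - e < b \<bullet> x + c" "b \<bullet> x + c \<le> g x" using m g(3) by auto
    then have "f x - e < g x" by linarith
    moreover have "g x \<le> f x" using g(2) that by blast
    ultimately show ?thesis using e by linarith
  qed
  then show ?thesis using g(1) by blast
qed

text \<open>A segment that crosses the line does so at a point where \<open>f\<close> vanishes;
  beyond it the new function agrees with \<open>f\<close>, and before it the value 0 is not above
  \<open>f\<close>. This splits a convex function along a chord of its zero set into two convex
  functions.\<close>

lemma convex_on_one_side:
  fixes f :: "'a::real_inner \<Rightarrow> real"
  assumes f: "convex_on Q f" and nonneg: "\<And>x. x \<in> Q \<Longrightarrow> 0 \<le> f x"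
    and zero: "\<And>x. x \<in> Q \<Longrightarrow> b \<bullet> x + c = 0 \<Longrightarrow> f x = 0"
  shows "convex_on Q (\<lambda>x. if b \<bullet> x + c \<le> 0 then 0 else f x)" (is "convex_on Q ?g")
proof (rule convex_onI)
  show cQ: "convex Q" using f by (simp add: convex_on_def)
  have key: "f ((1 - t) *\<^sub>R x + t *\<^sub>R y) \<le> t * f y"
    if t: "0 < t" "t < 1" and xy: "x \<in> Q" "y \<in> Q" and s: "b \<bullet> x + c \<le> 0" "0 < b \<bullet> y + c"
      and w: "0 < b \<bullet> ((1 - t) *\<^sub>R x + t *\<^sub>R y) + c" for t x y
  proof -
    let ?x = "b \<bullet> x + c" and ?y = "b \<bullet> y + c"
    \<comment> \<open>The parameter at which the segment from \<open>x\<close> to \<open>y\<close>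
      crosses the line.\<close>
    define r where "r = - ?x / (?y - ?x)"
    have r: "0 \<le> r" "r < 1" using s by (auto simp: r_def field_simps)
    let ?z = "(1 - r) *\<^sub>R x + r *\<^sub>R y"
    have zQ: "?z \<in> Q" using cQ xy r by (intro convexD) auto
    have "b \<bullet> ?z + c = (1 - r) * ?x + r * ?y" by (simp add: inner_simps algebra_simps)
    also have "\<dots> = 0" using s by (simp add: r_def field_simps)
    finally have z0: "f ?z = 0" by (rule zero[OF zQ])
    have "b \<bullet> ((1 - t) *\<^sub>R x + t *\<^sub>R y) + c = (1 - t) * ?x + t * ?y" by (simp add: inner_simps algebra_simps)
    then have "- ?x < t * (?y - ?x)" using w by (simp add: algebra_simps)
    then have rt: "r < t" using s by (simp add: r_def field_simps)
    \<comment> \<open>The parameter of the same point on the remaining segment from the crossing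
      point to \<open>y\<close>. It is smaller than \<open>t\<close>, which is where nonnegativity
      of \<open>f y\<close> enters.\<close>
    define u where "u = (t - r) / (1 - r)"
    have u: "0 \<le> u" "u \<le> 1" using r rt t by (auto simp: u_def field_simps)
    have ut: "u \<le> t"
    proof -
      have "t - r \<le> t * (1 - r)" using r t mult_left_le[of t r] by (simp add: algebra_simps)
      then show ?thesis using r by (simp add: u_def field_simps)
    qed
    have "u * (1 - r) = t - r" using r by (simp add: u_def)
    then have e1: "(1 - u) * (1 - r) = 1 - t" "(1 - u) * r + u = t"
      by (simp_all add: algebra_simps)
    have "(1 - u) *\<^sub>R ?z + u *\<^sub>R y = ((1 - u) * (1 - r)) *\<^sub>R x + ((1 - u) * r + u) *\<^sub>R y"
      by (simp add: algebra_simps)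
    then have "(1 - u) *\<^sub>R ?z + u *\<^sub>R y = (1 - t) *\<^sub>R x + t *\<^sub>R y" by (simp only: e1)
    then have "f ((1 - t) *\<^sub>R x + t *\<^sub>R y) \<le> (1 - u) * f ?z + u * f y"
      using convex_onD[OF f u(1) u(2) zQ xy(2)] by simp
    also have "\<dots> = u * f y" by (simp add: z0)
    also have "\<dots> \<le> t * f y" using ut nonneg[OF xy(2)] by (intro mult_right_mono)
    finally show ?thesis .
  qed
  fix t :: real and x y
  assume t: "0 < t" "t < 1" and xy: "x \<in> Q" "y \<in> Q"
  let ?w = "(1 - t) *\<^sub>R x + t *\<^sub>R y"
  have wQ: "?w \<in> Q" using cQ xy t by (intro convexD) auto
  have gn: "0 \<le> ?g z" if "z \<in> Q" for z using nonneg that by simp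
  show "?g ?w \<le> (1 - t) * ?g x + t * ?g y"
  proof (cases "b \<bullet> ?w + c \<le> 0")
    case True
    have "0 \<le> (1 - t) * ?g x + t * ?g y"
      using gn[OF xy(1)] gn[OF xy(2)] t by (intro add_nonneg_nonneg mult_nonneg_nonneg) auto
    then show ?thesis using True by simp
  next
    case False
    have bw: "b \<bullet> ?w + c = (1 - t) * (b \<bullet> x + c) + t * (b \<bullet> y + c)" by (simp add: inner_simps algebra_simps)
    consider "b \<bullet> x + c \<le> 0" "b \<bullet> y + c \<le> 0" | "b \<bullet> x + c \<le> 0" "0 < b \<bullet> y + c"
      | "0 < b \<bullet> x + c" "b \<bullet> y + c \<le> 0" | "0 < b \<bullet> x + c" "0 < b \<bullet> y + c" by linarith
    then show ?thesis
    proof cases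
      case 1
      then have "(1 - t) * (b \<bullet> x + c) \<le> 0" "t * (b \<bullet> y + c) \<le> 0"
        using t mult_nonneg_nonpos[of "1 - t" "b \<bullet> x + c"] mult_nonneg_nonpos[of t "b \<bullet> y + c"] by simp_all
      then show ?thesis using False bw by linarith
    next
      case 2
      then show ?thesis using key[OF t xy 2] False by simp
    next
      case 3
      have "f ((1 - (1 - t)) *\<^sub>R y + (1 - t) *\<^sub>R x) \<le> (1 - t) * f x"
        using key[of "1 - t" y x] t xy 3 False by (simp add: add.commute)
      then show ?thesis using False 3 by (simp add: add.commute)
    next
      case 4
      then show ?thesis using convex_onD[OF f _ _ xy, of t] t False by simp
    qed
  qed
qed

section \<open>Contact sets of convex functions on good sets\<close>

context boundary_pair
begin

lemma good_convex_on:
  assumes Q: "good Q" "compact Q" and f: "convex_on Q f" "continuous_on Q f"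
  shows "0 \<le> L Q f"
proof -
  have QP: "Q \<subseteq> P" using Q by (simp add: good_def)
  have "\<exists>g. convex_on UNIV g \<and> (\<forall>x\<in>Q. \<bar>f x - g x\<bar> \<le> 1 / real (Suc n))" for n
    by (rule convex_approximation[OF Q(2) f]) simp
  then obtain g where g: "\<And>n. convex_on UNIV (g n)" "\<And>n x. x \<in> Q \<Longrightarrow> \<bar>f x - g n x\<bar> \<le> 1 / real (Suc n)"
    by metis
  obtain B where B: "\<And>x. x \<in> Q \<Longrightarrow> \<bar>f x\<bar> \<le> B"
    using compact_imp_bounded[OF compact_continuous_image[OF f(2) Q(2)]] unfolding bounded_iff by auto
  have "(\<lambda>n. L Q (g n)) \<longlonglongrightarrow> L Q f"
  proof (rule L_tendsto)
    show "tame Q (g n)" for n by (rule good_tame[OF Q(1) g(1)])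
    show "tame Q f" by (rule tame_continuous_compact[OF Q(2) QP f(2)])
    show "\<bar>g n x\<bar> \<le> B + 1" if "x \<in> Q" for n x
    proof -
      have "1 / real (Suc n) \<le> 1" by simp
      then show ?thesis using g(2)[OF that, of n] B[OF that] by linarith
    qed
    have "(\<lambda>n. g n x) \<longlonglongrightarrow> f x" if "x \<in> Q" for x
    proof (rule LIM_zero_cancel, rule Lim_null_comparison)
      show "eventually (\<lambda>n. norm (g n x - f x) \<le> 1 / real (Suc n)) sequentially"
        using g(2)[OF that] by (intro always_eventually) (simp add: abs_minus_commute del: of_nat_Suc)
    qed (rule LIMSEQ_Suc[OF lim_1_over_n])
    then show "AE x in \<sigma>. x \<in> Q \<longrightarrow> (\<lambda>n. g n x) \<longlonglongrightarrow> f x"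
      "AE x in lborel. x \<in> Q \<longrightarrow> (\<lambda>n. g n x) \<longlonglongrightarrow> f x" by auto
  qed
  moreover have "0 \<le> L Q (g n)" for n using Q(1) g(1) by (simp add: good_def)
  ultimately show ?thesis by (intro LIMSEQ_le_const) auto
qed

text \<open>Since \<open>\<sigma>\<close> does not see the interior, adding a bump there decreases \<open>L\<close>.\<close>

lemma L_interior_bump:
  assumes B: "B \<in> sets borel" "B \<subseteq> P" and t: "tame B f"
    and nonneg: "\<And>x. x \<in> B \<Longrightarrow> 0 \<le> f x" and zero: "\<And>x. x \<in> B \<Longrightarrow> x \<in> frontier P \<Longrightarrow> f x = 0"
    and U: "open U" "U \<subseteq> B" "U \<noteq> {}" "\<And>x. x \<in> U \<Longrightarrow> 0 < f x"
  shows "L B f < 0"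
proof -
  have "(LINT x:B|\<sigma>. f x) = 0"
    unfolding set_lebesgue_integral_def
  proof (rule integral_eq_zero_AE)
    show "AE x in \<sigma>. indicator B x *\<^sub>R f x = 0"
      using AE_frontier by eventually_elim (auto simp: indicator_def zero)
  qed
  moreover have "0 < (LINT x:B|lborel. f x)"
  proof -
    let ?F = "\<lambda>x. indicator B x *\<^sub>R f x"
    have int: "integrable lborel ?F" using tame_integrable(2)[OF t] by (simp add: set_integrable_def)
    have F0: "0 \<le> ?F x" for x using nonneg by (auto simp: indicator_def)
    have "integral\<^sup>L lborel ?F \<noteq> 0"
    proof
      assume "integral\<^sup>L lborel ?F = 0"
      then have "AE x in lborel. ?F x = 0"
        using integral_nonneg_eq_0_iff_AE[OF int] F0 by simp
      then have "AE x in lborel. x \<notin> U"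
        by eventually_elim (use U in \<open>force simp: indicator_def split: if_splits\<close>)
      then have "emeasure lborel U = 0"
        using U(1) by (subst (asm) AE_iff_measurable[of U]) auto
      then have "U \<in> null_sets lebesgue" using U(1) by (auto intro!: null_sets_completionI)
      then have "negligible U" by (simp add: negligible_iff_null_sets)
      then show False using U open_not_negligible by blast
    qed
    moreover have "0 \<le> integral\<^sup>L lborel ?F" using F0 by simp
    ultimately show ?thesis unfolding set_lebesgue_integral_def by linarith
  qed
  ultimately show ?thesis using a_pos by (simp add: L_def)
qed

text \<open>An extreme point \<open>y\<close> of the contact set can be cut off by a line. If
  \<open>y\<close> were interior, a small affine function positive at \<open>y\<close> would exceed
  \<open>f\<close> only near \<open>y\<close>; replacing \<open>f\<close> by the maximum of the two
  keeps it convex and adds a bump away from the boundary, which brings \<open>L\<close> below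
  0.\<close>

lemma contact_extreme_point:
  assumes Q: "good Q" "compact Q" "convex Q"
    and f: "convex_on Q f" "continuous_on Q f" "L Q f = 0" "\<And>x. x \<in> Q \<Longrightarrow> 0 \<le> f x"
    and y: "y extreme_point_of {x \<in> Q. f x = 0}"
  shows "y \<notin> interior Q"
proof
  assume yQ: "y \<in> interior Q"
  let ?Z = "{x \<in> Q. f x = 0}"
  have QP: "Q \<subseteq> P" "Q \<in> sets borel" using Q(1) by (auto simp: good_def)
  have "closed (Q \<inter> f -` {0})" using f(2) compact_imp_closed[OF Q(2)] by (intro continuous_closed_preimage) auto
  moreover have Zeq: "Q \<inter> f -` {0} = ?Z" by auto
  ultimately have clZ: "closed ?Z" by simp
  have cmpZ: "compact ?Z" using Q(2) clZ by (metis (no_types, lifting) compact_Int_closed Collect_conj_eq Collect_mem_eq Int_absorb1 Zeq inf_le1)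
  obtain r where r: "0 < r" "cball y r \<subseteq> interior Q"
    using yQ open_interior open_contains_cball by blast
  \<comment> \<open>An extreme point does not lie in the hull of the contact points outside a ball
    around it. This compact hull is what the separating line keeps away from
    \<open>y\<close>.\<close>
  let ?K = "convex hull (?Z - ball y r)"
  have cvZ: "convex ?Z"
  proof (rule convexI)
    fix u v and s t :: real
    assume uv: "u \<in> ?Z" "v \<in> ?Z" and st: "0 \<le> s" "0 \<le> t" "s + t = 1"
    have m: "s *\<^sub>R u + t *\<^sub>R v \<in> Q" using uv st Q(3) by (auto intro: convexD)
    have "f (s *\<^sub>R u + t *\<^sub>R v) \<le> s * f u + t * f v"
      using f(1)[unfolded convex_on_def] uv st by blast
    then show "s *\<^sub>R u + t *\<^sub>R v \<in> ?Z" using m f(4)[OF m] uv by simp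
  qed
  have cmpK: "compact ?K" by (intro compact_convex_hull compact_diff cmpZ open_ball)
  have yK: "y \<notin> ?K"
  proof
    assume yK: "y \<in> ?K"
    have "?K \<subseteq> ?Z" using cvZ by (intro hull_minimal) auto
    then have "y extreme_point_of ?K" using y yK unfolding extreme_point_of_def by blast
    then have "y \<in> ?Z - ball y r" by (rule extreme_point_of_convex_hull)
    then show False using r by simp
  qed
  obtain d e where de: "d \<bullet> y < e" "\<And>x. x \<in> ?K \<Longrightarrow> e < d \<bullet> x"
    using separating_hyperplane_closed_point[OF convex_convex_hull compact_imp_closed[OF cmpK] yK] by blast
  let ?g = "\<lambda>x. (-d) \<bullet> x + e"
  let ?W = "{x \<in> Q - ball y r. 0 \<le> ?g x}"
  have "?W = (Q - ball y r) \<inter> {x. d \<bullet> x \<le> e}" by auto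
  then have cmpW: "compact ?W"
    using Q(2) by (simp add: compact_diff compact_Int_closed closed_halfspace_le)
  have fW: "0 < f x" if "x \<in> ?W" for x
  proof (rule ccontr)
    assume "\<not> 0 < f x"
    then have "x \<in> ?Z - ball y r" using f(4)[of x] that by auto
    then have "e < d \<bullet> x" by (intro de(2) hull_inc)
    then show False using that by simp
  qed
  \<comment> \<open>Outside the ball and on the side of \<open>y\<close>, \<open>f\<close> is
    positive on a compact set, so a small multiple of \<open>?g\<close> stays below it. At
    \<open>y\<close> itself only the sign of \<open>?g\<close> matters, so scaling is
    harmless.\<close>
  have "\<exists>\<delta>>0. \<forall>x\<in>?W. \<delta> * ?g x < f x"
  proof (cases "?W = {}")
    case False
    obtain m where m: "m \<in> ?W" "\<And>x. x \<in> ?W \<Longrightarrow> f m \<le> f x"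
      using continuous_attains_inf[OF cmpW False continuous_on_subset[OF f(2)]] by blast
    obtain n where n: "n \<in> ?W" "\<And>x. x \<in> ?W \<Longrightarrow> ?g x \<le> ?g n"
      using continuous_attains_sup[OF cmpW False continuous_on_affine[of _ "-d" e]] by blast
    \<comment> \<open>The summand 1 keeps the denominator positive when the maximum of
      \<open>?g\<close> is 0.\<close>
    let ?\<delta> = "f m / (?g n + 1)"
    have gn: "0 \<le> ?g n" using n(1) by blast
    have "0 < ?\<delta>" using fW[OF m(1)] gn by (intro divide_pos_pos) linarith+
    moreover have "?\<delta> * ?g x < f x" if "x \<in> ?W" for x
    proof -
      have "?\<delta> * ?g x \<le> ?\<delta> * ?g n" using \<open>0 < ?\<delta>\<close> n(2)[OF that] by (intro mult_left_mono) auto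
      also have "\<dots> < ?\<delta> * (?g n + 1)" using \<open>0 < ?\<delta>\<close> by (intro mult_strict_left_mono) auto
      also have "\<dots> = f m" using gn by (simp add: add_nonneg_eq_0_iff)
      also have "\<dots> \<le> f x" using m(2)[OF that] .
      finally show ?thesis .
    qed
    ultimately show ?thesis by blast
  qed (auto intro: exI[of _ 1])
  then obtain \<delta> where \<delta>: "0 < \<delta>" "\<And>x. x \<in> ?W \<Longrightarrow> \<delta> * ?g x < f x" by blast
  define g where "g x = (\<delta> *\<^sub>R (-d)) \<bullet> x + \<delta> * e" for x
  have g: "g x = \<delta> * ?g x" for x by (simp add: g_def algebra_simps)
  have gcont: "continuous_on S g" for S unfolding g_def by (intro continuous_intros)
  let ?h = "\<lambda>x. max (f x) (g x)"
  have cvx: "convex_on Q g"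
    unfolding g_def using convex_on_affine_fun[of "\<delta> *\<^sub>R (-d)" "\<delta> * e"] Q(3) convex_on_subset by blast
  have "0 \<le> L Q ?h"
    by (intro good_convex_on Q convex_on_max f(1) cvx continuous_intros f(2) gcont)
  moreover have "L Q ?h = L Q f + L Q (\<lambda>x. max (g x - f x) 0)"
  proof -
    have "L Q ?h = L Q (\<lambda>x. f x + max (g x - f x) 0)" by (rule L_cong) (auto simp: QP)
    also have "\<dots> = L Q f + L Q (\<lambda>x. max (g x - f x) 0)"
      by (intro L_add tame_continuous_compact Q QP continuous_intros f(2) gcont)
    finally show ?thesis .
  qed
  moreover have "L Q (\<lambda>x. max (g x - f x) 0) < 0"
  proof (rule L_interior_bump)
    show "tame Q (\<lambda>x. max (g x - f x) 0)"
      by (intro tame_continuous_compact Q QP continuous_intros f(2) gcont)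
    show "max (g x - f x) 0 = 0" if "x \<in> Q" "x \<in> frontier P" for x
    proof -
      have "x \<notin> interior P" using that by (simp add: frontier_def)
      then have "x \<notin> interior Q" using interior_mono[OF QP(1)] by blast
      then have "x \<notin> ball y r" using r(2) ball_subset_cball by blast
      moreover have "g x \<le> 0" if "?g x < 0"
        using mult_nonneg_nonpos[of \<delta> "?g x"] that \<delta>(1) by (simp add: g)
      ultimately have "g x \<le> f x"
        using \<delta>(2)[of x] that f(4)[OF that(1)] by (cases "0 \<le> ?g x") (auto simp: g less_imp_le)
      then show ?thesis by simp
    qed
    let ?U = "interior Q \<inter> {x. f x < g x}"
    have "open (interior Q \<inter> (\<lambda>x. g x - f x) -` {0<..})"
      by (intro continuous_open_preimage continuous_intros gcont continuous_on_subset[OF f(2)] interior_subset) auto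
    moreover have "interior Q \<inter> (\<lambda>x. g x - f x) -` {0<..} = ?U" by auto
    ultimately show "open ?U" by simp
    have "f y = 0" using y unfolding extreme_point_of_def by blast
    then have "y \<in> ?U" using yQ de(1) \<delta>(1) by (simp add: g)
    then show "?U \<noteq> {}" by blast
    show "?U \<subseteq> Q" using interior_subset by blast
  qed (use QP in auto)
  ultimately show False using f(3) by simp
qed

end

section \<open>Zero creases\<close>

definition det2 :: "real^2 \<Rightarrow> real^2 \<Rightarrow> real" where
  "det2 v w = v $ 1 * w $ 2 - v $ 2 * w $ 1"

lemma inner_2: "v \<bullet> w = v $ 1 * w $ 1 + v $ 2 * w $ 2" for v w :: "real^2"
  by (simp add: inner_vec_def sum_2)

lemma vec_eq_2: "v = w \<longleftrightarrow> v $ 1 = w $ 1 \<and> v $ 2 = w $ 2" for v w :: "'a^2"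
  by (simp add: vec_eq_iff forall_2)

lemma det2_zero_imp_parallel:
  assumes "det2 v w = 0" "w \<noteq> 0"
  shows "\<exists>t. v = t *\<^sub>R w"
proof (cases "w $ 1 = 0")
  case True
  then have "w $ 2 \<noteq> 0" using assms(2) by (simp add: vec_eq_2)
  then show ?thesis
    using True assms(1) by (intro exI[of _ "v $ 2 / w $ 2"]) (simp add: vec_eq_2 det2_def)
next
  case False
  then show ?thesis
    using assms(1) by (intro exI[of _ "v $ 1 / w $ 1"]) (simp add: vec_eq_2 det2_def field_simps)
qed

lemma orthogonal_imp_det2_zero:
  assumes "d \<noteq> 0" "d \<bullet> v = 0" "d \<bullet> w = 0"
  shows "det2 v w = 0"
proof -
  have "d $ 1 * det2 v w = w $ 2 * (d \<bullet> v) - v $ 2 * (d \<bullet> w)"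
       "d $ 2 * det2 v w = v $ 1 * (d \<bullet> w) - w $ 1 * (d \<bullet> v)"
    by (simp_all add: det2_def inner_2 algebra_simps)
  moreover have "d $ 1 \<noteq> 0 \<or> d $ 2 \<noteq> 0" using assms(1) by (simp add: vec_eq_2)
  ultimately show ?thesis using assms by auto
qed

lemma orthogonal_imp_parallel:
  fixes d v w :: "real^2"
  assumes "d \<noteq> 0" "d \<bullet> v = 0" "d \<bullet> w = 0" "w \<noteq> 0"
  shows "\<exists>t. v = t *\<^sub>R w"
  using det2_zero_imp_parallel[OF orthogonal_imp_det2_zero] assms by blast

lemma open_segment_interior:
  fixes z x :: "'a::euclidean_space"
  assumes "convex Q" "z \<in> interior Q" "x \<in> Q" "0 \<le> t" "t < 1"
  shows "z + t *\<^sub>R (x - z) \<in> interior Q"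
proof -
  have "x - (1 - t) *\<^sub>R (x - z) \<in> interior Q"
    by (rule mem_interior_convex_shrink[OF assms(1,2,3)]) (use assms in auto)
  then show ?thesis by (simp add: algebra_simps)
qed

lemma supporting_line:
  fixes Z :: "'a::euclidean_space set"
  assumes "convex Z" "z \<in> Z" "z \<notin> interior Z"
  shows "\<exists>d. d \<noteq> 0 \<and> (\<forall>x\<in>Z. d \<bullet> x \<le> d \<bullet> z)"
proof (cases "interior Z = {}")
  case True
  then obtain n e where "n \<noteq> 0" "Z \<subseteq> {x. n \<bullet> x = e}"
    using empty_interior_subset_hyperplane[OF assms(1)] by blast
  then have "n \<bullet> x = e" if "x \<in> Z" for x using that by blast
  then show ?thesis using assms(2) \<open>n \<noteq> 0\<close> by (intro exI[of _ n]) auto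
next
  case False
  then have "z \<notin> rel_interior Z" using assms(3) by (simp add: interior_rel_interior_gen split: if_splits)
  then obtain n where "n \<noteq> 0" "\<And>y. y \<in> Z \<Longrightarrow> n \<bullet> z \<le> n \<bullet> y"
    using supporting_hyperplane_rel_boundary[OF assms(1,2)] by metis
  then show ?thesis by (intro exI[of _ "- n"]) auto
qed

text \<open>The supporting line cuts a face out of \<open>Z\<close>, whose extreme points are
  extreme in \<open>Z\<close> and so not interior to \<open>Q\<close>. Points strictly between
  \<open>z\<close> and \<open>x\<close> are interior to \<open>Q\<close>, so the extreme point in
  the direction of \<open>x\<close> lies at \<open>x\<close> or beyond, and convexity of
  \<open>Z\<close> gives \<open>x\<close>.\<close>

lemma convex_chord_in_contact_set:
  fixes Q Z :: "(real^2) set"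
  assumes Q: "convex Q" and Z: "compact Z" "convex Z" "Z \<subseteq> Q"
    and ext: "\<And>y. y extreme_point_of Z \<Longrightarrow> y \<notin> interior Q"
    and z: "z \<in> Z" "z \<in> interior Q" and d: "d \<noteq> 0" "\<And>x. x \<in> Z \<Longrightarrow> d \<bullet> x \<le> d \<bullet> z"
    and x: "x \<in> Q" "d \<bullet> x = d \<bullet> z"
  shows "x \<in> Z"
proof (cases "x = z")
  case False
  let ?F = "Z \<inter> {x. d \<bullet> x = d \<bullet> z}" and ?w = "x - z"
  have w: "?w \<noteq> 0" using False by simp
  have face: "?F face_of Z" by (rule face_of_Int_supporting_hyperplane_le[OF Z(2) d(2)])
  have cvF: "convex ?F" using face face_of_imp_convex by blast
  have "compact ?F" by (intro compact_Int_closed Z closed_hyperplane)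
  then have F: "?F = convex hull {y. y extreme_point_of ?F}"
    using Krein_Milman_Minkowski cvF by blast
  \<comment> \<open>A linear functional on a compact convex set does not exceed its values at the
    extreme points; here it measures progress from \<open>z\<close> towards
    \<open>x\<close>.\<close>
  have "\<exists>y. y extreme_point_of ?F \<and> ?w \<bullet> z \<le> ?w \<bullet> y"
  proof (rule ccontr)
    assume "\<not> ?thesis"
    then have "{y. y extreme_point_of ?F} \<subseteq> {y. ?w \<bullet> y < ?w \<bullet> z}" by force
    then have "?F \<subseteq> {y. ?w \<bullet> y < ?w \<bullet> z}"
      using hull_minimal[of _ "{y. ?w \<bullet> y < ?w \<bullet> z}" convex] convex_halfspace_lt F by metis
    then show False using z by blast
  qed
  then obtain y where y: "y extreme_point_of ?F" "?w \<bullet> z \<le> ?w \<bullet> y" by blast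
  have yF: "y \<in> ?F" using y(1) by (simp add: extreme_point_of_def)
  have "y extreme_point_of Z" using extreme_point_of_face[OF face] y(1) by blast
  then have yi: "y \<notin> interior Q" by (rule ext)
  have "d \<bullet> (y - z) = 0" "d \<bullet> ?w = 0" using yF x by (auto simp: inner_diff_right)
  then obtain t where t: "y - z = t *\<^sub>R ?w" using orthogonal_imp_parallel[OF d(1)] w by blast
  then have yt: "y = z + t *\<^sub>R ?w" by (simp add: algebra_simps)
  have "0 \<le> ?w \<bullet> (y - z)" using y(2) by (simp add: inner_diff_right)
  then have "0 \<le> t * (?w \<bullet> ?w)" by (simp add: t)
  moreover have "0 < ?w \<bullet> ?w" using w by simp
  ultimately have t0: "0 \<le> t" by (simp add: zero_le_mult_iff)
  have t1: "1 \<le> t"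
  proof (rule ccontr)
    assume "\<not> 1 \<le> t"
    then have "y \<in> interior Q" using open_segment_interior[OF Q z(2) x(1) t0] yt by simp
    then show False using yi by simp
  qed
  have "(1 - 1/t) *\<^sub>R z + (1/t) *\<^sub>R y = x"
    using t1 by (simp add: yt algebra_simps)
  moreover have "(1 - 1/t) *\<^sub>R z + (1/t) *\<^sub>R y \<in> Z"
    using Z(2) z(1) yF t1 by (intro convexD) auto
  ultimately show ?thesis by simp
qed (use z in simp)

context boundary_pair
begin

lemma continuous_on_one_side:
  fixes f :: "real^2 \<Rightarrow> real"
  assumes "continuous_on Q f" "\<And>x. x \<in> Q \<Longrightarrow> b \<bullet> x + c = 0 \<Longrightarrow> f x = 0"
  shows "continuous_on Q (\<lambda>x. if b \<bullet> x + c \<le> 0 then 0 else f x)"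
  by (rule continuous_on_cases_le)
    (auto intro!: continuous_intros continuous_on_subset[OF assms(1)] simp: assms(2))

text \<open>After subtraction of a supporting affine function, \<open>f\<close> becomes a
  nonnegative \<open>\<phi>\<close> with \<open>L Q \<phi> = 0\<close> whose contact set is neither
  empty nor all of \<open>Q\<close>. A supporting line at a boundary point of the contact set gives
  a chord on which \<open>\<phi>\<close> vanishes. The crease function of that chord is a limit of
  multiples of differences of convex functions, which forces \<open>L\<close> to be at most 0 on
  it.\<close>

theorem zero_crease_exists:
  assumes Q: "good Q" "compact Q" "convex Q" "interior Q \<noteq> {}"
    and f: "convex_on Q f" "continuous_on Q f" "L Q f = 0"
    and nonaff: "\<not> (\<exists>b c. \<forall>x\<in>Q. f x = b \<bullet> x + c)"
  shows "\<exists>b c z. b \<noteq> 0 \<and> z \<in> interior Q \<and> b \<bullet> z + c = 0 \<and> L Q (\<lambda>x. max (b \<bullet> x + c) 0) = 0"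
proof -
  have QP: "Q \<subseteq> P" "Q \<in> sets borel" using Q(1) by (auto simp: good_def)
  obtain p where p: "p \<in> interior Q" using Q(4) by blast
  obtain b0 c0 where supp: "\<forall>y\<in>Q. b0 \<bullet> y + c0 \<le> f y" "b0 \<bullet> p + c0 = f p"
    using convex_subgradient[OF f(1) p] by blast
  define \<phi> where "\<phi> x = f x + ((-b0) \<bullet> x + (-c0))" for x
  have \<phi>0: "0 \<le> \<phi> x" if "x \<in> Q" for x using supp(1)[rule_format, OF that] by (simp add: \<phi>_def)
  have \<phi>conv: "convex_on Q \<phi>"
    unfolding \<phi>_def
    by (intro convex_on_add f convex_on_subset[OF convex_on_affine_fun] subset_UNIV Q)
  have \<phi>cont: "continuous_on Q \<phi>"
    unfolding \<phi>_def by (intro continuous_intros f)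
  note tc = tame_continuous_compact[OF Q(2) QP(1)]
  have L\<phi>: "L Q \<phi> = 0"
    unfolding \<phi>_def using good_affine[OF Q(1), of "-b0" "-c0"] f
    by (subst L_add) (auto intro!: tc continuous_intros)
  let ?Z = "{x \<in> Q. \<phi> x = 0}"
  have ext: "y \<notin> interior Q" if "y extreme_point_of ?Z" for y
    by (rule contact_extreme_point[OF Q(1-3) \<phi>conv \<phi>cont L\<phi> \<phi>0 that])
  have "closed (Q \<inter> \<phi> -` {0})"
    using \<phi>cont compact_imp_closed[OF Q(2)] by (intro continuous_closed_preimage) auto
  moreover have "Q \<inter> \<phi> -` {0} = ?Z" by auto
  ultimately have clZ: "closed ?Z" by simp
  then have cmpZ: "compact ?Z"
    using compact_Int_closed[OF Q(2) clZ] by (simp add: Int_def cong: conj_cong)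
  have cvZ: "convex ?Z"
  proof (rule convexI)
    fix u v and s t :: real
    assume uv: "u \<in> ?Z" "v \<in> ?Z" and st: "0 \<le> s" "0 \<le> t" "s + t = 1"
    have m: "s *\<^sub>R u + t *\<^sub>R v \<in> Q" using uv st Q(3) by (auto intro: convexD)
    have "\<phi> (s *\<^sub>R u + t *\<^sub>R v) \<le> s * \<phi> u + t * \<phi> v"
      using \<phi>conv[unfolded convex_on_def] uv st by blast
    then show "s *\<^sub>R u + t *\<^sub>R v \<in> ?Z" using m \<phi>0[OF m] uv by simp
  qed
  have pZ: "p \<in> ?Z" using p supp(2) interior_subset by (auto simp: \<phi>_def)
  have "\<not> interior Q \<subseteq> ?Z"
  proof
    assume "interior Q \<subseteq> ?Z"
    then have "closure (interior Q) \<subseteq> ?Z" using clZ closure_minimal by blast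
    then have "Q \<subseteq> ?Z" using convex_closure_interior[OF Q(3,4)] closure_subset by blast
    then have "f x = b0 \<bullet> x + c0" if "x \<in> Q" for x using that by (force simp: \<phi>_def)
    then show False using nonaff by blast
  qed
  then have "interior Q \<inter> frontier ?Z \<noteq> {}"
    using p pZ convex_connected[OF convex_interior[OF Q(3)]]
    by (intro connected_Int_frontier) auto
  then obtain z where z: "z \<in> interior Q" "z \<in> frontier ?Z" by blast
  have zZ: "z \<in> ?Z" "z \<notin> interior ?Z" using z(2) clZ by (auto simp: frontier_def)
  obtain d where d: "d \<noteq> 0" "\<And>x. x \<in> ?Z \<Longrightarrow> d \<bullet> x \<le> d \<bullet> z"
    using supporting_line[OF cvZ zZ] by blast
  define c where "c = - (d \<bullet> z)"
  have chord: "\<phi> x = 0" if "x \<in> Q" "d \<bullet> x + c = 0" for x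
  proof -
    have "x \<in> ?Z"
      by (rule convex_chord_in_contact_set[OF Q(3) cmpZ cvZ _ ext zZ(1) z(1) d that(1)])
        (use that(2) in \<open>auto simp: c_def\<close>)
    then show ?thesis by simp
  qed
  have pos: "0 < \<phi> x" if "x \<in> Q" "0 < d \<bullet> x + c" for x
  proof -
    have "x \<notin> ?Z" using d(2)[of x] that(2) unfolding c_def by linarith
    then show ?thesis using \<phi>0[OF that(1)] that(1) by (simp add: less_le)
  qed
  \<comment> \<open>Both halves of \<open>\<phi>\<close> on either side of the chord are convex, so
    their \<open>L\<close> are nonnegative with sum 0.\<close>
  define \<phi>1 where "\<phi>1 x = (if d \<bullet> x + c \<le> 0 then 0 else \<phi> x)" for x
  define \<phi>2 where "\<phi>2 x = (if (-d) \<bullet> x + (-c) \<le> 0 then 0 else \<phi> x)" for x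
  have chord': "\<phi> x = 0" if "x \<in> Q" "(-d) \<bullet> x + (-c) = 0" for x
    using chord[OF that(1)] that(2) by simp
  have c1: "convex_on Q \<phi>1" "continuous_on Q \<phi>1"
    unfolding \<phi>1_def
    by (rule convex_on_one_side[OF \<phi>conv \<phi>0 chord], assumption+)
      (rule continuous_on_one_side[OF \<phi>cont chord], assumption+)
  have c2: "convex_on Q \<phi>2" "continuous_on Q \<phi>2"
    unfolding \<phi>2_def
    by (rule convex_on_one_side[OF \<phi>conv \<phi>0 chord'], assumption+)
      (rule continuous_on_one_side[OF \<phi>cont chord'], assumption+)
  have "L Q \<phi> = L Q (\<lambda>x. \<phi>1 x + \<phi>2 x)"
    by (rule L_cong) (use QP chord in \<open>auto simp: \<phi>1_def \<phi>2_def\<close>)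
  also have "\<dots> = L Q \<phi>1 + L Q \<phi>2" by (intro L_add tc c1 c2)
  finally have L1: "L Q \<phi>1 = 0"
    using L\<phi> good_convex_on[OF Q(1,2) c1] good_convex_on[OF Q(1,2) c2] by linarith
  \<comment> \<open>On the positive side of the chord this is \<open>\<phi>\<close> minus a small
    multiple of the crease function, truncated at 0. The difference
    \<open>\<phi>1 - \<psi> n\<close> is the minimum of \<open>\<phi>\<close> and that multiple, so
    rescaling recovers the crease function in the limit; as \<open>L Q \<phi>1 = 0\<close>, every
    such difference has \<open>L Q\<close> at most 0.\<close>
  define \<psi> where "\<psi> n x = (if d \<bullet> x + c \<le> 0 then 0 else max (\<phi> x + (((- 1 / real (Suc n)) *\<^sub>R d) \<bullet> x + (- 1 / real (Suc n)) * c)) 0)" for n x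
  have c3: "convex_on Q (\<psi> n)" "continuous_on Q (\<psi> n)" for n
  proof -
    let ?h = "\<lambda>x. max (\<phi> x + (((- 1 / real (Suc n)) *\<^sub>R d) \<bullet> x + (- 1 / real (Suc n)) * c)) 0"
    have "convex_on Q (\<lambda>x. 0)" using Q(3) by (simp add: convex_on_def)
    then have h1: "convex_on Q ?h"
      by (intro convex_on_max convex_on_add \<phi>conv convex_on_subset[OF convex_on_affine_fun] subset_UNIV Q)
    have h2: "continuous_on Q ?h" by (intro continuous_intros \<phi>cont)
    have h0: "0 \<le> ?h x" for x by simp
    have hz: "?h x = 0" if "x \<in> Q" "d \<bullet> x + c = 0" for x
    proof -
      have "((- 1 / real (Suc n)) *\<^sub>R d) \<bullet> x + (- 1 / real (Suc n)) * c = (- 1 / real (Suc n)) * (d \<bullet> x + c)"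
        by (simp only: inner_scaleR_left distrib_left)
      then show ?thesis using chord[OF that] that(2) by simp
    qed
    show "convex_on Q (\<psi> n)" unfolding \<psi>_def by (rule convex_on_one_side[OF h1 h0 hz], assumption+)
    show "continuous_on Q (\<psi> n)" unfolding \<psi>_def by (rule continuous_on_one_side[OF h2 hz], assumption+)
  qed
  define m where "m n x = real (Suc n) * (\<phi>1 x - \<psi> n x)" for n x
  have mc: "continuous_on Q (m n)" for n unfolding m_def by (intro continuous_intros c1 c3)
  have Lm: "L Q (m n) \<le> 0" for n
  proof -
    have "L Q (m n) = real (Suc n) * (L Q \<phi>1 - L Q (\<psi> n))"
      unfolding m_def by (subst L_cmult, subst L_diff) (auto intro!: tc c1 c3)
    then show ?thesis using L1 good_convex_on[OF Q(1,2) c3] by (simp add: mult_nonneg_nonpos)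
  qed
  have meq: "m n x = (if d \<bullet> x + c \<le> 0 then 0 else min (real (Suc n) * \<phi> x) (d \<bullet> x + c))"
    if "x \<in> Q" for n x
  proof (cases "d \<bullet> x + c \<le> 0")
    case False
    have e: "((- 1 / real (Suc n)) *\<^sub>R d) \<bullet> x + (- 1 / real (Suc n)) * c = - ((d \<bullet> x + c) / real (Suc n))"
      by (simp only: inner_scaleR_left distrib_left[symmetric]) simp
    have "\<phi>1 x - \<psi> n x = min (\<phi> x) ((d \<bullet> x + c) / real (Suc n))"
      using False \<phi>0[OF that] unfolding \<phi>1_def \<psi>_def e by (auto simp: min_def max_def)
    then have "m n x = min (real (Suc n) * \<phi> x) (real (Suc n) * ((d \<bullet> x + c) / real (Suc n)))"
      unfolding m_def by (simp only: min_mult_distrib_left) simp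
    then show ?thesis using False by simp
  qed (simp add: m_def \<phi>1_def \<psi>_def)
  let ?l = "\<lambda>x. max (d \<bullet> x + c) 0"
  obtain B where B: "\<And>x. x \<in> Q \<Longrightarrow> \<bar>d \<bullet> x + c\<bar> \<le> B"
    using compact_imp_bounded[OF compact_continuous_image[OF continuous_on_affine Q(2)]]
    unfolding bounded_iff by (metis imageI real_norm_def)
  have lim: "(\<lambda>n. m n x) \<longlonglongrightarrow> ?l x" if x: "x \<in> Q" for x
  proof (cases "d \<bullet> x + c \<le> 0")
    case False
    obtain N where N: "(d \<bullet> x + c) / \<phi> x < real N" using reals_Archimedean2 by blast
    have "m n x = ?l x" if "n \<ge> N" for n
    proof -
      have "(d \<bullet> x + c) / \<phi> x \<le> real (Suc n)" using N that by simp
      then have "d \<bullet> x + c \<le> real (Suc n) * \<phi> x" using pos[OF x] False by (simp add: field_simps)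
      then show ?thesis using False meq[OF x] by simp
    qed
    then show ?thesis by (intro tendsto_eventually) (auto simp: eventually_sequentially)
  qed (simp add: meq[OF x])
  have "(\<lambda>n. L Q (m n)) \<longlonglongrightarrow> L Q ?l"
  proof (rule L_tendsto)
    show "tame Q (m n)" for n by (intro tc mc)
    show "tame Q ?l" by (intro tc continuous_intros)
    show "\<bar>m n x\<bar> \<le> B" if "x \<in> Q" for n x
      using B[OF that] \<phi>0[OF that] meq[OF that, of n] by (auto simp: min_def)
  qed (use lim in auto)
  then have "L Q ?l \<le> 0" using Lm by (intro LIMSEQ_le_const2) auto
  moreover have "0 \<le> L Q ?l" using Q(1) convex_crease unfolding good_def by blast
  ultimately have "L Q ?l = 0" by simp
  moreover have "d \<bullet> z + c = 0" by (simp add: c_def)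
  ultimately show ?thesis using d(1) z(1) by blast
qed

section \<open>Cells cut out by zero creases\<close>

definition zero_fun :: "real^2 \<Rightarrow> real \<Rightarrow> bool" where
  "zero_fun b c \<longleftrightarrow> crease_fun b c \<and> L P (\<lambda>x. max (b \<bullet> x + c) 0) = 0"

definition cell :: "((real^2) \<times> real) set \<Rightarrow> (real^2) set" where
  "cell K = P \<inter> {x. \<forall>(b, c)\<in>K. 0 < b \<bullet> x + c}"

lemma cell_insert: "cell (insert (b, c) K) = cell K \<inter> {x. b \<bullet> x + c > 0}"
proof -
  have "{x. \<forall>(b', c')\<in>insert (b, c) K. 0 < b' \<bullet> x + c'} =
      {x. 0 < b \<bullet> x + c} \<inter> {x. \<forall>(b', c')\<in>K. 0 < b' \<bullet> x + c'}"
    unfolding ball_simps(7) prod.case by (rule Collect_conj_eq)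
  then show ?thesis unfolding cell_def by (metis Int_assoc Int_commute)
qed

lemma convex_cell: "convex (cell K)"
proof -
  have "{x. \<forall>(b, c)\<in>K. 0 < b \<bullet> x + c} = (\<Inter>(b, c)\<in>K. {x. - c < b \<bullet> x})"
    by (auto simp: algebra_simps)
  moreover have "convex (\<Inter>(b, c)\<in>K. {x. - c < b \<bullet> (x::real^2)})"
    by (intro convex_INT) (auto simp: convex_halfspace_gt)
  ultimately show ?thesis unfolding cell_def by (simp only: convex_Int convex_P)
qed

lemma good_crease: "good A \<Longrightarrow> 0 \<le> L A (\<lambda>x. max (b \<bullet> x + c) 0)"
  unfolding good_def using convex_crease[of b c] by simp

lemma L_split_crease:
  assumes A: "good A" and cr: "crease_fun b c" and zero: "L A (\<lambda>x. max (b \<bullet> x + c) 0) = 0"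
  shows "L A (\<lambda>x. max (b' \<bullet> x + c') 0) =
    L (A \<inter> {x. b \<bullet> x + c > 0}) (\<lambda>x. max (b' \<bullet> x + c') 0) +
    L (A \<inter> {x. (-b) \<bullet> x + (-c) > 0}) (\<lambda>x. max (b' \<bullet> x + c') 0)"
    "good (A \<inter> {x. b \<bullet> x + c > 0})" "good (A \<inter> {x. (-b) \<bullet> x + (-c) > 0})"
proof -
  show "good (A \<inter> {x. b \<bullet> x + c > 0})" by (rule good_cut[OF A cr zero])
  show "good (A \<inter> {x. (-b) \<bullet> x + (-c) > 0})"
    by (rule good_cut[OF A _ crease_reverse[OF A zero]]) (simp only: crease_fun_uminus cr)
  show "L A (\<lambda>x. max (b' \<bullet> x + c') 0) =
    L (A \<inter> {x. b \<bullet> x + c > 0}) (\<lambda>x. max (b' \<bullet> x + c') 0) +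
    L (A \<inter> {x. (-b) \<bullet> x + (-c) > 0}) (\<lambda>x. max (b' \<bullet> x + c') 0)"
    by (rule L_split[OF A cr]) (intro continuous_intros)
qed

text \<open>Goodness and the zero creases must be carried through the induction together. When a
  cell is cut, \<open>L\<close> of another crease function splits into two nonnegative parts with
  sum 0, so both vanish.\<close>

lemma cell_good:
  assumes P: "good P" and K: "finite K" "\<And>b c. (b, c) \<in> K \<Longrightarrow> zero_fun b c"
  shows "good (cell K) \<and> (\<forall>b c. zero_fun b c \<longrightarrow> L (cell K) (\<lambda>x. max (b \<bullet> x + c) 0) = 0)"
  using K
proof induction
  case empty
  then show ?case using P by (simp add: cell_def zero_fun_def)
next
  case (insert k K)
  obtain b c where k: "k = (b, c)" by fastforce
  have IH: "good (cell K)" "\<And>b c. zero_fun b c \<Longrightarrow> L (cell K) (\<lambda>x. max (b \<bullet> x + c) 0) = 0"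
    using insert by auto
  have z: "zero_fun b c" using insert.prems k by blast
  then have cr: "crease_fun b c" by (simp add: zero_fun_def)
  note sp = L_split_crease[OF IH(1) cr IH(2)[OF z]]
  have "L (cell K \<inter> {x. b \<bullet> x + c > 0}) (\<lambda>x. max (b' \<bullet> x + c') 0) = 0" if "zero_fun b' c'" for b' c'
  proof -
    have "0 \<le> L (cell K \<inter> {x. b \<bullet> x + c > 0}) (\<lambda>x. max (b' \<bullet> x + c') 0)"
      "0 \<le> L (cell K \<inter> {x. (-b) \<bullet> x + (-c) > 0}) (\<lambda>x. max (b' \<bullet> x + c') 0)"
      by (rule good_crease[OF sp(2)], rule good_crease[OF sp(3)])
    then show ?thesis using sp(1)[of b' c'] IH(2)[OF that] by linarith
  qed
  then show ?case using sp(2) by (simp add: k cell_insert)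
qed

text \<open>Undoing one cut adds a convex region on which the affine function has no zero. It has
  constant sign there, so the crease function is affine on the region, and \<open>L\<close> vanishes
  because the region is good.\<close>

lemma cell_crease_extends:
  assumes P: "good P" and K: "finite K" "\<And>b c. (b, c) \<in> K \<Longrightarrow> zero_fun b c"
    and cr: "crease_fun b c" and sub: "\<And>x. x \<in> P \<Longrightarrow> b \<bullet> x + c = 0 \<Longrightarrow> x \<in> cell K"
    and zero: "L (cell K) (\<lambda>x. max (b \<bullet> x + c) 0) = 0"
  shows "zero_fun b c"
  using K sub zero
proof induction
  case empty
  then show ?case using cr by (simp add: cell_def zero_fun_def)
next
  case (insert k K)
  obtain b' c' where k: "k = (b', c')" by fastforce
  have z: "zero_fun b' c'" using insert.prems k by blast
  have gK: "good (cell K)" "L (cell K) (\<lambda>x. max (b' \<bullet> x + c') 0) = 0"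
    using cell_good[OF P insert.hyps(1)] insert.prems(1) z by blast+
  have cr': "crease_fun b' c'" using z by (simp add: zero_fun_def)
  note sp = L_split_crease[OF gK(1) cr' gK(2)]
  let ?B = "cell K \<inter> {x. (-b') \<bullet> x + (-c') > 0}"
  have nz: "b \<bullet> x + c \<noteq> 0" if "x \<in> ?B" for x
    using insert.prems(2)[of x] that by (auto simp: k cell_def)
  have cvB: "convex ?B"
  proof -
    have "?B = cell K \<inter> {x. c' < (-b') \<bullet> x}" by auto
    then show ?thesis using convex_cell convex_halfspace_gt by (metis convex_Int)
  qed
  have sB: "?B \<in> sets borel" using sp(3) by (simp add: good_def)
  have "L ?B (\<lambda>x. max (b \<bullet> x + c) 0) = 0"
  proof (cases "\<forall>x\<in>?B. b \<bullet> x + c < 0")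
    case True
    then have "L ?B (\<lambda>x. max (b \<bullet> x + c) 0) = L ?B (\<lambda>x. 0 \<bullet> x + 0)"
      by (intro L_cong sB) auto
    then show ?thesis using good_affine[OF sp(3)] by metis
  next
    case False
    then obtain x0 where x0: "x0 \<in> ?B" "0 < b \<bullet> x0 + c" using nz by fastforce
    have pos: "0 < b \<bullet> x + c" if x: "x \<in> ?B" for x
    proof (rule ccontr)
      assume "\<not> ?thesis"
      then have neg: "b \<bullet> x + c < 0" using nz[OF x] by linarith
      define t where "t = (b \<bullet> x0 + c) / ((b \<bullet> x0 + c) - (b \<bullet> x + c))"
      have t: "0 \<le> t" "t \<le> 1" using neg x0(2) by (auto simp: t_def field_simps)
      have "b \<bullet> ((1 - t) *\<^sub>R x0 + t *\<^sub>R x) + c = (b \<bullet> x0 + c) - t * ((b \<bullet> x0 + c) - (b \<bullet> x + c))"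
        by (simp add: inner_simps algebra_simps)
      also have "\<dots> = 0" using neg x0(2) by (simp add: t_def)
      finally have "b \<bullet> ((1 - t) *\<^sub>R x0 + t *\<^sub>R x) + c = 0" .
      moreover have "(1 - t) *\<^sub>R x0 + t *\<^sub>R x \<in> ?B" using convexD[OF cvB x0(1) x, of "1 - t" t] t by simp
      ultimately show False using nz by blast
    qed
    have "L ?B (\<lambda>x. max (b \<bullet> x + c) 0) = L ?B (\<lambda>x. b \<bullet> x + c)"
      by (rule L_cong[OF sB], drule pos) simp
    then show ?thesis using good_affine[OF sp(3)] by metis
  qed
  then have "L (cell K) (\<lambda>x. max (b \<bullet> x + c) 0) = 0"
    using sp(1)[of b c] insert.prems(3) by (simp add: k cell_insert)
  moreover have "x \<in> cell K" if "x \<in> P" "b \<bullet> x + c = 0" for x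
    using insert.prems(2)[OF that] by (auto simp: cell_def)
  ultimately show ?case using insert.IH insert.prems(1) by blast
qed

text \<open>Between two touching creases there would be a corner carrying no boundary mass, and cutting
  it off makes \<open>L\<close> negative.\<close>

lemma no_touch_aux:
  assumes P: "good P" and K: "finite K" "\<And>b c. (b, c) \<in> K \<Longrightarrow> zero_fun b c"
    and x0: "x0 \<in> interior P" "x0 \<in> cell K" "b \<bullet> x0 + c = 0" and b: "b \<noteq> 0"
    and zero: "L (cell K) (\<lambda>x. max (b \<bullet> x + c) 0) = 0"
    and z: "z \<in> P" "b \<bullet> z + c = 0" "\<And>b c. (b, c) \<in> K \<Longrightarrow> 0 \<le> b \<bullet> z + c"
    and k: "(b', c') \<in> K" "b' \<bullet> z + c' = 0"
    and y0: "y0 \<in> interior P" "b' \<bullet> y0 + c' = 0" "0 < b \<bullet> y0 + c"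
  shows False
proof -
  have gK: "good (cell K)" using cell_good[OF P K] by blast
  have cr: "crease_fun b c" using b x0 unfolding crease_fun_def by blast
  let ?B = "cell K \<inter> {x. 0 < b \<bullet> x + c}"
  have gB: "good ?B" by (rule good_cut[OF gK cr zero])
  have kx0: "0 < b' \<bullet> x0 + c'" using x0(2) k(1) by (auto simp: cell_def)
  define k1 l1 where "k1 = b' \<bullet> x0 + c'" and "l1 = b \<bullet> y0 + c"
  have kl: "0 < k1" "0 < l1" using kx0 y0 by (auto simp: k1_def l1_def)
  \<comment> \<open>The affine function with value 1 at \<open>z\<close> and 0 at \<open>x0\<close>
    and \<open>y0\<close>; its positive part lives on the corner at \<open>z\<close>.\<close>
  define bb where "bb = - ((1/k1) *\<^sub>R b' + (1/l1) *\<^sub>R b)"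
  define cc where "cc = 1 - c' / k1 - c / l1"
  have bbcc: "bb \<bullet> x + cc = 1 - (b' \<bullet> x + c') / k1 - (b \<bullet> x + c) / l1" for x
  proof -
    have "bb \<bullet> x = - ((b' \<bullet> x) / k1 + (b \<bullet> x) / l1)"
      by (simp add: bb_def inner_add_left inner_diff_left)
    then show ?thesis by (simp only: cc_def add_divide_distrib)
  qed
  let ?g = "\<lambda>x. max (bb \<bullet> x + cc) 0"
  have "0 \<le> L ?B ?g" by (rule good_crease[OF gB])
  moreover have "L ?B ?g < 0"
  proof (rule L_interior_bump)
    show "?B \<in> sets borel" "?B \<subseteq> P" using gB by (auto simp: good_def)
    show "tame ?B ?g" by (intro good_tame' gB continuous_intros)
    show "?g x = 0" if x: "x \<in> ?B" "x \<in> frontier P" for x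
    proof (rule ccontr)
      assume "?g x \<noteq> 0"
      then have s1: "(b' \<bullet> x + c') / k1 + (b \<bullet> x + c) / l1 < 1" unfolding bbcc by (auto simp: max_def split: if_splits)
      \<comment> \<open>These are the coordinates of \<open>x\<close> in the triangle
        \<open>z\<close>, \<open>y0\<close>, \<open>x0\<close>. As \<open>x0\<close> and
        \<open>y0\<close> are interior, every point of the triangle with both coordinates positive
        is interior to \<open>P\<close>, so the bump misses the frontier.\<close>
      define \<alpha> \<beta> where "\<alpha> = (b \<bullet> x + c) / l1" and "\<beta> = (b' \<bullet> x + c') / k1"
      have ab: "0 < \<alpha>" "0 < \<beta>" "\<alpha> + \<beta> < 1"
        using x(1) k(1) kl s1 by (auto simp: \<alpha>_def \<beta>_def cell_def)
      have bv: "b \<bullet> z = - c" "b \<bullet> x0 = - c" "b' \<bullet> z = - c'" "b' \<bullet> y0 = - c'"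
        using z(2) x0(3) k(2) y0(2) by auto
      define r where "r = x - (z + \<alpha> *\<^sub>R (y0 - z) + \<beta> *\<^sub>R (x0 - z))"
      have "b \<bullet> r = (b \<bullet> x + c) - \<alpha> * l1"
        by (simp add: r_def l1_def inner_simps bv algebra_simps)
      then have br: "b \<bullet> r = 0" using kl by (simp add: \<alpha>_def)
      have "b' \<bullet> r = (b' \<bullet> x + c') - \<beta> * k1"
        by (simp add: r_def k1_def inner_simps bv algebra_simps)
      then have b'r: "b' \<bullet> r = 0" using kl by (simp add: \<beta>_def)
      have "r = 0"
      proof (rule ccontr)
        assume r: "r \<noteq> 0"
        have "b' \<bullet> (y0 - z) = 0" using k(2) y0(2) by (simp add: inner_simps)
        moreover have "b' \<noteq> 0" using K(2)[OF k(1)] by (simp add: zero_fun_def crease_fun_def)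
        ultimately obtain t where "y0 - z = t *\<^sub>R r" using orthogonal_imp_parallel b'r r by blast
        then have "b \<bullet> (y0 - z) = 0" using br by simp
        then show False using y0(3) z(2) by (simp add: inner_simps)
      qed
      then have xe: "x = z + \<alpha> *\<^sub>R (y0 - z) + \<beta> *\<^sub>R (x0 - z)" by (simp add: r_def)
      define w where "w = (\<alpha> / (\<alpha> + \<beta>)) *\<^sub>R y0 + (\<beta> / (\<alpha> + \<beta>)) *\<^sub>R x0"
      have "w \<in> interior P" unfolding w_def
        by (rule convexD[OF convex_interior[OF convex_P] y0(1) x0(1)])
          (use ab in \<open>auto simp: add_divide_distrib[symmetric]\<close>)
      then have "w + (1 - (\<alpha> + \<beta>)) *\<^sub>R (z - w) \<in> interior P"
        using open_segment_interior[OF convex_P _ z(1)] ab by simp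
      also have "w + (1 - (\<alpha> + \<beta>)) *\<^sub>R (z - w) = (\<alpha> + \<beta>) *\<^sub>R w + (1 - (\<alpha> + \<beta>)) *\<^sub>R z"
        by (simp add: algebra_simps)
      also have "(\<alpha> + \<beta>) *\<^sub>R w = \<alpha> *\<^sub>R y0 + \<beta> *\<^sub>R x0"
        using ab by (simp add: w_def scaleR_right_distrib)
      also have "\<alpha> *\<^sub>R y0 + \<beta> *\<^sub>R x0 + (1 - (\<alpha> + \<beta>)) *\<^sub>R z = x" by (simp add: xe algebra_simps)
      finally show False using x(2) by (simp add: frontier_def)
    qed
    define V where "V = interior P \<inter> (\<Inter>(b, c)\<in>K. {x. - c < b \<bullet> x}) \<inter> {x. - cc < bb \<bullet> x}"
    have oV: "open V" unfolding V_def
      using K(1) by (intro open_Int open_interior open_INT open_halfspace_gt) (auto simp: open_halfspace_gt)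
    let ?U = "V \<inter> {x. - c < b \<bullet> x}"
    show "open ?U" by (intro open_Int oV open_halfspace_gt)
    have VB: "0 < b \<bullet> x + c" if "(b, c) \<in> K" "x \<in> V" for b c x
    proof -
      have "- c < b \<bullet> x" using that unfolding V_def by blast
      then show ?thesis by simp
    qed
    show "?U \<subseteq> ?B"
      using VB subsetD[OF interior_subset, of _ P] by (auto simp: cell_def V_def)
    show "0 < ?g x" if "x \<in> ?U" for x using that by (auto simp: V_def)
    \<comment> \<open>The midpoint of \<open>z\<close> and \<open>x0\<close> satisfies all strict
      inequalities except that it lies on the crease itself; a small shift along \<open>b\<close>
      repairs this.\<close>
    define w where "w = (1/2) *\<^sub>R z + (1/2) *\<^sub>R x0"
    have w: "bb' \<bullet> w + c'' = ((bb' \<bullet> z + c'') + (bb' \<bullet> x0 + c'')) / 2" for bb' c''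
      by (simp add: w_def inner_simps field_simps)
    have "w = x0 + (1/2) *\<^sub>R (z - x0)" by (simp add: w_def vec_eq_2 field_simps)
    then have "w \<in> interior P" using open_segment_interior[OF convex_P x0(1) z(1)] by simp
    moreover have "- c'' < b'' \<bullet> w" if "(b'', c'') \<in> K" for b'' c''
    proof -
      have "0 < b'' \<bullet> x0 + c''" "0 \<le> b'' \<bullet> z + c''" using that x0(2) z(3) by (auto simp: cell_def)
      then have "0 < b'' \<bullet> w + c''" unfolding w by simp
      then show ?thesis by simp
    qed
    moreover have "- cc < bb \<bullet> w"
    proof -
      have "bb \<bullet> w + cc = 1 / 2"
      proof -
        have "bb \<bullet> z + cc = 1" "bb \<bullet> x0 + cc = 0"
          unfolding bbcc using z(2) x0(3) k(2) kl by (simp_all add: k1_def)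
        then show ?thesis using w[of bb cc] by simp
      qed
      then show ?thesis by simp
    qed
    ultimately have "w \<in> V" by (auto simp: V_def)
    then obtain e where e: "0 < e" "ball w e \<subseteq> V" using oV open_contains_ball by blast
    define u where "u = w + (e / (2 * norm b)) *\<^sub>R b"
    have "dist w u = e / 2" using b e by (simp add: u_def dist_norm)
    then have "u \<in> V" using e by auto
    moreover have "0 < b \<bullet> u + c"
    proof -
      have "b \<bullet> u + c = (b \<bullet> w + c) + (e / (2 * norm b)) * (b \<bullet> b)"
        by (simp add: u_def inner_simps)
      moreover have "b \<bullet> w + c = 0" unfolding w using z(2) x0(3) by simp
      moreover have "0 < (e / (2 * norm b)) * (b \<bullet> b)" using e b by simp
      ultimately show ?thesis by simp
    qed
    ultimately show "?U \<noteq> {}" by auto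
  qed auto
  ultimately show False by simp
qed

text \<open>It remains to find \<open>y0\<close> on the line of the cut and strictly on one side of
  the crease. If it is on the negative side, the crease is reversed.\<close>

lemma no_touch:
  assumes P: "good P" and K: "finite K" "\<And>b c. (b, c) \<in> K \<Longrightarrow> zero_fun b c"
    and x0: "x0 \<in> interior P" "x0 \<in> cell K" "b \<bullet> x0 + c = 0" and b: "b \<noteq> 0"
    and zero: "L (cell K) (\<lambda>x. max (b \<bullet> x + c) 0) = 0"
    and z: "z \<in> P" "b \<bullet> z + c = 0" "\<And>b c. (b, c) \<in> K \<Longrightarrow> 0 \<le> b \<bullet> z + c"
    and k: "(b', c') \<in> K"
  shows "b' \<bullet> z + c' \<noteq> 0"
proof
  assume kz: "b' \<bullet> z + c' = 0"
  have gK: "good (cell K)" using cell_good[OF P K] by blast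
  have k0: "b' \<noteq> 0" "\<exists>y\<in>interior P. b' \<bullet> y + c' = 0"
    using K(2)[OF k] by (auto simp: zero_fun_def crease_fun_def)
  have kx0: "0 < b' \<bullet> x0 + c'" using x0(2) k by (auto simp: cell_def)
  \<comment> \<open>When \<open>z\<close> is on the frontier, any interior point of the line of the
    cut differs from it; when \<open>z\<close> is interior, a nearby point of that line is
    taken.\<close>
  obtain y0 where y0: "y0 \<in> interior P" "b' \<bullet> y0 + c' = 0" "y0 \<noteq> z"
  proof (cases "z \<in> interior P")
    case True
    then obtain e where e: "0 < e" "ball z e \<subseteq> interior P" using open_contains_ball open_interior by blast
    define v where "v = (vector [- (b' $ 2), b' $ 1] :: real^2)"
    have v: "b' \<bullet> v = 0" "v \<noteq> 0"
      using k0(1) by (auto simp: v_def inner_2 vec_eq_2)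
    define u where "u = z + (e / (2 * norm v)) *\<^sub>R v"
    have "dist z u = e / 2" using v e by (simp add: u_def dist_norm)
    then have "u \<in> interior P" using e by auto
    moreover have "b' \<bullet> u + c' = 0" using v kz by (simp add: u_def inner_simps)
    moreover have "u \<noteq> z" using v e by (simp add: u_def)
    ultimately show thesis using that by blast
  next
    case False
    then show thesis using k0(2) that by blast
  qed
  have ly: "b \<bullet> y0 + c \<noteq> 0"
  proof
    assume "b \<bullet> y0 + c = 0"
    then have "b \<bullet> (x0 - z) = 0" "b \<bullet> (y0 - z) = 0" using x0(3) z(2) by (auto simp: inner_simps)
    then obtain t where "x0 - z = t *\<^sub>R (y0 - z)" using orthogonal_imp_parallel[OF b] y0(3) by fastforce
    then have "b' \<bullet> (x0 - z) = t * (b' \<bullet> (y0 - z))" by simp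
    moreover have "b' \<bullet> (y0 - z) = 0" using kz y0(2) by (simp add: inner_diff_right)
    ultimately have "b' \<bullet> x0 = b' \<bullet> z" by (simp add: inner_diff_right)
    then show False using kz kx0 by simp
  qed
  show False
  proof (cases "0 < b \<bullet> y0 + c")
    case True
    show ?thesis by (rule no_touch_aux[OF P K x0 b zero z k kz y0(1,2) True])
  next
    case False
    have e: "(-b) \<bullet> x + (-c) = 0 \<longleftrightarrow> b \<bullet> x + c = 0" for x by auto
    show ?thesis
      by (rule no_touch_aux[OF P K x0(1,2) _ _ crease_reverse[OF gK zero] z(1) _ z(3) k kz y0(1,2)])
        (use x0(3) z(2) b ly False e in auto)
  qed
qed

end

section \<open>Integrals of affine functions over triangles\<close>

text \<open>A measure that agrees with volume on boxes is Lebesgue measure, so the claim reduces to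
  the volume of a linear image of a box.\<close>

lemma lborel_affine_map:
  fixes A :: "real^'n::{finite,wellorder}^'n::_"
  assumes A: "invertible A"
  shows "lborel = density (distr lborel borel (\<lambda>x. A *v x + b)) (\<lambda>_. ennreal \<bar>det A\<bar>)"
proof (rule lborel_eqI)
  let ?\<phi> = "\<lambda>x. A *v x + b"
  have m: "?\<phi> \<in> borel_measurable borel"
    by (intro borel_measurable_continuous_onI continuous_intros)
  show "sets (density (distr lborel borel ?\<phi>) (\<lambda>_. ennreal \<bar>det A\<bar>)) = sets borel" by simp
  fix l u :: "real^'n::_" assume lu: "\<And>i. i \<in> Basis \<Longrightarrow> l \<bullet> i \<le> u \<bullet> i"
  obtain B where B: "A ** B = mat 1" "B ** A = mat 1" using A by (auto simp: invertible_def)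
  have pre: "?\<phi> -` box l u = (\<lambda>y. B *v y) ` ((+) (-b) ` box l u)"
  proof -
    have "B *v (?\<phi> x - b) = x" for x by (simp add: matrix_vector_mul_assoc B)
    moreover have "?\<phi> (B *v (y - b)) = y" for y by (simp add: matrix_vector_mul_assoc B)
    ultimately have "?\<phi> -` box l u = (\<lambda>y. B *v (y - b)) ` box l u"
      by (auto simp: rev_image_eqI)
    then show ?thesis by (simp add: image_image)
  qed
  have lm: "(+) (-b) ` box l u \<in> lmeasurable"
    using measurable_translation[of "box l u" "-b"] by (simp add: lmeasurable_box)
  have lin: "linear ((*v) B)" by simp
  have meas: "measure lebesgue (?\<phi> -` box l u) = \<bar>det B\<bar> * measure lebesgue (box l u)"
    unfolding pre using measure_linear_image[OF lin lm] measure_translation[of "-b" "box l u"] by simp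
  have lm2: "?\<phi> -` box l u \<in> lmeasurable" unfolding pre by (rule measurable_linear_image[OF lin lm])
  have bor: "?\<phi> -` box l u \<in> sets borel" using measurable_sets[OF m, of "box l u"] by simp
  have "emeasure lborel (?\<phi> -` box l u) = emeasure lebesgue (?\<phi> -` box l u)"
    using bor by simp
  also have "\<dots> = ennreal (\<bar>det B\<bar> * measure lebesgue (box l u))"
    using emeasure_eq_ennreal_measure[OF fmeasurableD2[OF lm2]] meas by simp
  finally have e: "emeasure lborel (?\<phi> -` box l u) = ennreal (\<bar>det B\<bar> * measure lebesgue (box l u))" .
  have "det A * det B = 1" using B(1) by (metis det_mul det_I)
  then have d: "\<bar>det A\<bar> * \<bar>det B\<bar> = 1" by (metis abs_mult abs_one)
  have "emeasure (density (distr lborel borel ?\<phi>) (\<lambda>_. ennreal \<bar>det A\<bar>)) (box l u)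
      = ennreal \<bar>det A\<bar> * emeasure lborel (?\<phi> -` box l u)"
    using m by (simp add: emeasure_density_const emeasure_distr)
  also have "\<dots> = ennreal ((\<bar>det A\<bar> * \<bar>det B\<bar>) * measure lebesgue (box l u))"
    unfolding e by (simp add: ennreal_mult'[symmetric] mult.assoc)
  also have "\<dots> = ennreal (measure lebesgue (box l u))" by (simp add: d)
  also have "measure lebesgue (box l u) = (\<Prod>b\<in>Basis. (u - l) \<bullet> b)"
    using lu by (simp add: inner_diff_left)
  finally show "emeasure (density (distr lborel borel ?\<phi>) (\<lambda>_. ennreal \<bar>det A\<bar>)) (box l u) = (\<Prod>b\<in>Basis. (u - l) \<bullet> b)"
    by simp
qed

lemma integral_affine_map:
  fixes A :: "real^'n::{finite,wellorder}^'n::_" and g :: "real^'n::_ \<Rightarrow> real"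
  assumes A: "invertible A" and g: "g \<in> borel_measurable borel"
  shows "integral\<^sup>L lborel g = \<bar>det A\<bar> * (LINT x|lborel. g (A *v x + b))"
proof -
  have m: "(\<lambda>x. A *v x + b) \<in> borel_measurable borel"
    by (intro borel_measurable_continuous_onI continuous_intros)
  have "integral\<^sup>L lborel g = integral\<^sup>L (density (distr lborel borel (\<lambda>x. A *v x + b)) (\<lambda>_. ennreal \<bar>det A\<bar>)) g"
    using lborel_affine_map[OF A, of b] by simp
  also have "\<dots> = \<bar>det A\<bar> * integral\<^sup>L (distr lborel borel (\<lambda>x. A *v x + b)) g"
    using g by (subst integral_density) auto
  also have "integral\<^sup>L (distr lborel borel (\<lambda>x. A *v x + b)) g = (LINT x|lborel. g (A *v x + b))"
    using m g by (subst integral_distr) auto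
  finally show ?thesis .
qed

lemma det2_basis:
  assumes "det2 v w \<noteq> 0"
  shows "x = (det2 x w / det2 v w) *\<^sub>R v + (det2 v x / det2 v w) *\<^sub>R w"
proof -
  have "det2 v w * x $ 1 = det2 x w * v $ 1 + det2 v x * w $ 1"
       "det2 v w * x $ 2 = det2 x w * v $ 2 + det2 v x * w $ 2"
    by (simp_all add: det2_def algebra_simps)
  then show ?thesis
    using assms by (simp add: vec_eq_2 add_divide_distrib[symmetric] eq_divide_eq mult.commute)
qed

lemma content_triangle_det2:
  "measure lborel (convex hull {p, q, r}) = \<bar>det2 (q - p) (r - p)\<bar> / 2"
proof -
  have "compact (convex hull {p, q, r})" by (intro finite_imp_compact_convex_hull) simp
  then have "measure lebesgue (convex hull {p, q, r}) = measure lborel (convex hull {p, q, r})"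
    by (simp add: measure_completion borel_compact)
  then show ?thesis using content_triangle[of p q r]
    by (simp add: det2_def abs_minus_commute algebra_simps)
qed

text \<open>The cyclic permutation of the vertices extends to a measure preserving affine map, and the
  average of an affine function over its orbits is constant.\<close>

lemma integral_triangle:
  fixes b p q r :: "real^2" and c :: real
  defines "f \<equiv> \<lambda>x. b \<bullet> x + c"
  shows "(LINT x:convex hull {p, q, r}|lborel. f x) = \<bar>det2 (q - p) (r - p)\<bar> / 6 * (f p + f q + f r)"
proof -
  let ?T = "convex hull {p, q, r}" and ?D = "det2 (q - p) (r - p)"
  have cT: "compact ?T" by (intro finite_imp_compact_convex_hull) simp
  then have sT: "?T \<in> sets borel" by (simp add: borel_compact)
  have fm: "f \<in> borel_measurable borel"
    unfolding f_def by (intro borel_measurable_continuous_onI continuous_intros)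
  have intT: "set_integrable lborel ?T g" if "continuous_on UNIV g" for g :: "real^2 \<Rightarrow> real"
    unfolding set_integrable_def
    using borel_integrable_compact[OF cT continuous_on_subset[OF that subset_UNIV]]
    by (simp add: indicator_def if_distrib cong: if_cong)
  show ?thesis
  proof (cases "?D = 0")
    case True
    then have "measure lborel ?T = 0" by (simp add: content_triangle_det2)
    moreover have "emeasure lborel ?T \<noteq> \<infinity>"
      using emeasure_bounded_finite[OF compact_imp_bounded[OF cT]] by simp
    ultimately have "emeasure lborel ?T = 0" by (simp add: measure_eq_0_null_sets emeasure_eq_ennreal_measure)
    then have "?T \<in> null_sets lborel" using sT by auto
    then have "(LINT x:?T|lborel. f x) = 0"
      unfolding set_lebesgue_integral_def
      by (intro integral_eq_zero_AE) (auto dest!: AE_not_in elim!: eventually_mono simp: indicator_def)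
    then show ?thesis using True by simp
  next
    case False
    \<comment> \<open>By Cramer's rule, the linear map taking \<open>q - p\<close> to
      \<open>r - q\<close> and \<open>r - p\<close> to \<open>p - q\<close>; it is the linear part
      of the cyclic permutation of the vertices.\<close>
    define N where "N x = (det2 x (r - p) / ?D) *\<^sub>R (r - q) + (det2 (q - p) x / ?D) *\<^sub>R (p - q)" for x
    have lin: "linear N"
      by (rule linearI) (simp_all add: N_def det2_def add_divide_distrib diff_divide_distrib algebra_simps)
    define M where "M = matrix N"
    have M: "M *v x = N x" for x unfolding M_def by (rule fun_cong[OF matrix_vector_mul(2)[OF lin]])
    define \<rho> where "\<rho> x = M *v x + (q - N p)" for x
    define bary where "bary \<alpha> \<beta> = p + \<alpha> *\<^sub>R (q - p) + \<beta> *\<^sub>R (r - p)" for \<alpha> \<beta>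
    have \<rho>b: "\<rho> (bary \<alpha> \<beta>) = q + \<alpha> *\<^sub>R (r - q) + \<beta> *\<^sub>R (p - q)" for \<alpha> \<beta>
    proof -
      have "N (q - p) = r - q" "N (r - p) = p - q"
        using False by (simp_all add: N_def det2_def)
      moreover have "N (bary \<alpha> \<beta>) = N p + \<alpha> *\<^sub>R N (q - p) + \<beta> *\<^sub>R N (r - p)"
        by (simp only: bary_def linear_add[OF lin] linear_scale[OF lin])
      ultimately show ?thesis by (simp add: \<rho>_def M)
    qed
    have \<rho>0: "\<rho> p = q" "\<rho> q = r" "\<rho> r = p" 
      using \<rho>b[of 0 0] \<rho>b[of 1 0] \<rho>b[of 0 1] by (simp_all add: bary_def)
    have ex: "\<exists>\<alpha> \<beta>. x = bary \<alpha> \<beta>" for x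
    proof -
      have "bary (det2 (x - p) (r - p) / ?D) (det2 (q - p) (x - p) / ?D) = p + (x - p)"
        unfolding bary_def add.assoc det2_basis[OF False, of "x - p", symmetric] ..
      then have "x = bary (det2 (x - p) (r - p) / ?D) (det2 (q - p) (x - p) / ?D)" by simp
      then show ?thesis by blast
    qed
    have "\<rho> (\<rho> (\<rho> x)) = x" and fsum: "f x + f (\<rho> x) + f (\<rho> (\<rho> x)) = f p + f q + f r" for x
    proof -
      obtain \<alpha> \<beta> where x: "x = bary \<alpha> \<beta>" using ex by blast
      have 1: "\<rho> x = bary (1 - \<alpha> - \<beta>) \<alpha>" by (simp add: x \<rho>b) (simp add: bary_def algebra_simps)
      have 2: "\<rho> (\<rho> x) = bary \<beta> (1 - \<alpha> - \<beta>)" unfolding 1 \<rho>b by (simp add: bary_def algebra_simps)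
      have "\<rho> (bary \<beta> (1 - \<alpha> - \<beta>)) = bary \<alpha> \<beta>" unfolding \<rho>b by (simp add: bary_def algebra_simps)
      then show "\<rho> (\<rho> (\<rho> x)) = x" by (simp add: 2) (simp add: x)
      show "f x + f (\<rho> x) + f (\<rho> (\<rho> x)) = f p + f q + f r"
      proof -
        have "f x + f (\<rho> x) + f (\<rho> (\<rho> x)) = f (bary \<alpha> \<beta>) + f (bary (1 - \<alpha> - \<beta>) \<alpha>) + f (bary \<beta> (1 - \<alpha> - \<beta>))"
          by (simp only: 2, simp only: 1, simp only: x)
        then show ?thesis by (simp add: f_def bary_def inner_simps algebra_simps)
      qed
    qed
    then have bij: "bij \<rho>" by (intro o_bij[where g="\<lambda>x. \<rho> (\<rho> x)"]) (auto simp: fun_eq_iff)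
    have inv: "invertible M"
    proof -
      have "inj N"
      proof (rule injI)
        fix x y assume "N x = N y"
        then have "\<rho> x = \<rho> y" by (simp add: \<rho>_def M)
        then show "x = y" using bij by (simp add: bij_def inj_eq)
      qed
      moreover have "(*v) M = N" using M by (rule ext)
      ultimately show ?thesis
        unfolding invertible_eq_bij using linear_injective_imp_surjective[OF lin] by (simp add: bij_def)
    qed
    have \<rho>T: "\<rho> x \<in> ?T \<longleftrightarrow> x \<in> ?T" for x
    proof -
      have im: "\<rho> ` S = (+) (q - N p) ` (N ` S)" for S
        unfolding image_image by (simp add: \<rho>_def M add.commute)
      have "\<rho> ` ?T = convex hull (\<rho> ` {p, q, r})"
        by (simp only: im convex_hull_translation convex_hull_linear_image[OF lin])
      also have "\<rho> ` {p, q, r} = {p, q, r}" by (auto simp: \<rho>0)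
      finally show ?thesis using bij by (metis bij_is_inj inj_image_mem_iff)
    qed
    have \<rho>m: "\<rho> \<in> borel_measurable borel" and \<rho>c: "continuous_on UNIV \<rho>"
      unfolding \<rho>_def by (intro borel_measurable_continuous_onI continuous_intros)+
    have cv: "(LINT x:?T|lborel. g x) = \<bar>det M\<bar> * (LINT x:?T|lborel. g (\<rho> x))" if g: "g \<in> borel_measurable borel" for g :: "real^2 \<Rightarrow> real"
    proof -
      have "(LINT x:?T|lborel. g x) = \<bar>det M\<bar> * (LINT x|lborel. indicator ?T (\<rho> x) *\<^sub>R g (\<rho> x))"
        unfolding set_lebesgue_integral_def \<rho>_def
        by (rule integral_affine_map[OF inv]) (use g sT in simp)
      moreover have "indicator ?T (\<rho> x) = (indicator ?T x :: real)" for x by (simp add: indicator_def \<rho>T)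
      ultimately show ?thesis by (simp only: set_lebesgue_integral_def)
    qed
    \<comment> \<open>A map that preserves a triangle of positive area has determinant 1 in absolute
      value.\<close>
    have "measure lborel ?T = (LINT x:?T|lborel. 1)" using sT by (simp add: set_lebesgue_integral_def)
    then have "measure lborel ?T = \<bar>det M\<bar> * measure lborel ?T"
      using cv[of "\<lambda>_. 1"] by simp
    moreover have "measure lborel ?T \<noteq> 0" using False by (simp add: content_triangle_det2)
    ultimately have det1: "\<bar>det M\<bar> = 1" by simp
    let ?I = "LINT x:?T|lborel. f x"
    have f\<rho>: "f \<circ> \<rho> \<in> borel_measurable borel" using \<rho>m fm by (rule measurable_comp)
    have I1: "(LINT x:?T|lborel. f (\<rho> x)) = ?I" using cv[OF fm] det1 by simp
    have I2: "(LINT x:?T|lborel. f (\<rho> (\<rho> x))) = ?I" using cv[OF f\<rho>] det1 I1 by simp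
    have fc: "continuous_on UNIV f" unfolding f_def by (intro continuous_intros)
    have c1: "continuous_on UNIV (\<lambda>x. f (\<rho> x))" by (rule continuous_on_compose2[OF fc \<rho>c]) simp
    have c2: "continuous_on UNIV (\<lambda>x. f (\<rho> (\<rho> x)))" by (rule continuous_on_compose2[OF c1 \<rho>c]) simp
    have "3 * ?I = (LINT x:?T|lborel. f x + f (\<rho> x) + f (\<rho> (\<rho> x)))"
      using set_integral_add(2)[OF set_integral_add(1)[OF intT[OF fc] intT[OF c1]] intT[OF c2]]
        set_integral_add(2)[OF intT[OF fc] intT[OF c1]] I1 I2 by simp
    also have "\<dots> = (f p + f q + f r) * measure lborel ?T"
      unfolding fsum using sT by (simp add: set_lebesgue_integral_def)
    finally have "3 * ?I = (f p + f q + f r) * (\<bar>?D\<bar> / 2)" by (simp only: content_triangle_det2)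
    then show ?thesis by (simp add: field_simps)
  qed
qed

section \<open>The boundary measure of a lattice polygon\<close>

definition nvec :: "int^2 \<Rightarrow> real^2" where
  "nvec u = vector [of_int (u $ 1), of_int (u $ 2)]"

definition dvec :: "int^2 \<Rightarrow> real^2" where
  "dvec u = vector [- of_int (u $ 2), of_int (u $ 1)]"

definition idet :: "int^2 \<Rightarrow> int^2 \<Rightarrow> int" where
  "idet u w = u $ 1 * w $ 2 - u $ 2 * w $ 1"

lemma nvec_nth [simp]: "nvec u $ 1 = of_int (u $ 1)" "nvec u $ 2 = of_int (u $ 2)"
  and dvec_nth [simp]: "dvec u $ 1 = - of_int (u $ 2)" "dvec u $ 2 = of_int (u $ 1)"
  by (simp_all add: nvec_def dvec_def)

lemma lform_nvec: "lform u x = nvec u \<bullet> x"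
  by (simp add: lform_def inner_2)

lemma nvec_eq_0: "nvec u = 0 \<longleftrightarrow> u = 0" and dvec_eq_0: "dvec u = 0 \<longleftrightarrow> u = 0"
  by (auto simp: vec_eq_2)

lemma lform_dvec: "lform u (dvec w) = - of_int (idet u w)" and lform_dvec_same [simp]: "lform u (dvec u) = 0"
  by (simp_all add: lform_def idet_def)

lemma lform_add: "lform u (x + y) = lform u x + lform u y"
  and lform_diff: "lform u (x - y) = lform u x - lform u y"
  and lform_scaleR: "lform u (t *\<^sub>R x) = t * lform u x"
  and lform_uminus: "lform (- u) x = - lform u x"
  by (simp_all add: lform_def algebra_simps)

lemma det2_dvec: "det2 x (dvec u) = lform u x"
  by (simp add: det2_def lform_def mult.commute)

definition line_point :: "int^2 \<Rightarrow> real \<Rightarrow> real \<Rightarrow> real^2" where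
  "line_point u c t = (c / (of_int (u $ 1) ^ 2 + of_int (u $ 2) ^ 2)) *\<^sub>R nvec u + t *\<^sub>R dvec u"

lemma line_measure_eq: "line_measure u c = distr lborel borel (line_point u c)"
  by (simp add: line_measure_def line_point_def[abs_def] nvec_def dvec_def)

lemma continuous_line_point: "continuous_on S (line_point u c)"
  unfolding line_point_def by (intro continuous_intros)

lemma measurable_line_point [measurable]: "line_point u c \<in> borel_measurable borel"
  by (intro borel_measurable_continuous_onI continuous_line_point)

lemma sets_line_measure [simp, measurable_cong]: "sets (line_measure u c) = sets borel"
  by (simp add: line_measure_eq)

lemma space_line_measure [simp]: "space (line_measure u c) = UNIV"
  by (simp add: line_measure_eq)

lemma lform_line_point:
  assumes "u \<noteq> 0"
  shows "lform u (line_point u c t) = c"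
proof -
  have "(of_int (u $ 1))\<^sup>2 + (of_int (u $ 2))\<^sup>2 \<noteq> (0::real)"
    using assms by (simp add: sum_power2_eq_zero_iff vec_eq_2)
  moreover have "lform u (nvec u) = (of_int (u $ 1))\<^sup>2 + (of_int (u $ 2))\<^sup>2"
    by (simp add: lform_def power2_eq_square)
  ultimately show ?thesis
    by (simp add: line_point_def lform_add lform_scaleR)
qed

lemma ex_line_point:
  assumes "u \<noteq> 0" "lform u x = c"
  shows "\<exists>t. x = line_point u c t"
proof -
  have "nvec u \<bullet> (x - line_point u c 0) = 0" "nvec u \<bullet> dvec u = 0"
    using assms lform_line_point[OF assms(1), of c 0] by (simp_all add: lform_nvec[symmetric] lform_diff)
  then obtain t where "x - line_point u c 0 = t *\<^sub>R dvec u"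
    using orthogonal_imp_parallel[of "nvec u"] assms(1) nvec_eq_0 dvec_eq_0 by blast
  then show ?thesis by (intro exI[of _ t]) (simp add: line_point_def algebra_simps)
qed

lemma line_point_add: "line_point u c t + s *\<^sub>R dvec u = line_point u c (t + s)"
  by (simp add: line_point_def algebra_simps)

lemma inner_line_point: "b \<bullet> line_point u c t + d = (b \<bullet> line_point u c 0 + d) + t * (b \<bullet> dvec u)"
  by (simp add: line_point_def inner_simps)

lemma AE_line_measure:
  assumes "{x. \<not> Q x} \<in> sets borel"
  shows "(AE x in line_measure u c. Q x) \<longleftrightarrow> (AE t in lborel. Q (line_point u c t))"
proof -
  have "{x \<in> space borel. Q x} = - {x. \<not> Q x}" by auto
  then have "{x \<in> space borel. Q x} \<in> sets borel" using assms by (simp add: borel_comp)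
  then show ?thesis unfolding line_measure_eq by (subst AE_distr_iff) auto
qed

lemma closed_lform: "closed {x. lform u x = c}"
  unfolding lform_nvec by (rule closed_hyperplane)

lemma AE_line_measure_line:
  assumes "u \<noteq> 0"
  shows "AE x in line_measure u c. lform u x = c"
proof -
  have "{x. \<not> lform u x = c} = - {x. lform u x = c}" by auto
  then have "{x. \<not> lform u x = c} \<in> sets borel" using closed_lform[of u c] by (simp add: borel_comp borel_closed)
  then show ?thesis using lform_line_point[OF assms] by (subst AE_line_measure) auto
qed

text \<open>Along a line an affine function that is not identically zero vanishes for at most one
  parameter.\<close>

lemma AE_line_measure_other:
  assumes "b \<bullet> line_point u c t0 + d \<noteq> 0"
  shows "AE x in line_measure u c. b \<bullet> x + d \<noteq> 0"
proof -
  have "{x. \<not> b \<bullet> x + d \<noteq> 0} = {x. b \<bullet> x = - d}" by auto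
  then have s: "{x. \<not> b \<bullet> x + d \<noteq> 0} \<in> sets borel" using closed_hyperplane[of b "-d"] by (simp add: borel_closed)
  let ?\<alpha> = "b \<bullet> line_point u c 0 + d" and ?\<beta> = "b \<bullet> dvec u"
  have "AE t in lborel. t \<noteq> - ?\<alpha> / ?\<beta>"
    using AE_lborel_singleton by simp
  then have "AE t in lborel. b \<bullet> line_point u c t + d \<noteq> 0"
  proof eventually_elim
    case (elim t)
    have n: "?\<beta> \<noteq> 0 \<or> ?\<alpha> \<noteq> 0" using assms unfolding inner_line_point[of b u c t0] by auto
    show ?case
    proof (cases "?\<beta> = 0")
      case False
      then show ?thesis using elim unfolding inner_line_point[of b u c t] by (simp add: field_simps add_eq_0_iff)
    qed (use n in \<open>simp add: inner_line_point[of b u c t]\<close>)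
  qed
  then show ?thesis using AE_line_measure[OF s] by simp
qed

text \<open>The trapezoid rule. The length \<open>s\<close> is measured in multiples of
  \<open>dvec u\<close>, which for primitive \<open>u\<close> is lattice length.\<close>

lemma integral_segment_line_measure:
  fixes b :: "real^2" and d :: real
  defines "f \<equiv> \<lambda>x. b \<bullet> x + d"
  assumes u: "u \<noteq> 0" and p: "lform u p = c" and s: "0 \<le> s"
  shows "(LINT x:closed_segment p (p + s *\<^sub>R dvec u)|line_measure u c. f x) = s * (f p + f (p + s *\<^sub>R dvec u)) / 2"
proof -
  obtain t0 where t0: "p = line_point u c t0" using ex_line_point[OF u p] by blast
  have q: "p + s *\<^sub>R dvec u = line_point u c (t0 + s)" by (simp add: t0 line_point_add)
  let ?S = "closed_segment p (p + s *\<^sub>R dvec u)"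
  have pre: "line_point u c t \<in> ?S \<longleftrightarrow> t \<in> {t0..t0 + s}" for t
  proof -
    have inj: "line_point u c t = line_point u c t' \<longleftrightarrow> t = t'" for t'
      using u by (simp add: line_point_def dvec_eq_0)
    have "(1 - r) *\<^sub>R p + r *\<^sub>R (p + s *\<^sub>R dvec u) = line_point u c (t0 + r * s)" for r
      unfolding line_point_add[symmetric] t0[symmetric] by (simp add: algebra_simps)
    then have "line_point u c t \<in> ?S \<longleftrightarrow> (\<exists>r\<in>{0..1}. t = t0 + r * s)"
      by (auto simp: in_segment inj)
    also have "\<dots> \<longleftrightarrow> t \<in> {t0..t0 + s}"
    proof (cases "s = 0")
      case False
      then show ?thesis using s
        by (auto simp: field_simps mult_left_le_one_le intro!: bexI[of _ "(t - t0) / s"])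
    qed (auto intro: bexI[of _ 0])
    finally show ?thesis .
  qed
  have ind: "indicator ?S (line_point u c t) = (indicator {t0..t0 + s} t :: real)" for t
    unfolding indicator_def pre ..
  have fm: "(\<lambda>x. indicator ?S x *\<^sub>R f x) \<in> borel_measurable borel"
    unfolding f_def by (intro borel_measurable_scaleR borel_measurable_indicator borel_measurable_continuous_onI
        continuous_intros borel_closed closed_segment)
  define \<alpha> \<beta> where "\<alpha> = f (line_point u c 0)" and "\<beta> = b \<bullet> dvec u"
  have fl: "f (line_point u c t) = \<alpha> + t * \<beta>" for t
    unfolding \<alpha>_def \<beta>_def f_def by (rule inner_line_point)
  have "(LINT x:?S|line_measure u c. f x) = (LINT t|lborel. indicator ?S (line_point u c t) *\<^sub>R f (line_point u c t))"
    unfolding set_lebesgue_integral_def line_measure_eq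
    by (rule integral_distr[OF _ fm]) simp
  also have "\<dots> = (LINT t|lborel. indicator {t0..t0+s} t *\<^sub>R (\<alpha> + t * \<beta>))"
    unfolding fl ind ..
  also have "\<dots> = (\<alpha> * (t0 + s) + \<beta> * (t0 + s)^2 / 2) - (\<alpha> * t0 + \<beta> * t0^2 / 2)"
    using s by (intro integral_FTC_atLeastAtMost)
      (auto intro!: derivative_eq_intros continuous_intros simp: has_real_derivative_iff_has_vector_derivative[symmetric])
  also have "\<dots> = s * (f p + f (p + s *\<^sub>R dvec u)) / 2"
    unfolding q unfolding t0 fl by (simp add: power2_eq_square field_simps)
  finally show ?thesis .
qed

lemma coprime_imp_nonzero: "coprime (u $ 1) (u $ 2) \<Longrightarrow> u \<noteq> 0" for u :: "int^2"
  by auto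

text \<open>Proportional primitive vectors divide each other coordinatewise, so their coordinates
  agree up to sign; the determinant ties the two signs together.\<close>

lemma coprime_parallel:
  fixes u w :: "int^2"
  assumes "coprime (u $ 1) (u $ 2)" "coprime (w $ 1) (w $ 2)" "idet u w = 0"
  shows "w = u \<or> w = - u"
proof -
  have eq: "u $ 1 * w $ 2 = u $ 2 * w $ 1" using assms(3) by (simp add: idet_def)
  have d: "u $ 1 dvd u $ 2 * w $ 1" "w $ 1 dvd u $ 1 * w $ 2" "u $ 2 dvd u $ 1 * w $ 2" "w $ 2 dvd u $ 2 * w $ 1"
    using eq dvd_triv_left[of "u $ 1" "w $ 2"] dvd_triv_right[of "w $ 1" "u $ 2"]
      dvd_triv_left[of "u $ 2" "w $ 1"] dvd_triv_right[of "w $ 2" "u $ 1"] by simp_all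
  have c: "coprime (u $ 2) (u $ 1)" "coprime (w $ 2) (w $ 1)" using assms(1,2) by (simp_all add: coprime_commute)
  have "w $ 1 dvd u $ 1" "u $ 1 dvd w $ 1" "w $ 2 dvd u $ 2" "u $ 2 dvd w $ 2"
    using d coprime_dvd_mult_right_iff[OF assms(1)] coprime_dvd_mult_left_iff[OF assms(2)]
      coprime_dvd_mult_right_iff[OF c(1)] coprime_dvd_mult_left_iff[OF c(2)] by blast+
  then have "\<bar>w $ 1\<bar> = \<bar>u $ 1\<bar>" "\<bar>w $ 2\<bar> = \<bar>u $ 2\<bar>"
    using zdvd_antisym_abs by blast+
  then have "(w $ 1 = u $ 1 \<or> w $ 1 = - u $ 1) \<and> (w $ 2 = u $ 2 \<or> w $ 2 = - u $ 2)"
    by (simp only: abs_eq_iff)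
  then have "w $ 1 = u $ 1 \<and> w $ 2 = u $ 2 \<or> w $ 1 = - u $ 1 \<and> w $ 2 = - u $ 2"
    using eq by (elim conjE disjE) auto
  then show ?thesis by (simp add: vec_eq_2)
qed

lemma two_points_imp_idet_zero:
  assumes "x \<noteq> y" "lform u x = lform u y" "lform w x = lform w y"
  shows "idet u w = 0"
proof -
  have "lform u (x - y) = 0" "lform w (x - y) = 0" using assms by (simp_all add: lform_diff)
  then have "real_of_int (idet u w) * (x - y) $ 1 = 0" "real_of_int (idet u w) * (x - y) $ 2 = 0"
    unfolding lform_def idet_def by (simp_all only: of_int_diff of_int_mult) algebra+
  moreover have "(x - y) $ 1 \<noteq> 0 \<or> (x - y) $ 2 \<noteq> 0" using assms(1) by (simp add: vec_eq_2)
  ultimately show ?thesis by auto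
qed

section \<open>The boundary measure as a sum over facets\<close>

locale lattice_polygon =
  fixes P :: "(real^2) set"
  assumes moment: "moment_polygon P"
begin

lemma polytope_P: "polytope P" and int_P: "interior P \<noteq> {}"
  using moment by (auto simp: moment_polygon_def)

lemma compact_P: "compact P" and convex_P: "convex P" and closed_P: "closed P"
  using polytope_P by (auto simp: polytope_imp_compact polytope_imp_convex polytope_imp_closed)

lemma vertex_Ints: "v extreme_point_of P \<Longrightarrow> v $ i \<in> \<int>"
  using moment by (simp add: moment_polygon_def)

abbreviation "\<F> \<equiv> facet_data P"

definition edge :: "int^2 \<Rightarrow> real \<Rightarrow> (real^2) set" where
  "edge u c = {x \<in> P. lform u x = c}"

lemma facetD:
  assumes "(u, c) \<in> \<F>"
  shows "coprime (u $ 1) (u $ 2)" "u \<noteq> 0" "\<And>x. x \<in> P \<Longrightarrow> c \<le> lform u x" "edge u c edge_of P"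
  using assms coprime_imp_nonzero unfolding facet_data_def edge_def by auto

lemma edge_subset: "edge u c \<subseteq> P"
  by (auto simp: edge_def)

lemma convex_edge: "convex (edge u c)" and compact_edge: "compact (edge u c)"
proof -
  have "edge u c = P \<inter> {x. nvec u \<bullet> x = c}" by (auto simp: edge_def lform_nvec)
  then show "convex (edge u c)" "compact (edge u c)"
    using convex_P compact_P by (simp_all add: convex_Int convex_hyperplane compact_Int_closed closed_hyperplane)
qed

lemma facet_interior:
  assumes "(u, c) \<in> \<F>" "x \<in> interior P"
  shows "c < lform u x"
proof -
  obtain e where e: "0 < e" "cball x e \<subseteq> P" using assms(2) mem_interior_cball by blast
  have n0: "nvec u \<noteq> 0" using facetD(2)[OF assms(1)] by (simp add: nvec_eq_0)
  let ?y = "x - (e / norm (nvec u)) *\<^sub>R nvec u"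
  have "?y \<in> P" using e n0 by (intro subsetD[OF e(2)]) (simp add: dist_norm)
  then have "c \<le> lform u ?y" using facetD(3)[OF assms(1)] by blast
  also have "lform u ?y = lform u x - e / norm (nvec u) * (nvec u \<bullet> nvec u)"
    by (simp add: lform_nvec inner_diff_right)
  also have "\<dots> < lform u x" using e n0 by simp
  finally show ?thesis .
qed

lemma edge_frontier:
  assumes "(u, c) \<in> \<F>"
  shows "edge u c \<subseteq> frontier P"
proof
  fix x assume "x \<in> edge u c"
  then have "x \<in> P" "x \<notin> interior P" using facet_interior[OF assms, of x] by (auto simp: edge_def)
  then show "x \<in> frontier P" using closure_subset by (auto simp: frontier_def)
qed

lemma edge_two_points:
  assumes "(u, c) \<in> \<F>"
  obtains x y where "x \<in> edge u c" "y \<in> edge u c" "x \<noteq> y"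
proof -
  have "aff_dim (edge u c) = 1" using facetD(4)[OF assms] by (simp add: edge_of_def)
  then have "edge u c \<noteq> {}" "\<not> (\<exists>a. edge u c = {a})" by auto
  then show thesis using that by blast
qed

text \<open>Two common points make the primitive normals equal or opposite; opposite ones would
  leave \<open>P\<close> no interior.\<close>

lemma facet_unique:
  assumes F: "(u, c) \<in> \<F>" "(w, d) \<in> \<F>" and xy: "x \<noteq> y" "x \<in> P" "lform u x = c" "lform u y = c" "lform w x = d" "lform w y = d"
  shows "u = w \<and> c = d"
proof -
  have "idet u w = 0" using two_points_imp_idet_zero[OF xy(1)] xy by simp
  then have "w = u \<or> w = - u" using coprime_parallel facetD(1) F by blast
  moreover have "w \<noteq> - u"
  proof
    assume w: "w = - u"
    obtain z where z: "z \<in> interior P" using int_P by blast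
    have "c < lform u z" "d < lform w z" using facet_interior F z by blast+
    moreover have "d = - c" using xy(3,5) by (simp add: w lform_uminus)
    ultimately show False by (simp add: w lform_uminus)
  qed
  ultimately show ?thesis using xy by auto
qed

lemma finite_facets: "finite \<F>"
proof (rule inj_on_finite[where f="\<lambda>(u, c). edge u c"])
  show "inj_on (\<lambda>(u, c). edge u c) \<F>"
  proof (rule inj_onI, clarify)
    fix u c w d assume F: "(u, c) \<in> \<F>" "(w, d) \<in> \<F>" and eq: "edge u c = edge w d"
    obtain x y where xy: "x \<in> edge u c" "y \<in> edge u c" "x \<noteq> y" using edge_two_points[OF F(1)] .
    have "x \<in> edge w d" "y \<in> edge w d" using xy eq by auto
    then show "u = w \<and> c = d" using facet_unique[OF F xy(3)] xy by (auto simp: edge_def)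
  qed
  show "(\<lambda>(u, c). edge u c) ` \<F> \<subseteq> {T. T face_of P}"
    using facetD(4) by (auto simp: edge_of_def)
  show "finite {T. T face_of P}" by (rule finite_polytope_faces[OF polytope_P])
qed

abbreviation \<sigma> :: "(real^2) measure" where "\<sigma> \<equiv> dsigma P"

lemma sets_dsigma: "sets \<sigma> = sets borel"
  using sets.sigma_sets_eq[of "borel :: (real^2) measure"] by (simp add: dsigma_def)

lemma space_dsigma: "space \<sigma> = UNIV"
  by (simp add: dsigma_def)

lemma P_borel [measurable]: "P \<in> sets borel"
  using compact_P by (rule borel_compact)

text \<open>The value prescribed in \<open>dsigma\<close> is attained because a finite sum of
  measures restricted to \<open>P\<close> is countably additive.\<close>

lemma emeasure_dsigma:
  assumes "B \<in> sets borel"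
  shows "emeasure \<sigma> B = (\<Sum>(u, c)\<in>\<F>. emeasure (line_measure u c) (B \<inter> P))"
  unfolding dsigma_def
proof (rule emeasure_measure_of_sigma)
  let ?\<mu> = "\<lambda>B. \<Sum>(u, c)\<in>\<F>. emeasure (line_measure u c) (B \<inter> P)"
  show "sigma_algebra UNIV (sets (borel :: (real^2) measure))"
    using sets.sigma_algebra_axioms[of "borel :: (real^2) measure"] by simp
  show "positive (sets borel) ?\<mu>" by (simp add: positive_def split_def)
  show "countably_additive (sets borel) ?\<mu>"
  proof (rule countably_additiveI)
    fix A :: "nat \<Rightarrow> (real^2) set"
    assume A: "range A \<subseteq> sets borel" "disjoint_family A" "\<Union>(range A) \<in> sets borel"
    have "(\<Sum>i. ?\<mu> (A i)) = (\<Sum>k\<in>\<F>. \<Sum>i. emeasure (line_measure (fst k) (snd k)) (A i \<inter> P))"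
      by (simp add: split_def suminf_sum)
    also have "\<dots> = (\<Sum>k\<in>\<F>. emeasure (line_measure (fst k) (snd k)) (\<Union>(range A) \<inter> P))"
    proof (rule sum.cong[OF refl])
      fix k assume "k \<in> \<F>"
      have "disjoint_family (\<lambda>i. A i \<inter> P)" using A(2) by (auto simp: disjoint_family_on_def)
      then have "(\<Sum>i. emeasure (line_measure (fst k) (snd k)) (A i \<inter> P)) = emeasure (line_measure (fst k) (snd k)) (\<Union>i. A i \<inter> P)"
        using A(1) by (intro suminf_emeasure) auto
      also have "(\<Union>i. A i \<inter> P) = \<Union>(range A) \<inter> P" by auto
      finally show "(\<Sum>i. emeasure (line_measure (fst k) (snd k)) (A i \<inter> P)) = emeasure (line_measure (fst k) (snd k)) (\<Union>(range A) \<inter> P)" .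
    qed
    finally show "(\<Sum>i. ?\<mu> (A i)) = ?\<mu> (\<Union>(range A))" by (simp add: split_def)
  qed
qed (rule assms)

lemma AE_dsigma:
  assumes "{x. \<not> Q x} \<in> sets borel"
    and "\<And>u c. (u, c) \<in> \<F> \<Longrightarrow> AE x in line_measure u c. x \<in> P \<longrightarrow> Q x"
  shows "AE x in \<sigma>. Q x"
proof (rule AE_I)
  show "{x \<in> space \<sigma>. \<not> Q x} \<subseteq> {x. \<not> Q x}" by auto
  have "emeasure (line_measure u c) ({x. \<not> Q x} \<inter> P) = 0" if "(u, c) \<in> \<F>" for u c
  proof -
    have "AE x in line_measure u c. x \<notin> {x. \<not> Q x} \<inter> P" using assms(2)[OF that] by eventually_elim auto
    then show ?thesis using assms(1) by (subst (asm) AE_iff_measurable[of "{x. \<not> Q x} \<inter> P"]) auto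
  qed
  then show "emeasure \<sigma> {x. \<not> Q x} = 0"
    unfolding emeasure_dsigma[OF assms(1)] by (intro sum.neutral) auto
  show "{x. \<not> Q x} \<in> sets \<sigma>" using assms(1) by (simp add: sets_dsigma)
qed

lemma emeasure_line_measure_P_finite:
  assumes "u \<noteq> 0"
  shows "emeasure (line_measure u c) P < \<infinity>"
proof -
  have "compact (line_point u c -` P)"
  proof -
    have "bounded (line_point u c -` P)"
    proof -
      obtain B where B: "\<And>x. x \<in> P \<Longrightarrow> norm x \<le> B" using compact_imp_bounded[OF compact_P] bounded_iff by blast
      have "norm t \<le> (B + norm (line_point u c 0)) / norm (dvec u)" if "t \<in> line_point u c -` P" for t
      proof -
        have "norm (t *\<^sub>R dvec u) = norm (line_point u c t - line_point u c 0)" by (simp add: line_point_def)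
        also have "\<dots> \<le> norm (line_point u c t) + norm (line_point u c 0)" by (rule norm_triangle_ineq4)
        also have "\<dots> \<le> B + norm (line_point u c 0)" using B that by simp
        finally show ?thesis using assms by (simp add: dvec_eq_0 field_simps)
      qed
      then show ?thesis unfolding bounded_iff by blast
    qed
    moreover have "closed (line_point u c -` P)"
      using continuous_closed_vimage[OF closed_P, of "line_point u c"] continuous_line_point[of UNIV u c]
      by (simp add: continuous_on_eq_continuous_at)
    ultimately show ?thesis by (simp add: compact_eq_bounded_closed)
  qed
  then have "emeasure lborel (line_point u c -` P) < \<infinity>"
    using emeasure_bounded_finite compact_imp_bounded by blast
  then show ?thesis unfolding line_measure_eq by (simp add: emeasure_distr)
qed

lemma finite_dsigma: "emeasure \<sigma> UNIV \<noteq> \<infinity>"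
proof -
  have fin: "(\<Sum>k\<in>F. f k) < \<infinity>" if "finite F" "\<And>k. k \<in> F \<Longrightarrow> f k < \<infinity>" for F and f :: "(int^2) \<times> real \<Rightarrow> ennreal"
    using that by (induction F rule: finite_induct) auto
  have UNIV_borel: "UNIV \<in> sets (borel :: (real^2) measure)" by simp
  have "emeasure \<sigma> UNIV < \<infinity>"
    unfolding emeasure_dsigma[OF UNIV_borel]
  proof (rule fin[OF finite_facets])
    show "(case k of (u, c) \<Rightarrow> emeasure (line_measure u c) (UNIV \<inter> P)) < \<infinity>" if "k \<in> \<F>" for k
      using that emeasure_line_measure_P_finite facetD(2) by (cases k) auto
  qed
  then show ?thesis by simp
qed

lemma AE_dsigma_frontier: "AE x in \<sigma>. x \<in> frontier P"
proof (rule AE_dsigma)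
  have "{x. x \<notin> frontier P} = - frontier P" by auto
  then show "{x. x \<notin> frontier P} \<in> sets borel" using closed_P by (simp add: borel_comp borel_closed)
  fix u c assume F: "(u, c) \<in> \<F>"
  show "AE x in line_measure u c. x \<in> P \<longrightarrow> x \<in> frontier P"
    using AE_line_measure_line[OF facetD(2)[OF F], of c]
    by eventually_elim (use edge_frontier[OF F] in \<open>auto simp: edge_def\<close>)
qed

lemma AE_dsigma_line:
  assumes "b \<noteq> 0" "x \<in> interior P" "b \<bullet> x + d = 0"
  shows "AE y in \<sigma>. b \<bullet> y + d \<noteq> 0"
proof (rule AE_dsigma)
  have "{x. \<not> b \<bullet> x + d \<noteq> 0} = {x. b \<bullet> x = - d}" by auto
  then show "{x. \<not> b \<bullet> x + d \<noteq> 0} \<in> sets borel" using closed_hyperplane[of b "-d"] by (simp add: borel_closed)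
  fix u c assume F: "(u, c) \<in> \<F>"
  have "\<exists>t. b \<bullet> line_point u c t + d \<noteq> 0"
  proof (rule ccontr)
    assume "\<not> ?thesis"
    then have z: "b \<bullet> line_point u c t + d = 0" for t by blast
    have "b \<bullet> dvec u = 0" using z[of 0] z[of 1] inner_line_point[of b u c 1 d] by simp
    moreover have "b \<bullet> (x - line_point u c 0) = 0" using z[of 0] assms(3) by (simp add: inner_diff_right)
    ultimately obtain t where "x - line_point u c 0 = t *\<^sub>R dvec u"
      using orthogonal_imp_parallel[OF assms(1)] facetD(2)[OF F] dvec_eq_0 by blast
    then have "x = line_point u c t" by (simp add: line_point_def algebra_simps)
    then have "lform u x = c" using lform_line_point facetD(2)[OF F] by simp
    then show False using facet_interior[OF F assms(2)] by simp
  qed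
  then obtain t where "b \<bullet> line_point u c t + d \<noteq> 0" by blast
  from AE_line_measure_other[OF this] show "AE x in line_measure u c. x \<in> P \<longrightarrow> b \<bullet> x + d \<noteq> 0"
    by eventually_elim auto
qed

lemma AE_other_facet:
  assumes F: "(u, c) \<in> \<F>" "(w, d) \<in> \<F>" "(w, d) \<noteq> (u, c)"
  shows "AE x in line_measure w d. lform u x \<noteq> c"
proof -
  obtain x y where xy: "x \<in> edge w d" "y \<in> edge w d" "x \<noteq> y" using edge_two_points[OF F(2)] .
  have "\<not> (lform u x = c \<and> lform u y = c)"
    using facet_unique[OF F(1,2) xy(3)] xy F(3) by (auto simp: edge_def)
  then obtain z where z: "z \<in> edge w d" "lform u z \<noteq> c" using xy by blast
  obtain t where "z = line_point w d t"
    using ex_line_point[OF facetD(2)[OF F(2)], of z d] z(1) unfolding edge_def by blast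
  then have "nvec u \<bullet> line_point w d t + (- c) \<noteq> 0" using z by (simp add: lform_nvec)
  from AE_line_measure_other[OF this] show ?thesis by eventually_elim (simp add: lform_nvec)
qed

text \<open>The line of a facet is null for the measures of all other facets, so a single summand of
  \<open>dsigma P\<close> survives on it.\<close>

lemma density_facet:
  assumes F: "(u, c) \<in> \<F>"
  shows "density \<sigma> (indicator {x. lform u x = c}) = density (line_measure u c) (indicator P)"
proof (rule measure_eqI)
  let ?l = "{x. lform u x = c}"
  have l: "?l \<in> sets borel" using closed_lform by (rule borel_closed)
  show "sets (density \<sigma> (indicator ?l)) = sets (density (line_measure u c) (indicator P))"
    by (simp add: sets_dsigma)
  fix B assume "B \<in> sets (density \<sigma> (indicator ?l))"
  then have B: "B \<in> sets borel" by (simp add: sets_dsigma)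
  have "emeasure (density \<sigma> (indicator ?l)) B = emeasure \<sigma> (?l \<inter> B)"
  proof -
    have "indicator ?l \<in> borel_measurable \<sigma>" using l by (intro borel_measurable_indicator) (simp add: sets_dsigma)
    then show ?thesis
      using B l by (subst emeasure_density) (auto simp: sets_dsigma indicator_inter_arith[symmetric])
  qed
  also have "\<dots> = (\<Sum>(w, d)\<in>\<F>. emeasure (line_measure w d) (?l \<inter> B \<inter> P))"
    using B l by (intro emeasure_dsigma) auto
  also have "\<dots> = (\<Sum>k\<in>\<F>. if k = (u, c) then emeasure (line_measure u c) (P \<inter> B) else 0)"
  proof (rule sum.cong[OF refl], clarify)
    fix w d assume W: "(w, d) \<in> \<F>"
    show "emeasure (line_measure w d) (?l \<inter> B \<inter> P) =
      (if (w, d) = (u, c) then emeasure (line_measure u c) (P \<inter> B) else 0)"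
    proof (cases "(w, d) = (u, c)")
      case True
      then show ?thesis
        using B l AE_line_measure_line[OF facetD(2)[OF F], of c]
        by (auto intro!: emeasure_eq_AE elim!: eventually_mono)
    next
      case False
      have "AE x in line_measure w d. x \<notin> ?l \<inter> B \<inter> P"
        using AE_other_facet[OF F W False] by eventually_elim auto
      then show ?thesis using False B l by (subst (asm) AE_iff_measurable[of "?l \<inter> B \<inter> P"]) auto
    qed
  qed
  also have "\<dots> = emeasure (line_measure u c) (P \<inter> B)"
    using F finite_facets by simp
  also have "\<dots> = emeasure (density (line_measure u c) (indicator P)) B"
    using B by (subst emeasure_density) (auto simp: nn_integral_indicator indicator_inter_arith[symmetric])
  finally show "emeasure (density \<sigma> (indicator ?l)) B = emeasure (density (line_measure u c) (indicator P)) B" .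
qed

lemma integral_facet:
  fixes f :: "real^2 \<Rightarrow> real"
  assumes F: "(u, c) \<in> \<F>" and S: "S \<in> sets borel" "S \<subseteq> edge u c" and f: "continuous_on UNIV f"
  shows "(LINT x:S|\<sigma>. f x) = (LINT x:S|line_measure u c. f x)"
proof -
  let ?l = "{x. lform u x = c}" and ?g = "\<lambda>x. indicator S x *\<^sub>R f x"
  have l: "?l \<in> sets borel" using closed_lform by (rule borel_closed)
  have g: "?g \<in> borel_measurable borel"
    using S f by (intro borel_measurable_scaleR borel_measurable_indicator borel_measurable_continuous_onI) auto
  have m\<sigma>: "borel_measurable \<sigma> = borel_measurable borel" by (rule measurable_cong_sets) (simp_all add: sets_dsigma)
  have ind: "(indicator A x :: ennreal) = ennreal (indicator A x)" for A and x :: "real^2"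
    by (simp add: indicator_def)
  have "(LINT x:S|\<sigma>. f x) = (LINT x|\<sigma>. indicator ?l x *\<^sub>R ?g x)"
    unfolding set_lebesgue_integral_def using S by (intro Bochner_Integration.integral_cong) (auto simp: indicator_def edge_def)
  also have "\<dots> = integral\<^sup>L (density \<sigma> (indicator ?l)) ?g"
    unfolding ind using g l by (subst integral_density) (auto simp: m\<sigma>)
  also have "\<dots> = integral\<^sup>L (density (line_measure u c) (indicator P)) ?g"
    by (simp only: density_facet[OF F])
  also have "\<dots> = (LINT x|line_measure u c. indicator P x *\<^sub>R ?g x)"
    unfolding ind using g by (subst integral_density) auto
  also have "\<dots> = (LINT x:S|line_measure u c. f x)"
    unfolding set_lebesgue_integral_def using S by (intro Bochner_Integration.integral_cong) (auto simp: indicator_def edge_def)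
  finally show ?thesis .
qed

lemma integral_segment:
  fixes b :: "real^2" and d :: real
  defines "f \<equiv> \<lambda>x. b \<bullet> x + d"
  assumes F: "(u, c) \<in> \<F>" and p: "p \<in> edge u c" "p + s *\<^sub>R dvec u \<in> edge u c" and s: "0 \<le> s"
  shows "(LINT x:closed_segment p (p + s *\<^sub>R dvec u)|\<sigma>. f x) = s * (f p + f (p + s *\<^sub>R dvec u)) / 2"
proof -
  have "closed_segment p (p + s *\<^sub>R dvec u) \<subseteq> edge u c"
    using p convex_edge by (simp add: closed_segment_subset)
  moreover have "lform u p = c" using p by (simp add: edge_def)
  moreover have "continuous_on UNIV f" unfolding f_def by (intro continuous_intros)
  ultimately show ?thesis
    using integral_facet[OF F _ _ \<open>continuous_on UNIV f\<close>, of "closed_segment p (p + s *\<^sub>R dvec u)"]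
      integral_segment_line_measure[OF facetD(2)[OF F] _ s, of p c b d] unfolding f_def
    by (simp add: borel_closed)
qed

end

section \<open>Chords\<close>

definition perp :: "real^2 \<Rightarrow> real^2" where
  "perp v = vector [- (v $ 2), v $ 1]"

lemma perp_nth [simp]: "perp v $ 1 = - (v $ 2)" "perp v $ 2 = v $ 1"
  by (simp_all add: perp_def)

lemma det2_perp: "det2 v x = perp v \<bullet> x"
  by (simp add: det2_def inner_2)

lemma perp_eq_0 [simp]: "perp v = 0 \<longleftrightarrow> v = 0"
  by (auto simp: vec_eq_2)

lemma det2_linear:
  "det2 (x + y) z = det2 x z + det2 y z" "det2 z (x + y) = det2 z x + det2 z y"
  "det2 (x - y) z = det2 x z - det2 y z" "det2 z (x - y) = det2 z x - det2 z y"
  "det2 (r *\<^sub>R x) z = r * det2 x z" "det2 z (r *\<^sub>R x) = r * det2 z x"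
  "det2 (- x) z = - det2 x z" "det2 z (- x) = - det2 z x" "det2 x x = 0"
  by (simp_all add: det2_def algebra_simps)

lemma det2_commute: "det2 v w = - det2 w v"
  by (simp add: det2_def)

text \<open>Twice the signed area of the triangle \<open>p\<close>, \<open>q\<close>,
  \<open>x\<close>. The sign distinguishes the two halves cut off by a chord, and swapping the ends
  exchanges them.\<close>

definition side :: "real^2 \<Rightarrow> real^2 \<Rightarrow> real^2 \<Rightarrow> real" where
  "side p q x = det2 (q - p) (x - p)"

lemma side_affine: "side p q x = perp (q - p) \<bullet> x + (- (perp (q - p) \<bullet> p))"
  by (simp add: side_def det2_perp inner_diff_right)

lemma side_swap: "side q p x = - side p q x"
  by (simp add: side_def det2_def algebra_simps)

lemma side_ends [simp]: "side p q p = 0" "side p q q = 0"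
  by (simp_all add: side_def det2_linear) (simp add: det2_def)

text \<open>At a point that is not interior there is a supporting line; positive weights would force
  all three vertices onto it.\<close>

lemma interior_triangle:
  fixes P :: "(real^2) set"
  assumes P: "convex P" and pts: "p1 \<in> P" "p2 \<in> P" "p3 \<in> P" and d: "det2 (p2 - p1) (p3 - p1) \<noteq> 0"
    and c: "0 < r1" "0 < r2" "0 < r3" "r1 + r2 + r3 = 1"
  shows "r1 *\<^sub>R p1 + r2 *\<^sub>R p2 + r3 *\<^sub>R p3 \<in> interior P" (is "?x \<in> _")
proof (rule ccontr)
  assume ni: "?x \<notin> interior P"
  have "?x = r1 *\<^sub>R p1 + (r2 + r3) *\<^sub>R ((r2 / (r2 + r3)) *\<^sub>R p2 + (r3 / (r2 + r3)) *\<^sub>R p3)"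
    using c by (simp add: scaleR_right_distrib)
  also have "\<dots> \<in> P"
    using c by (intro convexD[OF P] pts) (auto simp: add_divide_distrib[symmetric])
  finally have "?x \<in> P" .
  then obtain n where n: "n \<noteq> 0" "\<forall>y\<in>P. n \<bullet> y \<le> n \<bullet> ?x" using supporting_line[OF P _ ni] by blast
  have le: "n \<bullet> p1 \<le> n \<bullet> ?x" "n \<bullet> p2 \<le> n \<bullet> ?x" "n \<bullet> p3 \<le> n \<bullet> ?x" using n pts by auto
  define \<delta> where "\<delta> i = n \<bullet> ?x - n \<bullet> i" for i
  have "r1 * \<delta> p1 + r2 * \<delta> p2 + r3 * \<delta> p3 = (r1 + r2 + r3) * (n \<bullet> ?x) - n \<bullet> ?x"
    by (simp add: \<delta>_def inner_simps algebra_simps)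
  then have s: "r1 * \<delta> p1 + r2 * \<delta> p2 + r3 * \<delta> p3 = 0" using c by simp
  have "0 \<le> r1 * \<delta> p1" "0 \<le> r2 * \<delta> p2" "0 \<le> r3 * \<delta> p3"
    using c le by (simp_all add: \<delta>_def)
  then have "r1 * \<delta> p1 = 0" "r2 * \<delta> p2 = 0" "r3 * \<delta> p3 = 0" using s by linarith+
  then have "\<delta> p1 = 0" "\<delta> p2 = 0" "\<delta> p3 = 0" using c by auto
  then have "n \<bullet> (p2 - p1) = 0" "n \<bullet> (p3 - p1) = 0" by (simp_all add: \<delta>_def inner_diff_right)
  then show False using orthogonal_imp_det2_zero[OF n(1)] d by blast
qed

lemma closed_segment_line:
  "closed_segment p (p + s *\<^sub>R e) = {p + (r * s) *\<^sub>R e |r. 0 \<le> r \<and> r \<le> 1}"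
proof -
  have "(1 - r) *\<^sub>R p + r *\<^sub>R (p + s *\<^sub>R e) = p + (r * s) *\<^sub>R e" for r
    by (simp add: algebra_simps)
  then show ?thesis by (auto simp: closed_segment_def)
qed

lemma compact_convex_on_line:
  assumes S: "compact S" "convex S" "S \<noteq> {}" and line: "\<And>x. x \<in> S \<Longrightarrow> lform u x = c" and u: "u \<noteq> 0"
  obtains x s where "0 \<le> s" "S = closed_segment x (x + s *\<^sub>R dvec u)"
    "x extreme_point_of S" "x + s *\<^sub>R dvec u extreme_point_of S"
proof -
  let ?e = "dvec u"
  have e: "?e \<noteq> 0" "0 < ?e \<bullet> ?e" using u by (auto simp: dvec_eq_0)
  have cont: "continuous_on S (\<lambda>y. ?e \<bullet> y)" by (intro continuous_intros)
  obtain x where x: "x \<in> S" "\<And>y. y \<in> S \<Longrightarrow> ?e \<bullet> x \<le> ?e \<bullet> y"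
    using continuous_attains_inf[OF S(1,3) cont] by blast
  obtain y where y: "y \<in> S" "\<And>z. z \<in> S \<Longrightarrow> ?e \<bullet> z \<le> ?e \<bullet> y"
    using continuous_attains_sup[OF S(1,3) cont] by blast
  have rep: "\<exists>t. z = x + t *\<^sub>R ?e" if "z \<in> S" for z
  proof -
    have "nvec u \<bullet> (z - x) = 0" "nvec u \<bullet> ?e = 0"
      using line[OF that] line[OF x(1)] by (simp_all add: lform_nvec[symmetric] lform_diff)
    then obtain t where "z - x = t *\<^sub>R ?e" using orthogonal_imp_parallel[of "nvec u"] u e nvec_eq_0 by blast
    then show ?thesis by (intro exI[of _ t]) (simp add: algebra_simps)
  qed
  obtain s where s: "y = x + s *\<^sub>R ?e" using rep[OF y(1)] by blast
  have s0: "0 \<le> s" using x(2)[OF y(1)] e by (simp add: s inner_add_right zero_le_mult_iff)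
  have sub: "S \<subseteq> closed_segment x y"
  proof
    fix z assume z: "z \<in> S"
    obtain t where t: "z = x + t *\<^sub>R ?e" using rep[OF z] by blast
    have "0 \<le> t" using x(2)[OF z] e by (simp add: t inner_add_right zero_le_mult_iff)
    moreover have "t \<le> s" using y(2)[OF z] e by (simp add: t s inner_add_right)
    ultimately show "z \<in> closed_segment x y"
      unfolding s closed_segment_line t
      by (cases "s = 0") (auto intro!: exI[of _ "t / s"])
  qed
  moreover have "closed_segment x y \<subseteq> S" using x(1) y(1) S(2) by (rule closed_segment_subset)
  ultimately have eq: "S = closed_segment x y" by blast
  have "x extreme_point_of S" "y extreme_point_of S" unfolding eq by (simp_all add: extreme_point_of_segment)
  then show thesis using that s0 eq s by blast
qed

lemma measure_lborel_pos:
  fixes Q :: "'a::euclidean_space set"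
  assumes "compact Q" "interior Q \<noteq> {}"
  shows "0 < measure lborel Q"
proof -
  have "Q \<notin> null_sets lebesgue"
  proof
    assume "Q \<in> null_sets lebesgue"
    then have "negligible Q" by (simp add: negligible_iff_null_sets)
    then have "negligible (interior Q)" using negligible_subset interior_subset by blast
    then show False using assms(2) open_not_negligible[OF open_interior] by blast
  qed
  then have "Q \<notin> null_sets lborel" using null_sets_completionI by blast
  then have "emeasure lborel Q \<noteq> 0" using assms(1) by (simp add: null_sets_def borel_compact)
  moreover have "emeasure lborel Q \<noteq> \<infinity>" using emeasure_bounded_finite[OF compact_imp_bounded[OF assms(1)]] by simp
  ultimately have "measure lborel Q \<noteq> 0" by (simp add: emeasure_eq_ennreal_measure)
  then show ?thesis using measure_nonneg[of lborel Q] by linarith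
qed

section \<open>Edges, frontier and half polygons\<close>

context lattice_polygon
begin

definition a :: real where "a = measure \<sigma> (frontier P) / measure lborel P"

text \<open>A facet has two lattice points as ends, so its direction is an integer vector. Division
  by the gcd and a quarter turn give a primitive normal.\<close>

lemma facet_imp_facet_data:
  assumes F: "F facet_of P"
  shows "\<exists>u c. (u, c) \<in> \<F> \<and> F = edge u c"
proof -
  have dim: "aff_dim P = 2" using aff_dim_nonempty_interior[OF int_P] by simp
  have face: "F face_of P" "F \<noteq> {}" "aff_dim F = 1" using F dim by (auto simp: facet_of_def)
  obtain n b where nb: "n \<noteq> 0" "P \<subseteq> {x. n \<bullet> x \<le> b}" "F = P \<inter> {x. n \<bullet> x = b}"
    using facet_of_polyhedron[OF polytope_imp_polyhedron[OF polytope_P] F] by metis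
  have cF: "compact F" "convex F"
    using face_of_imp_compact[OF convex_P compact_P face(1)] face_of_imp_convex[OF face(1)] convex_P by auto
  have "\<exists>v w. v extreme_point_of F \<and> w extreme_point_of F \<and> v \<noteq> w"
  proof (rule ccontr)
    assume "\<not> ?thesis"
    then have "\<exists>v. {x. x extreme_point_of F} \<subseteq> {v}" by blast
    then obtain v where "{x. x extreme_point_of F} \<subseteq> {v}" by blast
    then have "F \<subseteq> {v}" using Krein_Milman_Minkowski[OF cF] hull_mono convex_hull_singleton by metis
    then have "aff_dim F \<le> 0" using aff_dim_subset aff_dim_sing by metis
    then show False using face(3) by simp
  qed
  then obtain v w where vw: "v extreme_point_of F" "w extreme_point_of F" "v \<noteq> w" by blast
  have ext: "v extreme_point_of P" "w extreme_point_of P"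
    using vw extreme_point_of_face[OF face(1)] by blast+
  have vwF: "v \<in> F" "w \<in> F" using vw by (auto simp: extreme_point_of_def)
  obtain m k :: int where mk: "(w - v) $ 1 = m" "(w - v) $ 2 = k"
    using vertex_Ints[OF ext(1)] vertex_Ints[OF ext(2)] by (metis Ints_cases Ints_diff vector_minus_component)
  have mk0: "m \<noteq> 0 \<or> k \<noteq> 0"
  proof (rule ccontr)
    assume "\<not> ?thesis"
    then have "w - v = 0" using mk by (simp add: vec_eq_2)
    then show False using vw(3) by simp
  qed
  define g where "g = gcd m k"
  have g0: "g \<noteq> 0" using mk0 by (simp add: g_def)
  define u0 :: "int^2" where "u0 = vector [- (k div g), m div g]"
  have u0: "u0 $ 1 = - (k div g)" "u0 $ 2 = m div g" by (simp_all add: u0_def)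
  have cop: "coprime (u0 $ 1) (u0 $ 2)"
    using div_gcd_coprime[of k m] mk0 unfolding u0 g_def by (auto simp: gcd.commute coprime_commute)
  have mg: "m = g * (m div g)" "k = g * (k div g)" by (simp_all add: g_def)
  have "(w - v) \<bullet> nvec u0 = 0"
  proof -
    have "(w - v) \<bullet> nvec u0 = real_of_int (g * (m div g) * - (k div g) + g * (k div g) * (m div g))"
      unfolding inner_2 mk nvec_nth u0 using mg by simp
    then show ?thesis by simp
  qed
  moreover have "(w - v) \<bullet> n = 0"
    using vwF nb(3) by (simp add: inner_commute[of "w - v"] inner_diff_right)
  ultimately obtain \<kappa> where \<kappa>: "nvec u0 = \<kappa> *\<^sub>R n"
    using orthogonal_imp_parallel[of "w - v" "nvec u0" n] vw(3) nb(1) by auto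
  have "\<kappa> \<noteq> 0" using \<kappa> coprime_imp_nonzero[OF cop] nvec_eq_0[of u0] by auto
  \<comment> \<open>The supporting inequality of the facet uses an outer normal \<open>n\<close>;
    the sign is chosen so that \<open>u\<close> is a negative multiple of it and points
    inwards.\<close>
  define u where "u = (if \<kappa> < 0 then u0 else - u0)"
  define l where "l = (if \<kappa> < 0 then \<kappa> else - \<kappa>)"
  have l: "l < 0" using \<open>\<kappa> \<noteq> 0\<close> by (auto simp: l_def)
  have lf0: "lform u0 x = \<kappa> * (n \<bullet> x)" for x by (simp add: lform_nvec \<kappa>)
  have lf: "lform u x = l * (n \<bullet> x)" for x
    by (simp add: u_def l_def lform_uminus lf0)
  have cu: "coprime (u $ 1) (u $ 2)" using cop by (simp add: u_def)
  have ed: "edge u (l * b) = F" using l by (auto simp: edge_def lf nb(3))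
  have "(u, l * b) \<in> \<F>"
    unfolding facet_data_def
    using cu nb(2) l ed face lf by (auto simp: edge_of_def edge_def[symmetric] mult_left_mono_neg)
  then show ?thesis using ed by blast
qed

lemma frontier_facets:
  assumes "x \<in> frontier P"
  shows "\<exists>u c. (u, c) \<in> \<F> \<and> x \<in> edge u c"
proof -
  have "rel_frontier P = \<Union>{F. F facet_of P}"
    by (rule rel_frontier_of_polyhedron[OF polytope_imp_polyhedron[OF polytope_P]])
  moreover have "rel_frontier P = frontier P"
    using rel_frontier_nonempty_interior[OF int_P] .
  ultimately obtain F where "F facet_of P" "x \<in> F" using assms by blast
  then show ?thesis using facet_imp_facet_data by blast
qed

lemma edge_segment:
  assumes F: "(u, c) \<in> \<F>"
  obtains v s where "0 < s" "edge u c = closed_segment v (v + s *\<^sub>R dvec u)"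
    "v extreme_point_of P" "v + s *\<^sub>R dvec u extreme_point_of P"
proof -
  obtain x y where xy: "x \<in> edge u c" "y \<in> edge u c" "x \<noteq> y" using edge_two_points[OF F] .
  have ne: "edge u c \<noteq> {}" and ln: "\<And>x. x \<in> edge u c \<Longrightarrow> lform u x = c" using xy(1) by (auto simp: edge_def)
  obtain v s where v: "0 \<le> s" "edge u c = closed_segment v (v + s *\<^sub>R dvec u)"
    "v extreme_point_of edge u c" "v + s *\<^sub>R dvec u extreme_point_of edge u c"
    using compact_convex_on_line[OF compact_edge convex_edge ne ln facetD(2)[OF F]] .
  have "s \<noteq> 0" using xy v(2) by auto
  have face: "edge u c face_of P" using facetD(4)[OF F] by (simp add: edge_of_def)
  have "v extreme_point_of P" "v + s *\<^sub>R dvec u extreme_point_of P"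
    using v(3,4) extreme_point_of_face[OF face] by blast+
  moreover have "0 < s" using v(1) \<open>s \<noteq> 0\<close> by simp
  ultimately show thesis using that v(2) by blast
qed

lemma measure_frontier_pos: "0 < measure \<sigma> (frontier P)" and measure_P_pos: "0 < measure lborel P"
proof -
  have "frontier P \<noteq> {}"
    using int_P compact_P by (metis compact_imp_bounded bounded_interior frontier_eq_empty interior_empty not_bounded_UNIV)
  then obtain u c where F: "(u, c) \<in> \<F>" using frontier_facets by blast
  obtain v s where v: "0 < s" "edge u c = closed_segment v (v + s *\<^sub>R dvec u)" using edge_segment[OF F] .
  have "(LINT x:edge u c|\<sigma>. 0 \<bullet> x + 1) = s * ((0 \<bullet> v + 1) + (0 \<bullet> (v + s *\<^sub>R dvec u) + 1)) / 2"
    unfolding v(2) by (rule integral_segment[OF F]) (use v in auto)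
  then have m: "measure \<sigma> (edge u c) = s"
    using compact_edge by (simp add: set_lebesgue_integral_def borel_compact sets_dsigma)
  have "measure \<sigma> (edge u c) \<le> measure \<sigma> (frontier P)"
  proof (rule measure_mono_fmeasurable[OF edge_frontier[OF F]])
    show "edge u c \<in> sets \<sigma>" using compact_edge by (simp add: borel_compact sets_dsigma)
    have "emeasure \<sigma> (frontier P) \<le> emeasure \<sigma> UNIV" by (rule emeasure_mono) (simp_all add: sets_dsigma)
    then show "frontier P \<in> fmeasurable \<sigma>"
      using finite_dsigma by (intro fmeasurableI) (auto simp: sets_dsigma borel_closed less_top[symmetric] top_unique)
  qed
  then show "0 < measure \<sigma> (frontier P)" using m v(1) by simp
  show "0 < measure lborel P" by (rule measure_lborel_pos[OF compact_P int_P])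
qed

end

sublocale lattice_polygon \<subseteq> boundary_pair P "dsigma P" a
proof
  show "compact P" "convex P" by (rule compact_P convex_P)+
  show "sets \<sigma> = sets borel" "emeasure \<sigma> UNIV \<noteq> \<infinity>" "AE x in \<sigma>. x \<in> frontier P"
    by (rule sets_dsigma finite_dsigma AE_dsigma_frontier)+
  show "AE y in \<sigma>. b \<bullet> y + d \<noteq> 0" if "b \<noteq> 0" "x \<in> interior P" "b \<bullet> x + d = 0" for b d x
    by (rule AE_dsigma_line[OF that])
  show "0 < a" unfolding a_def using measure_frontier_pos measure_P_pos by simp
qed

context lattice_polygon
begin

lemma stab_functional_eq_L:
  assumes "continuous_on P f"
  shows "stab_functional \<sigma> P f = L P f"
proof -
  have t: "tame P f" by (intro tame_continuous assms) auto
  have tf: "tame (frontier P) f"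
    using closed_P by (intro tame_subset[OF t]) (auto simp: frontier_def borel_closed)
  have "(LINT x:frontier P|\<sigma>. f x) = (LINT x:P|\<sigma>. f x)"
    unfolding set_lebesgue_integral_def
  proof (rule integral_cong_AE)
    show "AE x in \<sigma>. indicator (frontier P) x *\<^sub>R f x = indicator P x *\<^sub>R f x"
      using AE_frontier
    proof eventually_elim
      case (elim x)
      then have "x \<in> P" using closed_P by (auto simp: frontier_def)
      then show ?case using elim by simp
    qed
  qed (use t tf in \<open>simp_all add: tame_def set_borel_measurable_def borel_measurable_\<sigma> del: real_scaleR_def\<close>)
  then show ?thesis unfolding stab_functional_def L_def a_def[symmetric] by simp
qed

definition meets :: "real^2 \<Rightarrow> real^2 \<Rightarrow> bool" where
  "meets p q \<longleftrightarrow> p \<noteq> q \<and> (\<exists>x\<in>interior P. side p q x = 0)"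

text \<open>With this orientation, moving \<open>p\<close> along its edge by a positive multiple of
  \<open>dvec u\<close> enlarges the set up to a null line.\<close>

definition below :: "real^2 \<Rightarrow> real^2 \<Rightarrow> (real^2) set" where
  "below p q = P \<inter> {x. side p q x < 0}"

lemma meets_swap: "meets q p \<longleftrightarrow> meets p q"
  by (auto simp: meets_def side_swap[of q p])

lemma meets_crease_fun:
  "meets p q \<longleftrightarrow> crease_fun (perp (q - p)) (- (perp (q - p) \<bullet> p))"
  unfolding meets_def crease_fun_def side_affine by auto

lemma meets_AE:
  assumes "meets p q"
  shows "AE x in \<sigma>. side p q x \<noteq> 0" "AE x in lborel. side p q x \<noteq> 0"
  using crease_fun_AE[of "perp (q - p)" "- (perp (q - p) \<bullet> p)"] assms
  unfolding meets_crease_fun side_affine by auto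

lemma below_eq: "below p q = P \<inter> {x. (- perp (q - p)) \<bullet> x + (- (- (perp (q - p) \<bullet> p))) > 0}"
  by (auto simp: below_def side_affine)

lemma below_borel: "below p q \<in> sets borel"
  unfolding below_eq by (intro sets.Int P_borel sets_halfplane)

lemma tame_below: "continuous_on UNIV f \<Longrightarrow> tame (below p q) f"
  by (intro tame_continuous below_borel) (auto simp: below_def elim: continuous_on_subset)

lemma triangle_coords:
  assumes "det2 (q - p) e \<noteq> 0" "s \<noteq> 0"
  shows "\<exists>\<alpha> \<beta>. x = p + (\<alpha> * s) *\<^sub>R e + \<beta> *\<^sub>R (q - p)"
proof -
  have d: "det2 (s *\<^sub>R e) (q - p) \<noteq> 0" using assms det2_commute[of e] by (simp add: det2_linear)
  have "p + (det2 (x - p) (q - p) / det2 (s *\<^sub>R e) (q - p) * s) *\<^sub>R e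
      + (det2 (s *\<^sub>R e) (x - p) / det2 (s *\<^sub>R e) (q - p)) *\<^sub>R (q - p) = p + (x - p)"
    unfolding add.assoc scaleR_scaleR[symmetric] det2_basis[OF d, of "x - p", symmetric] ..
  then show ?thesis by (metis add_diff_cancel_left' diff_add_cancel add.commute)
qed

text \<open>Moving one end of a chord along an edge adds a triangle, whose boundary mass lies on that edge.\<close>

lemma move_end_pos:
  fixes b :: "real^2" and d :: real
  defines "f \<equiv> \<lambda>x. b \<bullet> x + d"
  assumes F: "(u, c) \<in> \<F>" and p: "p \<in> edge u c" and p': "p' \<in> edge u c" "p' = p + s *\<^sub>R dvec u" and s: "0 < s"
    and q: "q \<in> frontier P" "c < lform u q" and m: "meets p q" "meets p' q"
  shows "L (below p' q) f = L (below p q) f + (s * (f p + f p') / 2 - a * (s * (lform u q - c) / 6 * (f p + f p' + f q)))"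
    and "below p q \<subseteq> below p' q \<union> {x. side p' q x = 0}"
proof -
  let ?e = "dvec u"
  define h where "h = lform u q - c"
  have h: "0 < h" using q(2) by (simp add: h_def)
  have pP: "p \<in> P" "p' \<in> P" "lform u p = c" using p p' by (auto simp: edge_def)
  have qP: "q \<in> P" "q \<notin> interior P" using q(1) closed_P by (auto simp: frontier_def)
  have de: "det2 (q - p) ?e = h" by (simp add: det2_dvec lform_diff pP(3) h_def)
  have de': "det2 ?e (q - p) = - h" using de det2_commute[of ?e] by simp
  define T where "T = convex hull {p, p', q}"
  have cT: "compact T" unfolding T_def by (intro finite_imp_compact_convex_hull) simp
  have TP: "T \<subseteq> P" unfolding T_def using pP qP by (intro hull_minimal convex_P) auto
  \<comment> \<open>Barycentric coordinates for the triangle \<open>p\<close>, \<open>p'\<close>,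
    \<open>q\<close>: \<open>\<alpha>\<close> and \<open>\<beta>\<close> are the weights of
    \<open>p'\<close> and \<open>q\<close>, and the two chords and the edge become
    \<open>\<alpha> = 0\<close>, \<open>\<alpha> + \<beta> = 1\<close> and
    \<open>\<beta> = 0\<close>.\<close>
  have coords: "\<exists>\<alpha> \<beta>. x = p + (\<alpha> * s) *\<^sub>R ?e + \<beta> *\<^sub>R (q - p)" for x
  proof -
    have "det2 (q - p) ?e \<noteq> 0" using de h by simp
    then show ?thesis using triangle_coords s by simp
  qed
  have s1: "side p q (p + (\<alpha> * s) *\<^sub>R ?e + \<beta> *\<^sub>R (q - p)) = s * h * \<alpha>" for \<alpha> \<beta>
    by (simp add: side_def det2_linear(2,6,9) add.assoc de)
  have s2: "side p' q (p + (\<alpha> * s) *\<^sub>R ?e + \<beta> *\<^sub>R (q - p)) = s * h * (\<alpha> + \<beta> - 1)" for \<alpha> \<beta>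
  proof -
    have "q - p' = (q - p) - s *\<^sub>R ?e" "p + (\<alpha> * s) *\<^sub>R ?e + \<beta> *\<^sub>R (q - p) - p' = ((\<alpha> - 1) * s) *\<^sub>R ?e + \<beta> *\<^sub>R (q - p)"
      by (simp_all add: p'(2) algebra_simps)
    moreover have "det2 (w - s *\<^sub>R ?e) (k *\<^sub>R ?e + \<beta> *\<^sub>R w) = k * det2 w ?e - s * \<beta> * det2 ?e w" for k w
      by (simp add: det2_def algebra_simps)
    ultimately show ?thesis unfolding side_def by (simp only: de de') (simp add: algebra_simps)
  qed
  have hx: "lform u (p + (\<alpha> * s) *\<^sub>R ?e + \<beta> *\<^sub>R (q - p)) - c = \<beta> * h" for \<alpha> \<beta>
    by (simp add: lform_add lform_scaleR lform_diff pP(3) h_def)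
  have comb: "p + (\<alpha> * s) *\<^sub>R ?e + \<beta> *\<^sub>R (q - p) = (1 - \<alpha> - \<beta>) *\<^sub>R p + \<alpha> *\<^sub>R p' + \<beta> *\<^sub>R q" for \<alpha> \<beta>
    by (simp add: p'(2) algebra_simps)
  have Tiff: "p + (\<alpha> * s) *\<^sub>R ?e + \<beta> *\<^sub>R (q - p) \<in> T \<longleftrightarrow> 0 \<le> \<alpha> \<and> 0 \<le> \<beta> \<and> \<alpha> + \<beta> \<le> 1" (is "?x \<in> T \<longleftrightarrow> ?R") for \<alpha> \<beta>
  proof
    assume "?x \<in> T"
    then obtain r1 r2 r3 where r: "?x = r1 *\<^sub>R p + r2 *\<^sub>R p' + r3 *\<^sub>R q" "0 \<le> r1" "0 \<le> r2" "0 \<le> r3" "r1 + r2 + r3 = 1"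
      unfolding T_def convex_hull_3 by auto
    have "r1 = 1 - r2 - r3" using r(5) by simp
    then have "?x = p + (r2 * s) *\<^sub>R ?e + r3 *\<^sub>R (q - p)" unfolding r(1) comb[of r2 r3] by simp
    then have "s * h * \<alpha> = s * h * r2" "\<beta> * h = r3 * h"
      by (metis s1, metis hx)
    then have "\<alpha> = r2" "\<beta> = r3" using s h by simp_all
    then show ?R using r by simp
  next
    assume ?R
    then show "?x \<in> T"
      unfolding T_def convex_hull_3 comb
      by (intro CollectI exI[of _ "1 - \<alpha> - \<beta>"] exI[of _ \<alpha>] exI[of _ \<beta>]) auto
  qed
  have hP: "0 \<le> \<beta>" if "p + (\<alpha> * s) *\<^sub>R ?e + \<beta> *\<^sub>R (q - p) \<in> P" for \<alpha> \<beta>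
  proof -
    have "0 \<le> \<beta> * h" using facetD(3)[OF F that] hx[of \<alpha> \<beta>] by linarith
    then show ?thesis using h by (simp add: zero_le_mult_iff)
  qed
  \<comment> \<open>The wedge opposite to the triangle at \<open>q\<close> contains no point of
    \<open>P\<close>: with such a point, \<open>q\<close> would be a positive combination of it,
    \<open>p\<close> and \<open>p'\<close>, hence interior.\<close>
  have noc: "\<not> (\<alpha> < 0 \<and> 1 < \<alpha> + \<beta>)" if xP: "p + (\<alpha> * s) *\<^sub>R ?e + \<beta> *\<^sub>R (q - p) \<in> P" (is "?x \<in> P") for \<alpha> \<beta>
  proof
    assume ab: "\<alpha> < 0 \<and> 1 < \<alpha> + \<beta>"
    have b: "0 < \<beta>" using ab by simp
    have "det2 (p' - p) (?x - p) = - (s * \<beta> * h)"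
    proof -
      have "p' - p = s *\<^sub>R ?e" "?x - p = (\<alpha> * s) *\<^sub>R ?e + \<beta> *\<^sub>R (q - p)" by (simp_all add: p'(2))
      moreover have "det2 (s *\<^sub>R ?e) ((\<alpha> * s) *\<^sub>R ?e + \<beta> *\<^sub>R w) = s * \<beta> * det2 ?e w" for w
        by (simp add: det2_def algebra_simps)
      ultimately show ?thesis by (simp only: de')
    qed
    then have "det2 (p' - p) (?x - p) \<noteq> 0" using s h b by simp
    then have "(1 - (1 - \<alpha>) / \<beta>) *\<^sub>R p + (- \<alpha> / \<beta>) *\<^sub>R p' + (1 / \<beta>) *\<^sub>R ?x \<in> interior P"
      by (rule interior_triangle[OF convex_P pP(1,2) xP]) (use ab b in \<open>auto simp: field_simps\<close>)
    also have "(1 - (1 - \<alpha>) / \<beta>) *\<^sub>R p + (- \<alpha> / \<beta>) *\<^sub>R p' + (1 / \<beta>) *\<^sub>R ?x = q"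
    proof -
      have "\<beta> *\<^sub>R ((1 - (1 - \<alpha>) / \<beta>) *\<^sub>R p + (- \<alpha> / \<beta>) *\<^sub>R p' + (1 / \<beta>) *\<^sub>R ?x) = \<beta> *\<^sub>R q"
      proof -
        have "\<beta> * (1 - (1 - \<alpha>) / \<beta>) = \<beta> - 1 + \<alpha>" "\<beta> * (- \<alpha> / \<beta>) = - \<alpha>" "\<beta> * (1 / \<beta>) = 1"
          using b by (simp_all add: field_simps)
        then show ?thesis
          unfolding scaleR_right_distrib scaleR_scaleR p'(2) by (simp only:) (simp add: algebra_simps)
      qed
      then show ?thesis using b by simp
    qed
    finally show False using qP by simp
  qed
  have key: "(x \<in> below p' q \<longleftrightarrow> x \<in> below p q \<union> T) \<and> \<not> (x \<in> below p q \<and> x \<in> T)"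
    if nz: "side p q x \<noteq> 0" "side p' q x \<noteq> 0" for x
  proof (cases "x \<in> P")
    case True
    obtain \<alpha> \<beta> where x: "x = p + (\<alpha> * s) *\<^sub>R ?e + \<beta> *\<^sub>R (q - p)" using coords by blast
    have sh: "0 < s * h" using s h by simp
    have n: "\<alpha> \<noteq> 0" "\<alpha> + \<beta> \<noteq> 1" using nz unfolding x s1 s2 by auto
    have b1: "x \<in> below p q \<longleftrightarrow> \<alpha> < 0" and b2: "x \<in> below p' q \<longleftrightarrow> \<alpha> + \<beta> < 1"
      using True s h unfolding below_def x by (auto simp: s1 s2 mult_less_0_iff)
    have b3: "x \<in> T \<longleftrightarrow> 0 \<le> \<alpha> \<and> 0 \<le> \<beta> \<and> \<alpha> + \<beta> \<le> 1" unfolding x by (rule Tiff)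
    have "0 \<le> \<beta>" "\<not> (\<alpha> < 0 \<and> 1 < \<alpha> + \<beta>)" using hP noc True unfolding x by blast+
    then show ?thesis using b1 b2 b3 n by auto
  next
    case False
    then show ?thesis using TP by (auto simp: below_def)
  qed
  show "below p q \<subseteq> below p' q \<union> {x. side p' q x = 0}"
  proof
    fix x assume x: "x \<in> below p q"
    then have "side p q x \<noteq> 0" by (simp add: below_def)
    then show "x \<in> below p' q \<union> {x. side p' q x = 0}" using key[of x] x by auto
  qed
  note ae = meets_AE[OF m(1)] meets_AE[OF m(2)]
  have fc: "continuous_on UNIV f" unfolding f_def by (intro continuous_intros)
  have tT: "tame T f" using tame_continuous_compact[OF cT TP] fc continuous_on_subset by blast
  have tB: "tame (below p q) f" "tame (below p' q) f" using tame_below[OF fc] by auto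
  have tU: "tame (below p q \<union> T) f"
    using below_borel cT TP fc by (intro tame_continuous) (auto simp: below_def borel_compact elim: continuous_on_subset)
  have "L (below p' q) f = L (below p q \<union> T) f"
  proof (rule L_null_cong)
    show "AE x in \<sigma>. x \<in> below p' q \<longleftrightarrow> x \<in> below p q \<union> T" using ae(1,3) by eventually_elim (use key in blast)
    show "AE x in lborel. x \<in> below p' q \<longleftrightarrow> x \<in> below p q \<union> T" using ae(2,4) by eventually_elim (use key in blast)
  qed (use tB tU in \<open>simp_all add: tame_def\<close>)
  also have "\<dots> = L (below p q) f + L T f"
  proof (rule L_Un[OF tB(1) tT])
    show "AE x in \<sigma>. \<not> (x \<in> below p q \<and> x \<in> T)" using ae(1,3) by eventually_elim (use key in blast)
    show "AE x in lborel. \<not> (x \<in> below p q \<and> x \<in> T)" using ae(2,4) by eventually_elim (use key in blast)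
  qed
  also have "L T f = s * (f p + f p') / 2 - a * (s * h / 6 * (f p + f p' + f q))"
  proof -
    let ?S = "closed_segment p p'"
    have ST: "?S \<subseteq> T" unfolding T_def by (simp add: segment_convex_hull hull_mono)
    have "(LINT x:T|\<sigma>. f x) = (LINT x:?S|\<sigma>. f x)"
      unfolding set_lebesgue_integral_def
    proof (rule integral_cong_AE)
      \<comment> \<open>A point of the triangle off both chords and off the edge is interior to
        \<open>P\<close>. All boundary mass of the triangle is thus on the segment from
        \<open>p\<close> to \<open>p'\<close>.\<close>
      have ST2: "x \<in> ?S" if xT: "x \<in> T" and fr: "x \<in> frontier P" and nz: "side p q x \<noteq> 0" "side p' q x \<noteq> 0" for x
      proof -
        obtain \<alpha> \<beta> where x: "x = p + (\<alpha> * s) *\<^sub>R ?e + \<beta> *\<^sub>R (q - p)" using coords by blast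
        have ab: "0 \<le> \<alpha>" "0 \<le> \<beta>" "\<alpha> + \<beta> \<le> 1" using xT Tiff unfolding x by blast+
        have n: "\<alpha> \<noteq> 0" "\<alpha> + \<beta> \<noteq> 1" using nz unfolding x s1 s2 by auto
        have "\<beta> = 0"
        proof (rule ccontr)
          assume "\<beta> \<noteq> 0"
          moreover have "det2 (p' - p) (q - p) \<noteq> 0" using s h de' by (simp add: p'(2) det2_linear(5))
          ultimately have "(1 - \<alpha> - \<beta>) *\<^sub>R p + \<alpha> *\<^sub>R p' + \<beta> *\<^sub>R q \<in> interior P"
            using ab n by (intro interior_triangle[OF convex_P pP(1,2) qP(1)]) auto
          then show False using fr unfolding x comb by (simp add: frontier_def)
        qed
        then show ?thesis using ab unfolding x p'(2) closed_segment_line by (auto intro!: exI[of _ \<alpha>])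
      qed
      show "AE x in \<sigma>. indicator T x *\<^sub>R f x = indicator ?S x *\<^sub>R f x"
        using ae(1) ae(3) AE_frontier
        by eventually_elim (use ST2 ST in \<open>auto simp: indicator_def\<close>)
      show "(\<lambda>x. indicator T x *\<^sub>R f x) \<in> borel_measurable \<sigma>"
        using tT by (simp add: tame_def set_borel_measurable_def borel_measurable_\<sigma> del: real_scaleR_def)
      have "tame ?S f" using tame_subset[OF tT ST] by (simp add: borel_closed)
      then show "(\<lambda>x. indicator ?S x *\<^sub>R f x) \<in> borel_measurable \<sigma>"
        by (simp add: tame_def set_borel_measurable_def borel_measurable_\<sigma> del: real_scaleR_def)
    qed
    also have "\<dots> = s * (f p + f p') / 2"
      unfolding f_def p'(2) by (rule integral_segment[OF F p]) (use p' s in auto)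
    finally have I1: "(LINT x:T|\<sigma>. f x) = s * (f p + f p') / 2" .
    have "\<bar>det2 (p' - p) (q - p)\<bar> = s * h"
    proof -
      have "p' - p = s *\<^sub>R ?e" by (simp add: p'(2))
      then show ?thesis using s h de' by (simp add: det2_linear(5) abs_mult)
    qed
    then have "(LINT x:T|lborel. f x) = s * h / 6 * (f p + f p' + f q)"
      unfolding T_def f_def by (simp only: integral_triangle)
    then show ?thesis unfolding L_def I1 by (simp only:)
  qed
  finally show "L (below p' q) f = L (below p q) f + (s * (f p + f p') / 2 - a * (s * (lform u q - c) / 6 * (f p + f p' + f q)))"
    unfolding h_def .
qed

end

lemma not_extreme_between:
  assumes "p + t *\<^sub>R e \<in> P" "p - t *\<^sub>R e \<in> P" "t \<noteq> 0" "e \<noteq> 0"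
  shows "\<not> p extreme_point_of P"
proof
  assume "p extreme_point_of P"
  then have "p \<notin> open_segment (p + t *\<^sub>R e) (p - t *\<^sub>R e)" using assms unfolding extreme_point_of_def by blast
  moreover have "p = midpoint (p + t *\<^sub>R e) (p - t *\<^sub>R e)" by (simp add: midpoint_def)
  moreover have "p + t *\<^sub>R e \<noteq> p - t *\<^sub>R e"
  proof
    assume "p + t *\<^sub>R e = p - t *\<^sub>R e"
    then have "(2 * t) *\<^sub>R e = 0" by (simp add: algebra_simps scaleR_2[symmetric] flip: scaleR_scaleR)
    then show False using assms by simp
  qed
  ultimately show False using midpoint_in_open_segment by metis
qed

context lattice_polygon
begin

lemma edge_in_frontier: "(u, c) \<in> \<F> \<Longrightarrow> p \<in> edge u c \<Longrightarrow> p \<in> frontier P"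
  using edge_frontier by blast

lemma edge_diff:
  assumes F: "(u, c) \<in> \<F>" and p: "p \<in> edge u c" "p' \<in> edge u c"
  obtains s where "p' = p + s *\<^sub>R dvec u"
proof -
  have "nvec u \<bullet> (p' - p) = 0" "nvec u \<bullet> dvec u = 0"
    using p by (simp_all add: lform_nvec[symmetric] lform_diff edge_def)
  moreover have "nvec u \<noteq> 0" "dvec u \<noteq> 0" using facetD(2)[OF F] by (simp_all add: nvec_eq_0 dvec_eq_0)
  ultimately obtain s where "p' - p = s *\<^sub>R dvec u"
    using orthogonal_imp_parallel by blast
  then show thesis using that[of s] by (simp add: algebra_simps)
qed

lemma nonvertex_neighbourhood:
  assumes F: "(u, c) \<in> \<F>" and p: "p \<in> edge u c" "\<not> p extreme_point_of P"
  obtains \<epsilon> where "0 < \<epsilon>" "\<And>t. \<bar>t\<bar> \<le> \<epsilon> \<Longrightarrow> p + t *\<^sub>R dvec u \<in> edge u c"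
    "\<And>t. \<bar>t\<bar> \<le> \<epsilon> \<Longrightarrow> \<not> (p + t *\<^sub>R dvec u) extreme_point_of P"
proof -
  obtain v s where v: "0 < s" "edge u c = closed_segment v (v + s *\<^sub>R dvec u)"
    "v extreme_point_of P" "v + s *\<^sub>R dvec u extreme_point_of P" using edge_segment[OF F] .
  obtain r where r: "p = v + (r * s) *\<^sub>R dvec u" "0 \<le> r" "r \<le> 1"
    using p(1) unfolding v(2) closed_segment_line by blast
  have "r \<noteq> 0" "r \<noteq> 1" using p(2) v(3,4) r(1) by auto
  then have r01: "0 < r" "r < 1" using r by auto
  \<comment> \<open>Half the distance to the nearer end, so that each point within
    \<open>\<epsilon>\<close> of \<open>p\<close> still has room \<open>\<epsilon>\<close> on both
    sides and is not a vertex.\<close>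
  define \<epsilon> where "\<epsilon> = s * min r (1 - r) / 2"
  have e0: "0 < \<epsilon>" using v(1) r01 by (simp add: \<epsilon>_def)
  have "min r (1 - r) * s \<le> r * s" "min r (1 - r) * s \<le> (1 - r) * s" using v(1) by (intro mult_right_mono; simp)+
  then have le: "2 * \<epsilon> \<le> r * s" "2 * \<epsilon> \<le> s - r * s"
    by (simp_all add: \<epsilon>_def algebra_simps)
  have mem: "p + t *\<^sub>R dvec u \<in> edge u c" if "\<bar>t\<bar> \<le> 2 * \<epsilon>" for t
  proof -
    have "p + t *\<^sub>R dvec u = v + ((r + t / s) * s) *\<^sub>R dvec u"
      using v(1) by (simp add: r(1) algebra_simps)
    moreover have "0 \<le> r + t / s" "r + t / s \<le> 1"
      using le that v(1) by (simp_all add: field_simps)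
    ultimately show ?thesis unfolding v(2) closed_segment_line by blast
  qed
  have "\<not> (p + t *\<^sub>R dvec u) extreme_point_of P" if "\<bar>t\<bar> \<le> \<epsilon>" for t
  proof (rule not_extreme_between[where t=\<epsilon> and e="dvec u"])
    have eq: "p + t *\<^sub>R dvec u + \<epsilon> *\<^sub>R dvec u = p + (t + \<epsilon>) *\<^sub>R dvec u" by (simp add: algebra_simps)
    have le: "\<bar>t + \<epsilon>\<bar> \<le> 2 * \<epsilon>" using that by linarith
    show "p + t *\<^sub>R dvec u + \<epsilon> *\<^sub>R dvec u \<in> P" unfolding eq using mem[OF le] edge_subset[of u c] by blast
    have eq: "p + t *\<^sub>R dvec u - \<epsilon> *\<^sub>R dvec u = p + (t - \<epsilon>) *\<^sub>R dvec u" by (simp add: algebra_simps)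
    have le: "\<bar>t - \<epsilon>\<bar> \<le> 2 * \<epsilon>" using that by linarith
    show "p + t *\<^sub>R dvec u - \<epsilon> *\<^sub>R dvec u \<in> P" unfolding eq using mem[OF le] edge_subset[of u c] by blast
  qed (use e0 facetD(2)[OF F] in \<open>auto simp: dvec_eq_0\<close>)
  moreover have "p + t *\<^sub>R dvec u \<in> edge u c" if "\<bar>t\<bar> \<le> \<epsilon>" for t using mem[of t] that e0 by simp
  ultimately show thesis using that e0 by blast
qed

text \<open>The midpoint of \<open>p\<close> and \<open>q\<close> is a positive combination of
  \<open>q\<close> and two edge points on either side of \<open>p\<close>.\<close>

lemma meets_nonvertex:
  assumes F: "(u, c) \<in> \<F>" and p: "p \<in> edge u c" "\<not> p extreme_point_of P" and q: "q \<in> P" "c < lform u q"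
  shows "meets p q"
proof -
  obtain \<epsilon> where e: "0 < \<epsilon>" "\<And>t. \<bar>t\<bar> \<le> \<epsilon> \<Longrightarrow> p + t *\<^sub>R dvec u \<in> edge u c"
    using nonvertex_neighbourhood[OF F p] by metis
  let ?p1 = "p + \<epsilon> *\<^sub>R dvec u" and ?p2 = "p - \<epsilon> *\<^sub>R dvec u"
  have m: "?p1 \<in> P" "?p2 \<in> P" using e(2)[of \<epsilon>] e(2)[of "-\<epsilon>"] e(1) edge_subset by auto
  have "det2 (?p2 - ?p1) (q - ?p1) = (2 * \<epsilon>) * (lform u q - c)"
  proof -
    have "?p2 - ?p1 = (- (2 * \<epsilon>)) *\<^sub>R dvec u" by (simp add: vec_eq_2)
    moreover have "det2 (dvec u) (q - ?p1) = - lform u (q - ?p1)" using det2_commute[of "dvec u"] det2_dvec by simp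
    ultimately have "det2 (?p2 - ?p1) (q - ?p1) = (2 * \<epsilon>) * lform u (q - ?p1)" by (simp only: det2_linear(5))
    moreover have "lform u (q - ?p1) = lform u q - c" using p(1) by (simp add: lform_diff lform_add lform_scaleR edge_def)
    ultimately show ?thesis by simp
  qed
  then have "det2 (?p2 - ?p1) (q - ?p1) \<noteq> 0" using e(1) q by simp
  then have "(1/4) *\<^sub>R ?p1 + (1/4) *\<^sub>R ?p2 + (1/2) *\<^sub>R q \<in> interior P"
    by (rule interior_triangle[OF convex_P m q(1)]) auto
  moreover have "(1/4) *\<^sub>R ?p1 + (1/4) *\<^sub>R ?p2 + (1/2) *\<^sub>R q = (1/2) *\<^sub>R p + (1/2) *\<^sub>R q"
    by (simp add: vec_eq_2 field_simps)
  moreover have "side p q ((1/2) *\<^sub>R p + (1/2) *\<^sub>R q) = 0"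
    by (simp add: side_def det2_def) (simp add: field_simps)
  moreover have "p \<noteq> q" using p q by (auto simp: edge_def)
  ultimately show ?thesis unfolding meets_def by metis
qed

text \<open>The formula changes sign when \<open>p\<close> and \<open>p'\<close> are exchanged, so
  it extends to negative \<open>s\<close>.\<close>

lemma move_end:
  fixes b :: "real^2" and d :: real
  defines "f \<equiv> \<lambda>x. b \<bullet> x + d"
  assumes F: "(u, c) \<in> \<F>" and p: "p \<in> edge u c" and p': "p' \<in> edge u c" "p' = p + s *\<^sub>R dvec u"
    and q: "q \<in> frontier P" "c < lform u q" and m: "meets p q" "meets p' q"
  shows "L (below p' q) f = L (below p q) f + (s * (f p + f p') / 2 - a * (s * (lform u q - c) / 6 * (f p + f p' + f q)))"
proof -
  consider "s = 0" | "0 < s" | "s < 0" by linarith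
  then show ?thesis
  proof cases
    case 1
    then show ?thesis using p' by simp
  next
    case 2
    then show ?thesis unfolding f_def by (rule move_end_pos(1)[OF F p p' _ q m])
  next
    case 3
    have "p = p' + (- s) *\<^sub>R dvec u" by (simp add: p'(2))
    moreover have "0 < - s" using 3 by simp
    ultimately have "L (below p q) f = L (below p' q) f + (- s * (f p' + f p) / 2 - a * (- s * (lform u q - c) / 6 * (f p' + f p + f q)))"
      unfolding f_def by (intro move_end_pos(1)[OF F p'(1) p _ _ q m(2,1)])
    moreover have "- s * (f p' + f p) / 2 - a * (- s * h / 6 * (f p' + f p + f q)) =
        - (s * (f p + f p') / 2 - a * (s * h / 6 * (f p + f p' + f q)))" for h
      by (simp add: field_simps)
    ultimately show ?thesis by simp
  qed
qed

end

section \<open>Zero chords of a semistable polygon\<close>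

locale semistable_polygon = lattice_polygon +
  assumes semistable: "K_semistable (dsigma P) P"
begin

lemma good_P: "good P"
  unfolding good_def
proof (intro conjI allI impI)
  fix g :: "real^2 \<Rightarrow> real" assume g: "convex_on UNIV g"
  have "convex_on P g" using convex_on_subset[OF g] convex_P by blast
  moreover have c: "continuous_on P g" by (rule continuous_on_convex_UNIV[OF g])
  ultimately have "0 \<le> stab_functional \<sigma> P g" using semistable by (simp add: K_semistable_def)
  then show "0 \<le> L P g" by (simp add: stab_functional_eq_L[OF c])
qed auto

lemma below_swap_eq: "below q p = P \<inter> {x. perp (q - p) \<bullet> x + (- (perp (q - p) \<bullet> p)) > 0}"
  unfolding below_def side_swap[of q p] side_affine[of p q] by auto

lemma L_below_split:
  assumes "meets p q" "continuous_on UNIV f"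
  shows "L P f = L (below q p) f + L (below p q) f"
  unfolding below_swap_eq[of q p] below_eq[of p q]
  by (rule L_split[OF good_P _ assms(2)]) (use assms(1) meets_crease_fun in blast)

lemma L_below_swap:
  assumes "meets p q"
  shows "L (below q p) (\<lambda>x. b \<bullet> x + d) = - L (below p q) (\<lambda>x. b \<bullet> x + d)"
  using L_below_split[OF assms continuous_on_affine[of UNIV b d]] good_affine[OF good_P, of b d] by simp

text \<open>The second end is moved after passing to the other half, where \<open>L\<close> of an
  affine function has the opposite sign. This is why \<open>q\<close> moves along
  \<open>- dvec w\<close> and why the second height is taken at the new end
  \<open>p'\<close>.\<close>

lemma move_both:
  fixes b :: "real^2" and d :: real
  defines "f \<equiv> \<lambda>x. b \<bullet> x + d"
  assumes F: "(u, c) \<in> \<F>" "(w, e) \<in> \<F>"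
    and p: "p \<in> edge u c" "p' \<in> edge u c" "p' = p + s *\<^sub>R dvec u"
    and q: "q \<in> edge w e" "q' \<in> edge w e" "q' = q - t *\<^sub>R dvec w"
    and pos: "c < lform u q" "e < lform w p'"
    and m: "meets p q" "meets p' q" "meets p' q'"
  shows "L (below p' q') f = L (below p q) f +
      (s * (f p + f p') / 2 - a * (s * (lform u q - c) / 6 * (f p + f p' + f q))) +
      (t * (f q + f q') / 2 - a * (t * (lform w p' - e) / 6 * (f q + f q' + f p')))"
proof -
  have 1: "L (below p' q) f = L (below p q) f + (s * (f p + f p') / 2 - a * (s * (lform u q - c) / 6 * (f p + f p' + f q)))"
    unfolding f_def by (rule move_end[OF F(1) p edge_in_frontier[OF F(2) q(1)] pos(1) m(1,2)])
  have q'': "q' = q + (- t) *\<^sub>R dvec w" by (simp add: q(3))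
  have "L (below q' p') f = L (below q p') f + ((- t) * (f q + f q') / 2 - a * ((- t) * (lform w p' - e) / 6 * (f q + f q' + f p')))"
    unfolding f_def
    by (rule move_end[OF F(2) q(1,2) q'' edge_in_frontier[OF F(1) p(2)] pos(2)]) (use m meets_swap in auto)
  moreover have "L (below q' p') f = - L (below p' q') f" "L (below q p') f = - L (below p' q) f"
    unfolding f_def using L_below_swap m(2,3) by blast+
  ultimately show ?thesis using 1 by simp
qed

text \<open>Asking for \<open>L\<close> to vanish on all affine functions below the chord is
  equivalent to its being a zero crease, and it is the form to which the formulas for moving ends
  apply: it yields polynomial equations for the ends.\<close>

definition zchord :: "real^2 \<Rightarrow> real^2 \<Rightarrow> bool" where
  "zchord p q \<longleftrightarrow> meets p q \<and> (\<forall>b d. L (below p q) (\<lambda>x. b \<bullet> x + d) = 0)"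

lemma zchord_swap: "zchord q p \<longleftrightarrow> zchord p q"
  unfolding zchord_def meets_swap[of q p] using L_below_swap by auto

lemma zero_fun_zchord:
  assumes z: "zero_fun b c" and pq: "p \<noteq> q" "b \<bullet> p + c = 0" "b \<bullet> q + c = 0"
  shows "zchord p q"
proof -
  have cr: "crease_fun b c" and z0: "L P (\<lambda>x. max (b \<bullet> x + c) 0) = 0" using z by (auto simp: zero_fun_def)
  have b: "b \<noteq> 0" using cr by (simp add: crease_fun_def)
  have "(q - p) \<bullet> perp (q - p) = 0" by (simp add: inner_2 algebra_simps)
  moreover have "(q - p) \<bullet> b = 0" using pq by (simp add: inner_commute[of "q - p"] inner_diff_right)
  ultimately obtain \<kappa> where \<kappa>: "perp (q - p) = \<kappa> *\<^sub>R b"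
    using orthogonal_imp_parallel[of "q - p"] pq(1) b by auto
  have "\<kappa> \<noteq> 0" using \<kappa> pq(1) perp_eq_0[of "q - p"] by auto
  have s: "side p q x = \<kappa> * (b \<bullet> x + c)" for x
  proof -
    have "c = - (b \<bullet> p)" using pq(2) by simp
    then show ?thesis unfolding side_affine \<kappa> by (simp add: algebra_simps)
  qed
  obtain x0 where x0: "x0 \<in> interior P" "b \<bullet> x0 + c = 0" using cr by (auto simp: crease_fun_def)
  have m: "meets p q" unfolding meets_def using pq(1) x0 s by auto
  note sp = L_split_crease[OF good_P cr z0]
  have "good (below p q)"
  proof (cases "0 < \<kappa>")
    case True
    then have "below p q = P \<inter> {x. (-b) \<bullet> x + (-c) > 0}" by (auto simp: below_def s mult_less_0_iff)
    then show ?thesis using sp(3) by simp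
  next
    case False
    then have "below p q = P \<inter> {x. b \<bullet> x + c > 0}" using \<open>\<kappa> \<noteq> 0\<close> by (auto simp: below_def s mult_less_0_iff)
    then show ?thesis using sp(2) by simp
  qed
  then show ?thesis using m good_affine unfolding zchord_def by blast
qed

lemma zchord_zero_fun:
  assumes z: "zchord p q"
  shows "zero_fun (perp (q - p)) (- (perp (q - p) \<bullet> p))"
proof -
  let ?b = "perp (q - p)" and ?c = "- (perp (q - p) \<bullet> p)"
  have m: "meets p q" and l: "\<And>b d. L (below p q) (\<lambda>x. b \<bullet> x + d) = 0" using z by (auto simp: zchord_def)
  have "continuous_on UNIV (\<lambda>x. max (?b \<bullet> x + ?c) 0)" by (intro continuous_intros)
  then have "L P (\<lambda>x. max (?b \<bullet> x + ?c) 0) = L (below q p) (\<lambda>x. max (?b \<bullet> x + ?c) 0) + L (below p q) (\<lambda>x. max (?b \<bullet> x + ?c) 0)"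
    by (rule L_below_split[OF m])
  also have "L (below q p) (\<lambda>x. max (?b \<bullet> x + ?c) 0) = L (below q p) (\<lambda>x. ?b \<bullet> x + ?c)"
    by (rule L_cong[OF below_borel]) (simp add: below_swap_eq)
  also have "\<dots> = 0" using L_below_swap[OF m, of ?b ?c] l[of ?b ?c] by linarith
  also have "L (below p q) (\<lambda>x. max (?b \<bullet> x + ?c) 0) = L (below p q) (\<lambda>x. 0 \<bullet> x + 0)"
    by (rule L_cong[OF below_borel]) (simp add: below_def side_affine)
  also have "\<dots> = 0" by (rule l)
  finally show ?thesis using m meets_crease_fun by (simp add: zero_fun_def)
qed

lemma zchord_good:
  assumes z: "zchord p q"
  shows "good (below p q)" "good (below q p)"
proof -
  have "good (below q p)" if "zchord p q" for p q
    unfolding below_swap_eq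
    using zchord_zero_fun[OF that] L_split_crease(2)[OF good_P] unfolding zero_fun_def by blast
  then show "good (below p q)" "good (below q p)" using z zchord_swap by blast+
qed

text \<open>The far half of \<open>P\<close> is good, so \<open>L\<close> is nonnegative on the
  positive part of an affine function that cuts off the thin triangle \<open>p\<close>,
  \<open>p'\<close>, \<open>q\<close>. The formula for moving an end evaluates this to
  \<open>s * s * h * (3 - a * h) / 6\<close>, where \<open>h\<close> is the height of
  \<open>q\<close> over the edge; this is the origin of the constant 3.\<close>

lemma corner_bound:
  assumes z: "zchord p q" and F: "(u, c) \<in> \<F>" and p: "p \<in> edge u c" "\<not> p extreme_point_of P"
    and q: "q \<in> frontier P" "c < lform u q"
  shows "a * (lform u q - c) \<le> 3"
proof -
  have qP: "q \<in> P" using q(1) closed_P by (auto simp: frontier_def)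
  have m: "meets p q" and l: "\<And>b d. L (below p q) (\<lambda>x. b \<bullet> x + d) = 0" using z by (auto simp: zchord_def)
  obtain s where s: "0 < s" "\<And>t. \<bar>t\<bar> \<le> s \<Longrightarrow> p + t *\<^sub>R dvec u \<in> edge u c"
    "\<And>t. \<bar>t\<bar> \<le> s \<Longrightarrow> \<not> (p + t *\<^sub>R dvec u) extreme_point_of P" using nonvertex_neighbourhood[OF F p] by metis
  define p' where "p' = p + s *\<^sub>R dvec u"
  have p': "p' \<in> edge u c" "\<not> p' extreme_point_of P" using s(2)[of s] s(3)[of s] s(1) by (auto simp: p'_def)
  have m': "meets p' q" by (rule meets_nonvertex[OF F p' qP q(2)])
  define h where "h = lform u q - c"
  \<comment> \<open>This affine function vanishes along the moved chord from \<open>p'\<close> to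
    \<open>q\<close> and is positive at \<open>p\<close>.\<close>
  define b d where "b = - perp (q - p')" and "d = perp (q - p') \<bullet> p'"
  define g where "g = (\<lambda>x. b \<bullet> x + d)"
  have g: "g x = - side p' q x" for x by (simp add: g_def b_def d_def side_affine)
  have gc: "continuous_on UNIV g" unfolding g_def by (rule continuous_on_affine)
  have gp: "g p = s * h" "g p' = 0" "g q = 0"
  proof -
    have "side p' q p = - s * det2 (q - p') (dvec u)"
      by (simp add: side_def p'_def det2_linear)
    also have "det2 (q - p') (dvec u) = h" using p' by (simp add: det2_dvec lform_diff h_def edge_def)
    finally show "g p = s * h" by (simp add: g)
  qed (simp_all add: g)
  let ?B = "below q p \<inter> {x. b \<bullet> x + d > 0}"
  have sB: "?B \<in> sets borel" by (intro sets.Int below_borel sets_halfplane)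
  have BP: "?B \<subseteq> P" by (auto simp: below_def)
  have gP: "continuous_on P g" using gc continuous_on_subset by blast
  have tB: "tame ?B g" by (rule tame_continuous[OF sB BP gP])
  have tb: "tame (below p q) g" "tame (below p' q) g" using tame_below[OF gc] by auto
  have sub: "below p q \<subseteq> below p' q \<union> {x. side p' q x = 0}"
    by (rule move_end_pos(2)[OF F p(1) p'(1) _ s(1) q m m']) (simp add: p'_def)
  have "0 \<le> L (below q p) (\<lambda>x. max (b \<bullet> x + d) 0)" by (rule good_crease[OF zchord_good(2)[OF z]])
  also have "\<dots> = L (below q p) (\<lambda>x. indicator {x. b \<bullet> x + d > 0} x * g x)"
    by (rule L_cong[OF below_borel]) (auto simp: g_def indicator_def)
  also have "\<dots> = L ?B g" by (rule L_restrict)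
  \<comment> \<open>Beyond the old chord \<open>g\<close> is positive exactly between the two
    chords, so the integral is a difference of two half polygons.\<close>
  also have "L ?B g = L (below p' q) g - L (below p q) g"
  proof -
    have gb: "b \<bullet> x + d = - side p' q x" for x using g[of x] by (simp add: g_def)
    have "L (below p' q) g = L (below p q \<union> ?B) g"
    proof (rule L_null_cong)
      have eq: "x \<in> below p' q \<longleftrightarrow> x \<in> below p q \<union> ?B" if "side p q x \<noteq> 0" "side p' q x \<noteq> 0" for x
        using that sub by (auto simp: below_def gb side_swap[of q p])
      show "AE x in \<sigma>. x \<in> below p' q \<longleftrightarrow> x \<in> below p q \<union> ?B"
        using meets_AE(1)[OF m] meets_AE(1)[OF m'] by eventually_elim (rule eq)
      show "AE x in lborel. x \<in> below p' q \<longleftrightarrow> x \<in> below p q \<union> ?B"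
        using meets_AE(2)[OF m] meets_AE(2)[OF m'] by eventually_elim (rule eq)
      have "tame (below p q \<union> ?B) g"
        using BP by (intro tame_continuous gP sets.Un sB below_borel) (auto simp: below_def)
      then show "set_borel_measurable borel (below p q \<union> ?B) g" by (simp add: tame_def)
    qed (use tb in \<open>simp add: tame_def\<close>)
    also have "\<dots> = L (below p q) g + L ?B g"
      by (rule L_Un[OF tb(1) tB]) (auto simp: below_def side_swap[of q p])
    finally show ?thesis by simp
  qed
  also have "\<dots> = s * (g p + g p') / 2 - a * (s * (lform u q - c) / 6 * (g p + g p' + g q))"
    using move_end[OF F p(1) p'(1) p'_def q m m', of b d] by (simp add: g_def)
  also have "\<dots> = (s * s * h) * (3 - a * h) / 6" unfolding gp by (simp add: h_def field_simps)
  finally have "0 \<le> (s * s * h) * (3 - a * h)" by simp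
  moreover have "0 < s * s * h" using s(1) q(2) by (simp add: h_def)
  ultimately have "0 \<le> 3 - a * h" by (simp add: zero_le_mult_iff)
  then show ?thesis by (simp add: h_def)
qed

text \<open>Equal normals are impossible: the inequality of the second edge, which is sharp at
  \<open>q\<close>, would fail at \<open>p\<close>.\<close>

lemma opposite_facet:
  assumes F: "(u, c) \<in> \<F>" "(w, e) \<in> \<F>" and p: "p \<in> edge u c" and q: "q \<in> edge w e"
    and pos: "c < lform u q" and D: "idet u w = 0"
  shows "w = - u"
proof -
  have "w = u \<or> w = - u" using coprime_parallel facetD(1) F D by blast
  moreover have "w \<noteq> u"
  proof
    assume "w = u"
    then have "e = lform u q" "e \<le> lform u p" using q facetD(3)[OF F(2), of p] p by (auto simp: edge_def)
    then show False using pos p by (simp add: edge_def)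
  qed
  ultimately show ?thesis by blast
qed

lemma zchord_off_edge:
  assumes "meets p q" "(u, c) \<in> \<F>" "p \<in> edge u c" "q \<in> P"
  shows "c < lform u q"
proof (rule ccontr)
  assume "\<not> c < lform u q"
  then have qc: "lform u q = c" using facetD(3)[OF assms(2,4)] by simp
  obtain x where x: "x \<in> interior P" "side p q x = 0" "p \<noteq> q" using assms(1) by (auto simp: meets_def)
  have "det2 (x - p) (q - p) = 0" using x(2) det2_commute[of "x - p" "q - p"] by (simp add: side_def)
  moreover have "q - p \<noteq> 0" using x(3) by simp
  ultimately obtain t where t: "x - p = t *\<^sub>R (q - p)" using det2_zero_imp_parallel by blast
  have "lform u x - lform u p = t * (lform u q - lform u p)"
    unfolding lform_diff[symmetric] t lform_scaleR ..
  then have "lform u x = c" using qc assms(3) by (simp add: edge_def)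
  then show False using facet_interior[OF assms(2) x(1)] by simp
qed

text \<open>The change of \<open>L\<close> from one chord to the other vanishes for the test
  functions 1, \<open>lform u - c\<close> and \<open>lform w - e\<close>. Elimination leaves a
  product whose only factor that can vanish is \<open>D\<close>, the determinant of the two normals;
  so the edges are parallel, and then the equations give height \<open>2 / a\<close> and equal
  displacements.\<close>

theorem two_zchords:
  assumes F: "(u, c) \<in> \<F>" "(w, e) \<in> \<F>"
    and p: "p \<in> edge u c" "p' \<in> edge u c" "\<not> p' extreme_point_of P"
    and q: "q \<in> edge w e" "q' \<in> edge w e"
    and z: "zchord p q" "zchord p' q'"
    and disj: "\<And>x. x \<in> P \<Longrightarrow> side p q x = 0 \<Longrightarrow> side p' q' x \<noteq> 0"
  shows "w = - u \<and> a * (lform u q - c) = 2 \<and> (\<exists>s. s \<noteq> 0 \<and> p' = p + s *\<^sub>R dvec u \<and> q' = q + s *\<^sub>R dvec u)"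
proof -
  obtain s where s: "p' = p + s *\<^sub>R dvec u" using edge_diff[OF F(1) p(1,2)] .
  obtain t' where t': "q' = q + t' *\<^sub>R dvec w" using edge_diff[OF F(2) q] .
  define t where "t = - t'"
  have t: "q' = q - t *\<^sub>R dvec w" by (simp add: t' t_def)
  have P: "p \<in> P" "p' \<in> P" "q \<in> P" "q' \<in> P" using p q edge_subset by blast+
  have m: "meets p q" "meets p' q'" using z by (auto simp: zchord_def)
  have pos: "c < lform u q" "c < lform u q'" "e < lform w p" "e < lform w p'"
    using zchord_off_edge[OF m(1) F(1) p(1) P(3)] zchord_off_edge[OF m(2) F(1) p(2) P(4)]
      zchord_off_edge[OF _ F(2) q(1) P(1)] zchord_off_edge[OF _ F(2) q(2) P(2)] m meets_swap by blast+
  have m3: "meets p' q" by (rule meets_nonvertex[OF F(1) p(2,3) P(3) pos(1)])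
  define h k D where "h = lform u q - c" and "k = lform w p - e" and "D = real_of_int (idet u w)"
  have hk: "0 < h" "0 < k" using pos by (auto simp: h_def k_def)
  have hq': "lform u q' - c = h + t * D"
    by (simp add: t lform_diff lform_scaleR lform_dvec h_def D_def)
  have kp': "lform w p' - e = k + s * D"
    by (simp add: s lform_add lform_scaleR lform_dvec k_def D_def idet_def algebra_simps)
  have hk': "0 < h + t * D" "0 < k + s * D" using pos hq' kp' by linarith+
  have sp': "side p q p' = s * h"
    by (simp add: side_def s det2_linear det2_dvec) (use p(1) in \<open>simp add: det2_dvec[symmetric] det2_linear h_def edge_def\<close>)
  have sq': "side p q q' = t * k"
  proof -
    have "side p q q' = det2 (q - p) (q' - q) + det2 (q - p) (q - p)"
      by (simp add: side_def flip: det2_linear(2))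
    also have "det2 (q - p) (q' - q) = - t * lform w (q - p)"
    proof -
      have "q' - q = (- t) *\<^sub>R dvec w" by (simp add: t)
      then show ?thesis by (simp only: det2_linear(6) det2_dvec)
    qed
    finally show ?thesis using q(1) by (simp add: det2_linear(9) lform_diff k_def edge_def algebra_simps)
  qed
  have nz: "side p q p' \<noteq> 0" "side p q q' \<noteq> 0" using disj[OF P(2)] disj[OF P(4)] by auto
  \<comment> \<open>Disjoint chords: both ends of the second one lie on the same side of the first.
    This makes the displacements \<open>s\<close> and \<open>t\<close> have the same sign.\<close>
  have "0 < side p q p' * side p q q'"
  proof (rule ccontr)
    assume "\<not> ?thesis"
    then have neg: "side p q p' * side p q q' < 0" using nz by (simp add: less_le not_less)
    define r where "r = side p q p' / (side p q p' - side p q q')"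
    have ne: "side p q p' \<noteq> side p q q'" using neg by (auto simp: mult_less_0_iff)
    have r: "0 \<le> r" "r \<le> 1" using neg ne by (auto simp: r_def mult_less_0_iff field_simps)
    let ?x = "(1 - r) *\<^sub>R p' + r *\<^sub>R q'"
    have "?x \<in> P" using P r by (intro convexD[OF convex_P]) auto
    moreover have "side p q ?x = (1 - r) * side p q p' + r * side p q q'"
      by (simp add: side_affine inner_simps algebra_simps)
    then have "side p q ?x = side p q p' - r * (side p q p' - side p q q')" by (simp add: algebra_simps)
    then have "side p q ?x = 0" using ne by (simp add: r_def)
    moreover have "side p' q' ?x = 0" by (simp add: side_def det2_def) (simp add: algebra_simps)
    ultimately show False using disj by blast
  qed
  then have "0 < (s * t) * (h * k)" by (simp add: sp' sq' mult_ac)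
  then have st: "0 < s * t" using zero_less_mult_pos2[OF _ mult_pos_pos[OF hk]] by blast
  have eq: "(s * (f p + f p') / 2 - a * (s * h / 6 * (f p + f p' + f q))) +
      (t * (f q + f q') / 2 - a * (t * (k + s * D) / 6 * (f q + f q' + f p'))) = 0" if "f = (\<lambda>x. b \<bullet> x + d)" for f b d
    using move_both[OF F p(1,2) s q t pos(1,4) m(1) m3 m(2), of b d] z
    unfolding that h_def kp'[symmetric] by (simp add: zchord_def)
  have E1: "s + t - a * (s * h + t * (k + s * D)) / 2 = 0"
    using eq[of "\<lambda>x. 0 \<bullet> x + 1" 0 1] by (simp add: field_simps)
  have fu: "lform u p - c = 0" "lform u p' - c = 0" and fw: "lform w q - e = 0" "lform w q' - e = 0" using p q by (auto simp: edge_def)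
  have E2: "- a * (s * h / 6 * h) + (t * (h + (h + t * D)) / 2 - a * (t * (k + s * D) / 6 * (h + (h + t * D)))) = 0"
    using eq[of "\<lambda>x. lform u x - c" "nvec u" "- c"] unfolding fu hq' h_def[symmetric] by (simp add: lform_nvec)
  have E3: "(s * (k + (k + s * D)) / 2 - a * (s * h / 6 * (k + (k + s * D)))) - a * (t * (k + s * D) / 6 * (k + s * D)) = 0"
    using eq[of "\<lambda>x. lform w x - e" "nvec w" "- e"] unfolding fw kp' k_def[symmetric] by (simp add: lform_nvec)
  define m1 m2 where "m1 = h + t * D / 2" and "m2 = k + s * D / 2"
  \<comment> \<open>The weights are the mean heights \<open>m2\<close>, \<open>m1\<close> and minus
    their product. With them the boundary terms, those without \<open>a\<close>, cancel and an area
    term with the factor \<open>D\<close> squared remains.\<close>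
  have "(k + s * D / 2) * (- a * (s * h / 6 * h) + (t * (h + (h + t * D)) / 2 - a * (t * (k + s * D) / 6 * (h + (h + t * D)))))
     + (h + t * D / 2) * ((s * (k + (k + s * D)) / 2 - a * (s * h / 6 * (k + (k + s * D)))) - a * (t * (k + s * D) / 6 * (k + s * D)))
     - 2 * ((h + t * D / 2) * (k + s * D / 2)) * ((s + t - a * (s * h + t * (k + s * D)) / 2) / 2)
     = - a * s * t * D\<^sup>2 * (s * (h + t * D / 2) + t * (k + s * D / 2)) / 24"
    by (simp add: field_simps power2_eq_square)
  then have "a * (s * t) * D\<^sup>2 * (s * m1 + t * m2) = 0"
    unfolding E1 E2 E3 m1_def m2_def by simp
  moreover have "0 < m1" "0 < m2" using hk hk' by (auto simp: m1_def m2_def)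
  then have "s * m1 + t * m2 \<noteq> 0"
  proof (cases "0 < s")
    case True
    then have "0 < t" using st by (simp add: zero_less_mult_iff)
    then show ?thesis using True \<open>0 < m1\<close> \<open>0 < m2\<close> by (simp add: add_pos_pos less_imp_neq[symmetric])
  next
    case False
    then have "s < 0" "t < 0" using st by (auto simp: zero_less_mult_iff)
    then have "s * m1 < 0" "t * m2 < 0" using \<open>0 < m1\<close> \<open>0 < m2\<close> by (simp_all add: mult_neg_pos)
    then show ?thesis by linarith
  qed
  ultimately have D0: "D = 0" using st a_pos by auto
  then have w: "w = - u" using opposite_facet[OF F p(1) q(1) pos(1)] by (simp add: D_def)
  have kh: "k = h" using p(1) q(1) by (simp add: k_def h_def w lform_uminus edge_def)
  have "s \<noteq> 0" "t \<noteq> 0" using st by auto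
  have "s + t \<noteq> 0" using st by (auto simp: add_eq_0_iff2 mult_less_0_iff zero_less_mult_iff)
  have "(s + t) * (2 - a * h) = 0" using E1 D0 kh by (simp add: algebra_simps)
  then have ah: "a * h = 2" using \<open>s + t \<noteq> 0\<close> by simp
  have "h * (6 * t - (a * h) * (s + 2 * t)) = 0" using E2 unfolding D0 kh by (simp add: field_simps)
  then have "t = s" using hk ah by simp
  have "q' = q + s *\<^sub>R dvec u"
  proof -
    have "dvec w = - dvec u" by (simp add: w vec_eq_2)
    then show ?thesis using t \<open>t = s\<close> by simp
  qed
  then show ?thesis using w ah s \<open>s \<noteq> 0\<close> by (auto simp: h_def)
qed

text \<open>At height \<open>2 / a\<close> the boundary and area terms combine to a multiple of
  \<open>(f p - f p') + (f q' - f q)\<close>, which vanishes for affine \<open>f\<close> when both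
  ends are moved by the same vector.\<close>

lemma translate_zchord:
  assumes F: "(u, c) \<in> \<F>" "(- u, e) \<in> \<F>" and p: "p \<in> edge u c" "p + s *\<^sub>R dvec u \<in> edge u c"
    and q: "q \<in> edge (- u) e" "q + s *\<^sub>R dvec u \<in> edge (- u) e" and z: "zchord p q"
    and w: "a * (lform u q - c) = 2" and m: "meets (p + s *\<^sub>R dvec u) q" "meets (p + s *\<^sub>R dvec u) (q + s *\<^sub>R dvec u)"
  shows "zchord (p + s *\<^sub>R dvec u) (q + s *\<^sub>R dvec u)"
proof -
  let ?p = "p + s *\<^sub>R dvec u" and ?q = "q + s *\<^sub>R dvec u"
  have "dvec (- u) = - dvec u" by (simp add: vec_eq_2)
  then have q': "?q = q - s *\<^sub>R dvec (- u)" by simp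
  have "lform u q - c \<noteq> 0" using w by auto
  moreover have "q \<in> P" using q(1) edge_subset by blast
  ultimately have pos: "c < lform u q" using facetD(3)[OF F(1), of q] by linarith
  have hq: "lform (- u) ?p - e = lform u q - c" using p(2) q(1) by (simp add: edge_def lform_uminus)
  then have pos2: "e < lform (- u) ?p" using pos by linarith
  have mpq: "meets p q" using z by (simp add: zchord_def)
  have "L (below ?p ?q) (\<lambda>x. b \<bullet> x + d) = 0" for b d
  proof -
  define f where "f = (\<lambda>x. b \<bullet> x + d)"
  have z0: "L (below p q) f = 0" using z by (simp add: zchord_def f_def)
  have "L (below ?p ?q) f = L (below p q) f +
      (s * (f p + f ?p) / 2 - a * (s * (lform u q - c) / 6 * (f p + f ?p + f q))) +
      (s * (f q + f ?q) / 2 - a * (s * (lform (- u) ?p - e) / 6 * (f q + f ?q + f ?p)))"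
    unfolding f_def by (rule move_both[OF F p refl q q' pos pos2 mpq m])
  also have "\<dots> = (s * (f p + f ?p) / 2 - (a * (lform u q - c)) * s / 6 * (f p + f ?p + f q)) +
      (s * (f q + f ?q) / 2 - (a * (lform u q - c)) * s / 6 * (f q + f ?q + f ?p))"
  proof -
    have "a * (s * h / 6 * y) = (a * h) * s / 6 * y" for h y by simp
    then show ?thesis unfolding hq z0 by (simp only: add_0)
  qed
  also have "\<dots> = s * ((f p - f ?p) + (f ?q - f q)) / 6" unfolding w by (simp add: field_simps)
  also have "\<dots> = 0" by (simp add: f_def inner_simps)
  finally show ?thesis by (simp add: f_def)
  qed
  then show ?thesis using m(2) by (simp add: zchord_def)
qed

end

section \<open>Rationality of isolated creases\<close>

text \<open>Used to compare coefficients after powers of an irrational \<open>A\<close> have been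
  reduced to a rational combination of 1 and \<open>A\<close>.\<close>

lemma Rats_sqrt_free_conj:
  fixes A r0 r1 :: real
  assumes "r0 \<in> \<rat>" "r1 \<in> \<rat>" "A \<notin> \<rat>" "r1 * A + r0 = 0"
  shows "r1 = 0 \<and> r0 = 0"
proof (cases "r1 = 0")
  case False
  then have "A = - r0 / r1" using assms(4) by (simp add: field_simps add_eq_0_iff2)
  then show ?thesis using assms by simp
qed (use assms in simp)

text \<open>In the coordinates \<open>A = 1 - a h'(p) / 2\<close>, \<open>B = 1 - a h(q) / 2\<close> of a chord \<open>pq\<close>, the vanishing of \<open>L\<close>
  on affine functions below the chord gives three equations with rational coefficients. If \<open>A\<close> were
  irrational, both cubics obtained by eliminating \<open>B\<close> would be divisible by its minimal polynomial,
  which is excluded by the bounds on \<open>A\<close> and \<open>B\<close>.\<close>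

lemma chord_equations_rational:
  fixes A B g k l :: real
  assumes rat: "g \<in> \<rat>" "k \<in> \<rat>" "l \<in> \<rat>"
    and eq: "A * B = g" "A\<^sup>2 + (2 * g - 2) * A + 2 * B = k" "B\<^sup>2 + (2 * g - 2) * B + 2 * A = l"
    and bd: "- 1 / 2 \<le> A" "A < 1" "- 1 / 2 \<le> B" "B < 1"
  shows "A \<in> \<rat>"
proof (rule ccontr)
  assume irr: "A \<notin> \<rat>"
  have A0: "A \<noteq> 0" using irr by auto
  have g0: "g \<noteq> 0"
  proof
    assume "g = 0"
    then have "B = 0" using eq(1) A0 by simp
    then have "2 * A = l" using eq(3) by simp
    then have "A = l / 2" by simp
    moreover have "l / 2 \<in> \<rat>" using rat(3) by simp
    ultimately show False using irr by blast
  qed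
  \<comment> \<open>Multiplication by \<open>A\<close>, and by its square for the next cubic, turns
    \<open>B\<close> into \<open>g\<close> and leaves equations in \<open>A\<close> alone.\<close>
  have p1: "A ^ 3 + (2 * g - 2) * A\<^sup>2 - k * A + 2 * g = 0"
  proof -
    have "A * (A\<^sup>2 + (2 * g - 2) * A + 2 * B) = k * A" using eq(2) by simp
    then show ?thesis using eq(1) by (simp add: algebra_simps power2_eq_square power3_eq_cube)
  qed
  have p2: "2 * A ^ 3 - l * A\<^sup>2 + (2 * g - 2) * g * A + g\<^sup>2 = 0"
  proof -
    have "A\<^sup>2 * (B\<^sup>2 + (2 * g - 2) * B + 2 * A) = l * A\<^sup>2" using eq(3) by simp
    moreover have "A\<^sup>2 * (B\<^sup>2 + (2 * g - 2) * B + 2 * A) = (A * B)\<^sup>2 + (2 * g - 2) * (A * B) * A + 2 * A ^ 3"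
      by (simp add: algebra_simps power2_eq_square power3_eq_cube)
    ultimately show ?thesis unfolding eq(1) by simp
  qed
  \<comment> \<open>The second cubic minus twice the first: the leading terms cancel and
    \<open>A\<close> satisfies a rational quadratic equation.\<close>
  define q2 q1 q0 where "q2 = - l - 2 * (2 * g - 2)" and "q1 = (2 * g - 2) * g + 2 * k" and "q0 = g\<^sup>2 - 4 * g"
  have q: "q2 * A\<^sup>2 + q1 * A + q0 = 0"
    using p1 p2 by (simp add: q2_def q1_def q0_def algebra_simps)
  have qrat: "q2 \<in> \<rat>" "q1 \<in> \<rat>" "q0 \<in> \<rat>" using rat by (auto simp: q2_def q1_def q0_def)
  have g1: "g < 1"
  proof (cases "0 < A")
    case True
    then have "A * B < A * 1" using bd by (intro mult_strict_left_mono) auto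
    then show ?thesis using eq(1) bd by simp
  next
    case False
    have "\<bar>A\<bar> * \<bar>B\<bar> \<le> (1 / 2) * 1" using bd False by (intro mult_mono) auto
    then show ?thesis using eq(1) by (simp add: abs_mult[symmetric])
  qed
  have q2: "q2 \<noteq> 0"
  proof
    assume "q2 = 0"
    then have "q0 = 0" using Rats_sqrt_free_conj[OF qrat(3,2) irr] q by simp
    then have "g * (g - 4) = 0" by (simp add: q0_def power2_eq_square algebra_simps)
    then show False using g0 g1 by simp
  qed
  \<comment> \<open>Trace and norm of \<open>A\<close>: its minimal polynomial has coefficients
    \<open>- s\<close> and \<open>p\<close>.\<close>
  define s p where "s = - q1 / q2" and "p = q0 / q2"
  have sprat: "s \<in> \<rat>" "p \<in> \<rat>" using qrat by (auto simp: s_def p_def)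
  have A2: "A\<^sup>2 = s * A - p" using q q2 by (simp add: s_def p_def field_simps)
  have A3: "A ^ 3 = (s\<^sup>2 - p) * A - s * p"
  proof -
    have "A ^ 3 = A * A\<^sup>2" by (simp add: power2_eq_square power3_eq_cube)
    also have "\<dots> = A * (s * A - p)" by (simp only: A2)
    also have "\<dots> = s * A\<^sup>2 - p * A" by (simp add: algebra_simps power2_eq_square)
    also have "\<dots> = (s\<^sup>2 - p) * A - s * p" unfolding A2 by (simp add: algebra_simps power2_eq_square)
    finally show ?thesis .
  qed
  have "(s\<^sup>2 - p + (2 * g - 2) * s - k) * A + (2 * g - s * p - (2 * g - 2) * p) = 0"
    using p1 unfolding A2 A3 by (simp add: algebra_simps)
  then have c1: "2 * g = s * p + (2 * g - 2) * p"
    using Rats_sqrt_free_conj[OF _ _ irr, of "2 * g - s * p - (2 * g - 2) * p" "s\<^sup>2 - p + (2 * g - 2) * s - k"] rat sprat by simp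
  have "(2 * (s\<^sup>2 - p) - l * s + (2 * g - 2) * g) * A + (g\<^sup>2 - 2 * s * p + l * p) = 0"
    using p2 unfolding A2 A3 by (simp add: algebra_simps)
  then have c2: "2 * (s\<^sup>2 - p) - l * s + (2 * g - 2) * g = 0" "g\<^sup>2 - 2 * s * p + l * p = 0"
    using Rats_sqrt_free_conj[OF _ _ irr, of "g\<^sup>2 - 2 * s * p + l * p" "2 * (s\<^sup>2 - p) - l * s + (2 * g - 2) * g"] rat sprat by simp_all
  have p0: "p \<noteq> 0" using c2(2) g0 by auto
  have s_eq: "s * p = 2 * g - (2 * g - 2) * p" using c1 by simp
  have "p * (2 * (s\<^sup>2 - p) - l * s + (2 * g - 2) * g) + s * (g\<^sup>2 - 2 * s * p + l * p) = 0"
    using c2 by simp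
  then have "s * g\<^sup>2 - 2 * p\<^sup>2 + (2 * g - 2) * g * p = 0"
    by (simp add: algebra_simps power2_eq_square)
  then have "p * (s * g\<^sup>2 - 2 * p\<^sup>2 + (2 * g - 2) * g * p) = 0" by simp
  then have "(s * p) * g\<^sup>2 - 2 * p ^ 3 + (2 * g - 2) * g * p\<^sup>2 = 0"
    by (simp add: algebra_simps power2_eq_square power3_eq_cube)
  \<comment> \<open>Eliminating \<open>l\<close> and \<open>s\<close> leaves a cubic equation for
    the norm \<open>p\<close>. The root \<open>p = g\<close> means that \<open>B\<close> is the
    conjugate of \<open>A\<close>; the quadratic factor is reduced to this case below.\<close>
  then have "(p - g) * (p\<^sup>2 + (2 * g - g\<^sup>2) * p + g\<^sup>2) = 0"
    unfolding s_eq by (simp add: algebra_simps power2_eq_square power3_eq_cube)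
  then consider "p = g" | "p \<noteq> g" "p\<^sup>2 + (2 * g - g\<^sup>2) * p + g\<^sup>2 = 0" by auto
  then have pg: "p = g"
  proof cases
    case 2
    have "p * A\<^sup>2 = (2 * g - (2 * g - 2) * p) * A - p\<^sup>2"
    proof -
      have "p * A\<^sup>2 = (s * p) * A - p\<^sup>2" unfolding A2 by (simp add: algebra_simps power2_eq_square)
      then show ?thesis unfolding s_eq .
    qed
    define \<rho> where "\<rho> = p / g"
    have pr: "p = \<rho> * g" using g0 by (simp add: \<rho>_def)
    have r0: "\<rho> \<noteq> 0" using p0 pr by auto
    have "g\<^sup>2 * (\<rho>\<^sup>2 + (2 - g) * \<rho> + 1) = 0" using 2(2) unfolding pr by (simp add: algebra_simps power2_eq_square)
    then have r2: "\<rho>\<^sup>2 + (2 - g) * \<rho> + 1 = 0" using g0 by simp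
    then have gr: "g * \<rho> = (\<rho> + 1)\<^sup>2" by (simp add: algebra_simps power2_eq_square)
    have "g * (\<rho> * A\<^sup>2 - ((2 - (2 * g - 2) * \<rho>) * A - g * \<rho>\<^sup>2)) = 0"
      using \<open>p * A\<^sup>2 = _\<close> unfolding pr by (simp add: algebra_simps power2_eq_square)
    then have "\<rho> * A\<^sup>2 = (2 - (2 * g - 2) * \<rho>) * A - g * \<rho>\<^sup>2" using g0 by simp
    then have "A * (\<rho> * A) = A * ((2 - (2 * g - 2) * \<rho>) - B * \<rho>\<^sup>2)"
      unfolding eq(1)[symmetric] by (simp add: algebra_simps power2_eq_square)
    then have "\<rho> * A = (2 - (2 * g - 2) * \<rho>) - B * \<rho>\<^sup>2" by (simp only: mult_left_cancel[OF A0])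
    then have "\<rho> * A = 2 - 2 * (g * \<rho>) + 2 * \<rho> - B * \<rho>\<^sup>2" by (simp add: algebra_simps)
    then have "\<rho> * A + B * \<rho>\<^sup>2 + 2 * \<rho> + 2 * \<rho>\<^sup>2 = 0" unfolding gr by (simp add: algebra_simps power2_eq_square)
    then have "\<rho> * (A + B * \<rho> + 2 + 2 * \<rho>) = 0" by (simp add: algebra_simps power2_eq_square)
    then have "A + B * \<rho> + 2 + 2 * \<rho> = 0" using r0 mult_eq_0_iff by blast
    moreover have "- \<rho> * (B + 2) = - (B * \<rho>) - 2 * \<rho>" by (simp add: algebra_simps)
    ultimately have ab: "A + 2 = - \<rho> * (B + 2)" by linarith
    \<comment> \<open>Expressed in \<open>A\<close> and \<open>B\<close> the quadratic factor
      becomes the square of \<open>A * B + A + B\<close>. Its vanishing gives a second quadratic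
      equation for \<open>A\<close>, and comparison with the minimal polynomial yields
      \<open>p = g\<close> again.\<close>
    have "(A * B * (A + 2) * (B + 2) + (A - B)\<^sup>2) * \<rho> = 0"
    proof -
      have "- (\<rho> + 1) * (B + 2) = - \<rho> * (B + 2) - (B + 2)" by (simp add: algebra_simps)
      then have "A - B = - (\<rho> + 1) * (B + 2)" using ab by linarith
      then have "(A - B)\<^sup>2 = (\<rho> + 1)\<^sup>2 * (B + 2)\<^sup>2" by (simp only: power_mult_distrib power2_minus)
      moreover have "A * B * (A + 2) * (B + 2) = - (g * \<rho>) * (B + 2)\<^sup>2"
        unfolding ab eq(1) by (simp add: power2_eq_square)
      ultimately show ?thesis unfolding gr by simp
    qed
    then have "A * B * (A + 2) * (B + 2) + (A - B)\<^sup>2 = 0" using r0 by simp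
    moreover have "A * B * (A + 2) * (B + 2) + (A - B)\<^sup>2 = (A * B + A + B)\<^sup>2"
      by (simp add: algebra_simps power2_eq_square)
    ultimately have "A * B + A + B = 0" by simp
    then have "A * (A * B + A + B) = 0" by simp
    then have "A * (A * B) + A * A + A * B = 0" by (simp only: distrib_left)
    then have "A * g + A * A + g = 0" unfolding eq(1) .
    moreover have "A * A = s * A - p" using A2 by (simp add: power2_eq_square)
    ultimately have "(g + s) * A + (g - p) = 0" by (simp add: algebra_simps)
    then have "g - p = 0" using Rats_sqrt_free_conj[OF _ _ irr, of "g - p" "g + s"] rat sprat by simp
    then show ?thesis by simp
  qed
  have "s * g = 2 * g - (2 * g - 2) * g" using s_eq pg by simp
  then have "(s - (4 - 2 * g)) * g = 0" by (simp add: algebra_simps)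
  then have s: "s = 4 - 2 * g" using g0 by simp
  have AA: "A * A = s * A - p" using A2 by (simp add: power2_eq_square)
  have "A * (A + B) = A * A + A * B" by (simp add: algebra_simps)
  also have "\<dots> = A * s" unfolding AA eq(1) pg by simp
  finally have "A + B = s" by (simp only: mult_left_cancel[OF A0])
  then have "A + B = 4 - 2 * (A * B)" by (simp add: s eq(1))
  moreover have "(1 - A) * (1 - B) = 1 - (A + B) + A * B" by (simp add: algebra_simps)
  \<comment> \<open>Both factors \<open>1 - A\<close> and \<open>1 - B\<close> are positive and at
    most 3/2 by the corner bound, so twice their product is too small for this identity.\<close>
  ultimately have 3: "3 * ((1 - A) + (1 - B)) = 2 * ((1 - A) * (1 - B))" by algebra
  have "(1 - A) * (1 - B) \<le> (3 / 2) * (1 - B)" "(1 - A) * (1 - B) \<le> (1 - A) * (3 / 2)"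
    using bd by (intro mult_right_mono mult_left_mono; simp)+
  moreover have "0 < 1 - A" "0 < 1 - B" using bd by auto
  moreover have False if "0 < x" "0 < y" "z \<le> (3 / 2) * y" "z \<le> x * (3 / 2)" "3 * (x + y) = 2 * z" for x y z :: real
    using that by simp
  ultimately show False using 3 by blast
qed

section \<open>Integrals over polygons with rational vertices\<close>

definition rat_vec :: "real^2 \<Rightarrow> bool" where
  "rat_vec x \<longleftrightarrow> (\<forall>i. x $ i \<in> \<rat>)"

lemma rat_vec_2: "rat_vec x \<longleftrightarrow> x $ 1 \<in> \<rat> \<and> x $ 2 \<in> \<rat>"
  by (simp add: rat_vec_def forall_2)

lemma rat_vec_arith:
  "rat_vec x \<Longrightarrow> rat_vec y \<Longrightarrow> rat_vec (x + y)" "rat_vec x \<Longrightarrow> rat_vec y \<Longrightarrow> rat_vec (x - y)"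
  "r \<in> \<rat> \<Longrightarrow> rat_vec x \<Longrightarrow> rat_vec (r *\<^sub>R x)" "rat_vec (nvec u)" "rat_vec (dvec u)"
  "rat_vec x \<Longrightarrow> rat_vec y \<Longrightarrow> x \<bullet> y \<in> \<rat>" "rat_vec x \<Longrightarrow> rat_vec y \<Longrightarrow> det2 x y \<in> \<rat>"
  by (auto simp: rat_vec_2 inner_2 det2_def)

lemma segment_of_line:
  fixes S :: "(real^2) set"
  assumes S: "compact S" "convex S" "S \<noteq> {}" and line: "\<And>x. x \<in> S \<Longrightarrow> n \<bullet> x = c" and n: "n \<noteq> 0"
  shows "\<exists>x y. S = closed_segment x y \<and> x extreme_point_of S \<and> y extreme_point_of S"
proof -
  let ?e = "perp n"
  have "?e \<noteq> 0" "n \<bullet> ?e = 0" using n by (simp_all add: inner_2)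
  then have e: "?e \<noteq> 0" "0 < ?e \<bullet> ?e" "n \<bullet> ?e = 0" by simp_all
  have cont: "continuous_on S (\<lambda>y. ?e \<bullet> y)" by (intro continuous_intros)
  obtain x where x: "x \<in> S" "\<And>y. y \<in> S \<Longrightarrow> ?e \<bullet> x \<le> ?e \<bullet> y"
    using continuous_attains_inf[OF S(1,3) cont] by blast
  obtain y where y: "y \<in> S" "\<And>z. z \<in> S \<Longrightarrow> ?e \<bullet> z \<le> ?e \<bullet> y"
    using continuous_attains_sup[OF S(1,3) cont] by blast
  have rep: "\<exists>t. z = x + t *\<^sub>R ?e" if "z \<in> S" for z
  proof -
    have "n \<bullet> (z - x) = 0" using line[OF that] line[OF x(1)] by (simp add: inner_diff_right)
    then obtain t where "z - x = t *\<^sub>R ?e" using orthogonal_imp_parallel[OF n _ e(3,1)] by blast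
    then have "z = x + t *\<^sub>R ?e" by (simp add: algebra_simps)
    then show ?thesis by blast
  qed
  obtain s where s: "y = x + s *\<^sub>R ?e" using rep[OF y(1)] by blast
  have sub: "S \<subseteq> closed_segment x y"
  proof
    fix z assume z: "z \<in> S"
    obtain t where t: "z = x + t *\<^sub>R ?e" using rep[OF z] by blast
    have t0: "0 \<le> t" using x(2)[OF z] e(2) by (simp add: t inner_add_right zero_le_mult_iff)
    have ts: "t \<le> s" using y(2)[OF z] e(2) by (simp add: t s inner_add_right)
    show "z \<in> closed_segment x y"
    proof (cases "s = 0")
      case True
      then show ?thesis using t0 ts by (simp add: t s)
    next
      case False
      then have "z = x + ((t / s) * s) *\<^sub>R ?e" "0 \<le> t / s" "t / s \<le> 1" using t0 ts by (simp_all add: t field_simps)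
      then show ?thesis unfolding s closed_segment_line by blast
    qed
  qed
  have "closed_segment x y \<subseteq> S" using x(1) y(1) S(2) by (rule closed_segment_subset)
  then have eq: "S = closed_segment x y" using sub by blast
  have "x extreme_point_of S" "y extreme_point_of S" unfolding eq by (simp_all add: extreme_point_of_segment)
  then show ?thesis using eq by blast
qed

lemma facet_segment:
  fixes Q :: "(real^2) set"
  assumes Q: "polytope Q" "interior Q \<noteq> {}" and F: "F facet_of Q"
  shows "\<exists>n c v w. n \<noteq> 0 \<and> (\<forall>x\<in>Q. n \<bullet> x \<le> c) \<and> F = Q \<inter> {x. n \<bullet> x = c} \<and>
    F = closed_segment v w \<and> v extreme_point_of Q \<and> w extreme_point_of Q"
proof -
  have cQ: "compact Q" "convex Q" using Q(1) polytope_imp_compact polytope_imp_convex by blast+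
  have face: "F face_of Q" "F \<noteq> {}" using F by (auto simp: facet_of_def)
  obtain n c where nb: "n \<noteq> 0" "Q \<subseteq> {x. n \<bullet> x \<le> c}" "F = Q \<inter> {x. n \<bullet> x = c}"
    using facet_of_polyhedron[OF polytope_imp_polyhedron[OF Q(1)] F] by metis
  have cF: "compact F" "convex F"
    using face_of_imp_compact[OF cQ(2,1) face(1)] face_of_imp_convex[OF face(1)] cQ by auto
  have ln: "\<And>x. x \<in> F \<Longrightarrow> n \<bullet> x = c" using nb(3) by simp
  obtain v w where vw: "F = closed_segment v w" "v extreme_point_of F" "w extreme_point_of F"
    using segment_of_line[OF cF face(2) ln nb(1)] by blast
  have "v extreme_point_of Q" "w extreme_point_of Q" using vw(2,3) extreme_point_of_face[OF face(1)] by blast+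
  then show ?thesis using nb vw(1) by blast
qed

text \<open>A polygon is the union of the triangles spanned by an interior point and its edges.\<close>

lemma integral_cone_decomposition:
  fixes Q :: "(real^2) set" and f :: "real^2 \<Rightarrow> real"
  assumes Q: "polytope Q" "interior Q \<noteq> {}" and o: "o' \<in> interior Q" and f: "continuous_on UNIV f"
  shows "(LINT x:Q|lborel. f x) = (\<Sum>F\<in>{F. F facet_of Q}. LINT x:convex hull (insert o' F)|lborel. f x)"
proof -
  have cQ: "compact Q" "convex Q" using Q(1) polytope_imp_compact polytope_imp_convex by blast+
  let ?T = "\<lambda>F. convex hull (insert o' F)"
  have oQ: "o' \<in> Q" using o interior_subset by blast
  have cF: "compact F" "convex F" "F \<noteq> {}" "F \<subseteq> Q" if "F facet_of Q" for F
  proof -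
    have "F face_of Q" "F \<noteq> {}" using that by (auto simp: facet_of_def)
    then show "compact F" "convex F" "F \<noteq> {}" "F \<subseteq> Q"
      using face_of_imp_compact[OF cQ(2,1)] face_of_imp_convex cQ face_of_imp_subset by blast+
  qed
  have cT: "compact (?T F)" if "F facet_of Q" for F
    using cF(1)[OF that] by (intro compact_convex_hull compact_insert)
  have T: "\<exists>r y. 0 \<le> r \<and> r \<le> 1 \<and> y \<in> F \<and> x = o' + r *\<^sub>R (y - o')" if F: "F facet_of Q" and x: "x \<in> ?T F" for F x
  proof -
    have "convex hull F = F" using cF(2)[OF F] by (rule convex_hull_eq[THEN iffD2])
    then have "x \<in> {(1 - r) *\<^sub>R o' + r *\<^sub>R y |y r. 0 \<le> r \<and> r \<le> 1 \<and> y \<in> F}"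
      using x cF(3)[OF F] unfolding convex_hull_insert_alt by simp
    then obtain y r where y: "y \<in> F" "0 \<le> r" "r \<le> 1" "x = (1 - r) *\<^sub>R o' + r *\<^sub>R y" by blast
    have "x = o' + r *\<^sub>R (y - o')" unfolding y(4) by (simp add: algebra_simps)
    then show ?thesis using y(1-3) by blast
  qed
  have "Q = (\<Union>F\<in>{F. F facet_of Q}. ?T F)"
  proof (intro equalityI subsetI)
    fix x assume x: "x \<in> Q"
    have "\<exists>y\<in>frontier Q. \<exists>r. 0 \<le> r \<and> r \<le> 1 \<and> x = o' + r *\<^sub>R (y - o')"
    proof (cases "x = o'")
      case True
      have "frontier Q \<noteq> {}"
        using Q cQ by (metis compact_imp_bounded frontier_eq_empty interior_empty not_bounded_UNIV)
      then show ?thesis using True by (metis add.right_neutral ex_in_conv order_refl scale_zero_left zero_le_one)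
    next
      case False
      obtain d where d: "0 < d" "o' + d *\<^sub>R (x - o') \<in> frontier Q"
        using ray_to_frontier[OF compact_imp_bounded[OF cQ(1)] o, of "x - o'"] False by auto
      have "1 \<le> d"
      proof (rule ccontr)
        assume "\<not> 1 \<le> d"
        then have "o' + d *\<^sub>R (x - o') \<in> interior Q" using open_segment_interior[OF cQ(2) o x] d by simp
        then show False using d(2) by (simp add: frontier_def)
      qed
      then have "x = o' + (1 / d) *\<^sub>R ((o' + d *\<^sub>R (x - o')) - o')" "1 / d \<le> 1" "0 \<le> 1 / d" by simp_all
      then show ?thesis using d(2) by blast
    qed
    then obtain y r where y: "y \<in> frontier Q" "0 \<le> r" "r \<le> 1" "x = o' + r *\<^sub>R (y - o')" by blast
    have "rel_frontier Q = \<Union>{F. F facet_of Q}"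
      by (rule rel_frontier_of_polyhedron[OF polytope_imp_polyhedron[OF Q(1)]])
    moreover have "rel_frontier Q = frontier Q" using rel_frontier_nonempty_interior[OF Q(2)] .
    ultimately obtain F where F: "F facet_of Q" "y \<in> F" using y(1) by blast
    have "x = (1 - r) *\<^sub>R o' + r *\<^sub>R y" using y(4) by (simp add: algebra_simps)
    moreover have "(1 - r) *\<^sub>R o' + r *\<^sub>R y \<in> ?T F"
      using y F by (intro convexD[OF convex_convex_hull] hull_inc) auto
    ultimately show "x \<in> (\<Union>F\<in>{F. F facet_of Q}. ?T F)" using F(1) by blast
  next
    fix x assume "x \<in> (\<Union>F\<in>{F. F facet_of Q}. ?T F)"
    then obtain F where "F facet_of Q" "x \<in> ?T F" by blast
    moreover have "?T F \<subseteq> Q" if "F facet_of Q" for F using cF(4)[OF that] oQ by (intro hull_minimal cQ) auto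
    ultimately show "x \<in> Q" by blast
  qed
  moreover have "(LINT x:(\<Union>F\<in>{F. F facet_of Q}. ?T F)|lborel. f x) = (\<Sum>F\<in>{F. F facet_of Q}. LINT x:?T F|lborel. f x)"
  proof (rule set_integral_finite_UN_AE)
    show "finite {F. F facet_of Q}" by (rule finite_polytope_facets[OF Q(1)])
    show "?T F \<in> sets lborel" if "F \<in> {F. F facet_of Q}" for F using cT that by (simp add: borel_compact)
    show "set_integrable lborel (?T F) f" if "F \<in> {F. F facet_of Q}" for F
      unfolding set_integrable_def
      using borel_integrable_compact[OF cT continuous_on_subset[OF f subset_UNIV]] that
      by (simp add: indicator_def if_distrib cong: if_cong)
    fix F G assume FG: "F \<in> {F. F facet_of Q}" "G \<in> {F. F facet_of Q}"
    show "AE x in lborel. x \<in> ?T F \<and> x \<in> ?T G \<longrightarrow> F = G"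
    proof (cases "F = G")
      case False
      have F: "F facet_of Q" and G: "G facet_of Q" using FG by auto
      obtain n c where n: "n \<noteq> 0" "\<forall>x\<in>Q. n \<bullet> x \<le> c" "F = Q \<inter> {x. n \<bullet> x = c}"
        using facet_segment[OF Q F] by blast
      obtain n' c' where n': "n' \<noteq> 0" "\<forall>x\<in>Q. n' \<bullet> x \<le> c'" "G = Q \<inter> {x. n' \<bullet> x = c'}"
        using facet_segment[OF Q G] by blast
      have lt: "m \<bullet> o' < e" if "m \<noteq> 0" "\<forall>x\<in>Q. m \<bullet> x \<le> e" for m e
      proof -
        obtain \<epsilon> where \<epsilon>: "0 < \<epsilon>" "cball o' \<epsilon> \<subseteq> Q" using o mem_interior_cball by blast
        let ?y = "o' + (\<epsilon> / norm m) *\<^sub>R m"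
        have "?y \<in> Q" using \<epsilon> that(1) by (intro subsetD[OF \<epsilon>(2)]) (simp add: dist_norm)
        then have "m \<bullet> ?y \<le> e" using that(2) by blast
        moreover have "m \<bullet> ?y = m \<bullet> o' + \<epsilon> / norm m * (m \<bullet> m)" by (simp add: inner_add_right)
        moreover have "0 < \<epsilon> / norm m * (m \<bullet> m)" using \<epsilon> that(1) by simp
        ultimately show ?thesis by linarith
      qed
      have one: "y = z" if "y \<in> F \<inter> G" "z \<in> F \<inter> G" for y z
      proof (rule ccontr)
        assume "y \<noteq> z"
        then have yz: "y - z \<noteq> 0" by simp
        have "(y - z) \<bullet> n = 0" "(y - z) \<bullet> n' = 0"
          using that n(3) n'(3) by (simp_all add: inner_commute[of "y - z"] inner_diff_right)
        then obtain t where t: "n' = t *\<^sub>R n" using orthogonal_imp_parallel[OF yz] n(1) by blast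
        have c': "c' = t * c" using that n(3) n'(3) by (auto simp: t)
        have "t \<noteq> 0" using t n'(1) by auto
        have "n \<bullet> x = c \<longleftrightarrow> n' \<bullet> x = c'" for x using \<open>t \<noteq> 0\<close> by (simp add: t c')
        then show False using n(3) n'(3) False by blast
      qed
      \<comment> \<open>Distinct facets share at most one point \<open>z\<close>, so the cones over
        them overlap only on the null line through \<open>o'\<close> and \<open>z\<close>. Without a
        common point any \<open>z\<close> other than \<open>o'\<close> will do.\<close>
      obtain z where z: "z \<noteq> o'" "\<And>y. y \<in> F \<inter> G \<Longrightarrow> y = z"
      proof (cases "F \<inter> G = {}")
        case True
        have "o' + n \<noteq> o'" using n(1) by simp
        then show thesis using that True by blast
      next
        case ne: False
        then obtain z where z: "z \<in> F \<inter> G" by blast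
        then have "z \<noteq> o'" using n(3) lt[OF n(1,2)] by auto
        then show thesis using that one z by blast
      qed
      have "perp (z - o') \<noteq> 0" using z(1) by simp
      from AE_lborel_line[OF this, of "- (perp (z - o') \<bullet> o')"]
      show ?thesis
      proof eventually_elim
        case (elim x)
        then have nz: "side o' z x \<noteq> 0" by (simp add: side_affine)
        have "\<not> (x \<in> ?T F \<and> x \<in> ?T G)"
        proof
          assume "x \<in> ?T F \<and> x \<in> ?T G"
          then obtain r y r' y' where r: "0 \<le> r" "y \<in> F" "x = o' + r *\<^sub>R (y - o')"
            and r': "0 \<le> r'" "y' \<in> G" "x = o' + r' *\<^sub>R (y' - o')" using T[OF F] T[OF G] by meson
          have pos: "0 < c - n \<bullet> o'" "0 < c' - n' \<bullet> o'" using lt n(1,2) n'(1,2) by simp_all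
          have yQ: "y \<in> Q" "y' \<in> Q" "n \<bullet> y = c" "n' \<bullet> y' = c'" using r(2) r'(2) n(3) n'(3) by auto
          have xo: "r *\<^sub>R (y - o') = r' *\<^sub>R (y' - o')" using r(3) r'(3) by simp
          \<comment> \<open>The supporting inequality of each facet bounds one radial parameter by
            the other, so a common point of the cones comes from a common point of the
            facets.\<close>
          have "r * (c - n \<bullet> o') = n \<bullet> (r *\<^sub>R (y - o'))" by (simp add: inner_diff_right yQ)
          also have "\<dots> = r' * (n \<bullet> y' - n \<bullet> o')" unfolding xo by (simp add: inner_diff_right)
          also have "\<dots> \<le> r' * (c - n \<bullet> o')" using n(2) yQ r'(1) by (intro mult_left_mono) auto
          finally have "r \<le> r'" using pos by simp
          have "r' * (c' - n' \<bullet> o') = n' \<bullet> (r' *\<^sub>R (y' - o'))" by (simp add: inner_diff_right yQ)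
          also have "\<dots> = r * (n' \<bullet> y - n' \<bullet> o')" unfolding xo[symmetric] by (simp add: inner_diff_right)
          also have "\<dots> \<le> r * (c' - n' \<bullet> o')" using n'(2) yQ r(1) by (intro mult_left_mono) auto
          finally have "r' \<le> r" using pos by simp
          then have req: "r = r'" using \<open>r \<le> r'\<close> by simp
          have "r \<noteq> 0" using nz r(3) by auto
          then have "y = y'" using xo req by simp
          then have "y = z" using z(2) r(2) r'(2) by blast
          then have "side o' z x = 0" by (simp add: side_def r(3) det2_linear)
          then show False using nz by simp
        qed
        then show ?case by blast
      qed
    qed simp
  qed
  ultimately show ?thesis by simp
qed

text \<open>The centroid of three vertices that are not collinear.\<close>

lemma rational_polygon_interior_point:
  assumes "rational_polygon Q"
  shows "\<exists>x\<in>interior Q. rat_vec x"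
proof -
  have Q: "polytope Q" "interior Q \<noteq> {}" "\<And>v. v extreme_point_of Q \<Longrightarrow> rat_vec v"
    using assms by (auto simp: rational_polygon_def rat_vec_def)
  have cQ: "compact Q" "convex Q" using Q(1) polytope_imp_compact polytope_imp_convex by blast+
  let ?E = "{v. v extreme_point_of Q}"
  have hull: "Q = convex hull ?E" by (rule Krein_Milman_Minkowski[OF cQ])
  have "?E \<noteq> {}" using hull Q(2) by auto
  then obtain v where v: "v \<in> ?E" by blast
  have sub: "\<exists>x\<in>?E. n \<bullet> x \<noteq> n \<bullet> v" if n: "n \<noteq> 0" for n
  proof (rule ccontr)
    assume "\<not> ?thesis"
    then have "?E \<subseteq> {x. n \<bullet> x = n \<bullet> v}" by blast
    then have "Q \<subseteq> {x. n \<bullet> x = n \<bullet> v}"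
      using hull hull_minimal[of ?E "{x. n \<bullet> x = n \<bullet> v}" convex] convex_hyperplane by metis
    then have "interior Q \<subseteq> interior {x. n \<bullet> x = n \<bullet> v}" by (rule interior_mono)
    then show False using Q(2) interior_hyperplane[OF n] by simp
  qed
  obtain w where w: "w \<in> ?E" "w \<noteq> v" using sub[of "axis 1 1"] by (auto simp: axis_eq_0_iff)
  obtain x where x: "x \<in> ?E" "perp (w - v) \<bullet> x \<noteq> perp (w - v) \<bullet> v" using sub[of "perp (w - v)"] w by auto
  have mem: "v \<in> Q" "w \<in> Q" "x \<in> Q" using v w x by (auto simp: extreme_point_of_def)
  have "det2 (w - v) (x - v) \<noteq> 0" using x(2) by (simp add: det2_perp inner_diff_right)
  then have "(1/3) *\<^sub>R v + (1/3) *\<^sub>R w + (1/3) *\<^sub>R x \<in> interior Q"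
    by (rule interior_triangle[OF cQ(2) mem]) auto
  moreover have "rat_vec ((1/3) *\<^sub>R v + (1/3) *\<^sub>R w + (1/3) *\<^sub>R x)"
    using v w x Q(3) by (intro rat_vec_arith) auto
  ultimately show ?thesis by blast
qed

lemma integral_rational_polygon:
  assumes Q: "rational_polygon Q" and f: "rat_vec b" "d \<in> \<rat>"
  shows "(LINT x:Q|lborel. b \<bullet> x + d) \<in> \<rat>"
proof -
  have Q': "polytope Q" "interior Q \<noteq> {}" "\<And>v. v extreme_point_of Q \<Longrightarrow> rat_vec v"
    using Q by (auto simp: rational_polygon_def rat_vec_def)
  obtain o' where o': "o' \<in> interior Q" "rat_vec o'" using rational_polygon_interior_point[OF Q] by blast
  have "(LINT x:convex hull (insert o' F)|lborel. b \<bullet> x + d) \<in> \<rat>" if F: "F facet_of Q" for F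
  proof -
    obtain v w where vw: "F = closed_segment v w" "v extreme_point_of Q" "w extreme_point_of Q"
      using facet_segment[OF Q'(1,2) F] by blast
    have "convex hull (insert o' F) = convex hull {o', v, w}"
      unfolding vw(1) segment_convex_hull by (rule hull_insert[symmetric])
    moreover have "rat_vec v" "rat_vec w" using vw Q'(3) by auto
    then have "det2 (v - o') (w - o') \<in> \<rat>" "b \<bullet> o' \<in> \<rat>" "b \<bullet> v \<in> \<rat>" "b \<bullet> w \<in> \<rat>"
      using o'(2) f(1) by (simp_all add: rat_vec_arith)
    then have "\<bar>det2 (v - o') (w - o')\<bar> / 6 * ((b \<bullet> o' + d) + (b \<bullet> v + d) + (b \<bullet> w + d)) \<in> \<rat>"
      using f(2) by simp
    ultimately show ?thesis by (simp only: integral_triangle)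
  qed
  then show ?thesis
    unfolding integral_cone_decomposition[OF Q'(1,2) o'(1) continuous_on_affine]
    by (intro Rats_sum) auto
qed

text \<open>Inequalities that are strict at \<open>v\<close> hold near \<open>v\<close>. A segment
  in \<open>P\<close> around \<open>v\<close>, shrunk towards \<open>v\<close>, would therefore lie
  in the cut set.\<close>

lemma extreme_point_of_cut:
  fixes P :: "(real^2) set"
  assumes K: "finite K" and v: "v extreme_point_of (P \<inter> {x. \<forall>(b, c)\<in>K. 0 \<le> b \<bullet> x + c})"
    and pos: "\<And>b c. (b, c) \<in> K \<Longrightarrow> 0 < b \<bullet> v + c" and P: "convex P"
  shows "v extreme_point_of P"
  unfolding extreme_point_of_def
proof (intro conjI ballI)
  let ?Q = "P \<inter> {x. \<forall>(b, c)\<in>K. 0 \<le> b \<bullet> x + c}"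
  show vP: "v \<in> P" using v by (simp add: extreme_point_of_def)
  fix x y assume xy: "x \<in> P" "y \<in> P"
  show "v \<notin> open_segment x y"
  proof
    assume "v \<in> open_segment x y"
    then obtain t where t: "0 < t" "t < 1" "v = (1 - t) *\<^sub>R x + t *\<^sub>R y" "x \<noteq> y" by (auto simp: in_segment)
    define U where "U = (\<Inter>(b, c)\<in>K. {x. - c < b \<bullet> x})"
    have "open U" unfolding U_def using K by (intro open_INT) (auto simp: open_halfspace_gt)
    moreover have "v \<in> U" unfolding U_def using pos by force
    ultimately obtain e where e: "0 < e" "ball v e \<subseteq> U" using open_contains_ball by blast
    define \<eta> where "\<eta> = min 1 (e / (2 * (norm (x - v) + norm (y - v) + 1)))"
    have \<eta>: "0 < \<eta>" "\<eta> \<le> 1" "\<eta> * (norm (x - v) + norm (y - v) + 1) < e"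
    proof -
      have n: "0 < norm (x - v) + norm (y - v) + 1" by (simp add: add_nonneg_pos)
      then show "0 < \<eta>" "\<eta> \<le> 1" using e(1) by (simp_all add: \<eta>_def)
      have "\<eta> * (norm (x - v) + norm (y - v) + 1) \<le> e / (2 * (norm (x - v) + norm (y - v) + 1)) * (norm (x - v) + norm (y - v) + 1)"
        using n by (intro mult_right_mono) (auto simp: \<eta>_def)
      also have "\<dots> = e / 2"
      proof -
        have "e / (2 * r) * r = e / 2" if "0 < r" for r :: real using that by simp
        then show ?thesis using n .
      qed
      finally show "\<eta> * (norm (x - v) + norm (y - v) + 1) < e" using e(1) by simp
    qed
    have mem: "v + \<eta> *\<^sub>R (z - v) \<in> ?Q" if z: "z \<in> P" "norm (z - v) \<le> norm (x - v) + norm (y - v) + 1" for z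
    proof -
      have "v + \<eta> *\<^sub>R (z - v) = (1 - \<eta>) *\<^sub>R v + \<eta> *\<^sub>R z" by (simp add: algebra_simps)
      then have 1: "v + \<eta> *\<^sub>R (z - v) \<in> P" using convexD[OF P vP z(1), of "1 - \<eta>" \<eta>] \<eta> by simp
      have "\<eta> * norm (z - v) \<le> \<eta> * (norm (x - v) + norm (y - v) + 1)"
        using z(2) \<eta>(1) by (intro mult_left_mono) auto
      then have "\<eta> * norm (z - v) < e" using \<eta>(3) by linarith
      then have "dist v (v + \<eta> *\<^sub>R (z - v)) < e" using \<eta>(1) by (simp add: dist_norm)
      then have "v + \<eta> *\<^sub>R (z - v) \<in> U" using e(2) by auto
      then show ?thesis using 1 unfolding U_def by force
    qed
    let ?x = "v + \<eta> *\<^sub>R (x - v)" and ?y = "v + \<eta> *\<^sub>R (y - v)"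
    have "?x \<in> ?Q" "?y \<in> ?Q" using mem xy norm_ge_zero[of "x - v"] norm_ge_zero[of "y - v"] by simp_all
    moreover have "v \<in> open_segment ?x ?y"
    proof -
      have "(1 - t) *\<^sub>R (x - v) + t *\<^sub>R (y - v) = 0" unfolding t(3) by (simp add: algebra_simps)
      moreover have "(1 - t) *\<^sub>R ?x + t *\<^sub>R ?y = v + \<eta> *\<^sub>R ((1 - t) *\<^sub>R (x - v) + t *\<^sub>R (y - v))" by (simp add: algebra_simps)
      ultimately have "v = (1 - t) *\<^sub>R ?x + t *\<^sub>R ?y" by simp
      moreover have "?x \<noteq> ?y" using t(4) \<eta>(1) by simp
      ultimately show ?thesis using t(1,2) unfolding in_segment by blast
    qed
    ultimately show False using v unfolding extreme_point_of_def by blast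
  qed
qed

lemma polytope_Int_polyhedron:
  fixes S :: "'a::euclidean_space set"
  assumes "polytope S" "polyhedron T"
  shows "polytope (S \<inter> T)"
  using assms bounded_subset[OF _ inf_le1, of S T] by (simp add: polytope_eq_bounded_polyhedron polyhedron_Int)

lemma rat_scale:
  assumes "rat_vec (s *\<^sub>R dvec u)" "u \<noteq> 0"
  shows "s \<in> \<rat>"
proof (cases "u $ 1 = 0")
  case True
  then have "real_of_int (u $ 2) \<noteq> 0" using assms(2) by (simp add: vec_eq_2)
  moreover have "- (s * real_of_int (u $ 2)) \<in> \<rat>" using assms(1) by (simp add: rat_vec_2)
  ultimately have "- (s * real_of_int (u $ 2)) / - real_of_int (u $ 2) \<in> \<rat>" by (intro Rats_divide) auto
  then show ?thesis using \<open>real_of_int (u $ 2) \<noteq> 0\<close> by simp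
next
  case False
  have "s * real_of_int (u $ 1) \<in> \<rat>" using assms(1) by (simp add: rat_vec_2)
  then have "s * real_of_int (u $ 1) / real_of_int (u $ 1) \<in> \<rat>" by (intro Rats_divide) auto
  then show ?thesis using False by simp
qed

context lattice_polygon
begin

text \<open>If the line met \<open>P\<close> beyond \<open>p\<close> or \<open>q\<close>, that end
  would lie strictly between an interior point and a point of \<open>P\<close> and would be interior
  itself.\<close>

lemma chord_segment:
  assumes m: "meets p q" and pq: "p \<in> frontier P" "q \<in> frontier P"
  shows "{x \<in> P. side p q x = 0} = closed_segment p q"
proof -
  have P: "p \<in> P" "q \<in> P" "p \<notin> interior P" "q \<notin> interior P" using pq closed_P by (auto simp: frontier_def)
  obtain m where m: "m \<in> interior P" "side p q m = 0" "p \<noteq> q" using assms(1) by (auto simp: meets_def)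
  have rep: "\<exists>t. x = p + t *\<^sub>R (q - p)" if "side p q x = 0" for x
  proof -
    have "det2 (x - p) (q - p) = 0" using that det2_commute[of "x - p" "q - p"] by (simp add: side_def)
    moreover have "q - p \<noteq> 0" using m(3) by simp
    ultimately obtain t where "x - p = t *\<^sub>R (q - p)" using det2_zero_imp_parallel by blast
    then have "x = p + t *\<^sub>R (q - p)" by (simp add: algebra_simps)
    then show ?thesis by blast
  qed
  obtain r where r: "m = p + r *\<^sub>R (q - p)" using rep m(2) by blast
  have int: "m + t *\<^sub>R (x - m) \<in> interior P" if "x \<in> P" "0 \<le> t" "t < 1" for x t
    using open_segment_interior[OF convex_P m(1) that] .
  have r1: "r < 1"
  proof (rule ccontr)
    assume "\<not> r < 1"
    then have r1: "1 \<le> r" by simp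
    have "r *\<^sub>R (m + (1 - 1 / r) *\<^sub>R (p - m)) = r *\<^sub>R q"
      using r1 unfolding r scaleR_right_distrib scaleR_scaleR by (simp add: right_diff_distrib) (simp add: algebra_simps)
    then have "q = m + (1 - 1 / r) *\<^sub>R (p - m)" using r1 by simp
    then show False using int[OF P(1), of "1 - 1 / r"] r1 P(4) by simp
  qed
  have r0: "0 < r"
  proof (rule ccontr)
    assume "\<not> 0 < r"
    then have r0: "r \<le> 0" by simp
    have "(1 - r) *\<^sub>R (m + (- r / (1 - r)) *\<^sub>R (q - m)) = (1 - r) *\<^sub>R p"
      using r0 unfolding r scaleR_right_distrib scaleR_scaleR by (simp add: right_diff_distrib) (simp add: algebra_simps)
    then have "p = m + (- r / (1 - r)) *\<^sub>R (q - m)" using r0 by simp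
    moreover have "0 \<le> - r / (1 - r)" "- r / (1 - r) < 1" using r0 by (simp_all add: field_simps)
    ultimately show False using int[OF P(2), of "- r / (1 - r)"] P(3) by simp
  qed
  show ?thesis
  proof (intro equalityI subsetI)
    fix x assume "x \<in> {x \<in> P. side p q x = 0}"
    then have x: "x \<in> P" "side p q x = 0" by auto
    obtain t where t: "x = p + t *\<^sub>R (q - p)" using rep x(2) by blast
    have "t \<le> 1"
    proof (rule ccontr)
      assume "\<not> t \<le> 1"
      then have t1: "1 < t" by simp
      have "(t - r) *\<^sub>R (m + ((1 - r) / (t - r)) *\<^sub>R (x - m)) = (t - r) *\<^sub>R q"
        using t1 r1 unfolding t r scaleR_right_distrib scaleR_scaleR by simp (simp add: algebra_simps)
      then have "q = m + ((1 - r) / (t - r)) *\<^sub>R (x - m)" using t1 r1 by simp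
      moreover have "0 \<le> (1 - r) / (t - r)" "(1 - r) / (t - r) < 1" using t1 r1 by (simp_all add: field_simps)
      ultimately show False using int[OF x(1), of "(1 - r) / (t - r)"] P(4) by simp
    qed
    moreover have "0 \<le> t"
    proof (rule ccontr)
      assume "\<not> 0 \<le> t"
      then have t0: "t < 0" by simp
      have "(r - t) *\<^sub>R (m + (r / (r - t)) *\<^sub>R (x - m)) = (r - t) *\<^sub>R p"
        using t0 r0 unfolding t r scaleR_right_distrib scaleR_scaleR by simp (simp add: algebra_simps)
      then have "p = m + (r / (r - t)) *\<^sub>R (x - m)" using t0 r0 by simp
      moreover have "0 \<le> r / (r - t)" "r / (r - t) < 1" using t0 r0 by (simp_all add: field_simps)
      ultimately show False using int[OF x(1), of "r / (r - t)"] P(3) by simp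
    qed
    moreover have "x = (1 - t) *\<^sub>R p + t *\<^sub>R q" by (simp add: t algebra_simps)
    ultimately show "x \<in> closed_segment p q" unfolding in_segment by blast
  next
    fix x assume x: "x \<in> closed_segment p q"
    then have "x \<in> P" using closed_segment_subset[OF P(1,2) convex_P] by blast
    moreover have "side p q x = 0"
    proof -
      obtain t where "x = (1 - t) *\<^sub>R p + t *\<^sub>R q" using x unfolding in_segment by blast
      then have "x - p = t *\<^sub>R (q - p)" by (simp add: algebra_simps)
      then show ?thesis by (simp add: side_def det2_linear(6,9))
    qed
    ultimately show "x \<in> {x \<in> P. side p q x = 0}" by simp
  qed
qed

text \<open>The boundary part is a sum of trapezoids over the intersections of \<open>Q\<close> with
  the edges of \<open>P\<close>; these are faces of \<open>Q\<close>, so their ends are vertices of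
  \<open>Q\<close> and their lattice lengths are rational. The area part comes from triangles with
  rational vertices.\<close>

lemma L_rational_polygon:
  assumes Q: "rational_polygon Q" "Q \<subseteq> P" and f: "rat_vec b" "d \<in> \<rat>"
  shows "(LINT x:Q|\<sigma>. b \<bullet> x + d) \<in> \<rat>" "a \<in> \<rat> \<Longrightarrow> L Q (\<lambda>x. b \<bullet> x + d) \<in> \<rat>"
proof -
  let ?f = "\<lambda>x. b \<bullet> x + d"
  have Q': "polytope Q" "\<And>v. v extreme_point_of Q \<Longrightarrow> rat_vec v"
    using Q by (auto simp: rational_polygon_def rat_vec_def)
  have cQ: "compact Q" "convex Q" using Q'(1) polytope_imp_compact polytope_imp_convex by blast+
  have fc: "continuous_on UNIV ?f" by (rule continuous_on_affine)
  let ?E = "\<lambda>k. Q \<inter> edge (fst k) (snd k)"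
  have cE: "compact (?E k)" "?E k \<subseteq> P" for k
    using compact_Int[OF cQ(1) compact_edge] Q(2) by auto
  have tE: "tame (?E k) ?f" for k by (rule tame_continuous_compact[OF cE continuous_on_affine])
  have tQ: "tame Q ?f" by (rule tame_continuous_compact[OF cQ(1) Q(2) continuous_on_affine])
  have cU: "compact (\<Union>k\<in>\<F>. ?E k)" using finite_facets cE by (intro compact_UN) auto
  have tU: "tame (\<Union>k\<in>\<F>. ?E k) ?f"
    using cE(2) by (intro tame_continuous_compact[OF cU _ continuous_on_affine]) auto
  have "(LINT x:Q|\<sigma>. ?f x) = (LINT x:(\<Union>k\<in>\<F>. ?E k)|\<sigma>. ?f x)"
    unfolding set_lebesgue_integral_def
  proof (rule integral_cong_AE)
    show "AE x in \<sigma>. indicator Q x *\<^sub>R ?f x = indicator (\<Union>k\<in>\<F>. ?E k) x *\<^sub>R ?f x"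
      using AE_frontier
    proof eventually_elim
      case (elim x)
      then obtain u c where "(u, c) \<in> \<F>" "x \<in> edge u c" using frontier_facets by blast
      then have "x \<in> (\<Union>k\<in>\<F>. ?E k) \<longleftrightarrow> x \<in> Q" by force
      then show ?case by (simp add: indicator_def)
    qed
  qed (use tQ tU in \<open>simp_all add: tame_def set_borel_measurable_def borel_measurable_\<sigma> del: real_scaleR_def\<close>)
  also have "\<dots> = (\<Sum>k\<in>\<F>. LINT x:?E k|\<sigma>. ?f x)"
  proof (rule set_integral_finite_UN_AE[OF finite_facets])
    show "?E k \<in> sets \<sigma>" if "k \<in> \<F>" for k using cE by (simp add: sets_dsigma borel_compact)
    show "set_integrable \<sigma> (?E k) ?f" if "k \<in> \<F>" for k by (rule tame_integrable(1)[OF tE])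
    fix k j assume kj: "k \<in> \<F>" "j \<in> \<F>"
    obtain u c where k: "k = (u, c)" by fastforce
    obtain w e where j: "j = (w, e)" by fastforce
    show "AE x in \<sigma>. x \<in> ?E k \<and> x \<in> ?E j \<longrightarrow> k = j"
    proof (cases "k = j")
      case False
      have "AE x in \<sigma>. \<not> (x \<in> edge u c \<and> x \<in> edge w e)"
      proof (rule AE_dsigma)
        have "{x. \<not> \<not> (x \<in> edge u c \<and> x \<in> edge w e)} = edge u c \<inter> edge w e" by auto
        then show "{x. \<not> \<not> (x \<in> edge u c \<and> x \<in> edge w e)} \<in> sets borel"
          using compact_edge by (simp add: borel_compact compact_Int)
        fix u' c' assume F: "(u', c') \<in> \<F>"
        have "(u', c') \<noteq> (u, c) \<or> (u', c') \<noteq> (w, e)" using False k j by auto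
        then show "AE x in line_measure u' c'. x \<in> P \<longrightarrow> \<not> (x \<in> edge u c \<and> x \<in> edge w e)"
        proof
          assume "(u', c') \<noteq> (u, c)"
          then show ?thesis using AE_other_facet[OF _ F, of u c] kj k
            by (auto simp: edge_def elim!: eventually_mono)
        next
          assume "(u', c') \<noteq> (w, e)"
          then show ?thesis using AE_other_facet[OF _ F, of w e] kj j
            by (auto simp: edge_def elim!: eventually_mono)
        qed
      qed
      then show ?thesis by eventually_elim (auto simp: k j)
    qed simp
  qed
  also have "\<dots> \<in> \<rat>"
  proof (rule Rats_sum)
    fix k assume kF: "k \<in> \<F>"
    obtain u c where k: "k = (u, c)" by fastforce
    have F: "(u, c) \<in> \<F>" using kF k by simp
    show "(LINT x:?E k|\<sigma>. ?f x) \<in> \<rat>"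
    proof (cases "?E k = {}")
      case True
      then show ?thesis by (simp add: set_lebesgue_integral_def)
    next
      case False
      have cvE: "convex (?E k)" by (intro convex_Int cQ convex_edge)
      have ln: "\<And>x. x \<in> ?E k \<Longrightarrow> lform u x = c" by (simp add: k edge_def)
      obtain x s where xs: "0 \<le> s" "?E k = closed_segment x (x + s *\<^sub>R dvec u)"
        "x extreme_point_of ?E k" "x + s *\<^sub>R dvec u extreme_point_of ?E k"
        using compact_convex_on_line[OF cE(1) cvE False ln facetD(2)[OF F]] .
      have "(Q \<inter> {x. nvec u \<bullet> x = c}) face_of Q"
        using facetD(3)[OF F] Q(2) by (intro face_of_Int_supporting_hyperplane_ge cQ) (auto simp: lform_nvec)
      moreover have "?E k = Q \<inter> {x. nvec u \<bullet> x = c}" using Q(2) by (auto simp: k edge_def lform_nvec)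
      ultimately have face: "?E k face_of Q" by simp
      have rx: "rat_vec x" "rat_vec (x + s *\<^sub>R dvec u)"
        using xs(3,4) extreme_point_of_face[OF face] Q'(2) by blast+
      have "rat_vec (s *\<^sub>R dvec u)" using rat_vec_arith(2)[OF rx(2,1)] by simp
      then have "s \<in> \<rat>" using rat_scale facetD(2)[OF F] by blast
      have mem: "x \<in> edge u c" "x + s *\<^sub>R dvec u \<in> edge u c" using xs(3,4) by (auto simp: extreme_point_of_def k)
      have "(LINT x:?E k|\<sigma>. ?f x) = s * (?f x + ?f (x + s *\<^sub>R dvec u)) / 2"
        unfolding xs(2) by (rule integral_segment[OF F mem xs(1)])
      moreover have "b \<bullet> x \<in> \<rat>" "b \<bullet> (x + s *\<^sub>R dvec u) \<in> \<rat>" using rx f(1) by (simp_all only: rat_vec_arith)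
      then have "s * (?f x + ?f (x + s *\<^sub>R dvec u)) / 2 \<in> \<rat>"
        using \<open>s \<in> \<rat>\<close> f(2) by (intro Rats_divide Rats_mult Rats_add) simp_all
      ultimately show ?thesis by (simp only:)
    qed
  qed
  finally show 1: "(LINT x:Q|\<sigma>. ?f x) \<in> \<rat>" .
  show "L Q ?f \<in> \<rat>" if "a \<in> \<rat>"
    unfolding L_def using 1 that integral_rational_polygon[OF Q(1) f] by simp
qed

lemma vertex_rat: "v extreme_point_of P \<Longrightarrow> rat_vec v"
  using vertex_Ints Ints_subset_Rats unfolding rat_vec_def by blast

lemma rational_P: "rational_polygon P"
  using polytope_P int_P vertex_rat by (simp add: rational_polygon_def rat_vec_def)

lemma facet_rat: "(u, c) \<in> \<F> \<Longrightarrow> c \<in> \<rat>"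
proof -
  assume F: "(u, c) \<in> \<F>"
  obtain v s where v: "0 < s" "edge u c = closed_segment v (v + s *\<^sub>R dvec u)" "v extreme_point_of P"
    using edge_segment[OF F] .
  then have "lform u v = c" by (auto simp: edge_def)
  then show "c \<in> \<rat>" using rat_vec_arith(6)[OF rat_vec_arith(4) vertex_rat[OF v(3)], of u] by (simp add: lform_nvec)
qed

lemma a_rat: "a \<in> \<rat>"
proof -
  have r0: "rat_vec 0" by (simp add: rat_vec_def)
  have "(LINT x:P|\<sigma>. 0 \<bullet> x + 1) \<in> \<rat>" by (rule L_rational_polygon(1)[OF rational_P order_refl r0]) simp
  then have "measure \<sigma> P \<in> \<rat>" by (simp add: set_lebesgue_integral_def sets_dsigma)
  moreover have "measure \<sigma> P = measure \<sigma> (frontier P)"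
  proof (rule measure_eq_AE)
    show "AE x in \<sigma>. x \<in> P \<longleftrightarrow> x \<in> frontier P"
      using AE_frontier by eventually_elim (use closed_P in \<open>auto simp: frontier_def\<close>)
  qed (auto simp: sets_dsigma borel_closed)
  moreover have "(LINT x:P|lborel. 0 \<bullet> x + 1) \<in> \<rat>" by (rule integral_rational_polygon[OF rational_P r0]) simp
  then have "measure lborel P \<in> \<rat>" by (simp add: set_lebesgue_integral_def)
  ultimately show ?thesis by (simp add: a_def)
qed

lemma meets_below_point:
  assumes "meets p q"
  shows "\<exists>x\<in>interior P. side p q x < 0"
proof -
  obtain m where m: "m \<in> interior P" "side p q m = 0" "p \<noteq> q" using assms by (auto simp: meets_def)
  let ?n = "perp (q - p)"
  have n0: "?n \<noteq> 0" using m(3) by simp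
  obtain e where e: "0 < e" "ball m e \<subseteq> interior P" using m(1) open_contains_ball open_interior by blast
  define x where "x = m - (e / (2 * norm ?n)) *\<^sub>R ?n"
  have "dist m x = e / 2" using n0 e by (simp add: x_def dist_norm)
  then have "x \<in> interior P" using e by auto
  moreover have "side p q x = side p q m - (e / (2 * norm ?n)) * (?n \<bullet> ?n)"
    unfolding side_affine x_def by (simp add: inner_diff_right)
  moreover have "0 < (e / (2 * norm ?n)) * (?n \<bullet> ?n)" using n0 e by simp
  ultimately have "side p q x < 0" using m(2) by linarith
  then show ?thesis using \<open>x \<in> interior P\<close> by blast
qed

text \<open>A vertex of the half polygon is a vertex of \<open>P\<close> or an end of the
  chord.\<close>

lemma L_below_rational:
  assumes m: "meets p q" and pq: "p \<in> frontier P" "q \<in> frontier P" "rat_vec p" "rat_vec q" and f: "rat_vec b" "d \<in> \<rat>"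
  shows "L (below p q) (\<lambda>x. b \<bullet> x + d) \<in> \<rat>"
proof -
  define Q where "Q = P \<inter> {x. perp (q - p) \<bullet> x \<le> perp (q - p) \<bullet> p}"
  have Q: "Q = P \<inter> {x. side p q x \<le> 0}" by (auto simp: Q_def side_affine)
  have pP: "p \<in> P" "q \<in> P" using pq closed_P by (auto simp: frontier_def)
  have "polytope Q" unfolding Q_def by (intro polytope_Int_polyhedron polytope_P polyhedron_halfspace_le)
  moreover have "interior Q \<noteq> {}"
  proof -
    obtain x where x: "x \<in> interior P" "side p q x < 0" using meets_below_point[OF m] by blast
    have "open (interior P \<inter> {x. perp (q - p) \<bullet> x < perp (q - p) \<bullet> p})"
      by (intro open_Int open_interior open_halfspace_lt)
    moreover have "interior P \<inter> {x. perp (q - p) \<bullet> x < perp (q - p) \<bullet> p} \<subseteq> Q"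
      using interior_subset by (auto simp: Q_def)
    ultimately have "interior P \<inter> {x. perp (q - p) \<bullet> x < perp (q - p) \<bullet> p} \<subseteq> interior Q" by (intro interior_maximal)
    moreover have "x \<in> interior P \<inter> {x. perp (q - p) \<bullet> x < perp (q - p) \<bullet> p}" using x by (simp add: side_affine)
    ultimately show ?thesis by blast
  qed
  moreover have "rat_vec v" if v: "v extreme_point_of Q" for v
  proof -
    let ?K = "{(- perp (q - p), perp (q - p) \<bullet> p)}"
    have Qe: "Q = P \<inter> {x. \<forall>(b, c)\<in>?K. 0 \<le> b \<bullet> x + c}" by (auto simp: Q_def)
    have vQ: "v \<in> P" "side p q v \<le> 0" using v by (auto simp: extreme_point_of_def Q)
    show ?thesis
    proof (cases "side p q v < 0")
      case True
      have "v extreme_point_of P"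
        by (rule extreme_point_of_cut[of ?K]) (use v Qe True convex_P in \<open>auto simp: side_affine\<close>)
      then show ?thesis by (rule vertex_rat)
    next
      case False
      then have vs: "v \<in> closed_segment p q" using chord_segment[OF m pq(1,2)] vQ by auto
      moreover have "closed_segment p q \<subseteq> Q"
        unfolding chord_segment[OF m pq(1,2), symmetric] Q by auto
      ultimately have "v extreme_point_of closed_segment p q" using v unfolding extreme_point_of_def by blast
      then show ?thesis using pq by (auto simp: extreme_point_of_segment)
    qed
  qed
  ultimately have r: "rational_polygon Q" by (simp add: rational_polygon_def rat_vec_def)
  have sQ: "Q \<in> sets borel" unfolding Q_def
    by (intro sets.Int P_borel borel_closed closed_halfspace_le)
  have t: "tame Q (\<lambda>x. b \<bullet> x + d)" by (intro tame_continuous sQ continuous_on_affine) (auto simp: Q)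
  have "L (below p q) (\<lambda>x. b \<bullet> x + d) = L Q (\<lambda>x. b \<bullet> x + d)"
  proof (rule L_null_cong)
    show "AE x in \<sigma>. x \<in> below p q \<longleftrightarrow> x \<in> Q"
      using meets_AE(1)[OF m] by eventually_elim (auto simp: below_def Q)
    show "AE x in lborel. x \<in> below p q \<longleftrightarrow> x \<in> Q"
      using meets_AE(2)[OF m] by eventually_elim (auto simp: below_def Q)
  qed (use t tame_below[OF continuous_on_affine] in \<open>simp_all add: tame_def\<close>)
  also have "\<dots> \<in> \<rat>" by (rule L_rational_polygon(2)[OF r _ f a_rat]) (simp add: Q)
  finally show ?thesis .
qed

text \<open>Supplies the ends of a rational reference chord, with which an unknown chord between the
  same edges is compared.\<close>

lemma edge_midpoint:
  assumes F: "(u, c) \<in> \<F>"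
  obtains p where "p \<in> edge u c" "\<not> p extreme_point_of P" "rat_vec p"
proof -
  obtain v s where v: "0 < s" "edge u c = closed_segment v (v + s *\<^sub>R dvec u)"
    "v extreme_point_of P" "v + s *\<^sub>R dvec u extreme_point_of P" using edge_segment[OF F] .
  let ?p = "v + (1/2 * s) *\<^sub>R dvec u"
  have e: "?p = (1/2) *\<^sub>R v + (1/2) *\<^sub>R (v + s *\<^sub>R dvec u)" by (simp add: vec_eq_2 field_simps)
  have "?p \<in> edge u c" unfolding v(2) closed_segment_line by (intro CollectI exI[of _ "1/2"]) simp
  moreover have "rat_vec ?p" unfolding e using v(3,4) by (intro rat_vec_arith vertex_rat) auto
  moreover have "\<not> ?p extreme_point_of P"
  proof (rule not_extreme_between[where t="s / 2" and e="dvec u"])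
    have "v \<in> P" "v + s *\<^sub>R dvec u \<in> P" using v(3,4) by (auto simp: extreme_point_of_def)
    then show "?p + (s / 2) *\<^sub>R dvec u \<in> P" "?p - (s / 2) *\<^sub>R dvec u \<in> P"
      by (simp_all add: add.assoc flip: scaleR_add_left)
  qed (use v(1) facetD(2)[OF F] in \<open>simp_all add: dvec_eq_0\<close>)
  ultimately show thesis using that by blast
qed

text \<open>A linear form that attains its minimum over an edge at a relatively interior point is
  constant along that edge.\<close>

lemma off_edge_nonvertex:
  assumes F: "(u, c) \<in> \<F>" "(w, e) \<in> \<F>" and q0: "q0 \<in> edge w e" "\<not> q0 extreme_point_of P"
    and q: "q \<in> edge w e" "c < lform u q"
  shows "c < lform u q0"
proof (rule ccontr)
  assume "\<not> c < lform u q0"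
  moreover have "q0 \<in> P" using q0(1) edge_subset by blast
  ultimately have qc: "lform u q0 = c" using facetD(3)[OF F(1), of q0] by simp
  obtain \<epsilon> where e: "0 < \<epsilon>" "\<And>t. \<bar>t\<bar> \<le> \<epsilon> \<Longrightarrow> q0 + t *\<^sub>R dvec w \<in> edge w e"
    using nonvertex_neighbourhood[OF F(2) q0] by metis
  have inP: "c \<le> lform u (q0 + t *\<^sub>R dvec w)" if "\<bar>t\<bar> \<le> \<epsilon>" for t
    using e(2)[OF that] edge_subset facetD(3)[OF F(1)] by blast
  have "c \<le> lform u (q0 + \<epsilon> *\<^sub>R dvec w)" "c \<le> lform u (q0 + (- \<epsilon>) *\<^sub>R dvec w)"
    using inP[of \<epsilon>] inP[of "- \<epsilon>"] e(1) by simp_all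
  then have "0 \<le> \<epsilon> * lform u (dvec w)" "0 \<le> - (\<epsilon> * lform u (dvec w))"
    unfolding lform_add lform_scaleR qc by simp_all
  then have z: "lform u (dvec w) = 0" using e(1) by simp
  obtain t where "q = q0 + t *\<^sub>R dvec w" using edge_diff[OF F(2) q0(1) q(1)] .
  then have "lform u q = c" by (simp add: lform_add lform_scaleR z qc)
  then show False using q(2) by simp
qed

end

section \<open>Rational ends of zero chords\<close>

context semistable_polygon
begin

text \<open>\<open>L\<close> on a rational affine function is rational below the reference chord
  \<open>p0 q0\<close> and 0 below \<open>p q\<close>, so the change between the two is a rational
  value of a polynomial in the displacements \<open>s\<close> and \<open>t\<close>. Three test
  functions give three such equations. They are algebraic in the heights of the ends if the edges
  are not parallel, and linear in \<open>s\<close> and \<open>t\<close> if they are.\<close>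

theorem zchord_rational:
  assumes F: "(u, c) \<in> \<F>" "(w, e) \<in> \<F>" and p: "p \<in> edge u c" and q: "q \<in> edge w e" and z: "zchord p q"
    and nm: "\<not> p extreme_point_of P \<Longrightarrow> \<not> q extreme_point_of P \<Longrightarrow> w = - u \<Longrightarrow> a * (lform u q - c) \<noteq> 2"
  shows "rat_vec p \<and> rat_vec q"
proof -
  have P: "p \<in> P" "q \<in> P" using p q edge_subset by blast+
  have fr: "p \<in> frontier P" "q \<in> frontier P" using edge_in_frontier F p q by blast+
  have m: "meets p q" and l: "\<And>b d. L (below p q) (\<lambda>x. b \<bullet> x + d) = 0" using z by (auto simp: zchord_def)
  have pos: "c < lform u q" "e < lform w p"
    using zchord_off_edge[OF m F(1) p P(2)] zchord_off_edge[OF _ F(2) q P(1)] m meets_swap by blast+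
  obtain p0 where p0: "p0 \<in> edge u c" "\<not> p0 extreme_point_of P" "rat_vec p0" using edge_midpoint[OF F(1)] .
  obtain q0 where q0: "q0 \<in> edge w e" "\<not> q0 extreme_point_of P" "rat_vec q0" using edge_midpoint[OF F(2)] .
  have P0: "p0 \<in> P" "q0 \<in> P" using p0 q0 edge_subset by blast+
  have pos0: "c < lform u q0" "e < lform w p0"
    using off_edge_nonvertex[OF F q0(1,2) q pos(1)] off_edge_nonvertex[OF F(2,1) p0(1,2) p pos(2)] by auto
  have m0: "meets p0 q0" by (rule meets_nonvertex[OF F(1) p0(1,2) P0(2) pos0(1)])
  have m1: "meets p q0" using meets_nonvertex[OF F(2) q0(1,2) P(1) pos(2)] meets_swap by blast
  obtain s where s: "p = p0 + s *\<^sub>R dvec u" using edge_diff[OF F(1) p0(1) p] .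
  obtain t' where t': "q = q0 + t' *\<^sub>R dvec w" using edge_diff[OF F(2) q0(1) q] .
  define t where "t = - t'"
  have t: "q = q0 - t *\<^sub>R dvec w" by (simp add: t' t_def)
  have c_rat: "c \<in> \<rat>" "e \<in> \<rat>" using facet_rat F by blast+
  define h0 k0 D X Y where "h0 = lform u q0 - c" and "k0 = lform w p0 - e" and "D = real_of_int (idet u w)"
    and "X = lform w p - e" and "Y = lform u q - c"
  have rat0: "h0 \<in> \<rat>" "k0 \<in> \<rat>" "D \<in> \<rat>"
    using rat_vec_arith(6)[OF rat_vec_arith(4) q0(3), of u] rat_vec_arith(6)[OF rat_vec_arith(4) p0(3), of w] c_rat
    by (simp_all add: h0_def k0_def D_def lform_nvec)
  have XY: "0 < X" "0 < Y" "0 < h0" "0 < k0" using pos pos0 by (simp_all add: X_def Y_def h0_def k0_def)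
  have Y: "Y = h0 + t * D"
    by (simp add: t lform_diff lform_scaleR lform_dvec h0_def D_def Y_def)
  have X: "X = k0 + s * D"
    by (simp add: s lform_add lform_scaleR lform_dvec k0_def D_def X_def idet_def algebra_simps)
  have eq: "(s * (f p0 + f p) / 2 - a * (s * h0 / 6 * (f p0 + f p + f q0))) +
      (t * (f q0 + f q) / 2 - a * (t * X / 6 * (f q0 + f q + f p))) \<in> \<rat>"
    if f: "f = (\<lambda>x. b \<bullet> x + d)" and r: "rat_vec b" "d \<in> \<rat>" for f b d
  proof -
    have "L (below p q) f = L (below p0 q0) f +
      (s * (f p0 + f p) / 2 - a * (s * (lform u q0 - c) / 6 * (f p0 + f p + f q0))) +
      (t * (f q0 + f q) / 2 - a * (t * (lform w p - e) / 6 * (f q0 + f q + f p)))"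
      unfolding f by (rule move_both[OF F p0(1) p s q0(1) q t pos0(1) pos(2) m0 m1 m])
    then have "(s * (f p0 + f p) / 2 - a * (s * h0 / 6 * (f p0 + f p + f q0))) +
      (t * (f q0 + f q) / 2 - a * (t * X / 6 * (f q0 + f q + f p))) = - L (below p0 q0) f"
      using l[of b d] unfolding h0_def X_def f by simp
    moreover have "L (below p0 q0) f \<in> \<rat>" unfolding f
      by (rule L_below_rational[OF m0 _ _ p0(3) q0(3) r]) (use edge_in_frontier F p0(1) q0(1) in blast)+
    ultimately show ?thesis by simp
  qed
  have fu: "lform u p0 - c = 0" "lform u p - c = 0" and fw: "lform w q0 - e = 0" "lform w q - e = 0"
    using p q p0(1) q0(1) by (auto simp: edge_def)
  have r0: "rat_vec 0" by (simp add: rat_vec_def)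
  have E1: "s + t - a * (s * h0 + t * X) / 2 \<in> \<rat>"
  proof -
    have 1: "(s * (1 + 1) / 2 - a * (s * h0 / 6 * (1 + 1 + 1))) + (t * (1 + 1) / 2 - a * (t * X / 6 * (1 + 1 + 1))) \<in> \<rat>"
      using eq[of "\<lambda>x. 0 \<bullet> x + 1" 0 1] r0 by simp
    have 2: "(s * (1 + 1) / 2 - a * (s * h0 / 6 * (1 + 1 + 1))) + (t * (1 + 1) / 2 - a * (t * X / 6 * (1 + 1 + 1))) = s + t - a * (s * h0 + t * X) / 2"
      by (simp add: field_simps)
    show ?thesis using 1 unfolding 2 .
  qed
  have E2: "- (a * (s * h0 / 6 * h0)) + (t * (h0 + Y) / 2 - a * (t * X / 6 * (h0 + Y))) \<in> \<rat>"
    using eq[of "\<lambda>x. lform u x - c" "nvec u" "- c"] c_rat rat_vec_arith(4)[of u]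
    unfolding fu h0_def[symmetric] Y_def[symmetric] by (simp add: lform_nvec)
  have E3: "(s * (k0 + X) / 2 - a * (s * h0 / 6 * (k0 + X))) - a * (t * X / 6 * X) \<in> \<rat>"
    using eq[of "\<lambda>x. lform w x - e" "nvec w" "- e"] c_rat rat_vec_arith(4)[of w]
    unfolding fw k0_def[symmetric] X_def[symmetric] by (simp add: lform_nvec)
  have pX: "s \<in> \<rat>" if "p extreme_point_of P"
  proof -
    have "rat_vec (p - p0)" using vertex_rat[OF that] p0(3) by (intro rat_vec_arith)
    moreover have "p - p0 = s *\<^sub>R dvec u" by (simp add: s)
    ultimately show ?thesis using rat_scale facetD(2)[OF F(1)] by simp
  qed
  have qY: "t \<in> \<rat>" if "q extreme_point_of P"
  proof -
    have "rat_vec (q0 - q)" using vertex_rat[OF that] q0(3) by (intro rat_vec_arith)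
    moreover have "q0 - q = t *\<^sub>R dvec w" by (simp add: t)
    ultimately show ?thesis using rat_scale facetD(2)[OF F(2)] by simp
  qed
  have bY: "a * Y \<le> 3" if "\<not> p extreme_point_of P"
    unfolding Y_def by (rule corner_bound[OF z F(1) p that fr(2) pos(1)])
  have bX: "a * X \<le> 3" if "\<not> q extreme_point_of P"
    unfolding X_def by (rule corner_bound[OF _ F(2) q that fr(1) pos(2)]) (use z zchord_swap in blast)
  have a0: "0 < a" "a \<in> \<rat>" by (rule a_pos) (rule a_rat)
  have "s \<in> \<rat> \<and> t \<in> \<rat>"
  proof (cases "D = 0")
    case False
    \<comment> \<open>Normalised so that height 0 becomes 1, the critical height
      \<open>2 / a\<close> becomes 0 and the corner bound \<open>3 / a\<close> becomes
      \<open>- 1 / 2\<close>.\<close>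
    define A B g where "A = 1 - a * X / 2" and "B = 1 - a * Y / 2" and "g = A * B"
    have XA: "X = 2 * (1 - A) / a" and YB: "Y = 2 * (1 - B) / a" using a0 by (simp_all add: A_def B_def)
    have sX: "s = (X - k0) / D" "t = (Y - h0) / D" using False by (simp_all add: X Y)
    \<comment> \<open>Multiplication by \<open>D\<close> turns displacements into differences of
      heights. The added summand is the final expression at the reference heights \<open>k0\<close>
      and \<open>h0\<close>, so the reference chord drops out; \<open>r2\<close> and
      \<open>r3\<close> are formed in the same way.\<close>
    define r1 where "r1 = D * (s + t - a * (s * h0 + t * X) / 2) + (k0 + h0 - a * k0 * h0 / 2)"
    have r1: "r1 = X + Y - a * X * Y / 2"
      using X Y by (simp add: r1_def algebra_simps)
    have g: "g = 1 - a / 2 * r1"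
      unfolding r1 g_def A_def B_def by (simp add: field_simps)
    have "r1 \<in> \<rat>" unfolding r1_def using E1 rat0 a0 by simp
    then have g_rat: "g \<in> \<rat>" unfolding g using a0 by simp
    define r3 where "r3 = D * ((s * (k0 + X) / 2 - a * (s * h0 / 6 * (k0 + X))) - a * (t * X / 6 * X)) + (k0\<^sup>2 / 2 - a * h0 * k0\<^sup>2 / 6)"
    have r3: "r3 = X\<^sup>2 / 2 - a * X\<^sup>2 * Y / 6"
    proof -
      have "r3 = (D * s) * (k0 + X) / 2 - a * h0 / 6 * ((D * s) * (k0 + X)) - a / 6 * (D * t) * X\<^sup>2 + (k0\<^sup>2 / 2 - a * h0 * k0\<^sup>2 / 6)"
        by (simp add: r3_def field_simps power2_eq_square)
      also have "D * s = X - k0" by (simp add: X)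
      also have "D * t = Y - h0" by (simp add: Y)
      finally show ?thesis by (simp add: field_simps power2_eq_square)
    qed
    have r3_rat: "r3 \<in> \<rat>" unfolding r3_def using E3 rat0 a0 by simp
    define r2 where "r2 = D * (- (a * (s * h0 / 6 * h0)) + (t * (h0 + Y) / 2 - a * (t * X / 6 * (h0 + Y)))) + (h0\<^sup>2 / 2 - a * k0 * h0\<^sup>2 / 6)"
    have r2: "r2 = Y\<^sup>2 / 2 - a * Y\<^sup>2 * X / 6"
    proof -
      have "r2 = - a / 6 * (D * s) * h0\<^sup>2 + (D * t) * (h0 + Y) / 2 - a / 6 * X * ((D * t) * (h0 + Y)) + (h0\<^sup>2 / 2 - a * k0 * h0\<^sup>2 / 6)"
        by (simp add: r2_def field_simps power2_eq_square)
      also have "D * s = X - k0" by (simp add: X)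
      also have "D * t = Y - h0" by (simp add: Y)
      finally show ?thesis by (simp add: field_simps power2_eq_square)
    qed
    have r2_rat: "r2 \<in> \<rat>" unfolding r2_def using E2 rat0 a0 by simp
    have conv: "3 * a\<^sup>2 / 2 * (x\<^sup>2 / 2 - a * x\<^sup>2 * y / 6) - 1 + 4 * ((1 - a * x / 2) * (1 - a * y / 2)) =
        (1 - a * x / 2)\<^sup>2 + (2 * ((1 - a * x / 2) * (1 - a * y / 2)) - 2) * (1 - a * x / 2) + 2 * (1 - a * y / 2)" for x y
      by (simp add: field_simps power2_eq_square)
    have K: "A\<^sup>2 + (2 * g - 2) * A + 2 * B = 3 * a\<^sup>2 / 2 * r3 - 1 + 4 * g"
      unfolding r3 g_def A_def B_def by (rule conv[symmetric])
    have L: "B\<^sup>2 + (2 * g - 2) * B + 2 * A = 3 * a\<^sup>2 / 2 * r2 - 1 + 4 * g"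
      using conv[of Y X] unfolding r2 g_def A_def B_def by (simp add: mult.commute)
    have KL_rat: "3 * a\<^sup>2 / 2 * r3 - 1 + 4 * g \<in> \<rat>" "3 * a\<^sup>2 / 2 * r2 - 1 + 4 * g \<in> \<rat>"
      using r2_rat r3_rat g_rat a0 by simp_all
    have AB1: "A < 1" "B < 1" using XY a0 by (simp_all add: A_def B_def)
    have A_rat: "A \<in> \<rat>" if "s \<in> \<rat>" using that rat0 a0 by (simp add: A_def X)
    have B_rat: "B \<in> \<rat>" if "t \<in> \<rat>" using that rat0 a0 by (simp add: B_def Y)
    have half: "B \<in> \<rat>" if "A \<in> \<rat>" and eqs: "A * B = g" "2 * B = k - A\<^sup>2 - (2 * g - 2) * A" "k \<in> \<rat>" for A B k
    proof (cases "A = 0")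
      case True
      then have "B = k / 2" using eqs(2) by simp
      moreover have "k / 2 \<in> \<rat>" using eqs(3) by simp
      ultimately show ?thesis by (simp only:)
    next
      case False
      then have "B = g / A" using eqs(1) by (simp add: field_simps)
      then show ?thesis using that(1) g_rat by simp
    qed
    have AB_rat: "A \<in> \<rat> \<and> B \<in> \<rat>"
    proof (cases "p extreme_point_of P \<or> q extreme_point_of P")
      case True
      \<comment> \<open>If one end is a vertex, its displacement is rational, hence one of
        \<open>A\<close> and \<open>B\<close>; the normalised equations determine the other.\<close>
      have hA: "B \<in> \<rat>" if "A \<in> \<rat>" by (rule half[OF that g_def[symmetric] _ KL_rat(1)]) (use K in simp)
      have hB: "A \<in> \<rat>" if "B \<in> \<rat>" by (rule half[OF that _ _ KL_rat(2)]) (use L g_def in \<open>simp_all add: mult.commute\<close>)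
      show ?thesis using True pX qY A_rat B_rat hA hB by blast
    next
      case False
      then have "- 1 / 2 \<le> A" "- 1 / 2 \<le> B" using bX bY by (simp_all add: A_def B_def)
      then show ?thesis
        using chord_equations_rational[OF g_rat KL_rat g_def[symmetric] K L] AB1
          chord_equations_rational[OF g_rat KL_rat(2,1) _ L K] g_def by (simp add: mult.commute)
    qed
    then have "X \<in> \<rat>" "Y \<in> \<rat>" unfolding XA YB using a0 by simp_all
    then show ?thesis unfolding sX using rat0 by simp
  next
    case True
    then have w: "w = - u" using opposite_facet[OF F p q pos(1)] by (simp add: D_def)
    have XN: "X = h0" "Y = h0" using True p q0(1) by (simp_all add: X Y k0_def h0_def w lform_uminus) (use p0(1) lform_uminus[of u q0] in \<open>simp add: edge_def\<close>)
    \<comment> \<open>The linear equations determine \<open>s\<close> and \<open>t\<close> unless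
      \<open>mm\<close> is 2 or 6. For two ends that are not vertices, 2 is excluded by assumption
      and 6 exceeds the corner bound 3; a vertex end makes one of the unknowns rational
      beforehand.\<close>
    define mm where "mm = a * h0"
    have mm: "0 < mm" "mm \<in> \<rat>" using a0 XY rat0 by (simp_all add: mm_def)
    have e1: "(s + t) * (1 - mm / 2) \<in> \<rat>"
    proof -
      have "s + t - a * (s * h0 + t * X) / 2 = (s + t) * (1 - mm / 2)" by (simp add: XN mm_def field_simps)
      then show ?thesis using E1 by simp
    qed
    have e2: "t * (1 - mm / 3) - s * mm / 6 \<in> \<rat>"
    proof -
      have "- (a * (s * h0 / 6 * h0)) + (t * (h0 + Y) / 2 - a * (t * X / 6 * (h0 + Y))) = h0 * (t * (1 - mm / 3) - s * mm / 6)"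
        by (simp add: XN mm_def field_simps)
      then have "h0 * (t * (1 - mm / 3) - s * mm / 6) / h0 \<in> \<rat>" using E2 rat0 by (intro Rats_divide) simp_all
      then show ?thesis using XY by simp
    qed
    have cancel: "x \<in> \<rat>" if "x * y \<in> \<rat>" "y \<in> \<rat>" "y \<noteq> 0" for x y :: real
    proof -
      have "x * y / y \<in> \<rat>" using that by (intro Rats_divide)
      then show ?thesis using that(3) by simp
    qed
    show ?thesis
    proof (cases "q extreme_point_of P")
      case True
      then have tr: "t \<in> \<rat>" by (rule qY)
      have "t * (1 - mm / 3) \<in> \<rat>" using tr mm by simp
      from Rats_diff[OF this e2] have "t * (1 - mm / 3) - (t * (1 - mm / 3) - s * mm / 6) \<in> \<rat>" .
      then have "s * (mm / 6) \<in> \<rat>" by simp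
      then have "s \<in> \<rat>" using mm by (intro cancel[of s "mm / 6"]) simp_all
      then show ?thesis using tr by simp
    next
      case qn: False
      show ?thesis
      proof (cases "p extreme_point_of P")
        case True
        then have sr: "s \<in> \<rat>" by (rule pX)
        show ?thesis
        proof (cases "mm = 2")
          case True
          have "(t * (1 - mm / 3) - s * mm / 6) + s * mm / 6 \<in> \<rat>" using e2 sr mm by (intro Rats_add) simp_all
          then have "t * (1 - mm / 3) \<in> \<rat>" by simp
          then have "t \<in> \<rat>" using True by (intro cancel[of t "1 - mm / 3"]) simp_all
          then show ?thesis using sr by simp
        next
          case False
          then have "s + t \<in> \<rat>" using mm by (intro cancel[OF e1]) simp_all
          then have "(s + t) - s \<in> \<rat>" using sr by (intro Rats_diff)
          then show ?thesis using sr by simp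
        qed
      next
        case False
        have "mm \<noteq> 2" using nm[OF False qn w] XN by (simp add: mm_def Y_def)
        have "mm \<le> 3" using bY[OF False] XN by (simp add: mm_def)
        have st: "s + t \<in> \<rat>" using \<open>mm \<noteq> 2\<close> mm by (intro cancel[OF e1]) simp_all
        have "(t * (1 - mm / 3) - s * mm / 6) + (s + t) * mm / 6 \<in> \<rat>" using e2 st mm by (intro Rats_add) simp_all
        moreover have "(t * (1 - mm / 3) - s * mm / 6) + (s + t) * mm / 6 = t * (1 - mm / 6)" by (simp add: field_simps)
        ultimately have "t * (1 - mm / 6) \<in> \<rat>" by simp
        then have tr: "t \<in> \<rat>" using mm \<open>mm \<le> 3\<close> by (intro cancel[of t "1 - mm / 6"]) simp_all
        have "(s + t) - t \<in> \<rat>" using st tr by (intro Rats_diff)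
        then show ?thesis using tr by simp
      qed
    qed
  qed
  then show ?thesis unfolding s t using p0(3) q0(3) by (auto intro!: rat_vec_arith)
qed

end

section \<open>Creases and pieces\<close>

text \<open>A movable crease lies in a family of parallel creases none of which is distinguished, so the
  decomposition must not cut along it.\<close>

definition movable :: "(real^2) set \<Rightarrow> (real^2) set \<Rightarrow> bool" where
  "movable P l \<longleftrightarrow> (\<exists>v. v \<noteq> 0 \<and> (\<forall>t\<in>{-1..1}. (\<lambda>x. x + t *\<^sub>R v) ` l \<in> creases P))"

definition cuts :: "(real^2) set \<Rightarrow> (real^2) set set" where
  "cuts P = {l \<in> creases P. \<not> movable P l}"

text \<open>Describing a region by segments that avoid the cuts requires no equation or orientation
  for any cut, so an affine map carries it along directly.\<close>

definition visible :: "(real^2) set \<Rightarrow> real^2 \<Rightarrow> (real^2) set" where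
  "visible P x = {y \<in> interior P. closed_segment x y \<inter> \<Union>(cuts P) = {}}"

definition pieces :: "(real^2) set \<Rightarrow> (real^2) set set" where
  "pieces P = (\<lambda>x. closure (visible P x)) ` (interior P - \<Union>(cuts P))"

lemma translate_segment: "(\<lambda>x. x + v) ` closed_segment p q = closed_segment (p + v) (q + v)"
  using closed_segment_translation[of v p q] by (simp add: add.commute)

lemma affine_zero_between:
  fixes b x y :: "'a::real_inner"
  assumes "0 < b \<bullet> x + c" "b \<bullet> y + c \<le> 0"
  obtains t where "0 \<le> t" "t \<le> 1" "b \<bullet> (x + t *\<^sub>R (y - x)) + c = 0"
proof -
  define t where "t = (b \<bullet> x + c) / ((b \<bullet> x + c) - (b \<bullet> y + c))"
  have t: "0 \<le> t" "t \<le> 1" using assms by (auto simp: t_def field_simps)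
  have "b \<bullet> (x + t *\<^sub>R (y - x)) + c = (b \<bullet> x + c) - t * ((b \<bullet> x + c) - (b \<bullet> y + c))"
    by (simp add: inner_simps algebra_simps)
  also have "\<dots> = 0" using assms by (simp add: t_def)
  finally show thesis using that t by blast
qed

lemma segment_param: "closed_segment x y = {x + t *\<^sub>R (y - x) |t. 0 \<le> t \<and> t \<le> 1}"
proof -
  have "(1 - t) *\<^sub>R x + t *\<^sub>R y = x + t *\<^sub>R (y - x)" for t by (simp add: algebra_simps)
  then show ?thesis by (auto simp: closed_segment_def)
qed

section \<open>Disjointness, movability and finiteness of creases\<close>

context semistable_polygon
begin

lemma creases_iff: "l \<in> creases P \<longleftrightarrow> (\<exists>b c. zero_fun b c \<and> l = {x \<in> P. b \<bullet> x + c = 0})"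
proof -
  have s: "stab_functional \<sigma> P (\<lambda>x. max (b \<bullet> x + c) 0) = L P (\<lambda>x. max (b \<bullet> x + c) 0)" for b c
    by (intro stab_functional_eq_L continuous_intros)
  have "{x \<in> P. b \<bullet> x + c = 0} \<inter> interior P \<noteq> {} \<longleftrightarrow> (\<exists>x\<in>interior P. b \<bullet> x + c = 0)" for b c
    using interior_subset by blast
  then show ?thesis unfolding creases_def zero_fun_def crease_fun_def s by blast
qed

lemma zero_fun_uminus: "zero_fun b c \<Longrightarrow> zero_fun (- b) (- c)"
  unfolding zero_fun_def using crease_fun_uminus crease_reverse[OF good_P] by blast

lemma crease_ends:
  assumes "l \<in> creases P"
  obtains p q where "p \<in> frontier P" "q \<in> frontier P" "zchord p q" "l = closed_segment p q"
proof -
  obtain b c where z: "zero_fun b c" and l: "l = {x \<in> P. b \<bullet> x + c = 0}" using assms creases_iff by blast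
  have b: "b \<noteq> 0" using z by (simp add: zero_fun_def crease_fun_def)
  obtain m where m: "m \<in> interior P" "b \<bullet> m + c = 0" using z by (auto simp: zero_fun_def crease_fun_def)
  have le: "l = P \<inter> {x. b \<bullet> x = - c}" by (auto simp: l)
  have cl: "compact l" "convex l" unfolding le
    using compact_P convex_P by (auto intro: compact_Int_closed closed_hyperplane convex_Int convex_hyperplane)
  have ml: "m \<in> l" using m interior_subset by (auto simp: l)
  obtain p q where pq: "l = closed_segment p q" "p extreme_point_of l" "q extreme_point_of l"
    using segment_of_line[OF cl, of b "-c"] ml b le by blast
  have near: "\<exists>e. e \<noteq> 0 \<and> x + e *\<^sub>R perp b \<in> l \<and> x - e *\<^sub>R perp b \<in> l" if x: "x \<in> interior P" "x \<in> l" for x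
  proof -
    obtain e where e: "0 < e" "ball x e \<subseteq> interior P" using x(1) open_contains_ball open_interior by blast
    define d where "d = e / (2 * norm (perp b))"
    have d: "d \<noteq> 0" using e b by (simp add: d_def)
    have "dist x (x + d *\<^sub>R perp b) = e / 2" "dist x (x - d *\<^sub>R perp b) = e / 2"
      using e b by (simp_all add: dist_norm d_def)
    then have "x + d *\<^sub>R perp b \<in> interior P" "x - d *\<^sub>R perp b \<in> interior P" using e by auto
    moreover have "b \<bullet> perp b = 0" by (simp add: inner_2)
    ultimately have "x + d *\<^sub>R perp b \<in> l" "x - d *\<^sub>R perp b \<in> l"
      using x(2) interior_subset[of P] by (auto simp: l inner_simps)
    then show ?thesis using d by blast
  qed
  have fr: "x \<in> frontier P" if "x extreme_point_of l" for x
  proof (rule ccontr)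
    assume "x \<notin> frontier P"
    moreover have xl: "x \<in> l" using that by (simp add: extreme_point_of_def)
    ultimately have "x \<in> interior P" using closed_P by (auto simp: frontier_def l)
    then obtain e where "e \<noteq> 0" "x + e *\<^sub>R perp b \<in> l" "x - e *\<^sub>R perp b \<in> l" using near xl by blast
    then show False using not_extreme_between[of x e "perp b" l] b that by simp
  qed
  have "p \<noteq> q"
  proof
    assume "p = q"
    then have "l = {m}" using ml pq(1) by simp
    moreover obtain e where "e \<noteq> 0" "m + e *\<^sub>R perp b \<in> l" using near[OF m(1) ml] by blast
    ultimately show False using b by auto
  qed
  moreover have "p \<in> l" "q \<in> l" using pq by (auto simp: extreme_point_of_def)
  ultimately have "zchord p q" using zero_fun_zchord[OF z] by (simp add: l)
  then show thesis using that fr pq by blast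
qed

lemma meets_segmentI:
  assumes "meets p q" "p \<in> frontier P" "q \<in> frontier P" "x \<in> P" "side p q x = 0"
  shows "x \<in> closed_segment p q"
  using assms unfolding chord_segment[OF assms(1-3), symmetric] by simp

lemma zchord_crease:
  assumes z: "zchord p q" and fr: "p \<in> frontier P" "q \<in> frontier P"
  shows "closed_segment p q \<in> creases P"
proof -
  have "meets p q" using z by (simp add: zchord_def)
  then have "closed_segment p q = {x \<in> P. perp (q - p) \<bullet> x + (- (perp (q - p) \<bullet> p)) = 0}"
    using chord_segment[OF _ fr] by (simp add: side_affine)
  then show ?thesis using zchord_zero_fun[OF z] creases_iff by blast
qed

lemma crease_zchord:
  assumes "closed_segment p q \<in> creases P" "p \<noteq> q"
  shows "zchord p q"
proof -
  obtain b c where z: "zero_fun b c" and l: "closed_segment p q = {x \<in> P. b \<bullet> x + c = 0}"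
    using assms creases_iff by blast
  have "p \<in> {x \<in> P. b \<bullet> x + c = 0}" "q \<in> {x \<in> P. b \<bullet> x + c = 0}" unfolding l[symmetric] by auto
  then show ?thesis using zero_fun_zchord[OF z assms(2)] by simp
qed

text \<open>If \<open>l\<close> and \<open>l'\<close> met in \<open>z\<close>, then
  \<open>l'\<close> would be a zero crease of the half of \<open>P\<close> on one side of
  \<open>l\<close>, touching its bounding cut at \<open>z\<close>, which has been excluded.\<close>

lemma creases_disjoint:
  assumes l: "l \<in> creases P" "l' \<in> creases P" "l \<noteq> l'"
  shows "l \<inter> l' = {}"
proof (rule ccontr)
  assume "l \<inter> l' \<noteq> {}"
  then obtain z where z: "z \<in> l" "z \<in> l'" by blast
  obtain b0 c0 where zf0: "zero_fun b0 c0" and le0: "l = {x \<in> P. b0 \<bullet> x + c0 = 0}" using l creases_iff by blast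
  obtain b' c' where zf': "zero_fun b' c'" and le': "l' = {x \<in> P. b' \<bullet> x + c' = 0}" using l creases_iff by blast
  have b'0: "b' \<noteq> 0" using zf' by (simp add: zero_fun_def crease_fun_def)
  \<comment> \<open>Otherwise the affine function of \<open>l\<close> would vanish at two interior
    points of \<open>l'\<close>, and the two creases would coincide.\<close>
  have "\<exists>x0\<in>interior P. b' \<bullet> x0 + c' = 0 \<and> b0 \<bullet> x0 + c0 \<noteq> 0"
  proof (rule ccontr)
    assume "\<not> ?thesis"
    then have all: "\<And>x. x \<in> interior P \<Longrightarrow> b' \<bullet> x + c' = 0 \<Longrightarrow> b0 \<bullet> x + c0 = 0" by blast
    obtain m where m: "m \<in> interior P" "b' \<bullet> m + c' = 0" using zf' by (auto simp: zero_fun_def crease_fun_def)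
    obtain e where e: "0 < e" "ball m e \<subseteq> interior P" using m(1) open_contains_ball open_interior by blast
    let ?n = "m + (e / (2 * norm (perp b'))) *\<^sub>R perp b'"
    have "dist m ?n = e / 2" using e b'0 by (simp add: dist_norm)
    then have n: "?n \<in> interior P" using e by auto
    have "b' \<bullet> perp b' = 0" by (simp add: inner_2)
    then have "b' \<bullet> ?n + c' = 0" using m(2) by (simp add: inner_simps)
    then have "b0 \<bullet> ?n + c0 = 0" "b0 \<bullet> m + c0 = 0" using all n m by blast+
    moreover have "b0 \<bullet> ?n + c0 = (b0 \<bullet> m + c0) + (e / (2 * norm (perp b'))) * (b0 \<bullet> perp b')"
      by (simp add: inner_simps)
    ultimately have "(e / (2 * norm (perp b'))) * (b0 \<bullet> perp b') = 0" by linarith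
    then have "perp b' \<bullet> b0 = 0" "perp b' \<bullet> b' = 0" using e b'0 \<open>b' \<bullet> perp b' = 0\<close> by (auto simp: inner_commute)
    then obtain \<kappa> where \<kappa>: "b0 = \<kappa> *\<^sub>R b'" using orthogonal_imp_parallel[of "perp b'" b0 b'] b'0 by auto
    have "\<kappa> \<noteq> 0" using \<kappa> zf0 by (auto simp: zero_fun_def crease_fun_def)
    have "c0 = \<kappa> * c'"
    proof -
      have "c0 = - (b0 \<bullet> m)" "c' = - (b' \<bullet> m)" using \<open>b0 \<bullet> m + c0 = 0\<close> m(2) by linarith+
      then show ?thesis by (simp add: \<kappa>)
    qed
    then have "b0 \<bullet> x + c0 = \<kappa> * (b' \<bullet> x + c')" for x by (simp add: \<kappa> algebra_simps)
    then have "l = l'" using \<open>\<kappa> \<noteq> 0\<close> by (simp add: le0 le')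
    then show False using l(3) by simp
  qed
  then obtain x0 where x0: "x0 \<in> interior P" "b' \<bullet> x0 + c' = 0" "b0 \<bullet> x0 + c0 \<noteq> 0" by blast
  have "\<exists>b c. zero_fun b c \<and> 0 < b \<bullet> x0 + c \<and> b \<bullet> z + c = 0"
  proof (cases "0 < b0 \<bullet> x0 + c0")
    case True
    then show ?thesis using zf0 z(1) le0 by blast
  next
    case False
    then have "0 < (- b0) \<bullet> x0 + (- c0)" "(- b0) \<bullet> z + (- c0) = 0" using x0(3) z(1) le0 by auto
    then show ?thesis using zero_fun_uminus[OF zf0] by blast
  qed
  then obtain b c where bc: "zero_fun b c" "0 < b \<bullet> x0 + c" "b \<bullet> z + c = 0" by blast
  let ?K = "{(b, c)}"
  have K: "finite ?K" "\<And>b' c'. (b', c') \<in> ?K \<Longrightarrow> zero_fun b' c'" using bc(1) by auto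
  have "L (cell ?K) (\<lambda>x. max (b' \<bullet> x + c') 0) = 0" using cell_good[OF good_P K] zf' by blast
  moreover have "x0 \<in> cell ?K" using bc(2) x0(1) interior_subset by (auto simp: cell_def)
  moreover have "z \<in> P" "b' \<bullet> z + c' = 0" using z le' by auto
  ultimately have "b \<bullet> z + c \<noteq> 0"
    using no_touch[OF good_P K x0(1) _ x0(2) b'0, of z b c] bc(3) by auto
  then show False using bc(3) by simp
qed

text \<open>Both ends have room to slide on their edges; the smaller of the two ranges serves both,
  and the translation vector is scaled to make the parameter run from -1 to 1.\<close>

lemma strip_movable:
  assumes F: "(u, c) \<in> \<F>" "(- u, e) \<in> \<F>" and p: "p \<in> edge u c" "\<not> p extreme_point_of P"
    and q: "q \<in> edge (- u) e" "\<not> q extreme_point_of P" and z: "zchord p q" and w: "a * (lform u q - c) = 2"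
  shows "movable P (closed_segment p q)"
proof -
  obtain r1 where r1: "0 < r1" "\<And>t. \<bar>t\<bar> \<le> r1 \<Longrightarrow> p + t *\<^sub>R dvec u \<in> edge u c"
    "\<And>t. \<bar>t\<bar> \<le> r1 \<Longrightarrow> \<not> (p + t *\<^sub>R dvec u) extreme_point_of P" using nonvertex_neighbourhood[OF F(1) p] by metis
  obtain r2 where r2: "0 < r2" "\<And>t. \<bar>t\<bar> \<le> r2 \<Longrightarrow> q + t *\<^sub>R dvec (- u) \<in> edge (- u) e"
    using nonvertex_neighbourhood[OF F(2) q] by metis
  have dv: "dvec (- u) = - dvec u" by (simp add: vec_eq_2)
  define r where "r = min r1 r2"
  have "q \<in> P" "p \<in> P" using p q edge_subset by blast+
  have cq: "c < lform u q" using w facetD(3)[OF F(1) \<open>q \<in> P\<close>] a_pos by (cases "lform u q = c") auto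
  have zc: "zchord (p + t *\<^sub>R dvec u) (q + t *\<^sub>R dvec u) \<and> p + t *\<^sub>R dvec u \<in> edge u c \<and> q + t *\<^sub>R dvec u \<in> edge (- u) e"
    if t: "\<bar>t\<bar> \<le> r" for t
  proof -
    have pe: "p + t *\<^sub>R dvec u \<in> edge u c" "\<not> (p + t *\<^sub>R dvec u) extreme_point_of P" using r1 t by (auto simp: r_def)
    have qe: "q + t *\<^sub>R dvec u \<in> edge (- u) e" using r2(2)[of "- t"] t by (simp add: r_def dv)
    then have qP: "q + t *\<^sub>R dvec u \<in> P" using edge_subset by blast
    have "lform u (q + t *\<^sub>R dvec u) = lform u q" by (simp add: lform_add lform_scaleR)
    then have "meets (p + t *\<^sub>R dvec u) q" "meets (p + t *\<^sub>R dvec u) (q + t *\<^sub>R dvec u)"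
      using meets_nonvertex[OF F(1) pe \<open>q \<in> P\<close> cq] meets_nonvertex[OF F(1) pe qP] cq by simp_all
    then show ?thesis using translate_zchord[OF F p(1) pe(1) q(1) qe z w] pe qe by blast
  qed
  have "(\<lambda>x. x + t *\<^sub>R (r *\<^sub>R dvec u)) ` closed_segment p q \<in> creases P" if "t \<in> {-1..1}" for t
  proof -
    have "\<bar>t\<bar> * r \<le> 1 * r" using that r1(1) r2(1) by (intro mult_right_mono) (auto simp: r_def)
    then have "\<bar>t * r\<bar> \<le> r" using r1(1) r2(1) by (simp add: abs_mult r_def)
    from zc[OF this] show ?thesis
      unfolding translate_segment scaleR_scaleR using zchord_crease edge_in_frontier F by blast
  qed
  moreover have "r *\<^sub>R dvec u \<noteq> 0" using r1(1) r2(1) facetD(2)[OF F(1)] by (simp add: r_def dvec_eq_0)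
  ultimately show ?thesis unfolding movable_def by blast
qed

text \<open>The converse of \<open>strip_movable\<close>. Translation both ways keeps each end on
  its edge, so a translate is a second zero chord between the same two edges.\<close>

lemma movable_ends:
  assumes mov: "movable P (closed_segment p q)" and F: "(u, c) \<in> \<F>" "(w, e) \<in> \<F>"
    and p: "p \<in> edge u c" and q: "q \<in> edge w e" and pq: "p \<noteq> q"
  shows "\<not> p extreme_point_of P" "\<not> q extreme_point_of P" "w = - u" "a * (lform u q - c) = 2"
proof -
  obtain v where v: "v \<noteq> 0" "\<And>t. \<bar>t\<bar> \<le> 1 \<Longrightarrow> closed_segment (p + t *\<^sub>R v) (q + t *\<^sub>R v) \<in> creases P"
    using mov unfolding movable_def translate_segment by (auto simp: abs_le_iff)
  have inP: "p + t *\<^sub>R v \<in> P" "q + t *\<^sub>R v \<in> P" if "\<bar>t\<bar> \<le> 1" for t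
    using v(2)[OF that] unfolding creases_def by (blast intro: ends_in_segment)+
  have pm: "p + 1 *\<^sub>R v \<in> P" "p - 1 *\<^sub>R v \<in> P" "q + 1 *\<^sub>R v \<in> P" "q - 1 *\<^sub>R v \<in> P"
    using inP[of 1] inP[of "-1"] by simp_all
  show "\<not> p extreme_point_of P" "\<not> q extreme_point_of P"
    using not_extreme_between[OF pm(1,2) _ v(1)] not_extreme_between[OF pm(3,4) _ v(1)] by simp_all
  have e0: "lform w' v = 0" if "(w', e') \<in> \<F>" "x \<in> edge w' e'" "x + v \<in> P" "x - v \<in> P" for w' e' x
    using facetD(3)[OF that(1,3)] facetD(3)[OF that(1,4)] that(2) by (simp add: edge_def lform_add lform_diff)
  \<comment> \<open>Half the translation is used: the full one might bring an end to a vertex, but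
    the comparison of two chords requires that the moved end is not one.\<close>
  let ?p = "p + (1/2) *\<^sub>R v" and ?q = "q + (1/2) *\<^sub>R v"
  have h: "?p \<in> P" "?q \<in> P" using inP[of "1/2"] by simp_all
  have pe: "?p \<in> edge u c" using e0[OF F(1) p] pm h p by (simp add: edge_def lform_add lform_scaleR)
  have qe: "?q \<in> edge w e" using e0[OF F(2) q] pm h q by (simp add: edge_def lform_add lform_scaleR)
  have pn: "\<not> ?p extreme_point_of P"
  proof (rule not_extreme_between[where t="1/2" and e=v])
    have E: "?p + (1/2) *\<^sub>R v = p + 1 *\<^sub>R v" by (simp add: vec_eq_2)
    show "?p + (1/2) *\<^sub>R v \<in> P" unfolding E by (rule pm(1))
    show "?p - (1/2) *\<^sub>R v \<in> P" using p edge_subset by auto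
  qed (use v(1) in simp_all)
  have cr: "closed_segment p q \<in> creases P" "closed_segment ?p ?q \<in> creases P"
    using v(2)[of 0] v(2)[of "1/2"] by simp_all
  have z: "zchord p q" "zchord ?p ?q" using crease_zchord cr pq by simp_all
  have fr: "p \<in> frontier P" "q \<in> frontier P" "?p \<in> frontier P" "?q \<in> frontier P"
    using edge_in_frontier F p q pe qe by blast+
  have ne: "closed_segment p q \<noteq> closed_segment ?p ?q"
  proof
    assume "closed_segment p q = closed_segment ?p ?q"
    then have "{p, q} = {?p, ?q}" by (simp add: closed_segment_eq)
    then have "p = ?p \<or> p = ?q" "q = ?p \<or> q = ?q" by blast+
    then have "p = ?q" "q = ?p" using v(1) by simp_all
    then have "v = 0" unfolding vec_eq_2 by (auto simp: field_simps)
    then show False using v(1) by simp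
  qed
  have disj: "side ?p ?q x \<noteq> 0" if "x \<in> P" "side p q x = 0" for x
  proof
    assume "side ?p ?q x = 0"
    then have "x \<in> closed_segment p q" "x \<in> closed_segment ?p ?q"
      using that z fr by (auto intro!: meets_segmentI simp: zchord_def)
    then show False using creases_disjoint[OF cr ne] by blast
  qed
  note two = two_zchords[OF F p pe pn q qe z disj]
  show "w = - u" "a * (lform u q - c) = 2"
    using two by simp_all
qed

lemma cut_ends:
  assumes "l \<in> cuts P"
  obtains p q u c w e where "(u, c) \<in> \<F>" "(w, e) \<in> \<F>" "p \<in> edge u c" "q \<in> edge w e" "zchord p q"
    "l = closed_segment p q" "rat_vec p" "rat_vec q"
proof -
  have l: "l \<in> creases P" "\<not> movable P l" using assms by (auto simp: cuts_def)
  obtain p q where pq: "p \<in> frontier P" "q \<in> frontier P" "zchord p q" "l = closed_segment p q"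
    using crease_ends[OF l(1)] .
  obtain u c where F1: "(u, c) \<in> \<F>" "p \<in> edge u c" using frontier_facets pq(1) by blast
  obtain w e where F2: "(w, e) \<in> \<F>" "q \<in> edge w e" using frontier_facets pq(2) by blast
  have "rat_vec p \<and> rat_vec q"
    by (rule zchord_rational[OF F1(1) F2(1) F1(2) F2(2) pq(3)])
      (use strip_movable[OF F1(1) _ F1(2) _ _ _ pq(3)] F2 l(2) pq(4) in blast)
  then show thesis using that F1 F2 pq by blast
qed

lemma finite_vertices: "finite {v. v extreme_point_of P}"
  by (rule finite_polyhedron_extreme_points[OF polytope_imp_polyhedron[OF polytope_P]])

text \<open>By disjointness each vertex lies on at most one cut. Cuts that avoid the vertices are
  determined by the pair of edges they join, since two of them would be movable.\<close>

lemma finite_cuts: "finite (cuts P)"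
proof -
  let ?V = "{v. v extreme_point_of P}"
  let ?Cv = "{l \<in> cuts P. \<exists>v\<in>l. v extreme_point_of P}" and ?C0 = "{l \<in> cuts P. \<not> (\<exists>v\<in>l. v extreme_point_of P)}"
  have cr: "l \<in> creases P" if "l \<in> cuts P" for l using that by (simp add: cuts_def)
  have "?Cv \<subseteq> (\<lambda>v. SOME l. l \<in> cuts P \<and> v \<in> l) ` ?V"
  proof
    fix l assume "l \<in> ?Cv"
    then obtain v where v: "l \<in> cuts P" "v \<in> l" "v extreme_point_of P" by blast
    have "(SOME l. l \<in> cuts P \<and> v \<in> l) = l"
    proof (rule some_equality)
      show "l \<in> cuts P \<and> v \<in> l" using v by blast
      show "l' = l" if "l' \<in> cuts P \<and> v \<in> l'" for l'
        using creases_disjoint[of l' l] cr that v by blast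
    qed
    then show "l \<in> (\<lambda>v. SOME l. l \<in> cuts P \<and> v \<in> l) ` ?V" using v(3) by (intro image_eqI[where x = v]) simp_all
  qed
  then have fv: "finite ?Cv" by (rule finite_subset) (intro finite_imageI finite_vertices)
  define R where "R k l \<longleftrightarrow> l \<in> ?C0 \<and> (\<exists>p q. p \<in> edge (fst (fst k)) (snd (fst k)) \<and> q \<in> edge (fst (snd k)) (snd (snd k)) \<and>
      zchord p q \<and> l = closed_segment p q)" for k l
  have un: "l' = l" if k: "k \<in> \<F> \<times> \<F>" and R: "R k l" "R k l'" for k l l'
  proof (rule ccontr)
    assume ne: "l' \<noteq> l"
    obtain u c w e where ke: "k = ((u, c), (w, e))" by (metis prod.collapse)
    have F: "(u, c) \<in> \<F>" "(w, e) \<in> \<F>" using k by (auto simp: ke)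
    obtain p q where p: "p \<in> edge u c" "q \<in> edge w e" "zchord p q" "l = closed_segment p q" using R(1) by (auto simp: R_def ke)
    obtain p' q' where p': "p' \<in> edge u c" "q' \<in> edge w e" "zchord p' q'" "l' = closed_segment p' q'" using R(2) by (auto simp: R_def ke)
    have nv: "\<not> p extreme_point_of P" "\<not> q extreme_point_of P" "\<not> p' extreme_point_of P"
      using R p(4) p'(4) by (auto simp: R_def)
    have fr: "p \<in> frontier P" "q \<in> frontier P" "p' \<in> frontier P" "q' \<in> frontier P"
      using edge_in_frontier F p p' by blast+
    have disj: "side p' q' x \<noteq> 0" if "x \<in> P" "side p q x = 0" for x
    proof
      assume "side p' q' x = 0"
      then have "x \<in> l" "x \<in> l'"
        unfolding p(4) p'(4) using that p(3) p'(3) fr by (auto intro!: meets_segmentI simp: zchord_def)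
      then show False using creases_disjoint[of l l'] cr ne R by (auto simp: R_def)
    qed
    have w: "w = - u" "a * (lform u q - c) = 2"
      using two_zchords[OF F p(1) p'(1) nv(3) p(2) p'(2) p(3) p'(3) disj] by simp_all
    have "movable P l" unfolding p(4)
      using strip_movable[OF F(1) _ p(1) nv(1) _ nv(2) p(3) w(2)] F(2) p(2) w(1) by simp
    then show False using R by (simp add: R_def cuts_def)
  qed
  have "?C0 \<subseteq> (\<lambda>k. SOME l. R k l) ` (\<F> \<times> \<F>)"
  proof
    fix l assume l: "l \<in> ?C0"
    then have "l \<in> cuts P" by simp
    then obtain p q u c w e where pq: "(u, c) \<in> \<F>" "(w, e) \<in> \<F>" "p \<in> edge u c" "q \<in> edge w e" "zchord p q" "l = closed_segment p q"
      using cut_ends by metis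
    let ?k = "((u, c), (w, e))"
    have k: "?k \<in> \<F> \<times> \<F>" using pq by simp
    have R: "R ?k l" using l pq by (auto simp: R_def)
    have "(SOME l. R ?k l) = l" 
    proof (rule some_equality)
      show "R ?k l" by (rule R)
      show "l' = l" if "R ?k l'" for l' by (rule un[OF k R that])
    qed
    then show "l \<in> (\<lambda>k. SOME l. R k l) ` (\<F> \<times> \<F>)" using k by (intro image_eqI[where x = ?k]) simp_all
  qed
  then have f0: "finite ?C0" by (rule finite_subset) (intro finite_imageI finite_cartesian_product finite_facets)
  have "cuts P \<subseteq> ?Cv \<union> ?C0" by auto
  then show ?thesis using finite_UnI[OF fv f0] by (rule finite_subset)
qed

section \<open>The arrangement of cuts and its cells\<close>

lemma mem_cell: "y \<in> cell K \<longleftrightarrow> y \<in> P \<and> (\<forall>b c. (b, c) \<in> K \<longrightarrow> 0 < b \<bullet> y + c)"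
  unfolding cell_def by blast

definition closed_cell :: "((real^2) \<times> real) set \<Rightarrow> (real^2) set" where
  "closed_cell K = {y \<in> P. \<forall>b c. (b, c) \<in> K \<longrightarrow> 0 \<le> b \<bullet> y + c}"

lemma closed_cell_eq: "closed_cell K = P \<inter> {x. \<forall>(b, c)\<in>K. 0 \<le> b \<bullet> x + c}"
  unfolding closed_cell_def by blast

lemma polyhedron_halfplanes:
  fixes K :: "((real^2) \<times> real) set"
  assumes "finite K"
  shows "polyhedron {x. \<forall>(b, c)\<in>K. 0 \<le> b \<bullet> x + c}"
proof -
  have "{x. \<forall>(b, c)\<in>K. 0 \<le> b \<bullet> x + c} = \<Inter>((\<lambda>(b, c). {x. b \<bullet> x \<ge> - c}) ` K)"
  proof -
    have "0 \<le> b \<bullet> x + c \<longleftrightarrow> - c \<le> b \<bullet> x" for b x :: "real^2" and c by linarith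
    then show ?thesis by auto
  qed
  moreover have "polyhedron \<dots>"
    using assms by (intro polyhedron_Inter) (auto simp: polyhedron_halfspace_ge)
  ultimately show ?thesis by simp
qed

lemma polytope_closed_cell: "finite K \<Longrightarrow> polytope (closed_cell K)"
  unfolding closed_cell_eq by (rule polytope_Int_polyhedron[OF polytope_P polyhedron_halfplanes])

lemma open_cell:
  assumes "finite K"
  shows "open (interior P \<inter> cell K)"
proof -
  have "interior P \<inter> cell K = interior P \<inter> (\<Inter>k\<in>K. {x. fst k \<bullet> x > - snd k})"
  proof -
    have "- c < b \<bullet> x \<longleftrightarrow> 0 < b \<bullet> x + c" for b x :: "real^2" and c by linarith
    then have "(\<forall>b c. (b, c) \<in> K \<longrightarrow> 0 < b \<bullet> x + c) \<longleftrightarrow> (\<forall>k\<in>K. - snd k < fst k \<bullet> x)" for x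
      unfolding Ball_def split_paired_All fst_conv snd_conv by simp
    then have "x \<in> cell K \<longleftrightarrow> x \<in> P \<and> (\<forall>k\<in>K. - snd k < fst k \<bullet> x)" for x unfolding mem_cell by simp
    then show ?thesis using interior_subset[of P] unfolding set_eq_iff Int_iff INT_iff mem_Collect_eq by blast
  qed
  moreover have "open \<dots>"
    using assms by (intro open_Int open_interior open_INT ballI open_halfspace_gt)
  ultimately show ?thesis by simp
qed

lemma closure_cell:
  assumes K: "finite K" and x: "x \<in> interior P" "x \<in> cell K"
  shows "closure (interior P \<inter> cell K) = closed_cell K"
proof
  have "closed (closed_cell K)" using polytope_closed_cell[OF K] polytope_imp_closed by blast
  moreover have "interior P \<inter> cell K \<subseteq> closed_cell K"
    unfolding mem_cell closed_cell_def subset_iff Int_iff mem_Collect_eq by (meson less_imp_le)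
  ultimately show "closure (interior P \<inter> cell K) \<subseteq> closed_cell K" by (rule closure_minimal[rotated])
  show "closed_cell K \<subseteq> closure (interior P \<inter> cell K)"
  proof
    fix y assume y: "y \<in> closed_cell K"
    show "y \<in> closure (interior P \<inter> cell K)"
    proof (cases "x = y")
      case True
      have "x \<in> closure (interior P \<inter> cell K)" using x by (intro subsetD[OF closure_subset]) simp
      then show ?thesis using True by simp
    next
      case False
      have "open_segment x y \<subseteq> interior P \<inter> cell K"
      proof
        fix z assume "z \<in> open_segment x y"
        then obtain t where t: "0 < t" "t < 1" "z = (1 - t) *\<^sub>R x + t *\<^sub>R y" by (auto simp only: in_segment)
        then have ze: "z = x + t *\<^sub>R (y - x)" by (simp add: algebra_simps)
        have zi: "z \<in> interior P"
          unfolding ze by (rule open_segment_interior[OF convex_P x(1)]) (use t y in \<open>simp_all add: closed_cell_def\<close>)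
        have "0 < b \<bullet> z + c" if "(b, c) \<in> K" for b c
        proof -
          have "0 < (1 - t) * (b \<bullet> x + c)" using x(2) t that by (simp add: mem_cell)
          moreover have "0 \<le> t * (b \<bullet> y + c)" using y t that by (simp add: closed_cell_def)
          moreover have "b \<bullet> z + c = (1 - t) * (b \<bullet> x + c) + t * (b \<bullet> y + c)"
            by (simp add: ze inner_simps algebra_simps)
          ultimately show ?thesis by linarith
        qed
        then show "z \<in> interior P \<inter> cell K" using zi interior_subset unfolding Int_iff mem_cell by blast
      qed
      then have "closure (open_segment x y) \<subseteq> closure (interior P \<inter> cell K)" by (rule closure_mono)
      moreover have "y \<in> closure (open_segment x y)" using False by (simp add: closure_open_segment)
      ultimately show ?thesis by blast
    qed
  qed
qed

lemma interior_closed_cell: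
  assumes K: "finite K" and x: "x \<in> interior P" "x \<in> cell K"
  shows "interior (closed_cell K) = interior P \<inter> cell K"
proof -
  have c: "convex (interior P \<inter> cell K)" using convex_P by (intro convex_Int convex_interior convex_cell)
  then show ?thesis
    unfolding closure_cell[OF assms, symmetric]
    by (simp only: convex_interior_closure[OF c] interior_open[OF open_cell[OF K]])
qed

text \<open>An arbitrary equation for each cut, of arbitrary sign. The choice stays inside the
  proofs: \<open>visible\<close> and \<open>pieces\<close> do not refer to it.\<close>

definition cut_form :: "(real^2) set \<Rightarrow> (real^2) \<times> real" where
  "cut_form l = (SOME k. zero_fun (fst k) (snd k) \<and> l = {y \<in> P. fst k \<bullet> y + snd k = 0})"

text \<open>A set of cuts encodes a sign pattern of the arrangement, so finiteness of the cuts
  bounds the number of cells.\<close>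

definition signed_forms :: "(real^2) set set \<Rightarrow> ((real^2) \<times> real) set" where
  "signed_forms S = (\<lambda>l. if l \<in> S then cut_form l else (- fst (cut_form l), - snd (cut_form l))) ` cuts P"

definition positive_cuts :: "real^2 \<Rightarrow> (real^2) set set" where
  "positive_cuts x = {l \<in> cuts P. 0 < fst (cut_form l) \<bullet> x + snd (cut_form l)}"

lemma cut_form:
  assumes "l \<in> cuts P"
  shows "zero_fun (fst (cut_form l)) (snd (cut_form l))" "l = {y \<in> P. fst (cut_form l) \<bullet> y + snd (cut_form l) = 0}"
proof -
  have "l \<in> creases P" using assms by (simp add: cuts_def)
  then obtain b c where "zero_fun b c" "l = {y \<in> P. b \<bullet> y + c = 0}" using creases_iff by blast
  then have "\<exists>k. zero_fun (fst k) (snd k) \<and> l = {y \<in> P. fst k \<bullet> y + snd k = 0}"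
    by (intro exI[of _ "(b, c)"]) simp
  from someI_ex[OF this] show "zero_fun (fst (cut_form l)) (snd (cut_form l))"
    "l = {y \<in> P. fst (cut_form l) \<bullet> y + snd (cut_form l) = 0}" unfolding cut_form_def by blast+
qed

lemma cut_formE:
  assumes "l \<in> cuts P"
  obtains b c where "zero_fun b c" "l = {y \<in> P. b \<bullet> y + c = 0}"
  using cut_form[OF assms] by (rule that)

lemma finite_signed_forms: "finite (signed_forms S)"
  unfolding signed_forms_def using finite_cuts by simp

lemma signed_formsD:
  assumes "(b, c) \<in> signed_forms S"
  shows "zero_fun b c" "{y \<in> P. b \<bullet> y + c = 0} \<in> cuts P"
proof -
  obtain l where l: "l \<in> cuts P" "(b, c) = (if l \<in> S then cut_form l else (- fst (cut_form l), - snd (cut_form l)))"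
    using assms unfolding signed_forms_def by blast
  have "(b = fst (cut_form l) \<and> c = snd (cut_form l)) \<or> (b = - fst (cut_form l) \<and> c = - snd (cut_form l))"
    using l(2) by (metis fst_conv snd_conv)
  moreover have "- fst (cut_form l) \<bullet> y + - snd (cut_form l) = 0 \<longleftrightarrow> fst (cut_form l) \<bullet> y + snd (cut_form l) = 0" for y
    by auto
  ultimately show "zero_fun b c" "{y \<in> P. b \<bullet> y + c = 0} \<in> cuts P"
    using cut_form[OF l(1)] l(1) zero_fun_uminus by auto
qed

lemma signed_forms_cut:
  assumes "l \<in> cuts P"
  obtains b c where "(b, c) \<in> signed_forms S" "l = {y \<in> P. b \<bullet> y + c = 0}"
proof (cases "l \<in> S")
  case True
  then have "cut_form l \<in> signed_forms S" using assms unfolding signed_forms_def by auto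
  then show thesis using that[of "fst (cut_form l)" "snd (cut_form l)"] cut_form(2)[OF assms] by simp
next
  case False
  then have k: "(- fst (cut_form l), - snd (cut_form l)) \<in> signed_forms S" using assms unfolding signed_forms_def by auto
  have "- fst (cut_form l) \<bullet> y + - snd (cut_form l) = 0 \<longleftrightarrow> fst (cut_form l) \<bullet> y + snd (cut_form l) = 0" for y
    by auto
  then show thesis using that[OF k] cut_form(2)[OF assms] by simp
qed

lemma positive_cell:
  assumes x: "x \<in> P" "x \<notin> \<Union>(cuts P)"
  shows "x \<in> cell (signed_forms (positive_cuts x))"
  unfolding mem_cell
proof (intro conjI allI impI)
  fix b c assume k: "(b, c) \<in> signed_forms (positive_cuts x)"
  obtain l where l: "l \<in> cuts P" "(b, c) = (if l \<in> positive_cuts x then cut_form l else (- fst (cut_form l), - snd (cut_form l)))"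
    using k unfolding signed_forms_def by blast
  have "b \<bullet> x + c \<noteq> 0" using signed_formsD(2)[OF k] x by blast
  show "0 < b \<bullet> x + c"
  proof (cases "l \<in> positive_cuts x")
    case True
    then have "b = fst (cut_form l)" "c = snd (cut_form l)" using l(2) by (metis fst_conv snd_conv)+
    then show ?thesis using True by (simp add: positive_cuts_def)
  next
    case False
    then have "b = - fst (cut_form l)" "c = - snd (cut_form l)" using l(2) by auto
    then show ?thesis using False l(1) \<open>b \<bullet> x + c \<noteq> 0\<close> by (simp add: positive_cuts_def)
  qed
qed (rule x)

lemma cell_not_cut:
  assumes "y \<in> cell (signed_forms S)"
  shows "y \<notin> \<Union>(cuts P)"
proof
  assume "y \<in> \<Union>(cuts P)"
  then obtain l where l: "l \<in> cuts P" "y \<in> l" by blast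
  obtain b c where bc: "(b, c) \<in> signed_forms S" "l = {y \<in> P. b \<bullet> y + c = 0}" using signed_forms_cut[OF l(1)] .
  have "0 < b \<bullet> y + c" using assms bc(1) unfolding mem_cell by blast
  then show False using l(2) bc(2) by simp
qed

text \<open>A segment from \<open>x\<close> can leave the cell of \<open>x\<close> within
  \<open>P\<close> only through a cut, and conversely cells are convex and avoid the cuts. This
  identifies the choice-free region with a convex cell.\<close>

lemma visible_eq:
  assumes x: "x \<in> interior P" "x \<notin> \<Union>(cuts P)"
  shows "visible P x = interior P \<inter> cell (signed_forms (positive_cuts x))" (is "_ = _ \<inter> cell ?K")
proof -
  have xP: "x \<in> P" using x(1) interior_subset by blast
  have xc: "x \<in> cell ?K" by (rule positive_cell[OF xP x(2)])
  have "y \<in> cell ?K" if y: "y \<in> interior P" "closed_segment x y \<inter> \<Union>(cuts P) = {}" for y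
    unfolding mem_cell
  proof (intro conjI allI impI)
    show yP: "y \<in> P" using y(1) interior_subset by blast
    fix b c assume k: "(b, c) \<in> ?K"
    show "0 < b \<bullet> y + c"
    proof (rule ccontr)
      assume "\<not> 0 < b \<bullet> y + c"
      then have neg: "b \<bullet> y + c \<le> 0" by simp
      have "0 < b \<bullet> x + c" using xc k by (simp add: mem_cell)
      then obtain t where t: "0 \<le> t" "t \<le> 1" "b \<bullet> (x + t *\<^sub>R (y - x)) + c = 0" using affine_zero_between neg by blast
      have z: "x + t *\<^sub>R (y - x) \<in> closed_segment x y" unfolding segment_param using t by blast
      then have "x + t *\<^sub>R (y - x) \<in> P" using convex_P xP yP closed_segment_subset by blast
      then show False using signed_formsD(2)[OF k] t(3) z y(2) by blast
    qed
  qed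
  moreover have "closed_segment x y \<inter> \<Union>(cuts P) = {}" if "y \<in> cell ?K" for y
  proof -
    have "closed_segment x y \<subseteq> cell ?K" using closed_segment_subset[OF xc that convex_cell] .
    then show ?thesis using cell_not_cut by blast
  qed
  ultimately show ?thesis unfolding visible_def by blast
qed

lemma piece:
  assumes x: "x \<in> interior P" "x \<notin> \<Union>(cuts P)"
  defines "K \<equiv> signed_forms (positive_cuts x)"
  shows "x \<in> visible P x" "open (visible P x)" "convex (visible P x)" "visible P x = interior P \<inter> cell K"
    "closure (visible P x) = closed_cell K" "interior (closed_cell K) = visible P x"
proof -
  have xc: "x \<in> cell K" unfolding K_def using x interior_subset by (intro positive_cell) auto
  show v: "visible P x = interior P \<inter> cell K" unfolding K_def by (rule visible_eq[OF x])
  have f: "finite K" unfolding K_def by (rule finite_signed_forms)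
  show "x \<in> visible P x" "open (visible P x)" "closure (visible P x) = closed_cell K" "interior (closed_cell K) = visible P x"
    unfolding v using xc x(1) open_cell[OF f] closure_cell[OF f x(1) xc] interior_closed_cell[OF f x(1) xc] by simp_all
  show "convex (visible P x)" unfolding v using convex_P by (intro convex_Int convex_interior convex_cell)
qed

lemma visible_same:
  assumes x: "x \<in> interior P" "x \<notin> \<Union>(cuts P)" and z: "z \<in> visible P x"
  shows "z \<in> interior P" "z \<notin> \<Union>(cuts P)" "visible P z = visible P x"
proof -
  have zc: "z \<in> interior P" "z \<in> cell (signed_forms (positive_cuts x))" using z unfolding visible_eq[OF x] by auto
  show zi: "z \<in> interior P" "z \<notin> \<Union>(cuts P)" by (rule zc(1), rule cell_not_cut[OF zc(2)])
  have "l \<in> positive_cuts z \<longleftrightarrow> l \<in> positive_cuts x" if l: "l \<in> cuts P" for l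
  proof (cases "l \<in> positive_cuts x")
    case True
    then have "(fst (cut_form l), snd (cut_form l)) \<in> signed_forms (positive_cuts x)"
      using l unfolding signed_forms_def by auto
    then have "0 < fst (cut_form l) \<bullet> z + snd (cut_form l)" using zc(2) unfolding mem_cell by blast
    then show ?thesis using True l by (simp add: positive_cuts_def)
  next
    case False
    then have "(- fst (cut_form l), - snd (cut_form l)) \<in> signed_forms (positive_cuts x)"
      using l unfolding signed_forms_def by auto
    then have "0 < - fst (cut_form l) \<bullet> z + - snd (cut_form l)" using zc(2) unfolding mem_cell by blast
    then show ?thesis using False l by (simp add: positive_cuts_def)
  qed
  then have "positive_cuts z = positive_cuts x" unfolding positive_cuts_def by blast
  then show "visible P z = visible P x" unfolding visible_eq[OF x] visible_eq[OF zi] by simp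
qed

lemma finite_pieces: "finite (pieces P)"
proof -
  have "pieces P \<subseteq> (\<lambda>S. closed_cell (signed_forms S)) ` Pow (cuts P)"
  proof
    fix Q assume "Q \<in> pieces P"
    then obtain x where x: "x \<in> interior P" "x \<notin> \<Union>(cuts P)" "Q = closure (visible P x)" unfolding pieces_def by blast
    have "positive_cuts x \<in> Pow (cuts P)" by (auto simp: positive_cuts_def)
    then show "Q \<in> (\<lambda>S. closed_cell (signed_forms S)) ` Pow (cuts P)" unfolding x(3) piece(5)[OF x(1,2)] by (rule imageI)
  qed
  then show ?thesis by (rule finite_subset) (simp add: finite_cuts)
qed

lemma pieceE:
  assumes "Q \<in> pieces P"
  obtains x K where "x \<in> interior P" "x \<notin> \<Union>(cuts P)" "x \<in> interior Q" "K = signed_forms (positive_cuts x)"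
    "Q = closed_cell K" "interior Q = visible P x" "interior Q = interior P \<inter> cell K"
proof -
  obtain x where x: "x \<in> interior P" "x \<notin> \<Union>(cuts P)" "Q = closure (visible P x)" using assms unfolding pieces_def by blast
  then show thesis using that[of x "signed_forms (positive_cuts x)"] piece[OF x(1,2)] by simp
qed

text \<open>The finitely many cuts are negligible, so the points off them are dense in
  \<open>P\<close>, and a finite union of closed pieces that contains them is all of
  \<open>P\<close>.\<close>

lemma Union_pieces: "\<Union>(pieces P) = P"
proof
  show "\<Union>(pieces P) \<subseteq> P"
  proof
    fix y assume "y \<in> \<Union>(pieces P)"
    then obtain Q where "Q \<in> pieces P" "y \<in> Q" by blast
    then show "y \<in> P" by (elim pieceE) (auto simp: closed_cell_def)
  qed
  let ?N = "\<Union>(cuts P)"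
  have "negligible l" if lc: "l \<in> cuts P" for l
  proof -
    obtain b c where z: "zero_fun b c" and l: "l = {y \<in> P. b \<bullet> y + c = 0}" using cut_formE[OF lc] .
    have "l \<subseteq> {y. b \<bullet> y = - c}" using l by auto
    moreover have "b \<noteq> 0" using z by (simp add: zero_fun_def crease_fun_def)
    ultimately show ?thesis using negligible_hyperplane negligible_subset by blast
  qed
  then have N: "negligible ?N" using finite_cuts by (intro negligible_Union) auto
  have "closed (\<Union>(pieces P))"
  proof (rule closed_Union[OF finite_pieces], rule ballI)
    fix Q assume "Q \<in> pieces P"
    then show "closed Q" by (auto simp: pieces_def)
  qed
  moreover have "interior P - ?N \<subseteq> \<Union>(pieces P)"
  proof
    fix x assume x: "x \<in> interior P - ?N"
    then have "x \<in> visible P x" using piece(1)[of x] by simp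
    then have "x \<in> closure (visible P x)" using closure_subset by blast
    then show "x \<in> \<Union>(pieces P)" using x unfolding pieces_def by blast
  qed
  ultimately have cl: "closure (interior P - ?N) \<subseteq> \<Union>(pieces P)" by (rule closure_minimal[rotated])
  have "interior P \<subseteq> closure (interior P - ?N)"
  proof
    fix y assume y: "y \<in> interior P"
    show "y \<in> closure (interior P - ?N)"
    proof (rule ccontr)
      assume "y \<notin> closure (interior P - ?N)"
      then have "y \<in> interior P - closure (interior P - ?N)" using y by simp
      moreover have "open (interior P - closure (interior P - ?N))" by (intro open_Diff) auto
      moreover have "interior P - closure (interior P - ?N) \<subseteq> ?N" using closure_subset by blast
      ultimately show False using N negligible_subset open_not_negligible by (metis empty_iff)
    qed
  qed
  then have "closure (interior P) \<subseteq> closure (interior P - ?N)" by (rule closure_minimal) simp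
  then have "closure P \<subseteq> closure (interior P - ?N)"
    using convex_closure_interior[OF convex_P int_P] by simp
  then show "P \<subseteq> \<Union>(pieces P)" using cl closure_subset by blast
qed

text \<open>Other cuts are disjoint from \<open>l\<close>, so their affine functions keep a constant
  sign along it.\<close>

lemma cut_subset_closed_cell:
  assumes l: "l \<in> cuts P" and v: "v \<in> l" "v \<in> closed_cell (signed_forms S)"
  shows "l \<subseteq> closed_cell (signed_forms S)"
proof
  fix y assume y: "y \<in> l"
  have lP: "l \<subseteq> P" "convex l"
  proof -
    obtain b c where "zero_fun b c" and l: "l = {y \<in> P. b \<bullet> y + c = 0}" using cut_formE[OF assms(1)] .
    have "l = P \<inter> {y. b \<bullet> y = - c}" unfolding l by auto
    moreover have "convex (P \<inter> {y. b \<bullet> y = - c})" by (intro convex_Int convex_P convex_hyperplane)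
    ultimately show "l \<subseteq> P" "convex l" by auto
  qed
  have "0 \<le> b \<bullet> y + c" if k: "(b, c) \<in> signed_forms S" for b c
  proof (cases "l = {y \<in> P. b \<bullet> y + c = 0}")
    case True
    then show ?thesis using y by simp
  next
    case False
    have c: "{y \<in> P. b \<bullet> y + c = 0} \<in> creases P" "l \<in> creases P" using signed_formsD(2)[OF k] l by (simp_all add: cuts_def)
    have ne: "b \<bullet> z + c \<noteq> 0" if "z \<in> l" for z
    proof
      assume "b \<bullet> z + c = 0"
      then have "z \<in> l \<inter> {y \<in> P. b \<bullet> y + c = 0}" using that lP(1) by auto
      then show False unfolding creases_disjoint[OF c(2,1) False] by simp
    qed
    have "0 < b \<bullet> v + c" using v ne[OF v(1)] k by (simp add: closed_cell_def order_less_le)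
    show ?thesis
    proof (rule ccontr)
      assume "\<not> 0 \<le> b \<bullet> y + c"
      then have "b \<bullet> y + c \<le> 0" by simp
      then obtain t where t: "0 \<le> t" "t \<le> 1" "b \<bullet> (v + t *\<^sub>R (y - v)) + c = 0"
        using affine_zero_between \<open>0 < b \<bullet> v + c\<close> by blast
      have "v + t *\<^sub>R (y - v) \<in> closed_segment v y" unfolding segment_param using t by blast
      then have "v + t *\<^sub>R (y - v) \<in> l" using closed_segment_subset[OF v(1) y lP(2)] by blast
      then show False using ne t(3) by blast
    qed
  qed
  then show "y \<in> closed_cell (signed_forms S)" using y lP(1) by (auto simp: closed_cell_def)
qed

text \<open>Since a piece contains the whole of every cut it meets, a vertex of the piece on a cut
  is an end of that cut; any other vertex of the piece is a vertex of \<open>P\<close>.\<close>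

lemma rational_pieces:
  assumes "Q \<in> pieces P"
  shows "rational_polygon Q"
proof -
  obtain x K where x: "x \<in> interior P" "x \<notin> \<Union>(cuts P)" "x \<in> interior Q" "K = signed_forms (positive_cuts x)"
    "Q = closed_cell K" "interior Q = visible P x" "interior Q = interior P \<inter> cell K" using pieceE[OF assms] .
  have f: "finite K" unfolding x(4) by (rule finite_signed_forms)
  have "rat_vec v" if v: "v extreme_point_of Q" for v
  proof (cases "v \<in> \<Union>(cuts P)")
    case True
    then obtain l where l: "l \<in> cuts P" "v \<in> l" by blast
    have "v \<in> Q" using v by (simp add: extreme_point_of_def)
    then have lQ: "l \<subseteq> Q" using cut_subset_closed_cell[OF l] unfolding x(4,5) by blast
    obtain p q where pq: "l = closed_segment p q" "rat_vec p" "rat_vec q" using cut_ends[OF l(1)] by metis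
    have "v extreme_point_of l" using v l(2) lQ by (auto simp: extreme_point_of_def)
    then have "v = p \<or> v = q" unfolding pq(1) by (simp add: extreme_point_of_segment)
    then show ?thesis using pq by blast
  next
    case False
    have vQ: "v \<in> closed_cell K" using v x(5) by (simp add: extreme_point_of_def)
    have pos: "0 < b \<bullet> v + c" if k: "(b, c) \<in> K" for b c
    proof -
      have "{y \<in> P. b \<bullet> y + c = 0} \<in> cuts P" using signed_formsD(2) k unfolding x(4) by blast
      then have "b \<bullet> v + c \<noteq> 0" using False vQ by (auto simp: closed_cell_def)
      then show ?thesis using vQ k by (simp add: closed_cell_def order_less_le)
    qed
    have "v extreme_point_of P"
      by (rule extreme_point_of_cut[OF f _ pos convex_P]) (use v x(5) closed_cell_eq in auto)
    then show ?thesis by (rule vertex_rat)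
  qed
  then show ?thesis using polytope_closed_cell[OF f] x(3,5) by (auto simp: rational_polygon_def rat_vec_def)
qed

lemma pieces_disjoint:
  assumes "Q \<in> pieces P" "R \<in> pieces P" "Q \<noteq> R"
  shows "interior Q \<inter> interior R = {}"
proof (rule ccontr)
  assume "interior Q \<inter> interior R \<noteq> {}"
  then obtain z where z: "z \<in> interior Q" "z \<in> interior R" by blast
  obtain x where x: "x \<in> interior P" "x \<notin> \<Union>(cuts P)" "Q = closure (visible P x)" using assms(1) unfolding pieces_def by blast
  obtain y where y: "y \<in> interior P" "y \<notin> \<Union>(cuts P)" "R = closure (visible P y)" using assms(2) unfolding pieces_def by blast
  have "interior Q = visible P x" unfolding x(3) piece(5)[OF x(1,2)] by (rule piece(6)[OF x(1,2)])
  moreover have "interior R = visible P y" unfolding y(3) piece(5)[OF y(1,2)] by (rule piece(6)[OF y(1,2)])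
  ultimately have zv: "z \<in> visible P x" "z \<in> visible P y" using z by simp_all
  have "visible P x = visible P y"
    using visible_same(3)[OF x(1,2) zv(1)] visible_same(3)[OF y(1,2) zv(2)] by (rule trans[OF sym])
  then show False using assms(3) x(3) y(3) by simp
qed

lemma rational_decomposition_pieces: "rational_decomposition P (pieces P)"
  unfolding rational_decomposition_def pairwise_def
  using finite_pieces Union_pieces rational_pieces pieces_disjoint by blast

lemma cut_along_pieces: "cut_along P (cuts P) (pieces P)"
  unfolding cut_along_def
proof (intro equalityI subsetI)
  fix y assume "y \<in> (\<Union>Q\<in>pieces P. frontier Q)"
  then obtain Q where Q: "Q \<in> pieces P" "y \<in> frontier Q" by blast
  obtain x K where x: "x \<in> interior P" "x \<notin> \<Union>(cuts P)" "x \<in> interior Q" "K = signed_forms (positive_cuts x)"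
    "Q = closed_cell K" "interior Q = visible P x" "interior Q = interior P \<inter> cell K" using pieceE[OF Q(1)] .
  have "closed Q" using Q(1) by (auto simp: pieces_def)
  then have y: "y \<in> closed_cell K" "y \<notin> interior P \<inter> cell K" using Q(2) x(5,7) by (auto simp: frontier_def)
  show "y \<in> frontier P \<union> \<Union>(cuts P)"
  proof (cases "y \<in> interior P")
    case True
    then obtain b c where k: "(b, c) \<in> K" "\<not> 0 < b \<bullet> y + c" using y by (auto simp: mem_cell closed_cell_def)
    then have "b \<bullet> y + c = 0" "y \<in> P" using y(1) by (auto simp: closed_cell_def intro: antisym)
    moreover have "{y \<in> P. b \<bullet> y + c = 0} \<in> cuts P" using signed_formsD(2) k(1) unfolding x(4) by blast
    ultimately show ?thesis by blast
  next
    case False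
    then show ?thesis using y(1) closure_subset by (auto simp: frontier_def closed_cell_def)
  qed
next
  fix y assume y: "y \<in> frontier P \<union> \<Union>(cuts P)"
  have "frontier P \<subseteq> P" using closed_P by (simp add: frontier_subset_eq)
  moreover have "l \<subseteq> P" if "l \<in> cuts P" for l by (rule cut_formE[OF that]) auto
  ultimately have "y \<in> \<Union>(pieces P)" using y Union_pieces by blast
  then obtain Q where Q: "Q \<in> pieces P" "y \<in> Q" by blast
  obtain x K where x: "x \<in> interior P" "x \<notin> \<Union>(cuts P)" "x \<in> interior Q" "K = signed_forms (positive_cuts x)"
    "Q = closed_cell K" "interior Q = visible P x" "interior Q = interior P \<inter> cell K" using pieceE[OF Q(1)] .
  have "y \<notin> interior Q" using y cell_not_cut unfolding x(4,7) by (auto simp: frontier_def)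
  then have "y \<in> frontier Q" using Q(2) closure_subset by (auto simp: frontier_def)
  then show "y \<in> (\<Union>Q\<in>pieces P. frontier Q)" using Q(1) by blast
qed

lemma L_closed_cell:
  assumes f: "finite K" and zf: "\<And>b c. (b, c) \<in> K \<Longrightarrow> zero_fun b c" and g: "convex_on UNIV g"
  shows "L (closed_cell K) g = L (cell K) g"
proof -
  let ?Q = "closed_cell K"
  have gK: "good (cell K)" using cell_good[OF good_P f zf] by blast
  have QP: "?Q \<subseteq> P" by (auto simp: closed_cell_def)
  have cQ: "closed ?Q" using polytope_imp_closed[OF polytope_closed_cell[OF f]] .
  have ae: "AE y in M. y \<in> ?Q \<longleftrightarrow> y \<in> cell K"
    if M: "\<And>b c. crease_fun b c \<Longrightarrow> AE y in M. b \<bullet> y + c \<noteq> 0" for M :: "(real^2) measure"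
  proof -
    have "AE y in M. fst k \<bullet> y + snd k \<noteq> 0" if "k \<in> K" for k
    proof (rule M)
      show "crease_fun (fst k) (snd k)" using zf[of "fst k" "snd k"] that by (simp add: zero_fun_def)
    qed
    then have "AE y in M. \<forall>k\<in>K. fst k \<bullet> y + snd k \<noteq> 0" using f by (intro eventually_ball_finite) auto
    then show ?thesis
    proof eventually_elim
      case (elim y)
      have "b \<bullet> y + c \<noteq> 0" if "(b, c) \<in> K" for b c using elim that by force
      then show ?case unfolding mem_cell closed_cell_def by (auto simp: less_le)
    qed
  qed
  have "tame (cell K) g" by (rule good_tame[OF gK g])
  moreover have "tame ?Q g" using QP cQ by (intro tame_continuous continuous_on_convex_UNIV[OF g] borel_closed)
  moreover have "AE y in \<sigma>. y \<in> ?Q \<longleftrightarrow> y \<in> cell K" "AE y in lborel. y \<in> ?Q \<longleftrightarrow> y \<in> cell K"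
    by (rule ae[OF crease_fun_AE(1)], assumption) (rule ae[OF crease_fun_AE(2)], assumption)
  ultimately show ?thesis by (intro L_null_cong) (auto simp: tame_def)
qed

lemma good_closed_cell:
  assumes f: "finite K" and zf: "\<And>b c. (b, c) \<in> K \<Longrightarrow> zero_fun b c"
  shows "good (closed_cell K)"
  unfolding good_def
proof (intro conjI allI impI)
  show "closed_cell K \<in> sets borel" using polytope_imp_closed[OF polytope_closed_cell[OF f]] by (rule borel_closed)
  show "closed_cell K \<subseteq> P" by (auto simp: closed_cell_def)
  fix g :: "real^2 \<Rightarrow> real" assume g: "convex_on UNIV g"
  show "0 \<le> L (closed_cell K) g"
  proof -
    have "L (closed_cell K) g = L (cell K) g" by (rule L_closed_cell[OF f zf g])
    moreover have "good (cell K)" using cell_good[OF good_P f zf] by blast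
    ultimately show ?thesis using g by (simp add: good_def)
  qed
qed

end

section \<open>Polystable pieces and parallelograms\<close>

lemma open_halfplane: "open {x :: real^2. 0 < n \<bullet> x + k}" and convex_halfplane: "convex {x :: real^2. 0 < n \<bullet> x + k}"
  and closed_halfplane: "closed {x :: real^2. 0 \<le> n \<bullet> x + k}"
proof -
  have "{x. 0 < n \<bullet> x + k} = {x. n \<bullet> x > - k}" "{x. 0 \<le> n \<bullet> x + k} = {x. n \<bullet> x \<ge> - k}" by auto
  then show "open {x. 0 < n \<bullet> x + k}" "convex {x. 0 < n \<bullet> x + k}" "closed {x. 0 \<le> n \<bullet> x + k}"
    by (simp_all add: open_halfspace_gt convex_halfspace_gt closed_halfspace_ge)
qed

lemma closure_open_halfplanes:
  fixes S :: "((real^2) \<times> real) set"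
  assumes z: "\<And>k. k \<in> S \<Longrightarrow> 0 < fst k \<bullet> z + snd k"
  shows "closure {x. \<forall>k\<in>S. 0 < fst k \<bullet> x + snd k} = {x. \<forall>k\<in>S. 0 \<le> fst k \<bullet> x + snd k}" (is "closure ?A = ?B")
proof
  have "?B = (\<Inter>k\<in>S. {x. 0 \<le> fst k \<bullet> x + snd k})" by auto
  moreover have "closed (\<Inter>k\<in>S. {x :: real^2. 0 \<le> fst k \<bullet> x + snd k})" by (intro closed_INT ballI closed_halfplane)
  ultimately have "closed ?B" by simp
  moreover have "?A \<subseteq> ?B" by (auto intro: less_imp_le)
  ultimately show "closure ?A \<subseteq> ?B" by (rule closure_minimal[rotated])
  show "?B \<subseteq> closure ?A"
  proof
    fix y assume y: "y \<in> ?B"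
    show "y \<in> closure ?A"
    proof (cases "z = y")
      case True
      have "z \<in> ?A" using z by blast
      then have "z \<in> closure ?A" by (rule subsetD[OF closure_subset])
      then show ?thesis using True by simp
    next
      case False
      have "open_segment z y \<subseteq> ?A"
      proof
        fix w assume "w \<in> open_segment z y"
        then obtain t where t: "0 < t" "t < 1" "w = (1 - t) *\<^sub>R z + t *\<^sub>R y" by (auto simp only: in_segment)
        have "0 < fst k \<bullet> w + snd k" if k: "k \<in> S" for k
        proof -
          have "0 < (1 - t) * (fst k \<bullet> z + snd k)" using z[OF k] t by simp
          moreover have "0 \<le> t * (fst k \<bullet> y + snd k)" using y t k by simp
          moreover have "fst k \<bullet> w + snd k = (1 - t) * (fst k \<bullet> z + snd k) + t * (fst k \<bullet> y + snd k)"
            by (simp add: t(3) inner_simps algebra_simps)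
          ultimately show ?thesis by linarith
        qed
        then show "w \<in> ?A" by blast
      qed
      then have "closure (open_segment z y) \<subseteq> closure ?A" by (rule closure_mono)
      moreover have "y \<in> closure (open_segment z y)" using False by (simp add: closure_open_segment)
      ultimately show ?thesis by blast
    qed
  qed
qed

lemma det2_cramer: "det2 Y D *\<^sub>R X = det2 Y X *\<^sub>R D + det2 X D *\<^sub>R Y"
  by (simp add: vec_eq_2 det2_def algebra_simps)

section \<open>The induced boundary measure of a piece\<close>

context lattice_polygon
begin

text \<open>The line through the point and an interior point of \<open>P\<close> is null.\<close>

lemma AE_dsigma_point:
  assumes "z \<in> frontier P"
  shows "AE x in \<sigma>. x \<noteq> z"
proof -
  obtain m where m: "m \<in> interior P" using int_P by blast
  then have "m \<noteq> z" using assms by (auto simp: frontier_def)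
  have "perp (m - z) \<bullet> m + (- (perp (m - z) \<bullet> z)) = 0" by (simp add: inner_2 algebra_simps)
  from AE_dsigma_line[OF _ m this] \<open>m \<noteq> z\<close> have "AE x in \<sigma>. perp (m - z) \<bullet> x + (- (perp (m - z) \<bullet> z)) \<noteq> 0" by simp
  then show ?thesis by eventually_elim auto
qed

definition boundary_edges :: "(real^2) set \<Rightarrow> (real^2) set" where
  "boundary_edges Q = \<Union>{F. F edge_of Q \<and> (\<exists>E. E edge_of P \<and> F \<subseteq> E)}"

lemma closed_boundary_edges:
  assumes "polytope Q"
  shows "closed (boundary_edges Q)"
  unfolding boundary_edges_def
proof (rule closed_Union)
  have "finite {F. F face_of Q}" by (rule finite_polytope_faces[OF assms])
  then show "finite {F. F edge_of Q \<and> (\<exists>E. E edge_of P \<and> F \<subseteq> E)}"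
    by (rule rev_finite_subset) (auto simp: edge_of_def)
  show "\<forall>F\<in>{F. F edge_of Q \<and> (\<exists>E. E edge_of P \<and> F \<subseteq> E)}. closed F"
    using face_of_imp_closed[OF polytope_imp_convex[OF assms] polytope_imp_closed[OF assms]] by (auto simp: edge_of_def)
qed

text \<open>An edge of \<open>P\<close> meets \<open>Q\<close> in a face of \<open>Q\<close>: an
  edge, which belongs to the support of the induced measure, or at most a point, which is
  null.\<close>

lemma AE_boundary_edges:
  assumes Q: "polytope Q" "Q \<subseteq> P"
  shows "AE x in \<sigma>. x \<in> boundary_edges Q \<and> x \<in> frontier Q \<longleftrightarrow> x \<in> Q"
proof -
  have cQ: "convex Q" "closed Q" using Q(1) polytope_imp_convex polytope_imp_closed by blast+
  have "AE x in \<sigma>. x \<in> Q \<and> x \<in> edge (fst k) (snd k) \<longrightarrow> x \<in> boundary_edges Q" if k: "k \<in> \<F>" for k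
  proof -
    obtain u c where ku: "k = (u, c)" by fastforce
    have F: "(u, c) \<in> \<F>" using k ku by simp
    let ?G = "Q \<inter> edge u c"
    have G: "?G = Q \<inter> {x. nvec u \<bullet> x = c}" using Q(2) by (auto simp: edge_def lform_nvec)
    have face: "?G face_of Q"
      unfolding G using facetD(3)[OF F] Q(2) by (intro face_of_Int_supporting_hyperplane_ge cQ) (auto simp: lform_nvec)
    have "aff_dim ?G \<le> aff_dim (edge u c)" by (rule aff_dim_subset) blast
    then have d: "aff_dim ?G \<le> 1" using facetD(4)[OF F] by (simp add: edge_of_def)
    show ?thesis
    proof (cases "aff_dim ?G = 1")
      case True
      then have "?G edge_of Q" using face by (simp add: edge_of_def)
      then have "?G \<subseteq> boundary_edges Q" using facetD(4)[OF F] unfolding boundary_edges_def by blast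
      then show ?thesis by (auto simp: ku)
    next
      case False
      have "aff_dim ?G = 0 \<or> ?G = {}"
      proof -
        have "aff_dim ?G = -1 \<longleftrightarrow> ?G = {}" by (rule aff_dim_empty[symmetric])
        moreover have "-1 \<le> aff_dim ?G" by (rule aff_dim_geq)
        ultimately show ?thesis using d False by linarith
      qed
      then show ?thesis
      proof
        assume "aff_dim ?G = 0"
        then obtain z where z: "?G = {z}" using aff_dim_eq_0 by blast
        then have "z \<in> edge u c" by blast
        then have "AE x in \<sigma>. x \<noteq> z" using AE_dsigma_point edge_in_frontier[OF F] by blast
        then show ?thesis
        proof eventually_elim
          case (elim x)
          then have "x \<notin> ?G" unfolding z by simp
          then show ?case by (auto simp: ku)
        qed
      next
        assume "?G = {}"
        then show ?thesis by (intro AE_I2) (auto simp: ku)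
      qed
    qed
  qed
  then have "AE x in \<sigma>. \<forall>k\<in>\<F>. x \<in> Q \<and> x \<in> edge (fst k) (snd k) \<longrightarrow> x \<in> boundary_edges Q"
    using finite_facets by (intro eventually_ball_finite) auto
  then show ?thesis using AE_dsigma_frontier
  proof eventually_elim
    case (elim x)
    obtain u c where F: "(u, c) \<in> \<F>" "x \<in> edge u c" using frontier_facets[OF elim(2)] by blast
    have 1: "x \<in> boundary_edges Q" if "x \<in> Q" using elim(1) F that by force
    have 2: "x \<in> Q" if "x \<in> boundary_edges Q"
      using that face_of_imp_subset unfolding boundary_edges_def edge_of_def by blast
    have "x \<notin> interior Q" using elim(2) interior_mono[OF Q(2)] by (auto simp: frontier_def)
    then have 3: "x \<in> frontier Q" if "x \<in> Q" using that closure_subset by (auto simp: frontier_def)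
    show ?case using 1 2 3 by blast
  qed
qed

text \<open>\<open>L\<close> vanishes on the constant 1, so the ratio of boundary mass to area of
  \<open>Q\<close> is again \<open>a\<close>.\<close>

lemma stab_functional_dsigma_sub:
  assumes Q: "polytope Q" "Q \<subseteq> P" "interior Q \<noteq> {}" "good Q" and f: "continuous_on Q f"
  shows "stab_functional (dsigma_sub P Q) Q f = L Q f"
proof -
  let ?U = "boundary_edges Q"
  have cQ: "compact Q" using Q(1) by (rule polytope_imp_compact)
  have U: "?U \<in> sets borel" using closed_boundary_edges[OF Q(1)] by (rule borel_closed)
  have fr: "frontier Q \<in> sets borel" "frontier Q \<subseteq> Q"
    using compact_imp_closed[OF cQ] by (simp_all add: borel_closed frontier_subset_eq)
  have s: "dsigma_sub P Q = density \<sigma> (\<lambda>x. ennreal (indicator ?U x))"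
    unfolding dsigma_sub_def boundary_edges_def[symmetric] by (simp add: ennreal_indicator)
  have int: "(LINT x:frontier Q|dsigma_sub P Q. g x) = (LINT x:Q|\<sigma>. g x)" if g: "continuous_on Q g" for g :: "real^2 \<Rightarrow> real"
  proof -
    have tQ: "tame Q g" by (rule tame_continuous_compact[OF cQ Q(2) g])
    have tF: "tame (frontier Q) g" by (rule tame_subset[OF tQ fr(2,1)])
    have mF: "(\<lambda>x. indicator (frontier Q) x *\<^sub>R g x) \<in> borel_measurable \<sigma>"
      and mQ: "(\<lambda>x. indicator Q x *\<^sub>R g x) \<in> borel_measurable \<sigma>"
      using tQ tF by (simp_all only: tame_def set_borel_measurable_def borel_measurable_\<sigma>)
    have mU: "indicat_real ?U \<in> borel_measurable \<sigma>" using U by (simp add: borel_measurable_\<sigma>)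
    have "(LINT x:frontier Q|dsigma_sub P Q. g x) = (LINT x|\<sigma>. indicator ?U x *\<^sub>R (indicator (frontier Q) x *\<^sub>R g x))"
      unfolding s set_lebesgue_integral_def by (rule integral_density[OF mF mU]) simp
    also have "\<dots> = (LINT x|\<sigma>. indicator Q x *\<^sub>R g x)"
    proof (rule integral_cong_AE)
      show "(\<lambda>x. indicator ?U x *\<^sub>R (indicator (frontier Q) x *\<^sub>R g x)) \<in> borel_measurable \<sigma>"
        by (rule borel_measurable_scaleR[OF mU mF])
      show "AE x in \<sigma>. indicator ?U x *\<^sub>R (indicator (frontier Q) x *\<^sub>R g x) = indicator Q x *\<^sub>R g x"
        using AE_boundary_edges[OF Q(1,2)] by eventually_elim (auto simp: indicator_def)
    qed (rule mQ)
    finally show ?thesis by (simp only: set_lebesgue_integral_def)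
  qed
  have "L Q (\<lambda>x. 0 \<bullet> x + 1) = 0" by (rule good_affine[OF Q(4)])
  then have "(LINT x:Q|\<sigma>. (1::real)) = a * measure lborel Q"
    using cQ by (simp add: L_def set_lebesgue_integral_def borel_compact)
  moreover have "measure (dsigma_sub P Q) (frontier Q) = (LINT x:frontier Q|dsigma_sub P Q. (1::real))"
    using fr(1) by (simp add: set_lebesgue_integral_def s sets_dsigma space_dsigma)
  moreover have "(LINT x:frontier Q|dsigma_sub P Q. (1::real)) = (LINT x:Q|\<sigma>. (1::real))" by (rule int[OF continuous_on_const])
  ultimately have "measure (dsigma_sub P Q) (frontier Q) / measure lborel Q = a"
    using measure_lborel_pos[OF cQ Q(3)] by simp
  then show ?thesis unfolding stab_functional_def int[OF f] L_def by simp
qed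

end

section \<open>Pieces without and with a crease\<close>

context semistable_polygon
begin

text \<open>If equality held for a non-affine convex function, the piece would have a zero crease.
  It cannot touch the cuts that bound the piece, so its whole chord in \<open>P\<close> stays inside
  the cell and it is a crease of \<open>P\<close> that meets the interior of the piece.\<close>

lemma K_polystable_piece:
  assumes Qp: "Q \<in> pieces P" and no: "\<And>l. l \<in> creases P \<Longrightarrow> l \<inter> interior Q = {}"
  shows "K_polystable (dsigma_sub P Q) Q"
proof -
  obtain x K where x: "x \<in> interior P" "x \<notin> \<Union>(cuts P)" "x \<in> interior Q" "K = signed_forms (positive_cuts x)"
    "Q = closed_cell K" "interior Q = visible P x" "interior Q = interior P \<inter> cell K" using pieceE[OF Qp] .
  have f: "finite K" unfolding x(4) by (rule finite_signed_forms)
  have zf: "zero_fun b c" if "(b, c) \<in> K" for b c using signed_formsD(1) that unfolding x(4) by blast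
  have pQ: "polytope Q" unfolding x(5) by (rule polytope_closed_cell[OF f])
  have QP: "Q \<subseteq> P" unfolding x(5) by (auto simp: closed_cell_def)
  have iQ: "interior Q \<noteq> {}" using x(3) by blast
  have gQ: "good Q" unfolding x(5) by (rule good_closed_cell[OF f zf])
  have cQ: "compact Q" "convex Q" using pQ polytope_imp_compact polytope_imp_convex by blast+
  show ?thesis unfolding K_polystable_def
  proof (intro allI impI)
    fix g assume g: "convex_on Q g \<and> continuous_on Q g"
    then have gc: "convex_on Q g" "continuous_on Q g" by blast+
    have e: "stab_functional (dsigma_sub P Q) Q g = L Q g"
      by (rule stab_functional_dsigma_sub[OF pQ QP iQ gQ gc(2)])
    have "\<exists>b c. \<forall>x\<in>Q. g x = b \<bullet> x + c" if z0: "L Q g = 0"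
    proof (rule ccontr)
      assume "\<not> ?thesis"
      from zero_crease_exists[OF gQ cQ iQ gc z0 this] obtain b c z where
        bz: "b \<noteq> 0" "z \<in> interior Q" "b \<bullet> z + c = 0" "L Q (\<lambda>x. max (b \<bullet> x + c) 0) = 0" by blast
      have zero: "L (cell K) (\<lambda>x. max (b \<bullet> x + c) 0) = 0"
        using bz(4) L_closed_cell[OF f zf convex_crease] unfolding x(5) by metis
      have z: "z \<in> interior P" "z \<in> cell K" using bz(2) unfolding x(7) by blast+
      have zP: "z \<in> P" using z(1) interior_subset by blast
      have touch: "y \<in> cell K" if y: "y \<in> closed_cell K" "b \<bullet> y + c = 0" for y
        unfolding mem_cell
      proof (intro conjI allI impI)
        show yP: "y \<in> P" using y by (simp add: closed_cell_def)
        have nonneg: "\<And>b c. (b, c) \<in> K \<Longrightarrow> 0 \<le> b \<bullet> y + c" using y(1) by (simp add: closed_cell_def)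
        fix b' c' assume k: "(b', c') \<in> K"
        have "b' \<bullet> y + c' \<noteq> 0" by (rule no_touch[OF good_P f zf z bz(3,1) zero yP y(2) nonneg k])
        then show "0 < b' \<bullet> y + c'" using nonneg[OF k] by simp
      qed
      have sub: "y \<in> cell K" if y: "y \<in> P" "b \<bullet> y + c = 0" for y
      proof -
        let ?S = "closed_segment z y"
        let ?O = "\<Inter>k\<in>K. {x. 0 < fst k \<bullet> x + snd k}"
        have SP: "?S \<subseteq> P" by (rule closed_segment_subset[OF zP y(1) convex_P])
        have S0: "b \<bullet> s + c = 0" if s: "s \<in> ?S" for s
        proof -
          obtain t where t: "s = z + t *\<^sub>R (y - z)" using s unfolding segment_param by blast
          have "b \<bullet> s + c = (b \<bullet> z + c) + t * ((b \<bullet> y + c) - (b \<bullet> z + c))" unfolding t by (simp add: inner_simps algebra_simps)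
          then show ?thesis using bz(3) y(2) by simp
        qed
        have e1: "?S \<inter> ?O = ?S \<inter> cell K"
        proof -
          have "s \<in> ?O \<longleftrightarrow> (\<forall>b c. (b, c) \<in> K \<longrightarrow> 0 < b \<bullet> s + c)" for s
            unfolding INT_iff mem_Collect_eq Ball_def split_paired_All fst_conv snd_conv ..
          then show ?thesis using SP unfolding set_eq_iff Int_iff mem_cell by blast
        qed
        have e2: "?S \<inter> closed_cell K = ?S \<inter> cell K"
        proof -
          have "cell K \<subseteq> closed_cell K"
            unfolding mem_cell closed_cell_def subset_iff mem_Collect_eq by (meson less_imp_le)
          then show ?thesis using touch S0 by blast
        qed
        \<comment> \<open>Relative to the segment the cell is open, and it is closed because a point
          of the closed cell on this line touches no cut. Connectedness puts the whole segment into
          the cell.\<close>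
        have "open ?O" using f open_halfplane by (intro open_INT ballI)
        then have "openin (top_of_set ?S) (?S \<inter> ?O)" by (rule openin_open_Int)
        moreover have "closedin (top_of_set ?S) (?S \<inter> closed_cell K)"
          by (rule closedin_closed_Int[OF polytope_imp_closed[OF polytope_closed_cell[OF f]]])
        ultimately have "?S \<inter> cell K = {} \<or> ?S \<inter> cell K = ?S"
          unfolding e1 e2 using connected_segment(1)[of z y] unfolding connected_clopen by blast
        moreover have "z \<in> ?S \<inter> cell K" using z(2) by simp
        moreover have "y \<in> ?S" by simp
        ultimately show ?thesis by blast
      qed
      have cr: "crease_fun b c" using bz(1,3) z(1) by (auto simp: crease_fun_def)
      have "zero_fun b c" by (rule cell_crease_extends[OF good_P f zf cr sub zero])
      then have "{x \<in> P. b \<bullet> x + c = 0} \<in> creases P" unfolding creases_iff by blast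
      from no[OF this] show False using bz(2,3) zP by blast
    qed
    then show "0 \<le> stab_functional (dsigma_sub P Q) Q g \<and>
        (stab_functional (dsigma_sub P Q) Q g = 0 \<longrightarrow> (\<exists>b c. \<forall>x\<in>Q. g x = b \<bullet> x + c))"
      unfolding e using good_convex_on[OF gQ cQ(1) gc] by blast
  qed
qed

lemma parallel_coordinates:
  assumes "lform u q - lform u p = N" "N \<noteq> 0"
  shows "y = p + (side p q y / N) *\<^sub>R dvec u + ((lform u y - lform u p) / N) *\<^sub>R (q - p)"
proof -
  have "N *\<^sub>R (y - p) = side p q y *\<^sub>R dvec u + (lform u y - lform u p) *\<^sub>R (q - p)"
    using det2_cramer[of "q - p" "dvec u" "y - p"] assms(1) by (simp add: det2_dvec lform_diff side_def)
  then have "(1 / N) *\<^sub>R (N *\<^sub>R (y - p)) = (1 / N) *\<^sub>R (side p q y *\<^sub>R dvec u + (lform u y - lform u p) *\<^sub>R (q - p))"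
    by simp
  then have "y - p = (side p q y / N) *\<^sub>R dvec u + ((lform u y - lform u p) / N) *\<^sub>R (q - p)"
    using assms(2) by (simp add: scaleR_right_distrib)
  then show ?thesis by (simp add: algebra_simps)
qed

text \<open>The admissible translations form a compact interval around 0. At either end of it one
  end of the chord must be a vertex, since otherwise the chord could slide further.\<close>

lemma sliding_interval:
  assumes F: "(u, c) \<in> \<F>" "(- u, e) \<in> \<F>" and p: "p \<in> edge u c" "\<not> p extreme_point_of P"
    and q: "q \<in> edge (- u) e" "\<not> q extreme_point_of P"
  obtains \<alpha> \<beta> where "\<alpha> < 0" "0 < \<beta>"
    "\<forall>t. \<alpha> \<le> t \<and> t \<le> \<beta> \<longrightarrow> p + t *\<^sub>R dvec u \<in> edge u c \<and> q + t *\<^sub>R dvec u \<in> edge (- u) e"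
    "(p + \<alpha> *\<^sub>R dvec u) extreme_point_of P \<or> (q + \<alpha> *\<^sub>R dvec u) extreme_point_of P"
    "(p + \<beta> *\<^sub>R dvec u) extreme_point_of P \<or> (q + \<beta> *\<^sub>R dvec u) extreme_point_of P"
proof -
  let ?d = "dvec u"
  have d0: "?d \<noteq> 0" using facetD(2)[OF F(1)] by (simp add: dvec_eq_0)
  have dv: "dvec (- u) = - ?d" by (simp add: vec_eq_2)
  have lq: "lform u q = - e" using q(1) by (simp add: edge_def lform_uminus)
  define J where "J = {t. p + t *\<^sub>R ?d \<in> P \<and> q + t *\<^sub>R ?d \<in> P}"
  have edges: "p + t *\<^sub>R ?d \<in> edge u c \<and> q + t *\<^sub>R ?d \<in> edge (- u) e" if "t \<in> J" for t
    using that p(1) q(1) by (simp add: J_def edge_def lform_add lform_scaleR lform_uminus)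
  have near: "\<exists>\<epsilon>>0. \<forall>s. \<bar>s\<bar> \<le> \<epsilon> \<longrightarrow> t + s \<in> J"
    if t: "t \<in> J" "\<not> (p + t *\<^sub>R ?d) extreme_point_of P" "\<not> (q + t *\<^sub>R ?d) extreme_point_of P" for t
  proof -
    obtain r1 where r1: "0 < r1" "\<And>s. \<bar>s\<bar> \<le> r1 \<Longrightarrow> p + t *\<^sub>R ?d + s *\<^sub>R ?d \<in> edge u c"
      using nonvertex_neighbourhood[OF F(1) conjunct1[OF edges[OF t(1)]] t(2)] by metis
    obtain r2 where r2: "0 < r2" "\<And>s. \<bar>s\<bar> \<le> r2 \<Longrightarrow> q + t *\<^sub>R ?d + s *\<^sub>R dvec (- u) \<in> edge (- u) e"
      using nonvertex_neighbourhood[OF F(2) conjunct2[OF edges[OF t(1)]] t(3)] by metis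
    have "t + s \<in> J" if "\<bar>s\<bar> \<le> min r1 r2" for s
    proof -
      have "p + t *\<^sub>R ?d + s *\<^sub>R ?d \<in> P" "q + t *\<^sub>R ?d + s *\<^sub>R ?d \<in> P"
        using r1(2)[of s] r2(2)[of "- s"] that edge_subset by (auto simp: dv)
      then show ?thesis by (simp add: J_def scaleR_left_distrib add.assoc)
    qed
    moreover have "0 < min r1 r2" using r1(1) r2(1) by simp
    ultimately show ?thesis by blast
  qed
  have "p \<in> P" "q \<in> P" using p q edge_subset by blast+
  then have J0: "0 \<in> J" by (simp add: J_def)
  have "J = (\<lambda>t. p + t *\<^sub>R ?d) -` P \<inter> (\<lambda>t. q + t *\<^sub>R ?d) -` P" by (auto simp: J_def)
  moreover have "closed ((\<lambda>t. p + t *\<^sub>R ?d) -` P)" "closed ((\<lambda>t. q + t *\<^sub>R ?d) -` P)"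
    by (intro continuous_closed_vimage closed_P continuous_intros)+
  ultimately have clJ: "closed J" by (simp add: closed_Int)
  have "J \<subseteq> (\<lambda>x. (x - p) \<bullet> ?d / (?d \<bullet> ?d)) ` P"
  proof
    fix t assume "t \<in> J"
    then have "p + t *\<^sub>R ?d \<in> P" by (simp add: J_def)
    then show "t \<in> (\<lambda>x. (x - p) \<bullet> ?d / (?d \<bullet> ?d)) ` P" by (rule rev_image_eqI) (use d0 in simp)
  qed
  moreover have "bounded ((\<lambda>x. (x - p) \<bullet> ?d / (?d \<bullet> ?d)) ` P)"
    by (intro compact_imp_bounded compact_continuous_image compact_P continuous_intros) (use d0 in simp)
  ultimately have "compact J" using clJ bounded_subset compact_eq_bounded_closed by blast
  moreover have "convex J"
    unfolding convex_alt
  proof (intro ballI allI impI)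
    fix s t r :: real assume st: "s \<in> J" "t \<in> J" and r: "0 \<le> r \<and> r \<le> 1"
    have "x + ((1 - r) *\<^sub>R s + r *\<^sub>R t) *\<^sub>R ?d \<in> P" if "x + s *\<^sub>R ?d \<in> P" "x + t *\<^sub>R ?d \<in> P" for x
    proof -
      have "(1 - r) *\<^sub>R (x + s *\<^sub>R ?d) + r *\<^sub>R (x + t *\<^sub>R ?d) \<in> P"
        using convex_P that r unfolding convex_alt by blast
      moreover have "(1 - r) *\<^sub>R (x + s *\<^sub>R ?d) + r *\<^sub>R (x + t *\<^sub>R ?d) = x + ((1 - r) *\<^sub>R s + r *\<^sub>R t) *\<^sub>R ?d"
        by (simp add: algebra_simps)
      ultimately show ?thesis by simp
    qed
    then show "(1 - r) *\<^sub>R s + r *\<^sub>R t \<in> J" using st unfolding J_def mem_Collect_eq by blast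
  qed
  ultimately obtain \<alpha> \<beta> where J: "J = {\<alpha>..\<beta>}"
    using connected_compact_interval_1[of J] convex_connected by blast
  have p0: "\<not> (p + 0 *\<^sub>R ?d) extreme_point_of P" "\<not> (q + 0 *\<^sub>R ?d) extreme_point_of P" using p(2) q(2) by simp_all
  obtain \<epsilon> where e: "0 < \<epsilon>" "\<And>s. \<bar>s\<bar> \<le> \<epsilon> \<Longrightarrow> 0 + s \<in> J" using near[OF J0 p0] by blast
  have "\<epsilon> \<in> J" "- \<epsilon> \<in> J" using e(2)[of \<epsilon>] e(2)[of "- \<epsilon>"] e(1) by simp_all
  then have ab: "\<alpha> < 0" "0 < \<beta>" using e(1) unfolding J by simp_all
  have "(p + \<alpha> *\<^sub>R ?d) extreme_point_of P \<or> (q + \<alpha> *\<^sub>R ?d) extreme_point_of P"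
  proof (rule ccontr)
    assume "\<not> ?thesis"
    moreover have "\<alpha> \<in> J" using ab by (simp add: J)
    ultimately obtain \<epsilon> where "0 < \<epsilon>" "\<And>s. \<bar>s\<bar> \<le> \<epsilon> \<Longrightarrow> \<alpha> + s \<in> J" using near by blast
    from this(2)[of "- \<epsilon>"] this(1) show False unfolding J by simp
  qed
  moreover have "(p + \<beta> *\<^sub>R ?d) extreme_point_of P \<or> (q + \<beta> *\<^sub>R ?d) extreme_point_of P"
  proof (rule ccontr)
    assume "\<not> ?thesis"
    moreover have "\<beta> \<in> J" using ab by (simp add: J)
    ultimately obtain \<epsilon> where "0 < \<epsilon>" "\<And>s. \<bar>s\<bar> \<le> \<epsilon> \<Longrightarrow> \<beta> + s \<in> J" using near by blast
    from this(2)[of \<epsilon>] this(1) show False unfolding J by simp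
  qed
  ultimately show thesis using that[OF ab] edges unfolding J by simp
qed

text \<open>A crease through the interior of a piece is movable, and its translates sweep out an
  open parallelogram. The parallelogram contains no point of a cut, and its two lateral sides are
  cuts wherever they enter the interior of \<open>P\<close>, so it is the region visible from a
  point of the crease.\<close>

lemma parallelogram_piece:
  assumes Qp: "Q \<in> pieces P" and l: "l \<in> creases P" "l \<inter> interior Q \<noteq> {}"
  shows "parallelogram_between_edges P Q"
proof -
  obtain x K where x: "x \<in> interior P" "x \<notin> \<Union>(cuts P)" "x \<in> interior Q" "K = signed_forms (positive_cuts x)"
    "Q = closed_cell K" "interior Q = visible P x" "interior Q = interior P \<inter> cell K" using pieceE[OF Qp] .
  obtain z where z: "z \<in> l" "z \<in> visible P x" using l(2) x(6) by blast
  have zi: "z \<in> interior P" "z \<notin> \<Union>(cuts P)" and vz: "visible P z = visible P x" using visible_same[OF x(1,2) z(2)] .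
  have "Q = closure (visible P x)" using x(5) piece(5)[OF x(1,2)] unfolding x(4) by simp
  then have Qz: "Q = closure (visible P z)" using vz by simp
  have mov: "movable P l" using zi(2) z(1) l(1) by (auto simp: cuts_def)
  obtain p q where pq: "p \<in> frontier P" "q \<in> frontier P" "zchord p q" "l = closed_segment p q"
    using crease_ends[OF l(1)] .
  have neq: "p \<noteq> q" using pq(3) by (simp add: zchord_def meets_def)
  obtain u c where F1: "(u, c) \<in> \<F>" "p \<in> edge u c" using frontier_facets pq(1) by blast
  obtain w e where F2: "(w, e) \<in> \<F>" "q \<in> edge w e" using frontier_facets pq(2) by blast
  have nv: "\<not> p extreme_point_of P" "\<not> q extreme_point_of P" and w: "w = - u" and width: "a * (lform u q - c) = 2"
    using movable_ends[OF mov[unfolded pq(4)] F1(1) F2(1) F1(2) F2(2) neq] by blast+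
  have F: "(u, c) \<in> \<F>" "(- u, e) \<in> \<F>" and pe: "p \<in> edge u c" and qe: "q \<in> edge (- u) e" using F1 F2 w by simp_all
  let ?d = "dvec u"
  define N where "N = lform u q - c"
  have lp: "lform u p = c" using pe by (simp add: edge_def)
  have lq: "lform u q = - e" using qe by (simp add: edge_def lform_uminus)
  have PQ: "p \<in> P" "q \<in> P" using pe qe edge_subset by blast+
  have N: "0 < N" using facetD(3)[OF F(1) PQ(2)] width by (cases "N = 0") (auto simp: N_def)
  have Nn: "lform u q - lform u p = N" using lp by (simp add: N_def)
  obtain \<alpha> \<beta> where sl: "\<alpha> < 0" "0 < \<beta>"
    "\<forall>t. \<alpha> \<le> t \<and> t \<le> \<beta> \<longrightarrow> p + t *\<^sub>R ?d \<in> edge u c \<and> q + t *\<^sub>R ?d \<in> edge (- u) e"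
    "(p + \<alpha> *\<^sub>R ?d) extreme_point_of P \<or> (q + \<alpha> *\<^sub>R ?d) extreme_point_of P"
    "(p + \<beta> *\<^sub>R ?d) extreme_point_of P \<or> (q + \<beta> *\<^sub>R ?d) extreme_point_of P"
    using sliding_interval[OF F pe nv(1) qe nv(2)] .
  have ab: "\<alpha> < 0" "0 < \<beta>"
    "\<And>t. \<alpha> \<le> t \<Longrightarrow> t \<le> \<beta> \<Longrightarrow> p + t *\<^sub>R ?d \<in> edge u c \<and> q + t *\<^sub>R ?d \<in> edge (- u) e"
    using sl(1-3) by blast+
  let ?k = "- (perp (q - p) \<bullet> p)"
  \<comment> \<open>In the coordinates \<open>t\<close> along the edges and \<open>s\<close> across
    the strip these half-planes say that \<open>t\<close> lies between \<open>\<alpha>\<close> and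
    \<open>\<beta>\<close> and \<open>s\<close> between 0 and 1.\<close>
  define S where "S = {(perp (q - p), ?k - \<alpha> * N), (- perp (q - p), \<beta> * N - ?k), (nvec u, - c), (- nvec u, c + N)}"
  have S_iff: "(\<forall>k\<in>S. 0 < fst k \<bullet> y + snd k) \<longleftrightarrow>
      \<alpha> * N < side p q y \<and> side p q y < \<beta> * N \<and> c < lform u y \<and> lform u y < c + N"
    "(\<forall>k\<in>S. 0 \<le> fst k \<bullet> y + snd k) \<longleftrightarrow>
      \<alpha> * N \<le> side p q y \<and> side p q y \<le> \<beta> * N \<and> c \<le> lform u y \<and> lform u y \<le> c + N" for y
    by (auto simp: S_def side_affine lform_nvec)
  let ?W = "{y. \<forall>k\<in>S. 0 < fst k \<bullet> y + snd k}" and ?H = "{y. \<forall>k\<in>S. 0 \<le> fst k \<bullet> y + snd k}"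
  have fS: "finite S" by (simp add: S_def)
  have W_Int: "?W = (\<Inter>k\<in>S. {y. 0 < fst k \<bullet> y + snd k})" by auto
  have oW: "open ?W" unfolding W_Int using fS open_halfplane by (intro open_INT ballI)
  have cW: "convex ?W" unfolding W_Int by (intro convex_INT convex_halfplane)
  define pt where "pt t s = p + t *\<^sub>R ?d + s *\<^sub>R (q - p)" for t s
  have side_pt: "side p q (pt t s) = t * N" for t s
  proof -
    have "side p q (pt t s) = t * det2 (q - p) ?d + s * det2 (q - p) (q - p)"
      by (simp add: side_def pt_def det2_def algebra_simps)
    moreover have "det2 (q - p) (q - p) = 0" by (simp add: det2_def)
    ultimately show ?thesis by (simp add: det2_dvec lform_diff Nn)
  qed
  have lform_pt: "lform u (pt t s) = c + s * N" for t s
    by (simp add: pt_def lform_add lform_scaleR lform_diff lp N_def)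
  have coord: "y = pt (side p q y / N) ((lform u y - c) / N)" for y
    using parallel_coordinates[OF Nn, of y] N by (simp add: pt_def lp)
  have pt_mix: "pt t s = (1 - s) *\<^sub>R (p + t *\<^sub>R ?d) + s *\<^sub>R (q + t *\<^sub>R ?d)" for t s
    by (simp add: pt_def algebra_simps)
  have ptW: "pt t s \<in> ?W \<longleftrightarrow> \<alpha> < t \<and> t < \<beta> \<and> 0 < s \<and> s < 1" for t s
    using N by (simp add: S_iff(1) side_pt lform_pt zero_less_mult_iff)
  have ptH: "pt t s \<in> ?H \<longleftrightarrow> \<alpha> \<le> t \<and> t \<le> \<beta> \<and> 0 \<le> s \<and> s \<le> 1" for t s
    using N by (simp add: S_iff(2) side_pt lform_pt zero_le_mult_iff)
  have WH: "?W \<subseteq> ?H" by (auto intro: less_imp_le)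
  have mixP: "pt t s \<in> P" if "\<alpha> \<le> t" "t \<le> \<beta>" "0 \<le> s" "s \<le> 1" for t s
  proof -
    have "p + t *\<^sub>R ?d \<in> P" "q + t *\<^sub>R ?d \<in> P" using ab(3)[OF that(1,2)] edge_subset by blast+
    then show ?thesis unfolding pt_mix using convex_P that(3,4) unfolding convex_alt by blast
  qed
  have HP: "?H \<subseteq> P"
  proof
    fix y assume y: "y \<in> ?H"
    define t where "t = side p q y / N"
    define s where "s = (lform u y - c) / N"
    have yp: "y = pt t s" unfolding t_def s_def by (rule coord)
    have "\<alpha> \<le> t" "t \<le> \<beta>" "0 \<le> s" "s \<le> 1" using y unfolding yp ptH by blast+
    then show "y \<in> P" unfolding yp by (rule mixP)
  qed
  have WP: "?W \<subseteq> interior P" using WH HP oW by (intro interior_maximal) auto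
  have seg: "pt t s \<in> closed_segment (p + t *\<^sub>R ?d) (q + t *\<^sub>R ?d)" if "0 \<le> s" "s \<le> 1" for t s
    unfolding pt_mix closed_segment_def using that by blast
  have chord: "zchord (p + t *\<^sub>R ?d) (q + t *\<^sub>R ?d)" if t: "\<alpha> \<le> t" "t \<le> \<beta>" and m: "pt t s \<in> interior P" for t s
  proof (rule translate_zchord[OF F pe _ qe _ pq(3) width])
    show "p + t *\<^sub>R ?d \<in> edge u c" "q + t *\<^sub>R ?d \<in> edge (- u) e" using ab(3)[OF t] by blast+
    have lpt: "lform u (p + t *\<^sub>R ?d) = c" "lform u (q + t *\<^sub>R ?d) = c + N"
      using Nn by (simp_all add: lform_add lform_scaleR lp)
    \<comment> \<open>The midpoint of the oblique chord from the moved end to \<open>q\<close>; it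
      shows that the chord obtained by moving one end only meets the interior.\<close>
    have "pt (t / 2) (1 / 2) \<in> ?W" unfolding ptW using t ab by auto
    then have "pt (t / 2) (1 / 2) \<in> interior P" using WP by blast
    moreover have "side (p + t *\<^sub>R ?d) q (pt (t / 2) (1 / 2)) = 0"
      by (simp add: side_def det2_def pt_def algebra_simps)
    moreover have "p + t *\<^sub>R ?d \<noteq> q" using lpt(1) Nn N lp by auto
    ultimately show "meets (p + t *\<^sub>R ?d) q" unfolding meets_def by blast
    have "side (p + t *\<^sub>R ?d) (q + t *\<^sub>R ?d) (pt t s) = 0"
      by (simp add: side_def det2_def pt_def algebra_simps)
    moreover have "p + t *\<^sub>R ?d \<noteq> q + t *\<^sub>R ?d" using neq by simp
    ultimately show "meets (p + t *\<^sub>R ?d) (q + t *\<^sub>R ?d)" unfolding meets_def using m by blast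
  qed
  have fr: "p + t *\<^sub>R ?d \<in> frontier P" "q + t *\<^sub>R ?d \<in> frontier P" if "\<alpha> \<le> t" "t \<le> \<beta>" for t
    using ab(3)[OF that] edge_in_frontier F by blast+
  \<comment> \<open>An extreme translate ends in a vertex of \<open>P\<close>, and ends of movable
    creases are not vertices. The hypothesis on \<open>pt t s\<close> excludes a translate that runs
    along the frontier.\<close>
  have boundary: "closed_segment (p + t *\<^sub>R ?d) (q + t *\<^sub>R ?d) \<in> cuts P"
    if t: "t = \<alpha> \<or> t = \<beta>" and m: "pt t s \<in> interior P" for t s
  proof -
    have t': "\<alpha> \<le> t" "t \<le> \<beta>" using t ab by auto
    have "closed_segment (p + t *\<^sub>R ?d) (q + t *\<^sub>R ?d) \<in> creases P"
      by (rule zchord_crease[OF chord[OF t' m] fr[OF t']])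
    moreover have "\<not> movable P (closed_segment (p + t *\<^sub>R ?d) (q + t *\<^sub>R ?d))"
    proof
      assume mv: "movable P (closed_segment (p + t *\<^sub>R ?d) (q + t *\<^sub>R ?d))"
      have ne: "p + t *\<^sub>R ?d \<noteq> q + t *\<^sub>R ?d" using neq by simp
      note movable_ends(1,2)[OF mv F conjunct1[OF ab(3)[OF t']] conjunct2[OF ab(3)[OF t']] ne]
      then show False using t sl(4,5) by blast
    qed
    ultimately show ?thesis by (simp add: cuts_def)
  qed
  \<comment> \<open>Through every point of the open parallelogram passes a translate that is a
    movable crease. A cut through the same point would be a different crease meeting it.\<close>
  have inner: "y \<notin> \<Union>(cuts P)" if y: "y \<in> ?W" for y
  proof
    assume "y \<in> \<Union>(cuts P)"
    then obtain l' where l': "l' \<in> cuts P" "y \<in> l'" by blast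
    define t where "t = side p q y / N"
    define s where "s = (lform u y - c) / N"
    have yp: "y = pt t s" unfolding t_def s_def by (rule coord)
    have ts: "\<alpha> < t" "t < \<beta>" "0 < s" "s < 1" using y unfolding yp ptW by blast+
    have t': "\<alpha> \<le> t" "t \<le> \<beta>" using ts by simp_all
    have m: "pt t s \<in> interior P" using y yp WP by blast
    let ?p = "p + t *\<^sub>R ?d" and ?q = "q + t *\<^sub>R ?d"
    have z': "zchord ?p ?q" by (rule chord[OF t' m])
    have pe': "?p \<in> edge u c" "?q \<in> edge (- u) e" using ab(3)[OF t'] by blast+
    have ext: "\<not> (x + t *\<^sub>R ?d) extreme_point_of P"
      if xp: "\<And>t. \<alpha> \<le> t \<Longrightarrow> t \<le> \<beta> \<Longrightarrow> x + t *\<^sub>R ?d \<in> P" for x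
    proof (rule not_extreme_between)
      define r where "r = min (t - \<alpha>) (\<beta> - t)"
      have r: "0 < r" "\<alpha> \<le> t - r" "t + r \<le> \<beta>" using ts by (auto simp: r_def)
      show "x + t *\<^sub>R ?d + r *\<^sub>R ?d \<in> P" using xp[of "t + r"] r ts by (simp add: algebra_simps)
      show "x + t *\<^sub>R ?d - r *\<^sub>R ?d \<in> P" using xp[of "t - r"] r ts by (simp add: algebra_simps)
      show "r \<noteq> 0" using r by simp
      show "?d \<noteq> 0" using facetD(2)[OF F(1)] by (simp add: dvec_eq_0)
    qed
    have nv': "\<not> ?p extreme_point_of P" "\<not> ?q extreme_point_of P"
      by (rule ext, use ab(3) edge_subset in blast)+
    have "a * (lform u ?q - c) = 2" using width by (simp add: lform_add lform_scaleR)
    from strip_movable[OF F pe'(1) nv'(1) pe'(2) nv'(2) z' this] have mv: "movable P (closed_segment ?p ?q)" .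
    have cr: "closed_segment ?p ?q \<in> creases P" by (rule zchord_crease[OF z' fr[OF t']])
    have cr': "l' \<in> creases P" and nm: "\<not> movable P l'" using l'(1) by (auto simp: cuts_def)
    have "l' \<noteq> closed_segment ?p ?q" using mv nm by blast
    then have "l' \<inter> closed_segment ?p ?q = {}" by (rule creases_disjoint[OF cr' cr])
    moreover have "y \<in> closed_segment ?p ?q" unfolding yp using ts by (intro seg) simp_all
    ultimately show False using l'(2) by blast
  qed
  have zW: "z \<in> ?W"
  proof -
    obtain s where s: "0 \<le> s" "s \<le> 1" "z = p + s *\<^sub>R (q - p)" using z(1) unfolding pq(4) segment_param by blast
    have "z \<noteq> p" "z \<noteq> q" using zi(1) pq(1,2) by (auto simp: frontier_def)
    then have "s \<noteq> 0" "s \<noteq> 1" using s(3) by auto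
    moreover have "z = pt 0 s" using s(3) by (simp add: pt_def)
    ultimately show ?thesis using s(1,2) ab ptW[of 0 s] by simp
  qed
  have vis: "visible P z = ?W"
  proof
    show "?W \<subseteq> visible P z"
    proof
      fix y assume y: "y \<in> ?W"
      have "closed_segment z y \<subseteq> ?W" by (rule closed_segment_subset[OF zW y cW])
      then have "closed_segment z y \<inter> \<Union>(cuts P) = {}" using inner by blast
      then show "y \<in> visible P z" using y WP unfolding visible_def by blast
    qed
    show "visible P z \<subseteq> ?W"
    proof
      fix y assume "y \<in> visible P z"
      then have y: "y \<in> interior P" "closed_segment z y \<inter> \<Union>(cuts P) = {}" unfolding visible_def by blast+
      have low: "c < lform u y" if "y \<in> interior P" for y by (rule facet_interior[OF F(1) that])
      have high: "lform u y < c + N" if "y \<in> interior P" for y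
        using facet_interior[OF F(2) that] lq by (simp add: lform_uminus N_def)
      \<comment> \<open>Leaving the parallelogram sideways within the interior of \<open>P\<close>
        means crossing an extreme translate at an interior point, hence crossing a cut.\<close>
      have no: "side p q v \<noteq> t * N" if v: "v \<in> closed_segment z y" and t: "t = \<alpha> \<or> t = \<beta>" for v t
      proof
        assume sv: "side p q v = t * N"
        have vi: "v \<in> interior P" using v closed_segment_subset[OF zi(1) y(1) convex_interior[OF convex_P]] by blast
        define s where "s = (lform u v - c) / N"
        have vp: "v = pt t s" using coord[of v] sv N by (simp add: s_def)
        have "0 \<le> s" "s \<le> 1" using low[OF vi] high[OF vi] N by (simp_all add: s_def)
        then have "v \<in> closed_segment (p + t *\<^sub>R ?d) (q + t *\<^sub>R ?d)" unfolding vp by (rule seg)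
        moreover have "closed_segment (p + t *\<^sub>R ?d) (q + t *\<^sub>R ?d) \<in> cuts P" using boundary[OF t] vi unfolding vp by blast
        ultimately show False using v y(2) by blast
      qed
      have side_inner: "side p q v = perp (q - p) \<bullet> v + ?k" for v by (rule side_affine)
      have zs: "\<alpha> * N < side p q z" "side p q z < \<beta> * N" using zW S_iff(1)[of z] by simp_all
      have "side p q y < \<beta> * N"
      proof (rule ccontr)
        assume "\<not> side p q y < \<beta> * N"
        then have "(- perp (q - p)) \<bullet> y + (\<beta> * N - ?k) \<le> 0" "0 < (- perp (q - p)) \<bullet> z + (\<beta> * N - ?k)"
          using zs(2) by (simp_all add: side_inner)
        then obtain t where t: "0 \<le> t" "t \<le> 1" "(- perp (q - p)) \<bullet> (z + t *\<^sub>R (y - z)) + (\<beta> * N - ?k) = 0"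
          using affine_zero_between by blast
        have "z + t *\<^sub>R (y - z) \<in> closed_segment z y" unfolding segment_param using t by blast
        moreover have "side p q (z + t *\<^sub>R (y - z)) = \<beta> * N" using t(3) unfolding side_inner inner_minus_left by linarith
        ultimately show False using no by blast
      qed
      moreover have "\<alpha> * N < side p q y"
      proof (rule ccontr)
        assume "\<not> \<alpha> * N < side p q y"
        then have "perp (q - p) \<bullet> y + (?k - \<alpha> * N) \<le> 0" "0 < perp (q - p) \<bullet> z + (?k - \<alpha> * N)"
          using zs(1) by (simp_all add: side_inner)
        then obtain t where t: "0 \<le> t" "t \<le> 1" "perp (q - p) \<bullet> (z + t *\<^sub>R (y - z)) + (?k - \<alpha> * N) = 0"
          using affine_zero_between by blast
        have "z + t *\<^sub>R (y - z) \<in> closed_segment z y" unfolding segment_param using t by blast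
        moreover have "side p q (z + t *\<^sub>R (y - z)) = \<alpha> * N" using t(3) unfolding side_inner by linarith
        ultimately show False using no by blast
      qed
      ultimately show "y \<in> ?W" using low[OF y(1)] high[OF y(1)] by (simp add: S_iff(1))
    qed
  qed
  define m where "m = p + \<alpha> *\<^sub>R ?d"
  define v where "v = (\<beta> - \<alpha>) *\<^sub>R ?d"
  define w' where "w' = q - p"
  let ?C = "convex hull {m, m + v, m + w', m + v + w'}"
  have corners: "m = p + \<alpha> *\<^sub>R ?d" "m + v = p + \<beta> *\<^sub>R ?d" "m + w' = q + \<alpha> *\<^sub>R ?d" "m + v + w' = q + \<beta> *\<^sub>R ?d"
    unfolding m_def v_def w'_def by (simp_all add: scaleR_left_diff_distrib)
  have H_Int: "?H = closure ?W" using zW by (intro closure_open_halfplanes[symmetric]) blast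
  have "?H = ?C"
  proof
    have "convex ?H" unfolding H_Int by (rule convex_closure[OF cW])
    moreover have "{m, m + v, m + w', m + v + w'} \<subseteq> ?H"
    proof -
      have "m = pt \<alpha> 0" by (simp add: m_def pt_def)
      moreover have "m + v = pt \<beta> 0" by (simp add: corners(2) pt_def)
      moreover have "m + w' = pt \<alpha> 1" by (simp add: corners(3) pt_def)
      moreover have "m + v + w' = pt \<beta> 1" by (simp add: corners(4) pt_def)
      moreover have "pt \<alpha> 0 \<in> ?H" "pt \<beta> 0 \<in> ?H" "pt \<alpha> 1 \<in> ?H" "pt \<beta> 1 \<in> ?H" unfolding ptH using ab by simp_all
      ultimately show ?thesis by (simp only: insert_subset empty_subsetI simp_thms)
    qed
    ultimately show "?C \<subseteq> ?H" by (rule hull_minimal[rotated])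
    show "?H \<subseteq> ?C"
    proof
      fix y assume y: "y \<in> ?H"
      define t where "t = side p q y / N"
      define s where "s = (lform u y - c) / N"
      have yp: "y = pt t s" unfolding t_def s_def by (rule coord)
      have ts: "\<alpha> \<le> t" "t \<le> \<beta>" "0 \<le> s" "s \<le> 1" using y unfolding yp ptH by blast+
      have hC: "m \<in> ?C" "m + v \<in> ?C" "m + w' \<in> ?C" "m + v + w' \<in> ?C" by (simp_all add: hull_inc)
      define r where "r = (t - \<alpha>) / (\<beta> - \<alpha>)"
      have r: "0 \<le> r" "r \<le> 1" "t = (1 - r) * \<alpha> + r * \<beta>"
      proof -
        show "0 \<le> r" "r \<le> 1" using ts ab by (simp_all add: r_def)
        have "r * (\<beta> - \<alpha>) = t - \<alpha>" using ab by (simp add: r_def)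
        then show "t = (1 - r) * \<alpha> + r * \<beta>" by (simp add: algebra_simps)
      qed
      have mix: "x + t *\<^sub>R ?d \<in> ?C" if "x + \<alpha> *\<^sub>R ?d \<in> ?C" "x + \<beta> *\<^sub>R ?d \<in> ?C" for x
      proof -
        have "(1 - r) *\<^sub>R (x + \<alpha> *\<^sub>R ?d) + r *\<^sub>R (x + \<beta> *\<^sub>R ?d) \<in> ?C"
          using convex_convex_hull that r(1,2) unfolding convex_alt by blast
        moreover have "(1 - r) *\<^sub>R (x + \<alpha> *\<^sub>R ?d) + r *\<^sub>R (x + \<beta> *\<^sub>R ?d) = x + t *\<^sub>R ?d"
          unfolding r(3) by (simp add: algebra_simps)
        ultimately show ?thesis by simp
      qed
      have "p + t *\<^sub>R ?d \<in> ?C" using mix[of p] hC(1,2) unfolding corners(2) by (simp only: corners(1)[symmetric])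
      moreover have "q + t *\<^sub>R ?d \<in> ?C" by (rule mix[of q, folded corners(3,4), OF hC(3,4)])
      ultimately show "y \<in> ?C" unfolding yp pt_mix
        using convex_convex_hull[of "{m, m + v, m + w', m + v + w'}"] ts(3,4) unfolding convex_alt by blast
    qed
  qed
  then have QC: "Q = ?C" using Qz vis H_Int by simp
  have lv: "lform u v = 0" "lform u w' = N" by (simp_all add: v_def w'_def lform_scaleR lform_diff Nn)
  have v0: "v \<noteq> 0" using ab facetD(2)[OF F(1)] by (simp add: v_def dvec_eq_0)
  have w0: "w' \<noteq> 0" using neq by (simp add: w'_def)
  have vs: "v \<notin> span {w'}"
  proof
    assume "v \<in> span {w'}"
    then obtain k where k: "v = k *\<^sub>R w'" by (auto simp: span_singleton)
    then have "k * N = 0" using lv by (simp add: lform_scaleR)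
    then show False using N k v0 by simp
  qed
  have ind: "independent {v, w'}"
    using vs w0 by (simp add: independent_insert)
  have vw: "v \<noteq> w'" using lv N by auto
  have "closed_segment m (m + v) \<subseteq> edge u c" unfolding corners(2) unfolding corners(1)
    using ab(3)[of \<alpha>] ab(3)[of \<beta>] ab(1,2) by (intro closed_segment_subset convex_edge) auto
  moreover have "closed_segment (m + w') (m + v + w') \<subseteq> edge (- u) e" unfolding corners(4) unfolding corners(3)
    using ab(3)[of \<alpha>] ab(3)[of \<beta>] ab(1,2) by (intro closed_segment_subset convex_edge) auto
  ultimately show ?thesis
    unfolding parallelogram_between_edges_def using ind vw QC facetD(4)[OF F(1)] facetD(4)[OF F(2)] by blast
qed

theorem pieces_cases:
  assumes "Q \<in> pieces P"
  shows "K_polystable (dsigma_sub P Q) Q \<or> parallelogram_between_edges P Q"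
  using K_polystable_piece[OF assms] parallelogram_piece[OF assms] by blast

end

section \<open>Affine invariance\<close>

locale polygon_map =
  fixes P :: "(real^2) set" and A :: "real^2^2" and b :: "real^2" and \<phi> :: "real^2 \<Rightarrow> real^2"
  assumes \<phi>: "\<phi> = (\<lambda>x. A *v x + b)"
    and invertible_A: "invertible A"
    and moment: "moment_polygon P" "moment_polygon (\<phi> ` P)"
    and dsigma_image: "dsigma (\<phi> ` P) = distr (dsigma P) borel \<phi>"
begin

lemma inj_\<phi>: "inj \<phi>"
  using inj_matrix_vector_mult[OF invertible_A] by (simp add: \<phi> inj_def)

lemma \<phi>_mem [simp]: "\<phi> x \<in> \<phi> ` S \<longleftrightarrow> x \<in> S"
  by (rule inj_image_mem_iff[OF inj_\<phi>])

lemma image_\<phi>: "\<phi> ` S = (+) b ` ((*v) A ` S)"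
  by (auto simp: \<phi> image_image add.commute)

lemma interior_\<phi>: "interior (\<phi> ` S) = \<phi> ` interior S" and closure_\<phi>: "closure (\<phi> ` S) = \<phi> ` closure S"
  unfolding image_\<phi> interior_translation closure_translation
  using interior_injective_linear_image[OF matrix_vector_mul_linear inj_matrix_vector_mult[OF invertible_A]]
    closure_injective_linear_image[OF matrix_vector_mul_linear inj_matrix_vector_mult[OF invertible_A]] by simp_all

lemma frontier_\<phi>: "frontier (\<phi> ` S) = \<phi> ` frontier S"
  unfolding frontier_def interior_\<phi> closure_\<phi> by (rule image_set_diff[OF inj_\<phi>, symmetric])

lemma closed_segment_\<phi>: "closed_segment (\<phi> x) (\<phi> y) = \<phi> ` closed_segment x y"
proof -
  have "closed_segment (b + A *v x) (b + A *v y) = (+) b ` closed_segment (A *v x) (A *v y)"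
    by (rule closed_segment_translation)
  also have "closed_segment (A *v x) (A *v y) = (*v) A ` closed_segment x y"
    by (rule closed_segment_linear_image[OF matrix_vector_mul_linear])
  finally show ?thesis unfolding image_\<phi> by (simp add: \<phi> add.commute)
qed

lemma continuous_\<phi>: "continuous_on UNIV \<phi>"
  unfolding \<phi> by (intro continuous_intros)

lemma sets_dsigma_P: "sets (dsigma P) = sets borel" and sets_dsigma_image: "sets (dsigma (\<phi> ` P)) = sets borel"
  using lattice_polygon.sets_dsigma lattice_polygon.intro moment by blast+

lemma measurable_\<phi>: "\<phi> \<in> measurable (dsigma P) borel"
  unfolding measurable_cong_sets[OF sets_dsigma_P refl] by (rule borel_measurable_continuous_onI[OF continuous_\<phi>])

lemma set_integral_dsigma_image:
  fixes g :: "real^2 \<Rightarrow> real"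
  assumes "\<phi> ` S \<in> sets borel" "g \<in> borel_measurable borel"
  shows "(LINT x:\<phi> ` S|dsigma (\<phi> ` P). g x) = (LINT x:S|dsigma P. g (\<phi> x))"
proof -
  have "(\<lambda>x. indicator (\<phi> ` S) x *\<^sub>R g x) \<in> borel_measurable borel" using assms by simp
  from integral_distr[OF measurable_\<phi> this] show ?thesis
    unfolding set_lebesgue_integral_def dsigma_image by (simp add: indicator_def)
qed

lemma set_integral_lborel_image:
  fixes g :: "real^2 \<Rightarrow> real"
  assumes "\<phi> ` S \<in> sets borel" "g \<in> borel_measurable borel"
  shows "(LINT x:\<phi> ` S|lborel. g x) = \<bar>det A\<bar> * (LINT x:S|lborel. g (\<phi> x))"
proof -
  have "(\<lambda>x. indicator (\<phi> ` S) x *\<^sub>R g x) \<in> borel_measurable borel" using assms by simp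
  moreover have "(LINT x|lborel. h x) = \<bar>det A\<bar> * (LINT x|lborel. h (\<phi> x))"
    if "h \<in> borel_measurable borel" for h :: "real^2 \<Rightarrow> real"
    using integral_affine_map[OF invertible_A that, of b] by (simp only: \<phi>)
  ultimately show ?thesis
    unfolding set_lebesgue_integral_def by (simp add: indicator_def)
qed

lemma measure_eq_set_integral:
  "S \<in> sets M \<Longrightarrow> measure M S = (LINT x:S|M. (1::real))"
  by (simp add: set_lebesgue_integral_def)

text \<open>The Jacobian scales the area and the area integral alike and cancels in their quotient;
  the boundary terms are carried over by \<open>dsigma_image\<close>.\<close>

lemma stab_functional_image:
  assumes f: "continuous_on UNIV f"
  shows "stab_functional (dsigma (\<phi> ` P)) (\<phi> ` P) f = stab_functional (dsigma P) P (\<lambda>x. f (\<phi> x))"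
proof -
  have cl: "closed P" "closed (\<phi> ` P)" using moment by (auto simp: moment_polygon_def polytope_imp_closed)
  have fr: "frontier P \<in> sets borel" "\<phi> ` frontier P \<in> sets borel"
    unfolding frontier_\<phi>[symmetric] by (simp_all add: borel_closed)
  have PP: "P \<in> sets borel" "\<phi> ` P \<in> sets borel" using cl by (simp_all add: borel_closed)
  have fm: "f \<in> borel_measurable borel" by (rule borel_measurable_continuous_onI[OF f])
  have 1: "(LINT x:\<phi> ` frontier P|dsigma (\<phi> ` P). f x) = (LINT x:frontier P|dsigma P. f (\<phi> x))"
    by (rule set_integral_dsigma_image[OF fr(2) fm])
  have 2: "(LINT x:\<phi> ` P|lborel. f x) = \<bar>det A\<bar> * (LINT x:P|lborel. f (\<phi> x))"
    by (rule set_integral_lborel_image[OF PP(2) fm])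
  have 3: "measure (dsigma (\<phi> ` P)) (\<phi> ` frontier P) = measure (dsigma P) (frontier P)"
    using set_integral_dsigma_image[OF fr(2), of "\<lambda>x. 1"] fr
    by (simp add: measure_eq_set_integral sets_dsigma_P sets_dsigma_image)
  have 4: "measure lborel (\<phi> ` P) = \<bar>det A\<bar> * measure lborel P"
    using set_integral_lborel_image[OF PP(2), of "\<lambda>x. 1"] PP by (simp add: measure_eq_set_integral)
  have "det A \<noteq> 0" using invertible_A by (simp add: invertible_det_nz)
  then show ?thesis unfolding stab_functional_def frontier_\<phi> 1 2 3 4 by simp
qed

text \<open>The inverse map satisfies the same assumptions, so for creases and movability one
  implication suffices.\<close>

lemma inverse_map:
  obtains B d \<psi> where "polygon_map (\<phi> ` P) B d \<psi>" "\<forall>x. \<psi> (\<phi> x) = x"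
proof -
  obtain B where BA: "B ** A = mat 1" "A ** B = mat 1" using invertible_A unfolding invertible_def by blast
  define d where "d = - (B *v b)"
  define \<psi> where "\<psi> = (\<lambda>y. B *v y + d)"
  have \<psi>\<phi>: "\<psi> (\<phi> x) = x" for x
    by (simp add: \<psi>_def \<phi> d_def matrix_vector_right_distrib matrix_vector_mul_assoc BA)
  have im: "\<psi> ` (\<phi> ` S) = S" for S by (simp add: image_image \<psi>\<phi>)
  have mpsi: "\<psi> \<in> borel_measurable borel"
    unfolding \<psi>_def by (intro borel_measurable_continuous_onI continuous_intros)
  have "distr (dsigma (\<phi> ` P)) borel \<psi> = distr (dsigma P) borel (\<psi> \<circ> \<phi>)"
    unfolding dsigma_image by (rule distr_distr[OF mpsi measurable_\<phi>])
  also have "\<psi> \<circ> \<phi> = (\<lambda>x. x)" by (auto simp: \<psi>\<phi>)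
  also have "distr (dsigma P) borel (\<lambda>x. x) = dsigma P" by (rule distr_id2) (simp add: sets_dsigma_P)
  finally have ds: "dsigma P = distr (dsigma (\<phi> ` P)) borel \<psi>" ..
  have "invertible B" using BA unfolding invertible_def by blast
  then have "polygon_map (\<phi> ` P) B d \<psi>"
    using moment ds by unfold_locales (simp_all add: im, simp add: \<psi>_def)
  then show thesis using that \<psi>\<phi> by blast
qed

lemma crease_image:
  assumes "l \<in> creases P"
  shows "\<phi> ` l \<in> creases (\<phi> ` P)"
proof -
  obtain n c where l: "n \<noteq> 0" "l = {x \<in> P. n \<bullet> x + c = 0}" "l \<inter> interior P \<noteq> {}"
    "stab_functional (dsigma P) P (\<lambda>x. max (n \<bullet> x + c) 0) = 0" using assms unfolding creases_def by blast
  obtain B where BA: "B ** A = mat 1" using invertible_A unfolding invertible_def by blast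
  \<comment> \<open>Normals transform by the inverse transpose.\<close>
  define m where "m = transpose B *v n"
  define k where "k = c - m \<bullet> b"
  have mk: "m \<bullet> \<phi> x + k = n \<bullet> x + c" for x
  proof -
    have "m \<bullet> (A *v x) = n \<bullet> (B *v (A *v x))" unfolding m_def by (simp add: dot_lmul_matrix[symmetric] inner_commute)
    also have "B *v (A *v x) = x" by (simp add: matrix_vector_mul_assoc BA)
    finally show ?thesis by (simp add: \<phi> k_def inner_add_right)
  qed
  have "m \<noteq> 0"
  proof
    assume "m = 0"
    then have "n \<bullet> n + c = n \<bullet> 0 + c" using mk[of n] mk[of 0] by simp
    then show False using l(1) by simp
  qed
  moreover have im: "\<phi> ` l = {y \<in> \<phi> ` P. m \<bullet> y + k = 0}" unfolding l(2) by (auto simp: mk)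
  moreover have "\<phi> ` l \<inter> interior (\<phi> ` P) \<noteq> {}" using l(3) unfolding interior_\<phi> by blast
  moreover have "stab_functional (dsigma (\<phi> ` P)) (\<phi> ` P) (\<lambda>y. max (m \<bullet> y + k) 0) = 0"
  proof -
    have "continuous_on UNIV (\<lambda>y. max (m \<bullet> y + k) 0)" by (intro continuous_intros)
    then show ?thesis using l(4) by (simp add: stab_functional_image mk)
  qed
  ultimately show ?thesis unfolding creases_def by blast
qed

lemma movable_image:
  assumes "movable P l"
  shows "movable (\<phi> ` P) (\<phi> ` l)"
proof -
  obtain v where v: "v \<noteq> 0" "\<And>t. t \<in> {-1..1} \<Longrightarrow> (\<lambda>x. x + t *\<^sub>R v) ` l \<in> creases P"
    using assms unfolding movable_def by blast
  have "A *v v \<noteq> 0"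
    using v(1) inj_matrix_vector_mult[OF invertible_A] by (auto dest: injD[of _ v 0])
  moreover have "(\<lambda>x. x + t *\<^sub>R (A *v v)) ` (\<phi> ` l) \<in> creases (\<phi> ` P)" if t: "t \<in> {-1..1}" for t
  proof -
    have "\<phi> x + t *\<^sub>R (A *v v) = \<phi> (x + t *\<^sub>R v)" for x
      by (simp add: \<phi> matrix_vector_right_distrib matrix_vector_mult_scaleR)
    then have "(\<lambda>x. x + t *\<^sub>R (A *v v)) ` (\<phi> ` l) = \<phi> ` ((\<lambda>x. x + t *\<^sub>R v) ` l)" by (simp add: image_image)
    then show ?thesis using crease_image[OF v(2)[OF t]] by simp
  qed
  ultimately show ?thesis unfolding movable_def by blast
qed

end

section \<open>Invariance of cuts and pieces\<close>

context polygon_map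
begin

lemma cuts_image: "cuts (\<phi> ` P) = (`) \<phi> ` cuts P"
proof -
  obtain B d \<psi> where inv: "polygon_map (\<phi> ` P) B d \<psi>" "\<forall>x. \<psi> (\<phi> x) = x" using inverse_map .
  interpret inv: polygon_map "\<phi> ` P" B d \<psi> by (rule inv(1))
  have im: "\<psi> ` (\<phi> ` S) = S" for S by (simp add: image_image inv(2))
  have cr: "\<phi> ` l \<in> creases (\<phi> ` P) \<longleftrightarrow> l \<in> creases P" for l
    using crease_image[of l] inv.crease_image[of "\<phi> ` l"] unfolding im by blast
  have mv: "movable (\<phi> ` P) (\<phi> ` l) \<longleftrightarrow> movable P l" for l
    using movable_image[of l] inv.movable_image[of "\<phi> ` l"] unfolding im by blast
  show ?thesis
  proof (intro equalityI subsetI)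
    fix l assume l: "l \<in> cuts (\<phi> ` P)"
    then have "l \<subseteq> \<phi> ` P" by (auto simp: cuts_def creases_def)
    then obtain S where S: "l = \<phi> ` S" by (metis subset_imageE)
    then have "S \<in> cuts P" using l cr mv by (simp add: cuts_def)
    then show "l \<in> (`) \<phi> ` cuts P" unfolding S by (rule imageI)
  next
    fix l assume "l \<in> (`) \<phi> ` cuts P"
    then show "l \<in> cuts (\<phi> ` P)" using cr mv by (auto simp: cuts_def)
  qed
qed

lemma visible_image: "visible (\<phi> ` P) (\<phi> x) = \<phi> ` visible P x"
proof -
  have "closed_segment (\<phi> x) (\<phi> y) \<inter> \<Union>(cuts (\<phi> ` P)) = {} \<longleftrightarrow> closed_segment x y \<inter> \<Union>(cuts P) = {}" for y
  proof -
    have "\<Union>(cuts (\<phi> ` P)) = \<phi> ` \<Union>(cuts P)" unfolding cuts_image by blast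
    then have "closed_segment (\<phi> x) (\<phi> y) \<inter> \<Union>(cuts (\<phi> ` P)) = \<phi> ` (closed_segment x y \<inter> \<Union>(cuts P))"
      unfolding closed_segment_\<phi> by (simp only: image_Int[OF inj_\<phi>])
    then show ?thesis by simp
  qed
  then show ?thesis unfolding visible_def interior_\<phi> by auto
qed

lemma pieces_image: "pieces (\<phi> ` P) = (`) \<phi> ` pieces P"
proof -
  have "\<Union>(cuts (\<phi> ` P)) = \<phi> ` \<Union>(cuts P)" unfolding cuts_image by blast
  then have "interior (\<phi> ` P) - \<Union>(cuts (\<phi> ` P)) = \<phi> ` (interior P - \<Union>(cuts P))"
    unfolding interior_\<phi> by (simp only: image_set_diff[OF inj_\<phi>])
  then show ?thesis unfolding pieces_def by (simp add: image_image visible_image closure_\<phi>)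
qed

end

lemma choice_free_pieces: "choice_free pieces"
  unfolding choice_free_def Let_def
proof (intro allI impI)
  fix P and A :: "real^2^2" and b
  assume "moment_polygon P \<and> K_semistable (dsigma P) P \<and> invertible A \<and>
    moment_polygon ((\<lambda>x. A *v x + b) ` P) \<and> dsigma ((\<lambda>x. A *v x + b) ` P) = distr (dsigma P) borel (\<lambda>x. A *v x + b)"
  then interpret polygon_map P A b "\<lambda>x. A *v x + b" by unfold_locales auto
  show "pieces ((\<lambda>x. A *v x + b) ` P) = (`) (\<lambda>x. A *v x + b) ` pieces P" by (rule pieces_image)
qed

theorem theorem4p2p7:
  "\<exists>D :: (real^2) set \<Rightarrow> (real^2) set set. choice_free D \<and>
     (\<forall>P. moment_polygon P \<and> K_semistable (dsigma P) P \<longrightarrow>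
        rational_decomposition P (D P) \<and>
        (\<exists>C. finite C \<and> C \<subseteq> creases P \<and> cut_along P C (D P)) \<and>
        (\<forall>Q\<in>D P. K_polystable (dsigma_sub P Q) Q \<or> parallelogram_between_edges P Q))"
proof (intro exI[of _ pieces] conjI allI impI)
  show "choice_free pieces" by (rule choice_free_pieces)
  fix P assume P: "moment_polygon P \<and> K_semistable (dsigma P) P"
  interpret semistable_polygon P by unfold_locales (use P in blast)+
  show "rational_decomposition P (pieces P)" by (rule rational_decomposition_pieces)
  have "cuts P \<subseteq> creases P" by (auto simp: cuts_def)
  then show "\<exists>C. finite C \<and> C \<subseteq> creases P \<and> cut_along P C (pieces P)"
    using finite_cuts cut_along_pieces by blast
  show "\<forall>Q\<in>pieces P. K_polystable (dsigma_sub P Q) Q \<or> parallelogram_between_edges P Q"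
    using pieces_cases by blast
qed

end
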